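(* Let $\mathfrak M\in\mathfrak S$ be parameters and $\xi$ random drifts. Suppose that $\operatorname{spr}(\mathrm H_{\mathfrak M})<1$, that $b^\alpha_p\in L^{1,n_p}_\infty$ for all $\alpha\in\mathbf M\cup\mathbf P$ and $p\in\mathbf P$, and that $\sup_{(p,k)\in\mathcal Q}\mathbb E[|\xi^p_k|]<\infty$. Then, up to modification, there exists a unique HAR process with parameters $\mathfrak M$ and random drifts $\xi$, started at $-\infty$, such that $$\sup_{m\in\mathbf M,\ t\in\mathbb R}\mathbb E\big[|\lambda^m_t|\big]<\infty\quad\text{and}\quad\sup_{p\in\mathbf P,\ k\in\mathcal D_p}\mathbb E\big[|W^p_k|\big]<\infty .$$ Moreover, this process is 1-stationary.
   Context: Labels and domains. $\mathbf M$ and $\mathbf P$ are disjoint nonempty finite label sets. Each $p\in\mathbf P$ has a frequency $n_p\in\mathbb N^*=\{1,2,\dots\}$ and a phase $0\le\phi_p<1/n_p$, and $\mathcal D_p=\frac1{n_p}\mathbb Z+\phi_p$; $\mathcal Q=\{(p,k):p\in\mathbf P,\ k\in\mathcal D_p\}$. Standing assumption: $\gcd(n_p,\ p\in\mathbf P)=1$. $\mathscr D^p$ is the counting measure on $\mathcal D_p$. In integrals against $\mathscr D^p$ or point processes, $\int_a^{b-}$ is over $[a,b)$ ($a=-\infty$ allowed). Norms. Functions on $(0,\infty)$ are extended by $0$ to $\mathbb R$. $\|f\|_1$ is the $L^1$ norm; for $\alpha>0$, $\|f\|^\infty_{1,\alpha}=\sup_{x\in\mathbb R}\sum_{k\in\mathbb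 Z}|f(x+k/\alpha)|$, and $f\in L^{1,\alpha}_\infty$ means $\|f\|^\infty_{1,\alpha}<\infty$. Parameters. $\mathfrak S$ is the set of all $\mathfrak M=\big((h^\alpha_m)_{\alpha,m},(J^\alpha_p,h^\alpha_p,b^\alpha_p)_{\alpha,p},(\Phi^m)_m,(\Phi^p)_p\big)$ (with $\alpha\in\mathbf M\cup\mathbf P$, $m\in\mathbf M$, $p\in\mathbf P$) of (measurable) functions such that: $h^\alpha_m:(0,\infty)\to\mathbb R$; $J^\alpha_p:(0,\infty)\times\mathbb R\to\mathbb R$ and $h^\alpha_p,b^\alpha_p:(0,\infty)\to[0,\infty)$ satisfy $|J^\alpha_p(s,w)|\le h^\alpha_p(s)|w|+b^\alpha_p(s)$ and $|J^\alpha_p(s,w)-J^\alpha_p(s,w')|\le h^\alpha_p(s)|w-w'|$ for all $s>0$, $w,w'\in\mathbb R$; $\Phi^m:\mathbb R\to[0,\infty)$ is Lipschitz; $\Phi^p:\mathbb R\to\mathbb R$ is Lipschitz with $\Phi^p(0)=0$. $L_\alpha$ denotes the Lipschitz constant of $\Phi^\alpha$. Matrix. $\mathrm H_{\mathfrak M}=\begin{pmatrix}\mathrm H^N_N&\mathrm H^N_W\\ \mathrm H^W_N&\mathrm H^W_W\end{pmatrix}$ with $\mathrm H^N_N=(L_m\|h^m_{m'}\|_1)_{m,m'\in\mathbf M}$, $\mathrm H^N_W=(L_m\|h^m_p\|^\infty_{1,n_p})_{m\in\mathbf M,p\in\mathbf P}$, $\mathrm H^W_N=(L_p\|h^p_m\|_1)_{p\in\mathbf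 P,m\in\mathbf M}$, $\mathrm H^W_W=(L_p\|h^p_{p'}\|^\infty_{1,n_{p'}})_{p,p'\in\mathbf P}$, with the convention $\infty\times0=0\times\infty=\infty$. $\operatorname{spr}$ is the spectral radius; $\operatorname{spr}<1$ includes that all entries are finite. Probabilistic setting. On $(\Omega,\mathcal F,\mathbb P)$, $(\pi^m)_{m\in\mathbf M}$ are independent Poisson random measures on $\mathbb R\times[0,\infty)$ with intensity $dt\,dx$, whose atoms all have distinct time coordinates. Random drifts $\xi=(\xi^p_k)_{(p,k)\in\mathcal Q}$ are independent real random variables, independent of the $\pi^m$, with $\xi^p_k\sim\xi^p_{k+n}$ in law for all $(p,k)\in\mathcal Q$, $n\in\mathbb Z$. $\mathcal F_t=\sigma\big(\pi^m\cap((-\infty,t]\times[0,\infty)),\,m\in\mathbf M;\ \xi^p_k,\,(p,k)\in\mathcal Q,\,k\le t\big)$. HAR process started at $-\infty$: a process $X=((N^m)_{m\in\mathbf M},(W^p)_{p\in\mathbf P})$ adapted to $(\mathcal F_t)_t$, where $(N^m)_m$ is a multivariate point process on $\mathbb R$ (pairwise disjoint random sets of points, with counting measures $dN^m$) and $W^p=(W^p_k)_{k\in\mathcal D_p}$ is real valued, together with intensities $\lambda^m$, such that $$\lambda^m_t=\Phi^m\Big(\sum_{m'}\int_{-\infty}^{t-}h^m_{m'}(t-s)\,dN^{m'}_s+\sum_p\int_{-\infty}^{t-}J^m_p(t-k,W^p_k)\,d\mathscr D^p_k\Big)\quad \mathbb P(d\omega)\otimes dt\text{-a.e.},$$ almost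 surely $N^m(C)=\int_{C\times[0,\infty)}\mathbf 1_{x\le\lambda^m_s}\,d\pi^m(s,x)$ for all $C\subset\mathbb R$, and almost surely for all $(p,k)\in\mathcal Q$ $$W^p_k=\xi^p_k+\Phi^p\Big(\sum_m\int_{-\infty}^{k-}h^p_m(k-s)\,dN^m_s+\sum_{p'}\int_{-\infty}^{k-}J^p_{p'}(k-k',W^{p'}_{k'})\,d\mathscr D^{p'}_{k'}\Big).$$ The predictable intensity $\lambda^m$ is defined only up to $\mathbb P\otimes dt$-null sets. Two processes are modifications of each other if almost surely $N^m=\tilde N^m$ for all $m$ and almost surely $W^p_k=\tilde W^p_k$ for all $(p,k)\in\mathcal Q$. 1-stationary means $\big((\lambda^m_t)_{t\in\mathbb R,m},(N^m)_m,(W^p_k)_{(p,k)\in\mathcal Q}\big)$ has the same law as $\big((\lambda^m_{t+1})_{t\in\mathbb R,m},(N^m+1)_m,(W^p_{k+1})_{(p,k)\in\mathcal Q}\big)$ with the time shift by one unit applied to the whole process, i.e. $N^m$ is translated by one time unit consistently with $\lambda^m$ and $W^p$ (the process seen from time $1$ has the law of the process seen from time $0$). *)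

theory Defs
  imports "HOL-Probability.Probability"
begin

text \<open>
  The label sets are two finite types \<open>'m\<close> and \<open>'p\<close> (nonempty, as all types are), and
  \<open>'m + 'p\<close> is their disjoint union, over which \<open>\<alpha>\<close> ranges.
  A family indexed by the pairs \<open>(p, k)\<close> with \<open>k \<in> grid n \<phi> p\<close> is a function
  \<open>'p \<Rightarrow> real \<Rightarrow> _\<close>; its values off the grid are never used.
\<close>

section \<open>Grids, norms and the spectral radius\<close>

definition grid :: "('p \<Rightarrow> nat) \<Rightarrow> ('p \<Rightarrow> real) \<Rightarrow> 'p \<Rightarrow> real set" where
  "grid n \<phi> p = {of_int j / real (n p) + \<phi> p | j :: int. True}"

definition grid_points :: "('p \<Rightarrow> nat) \<Rightarrow> ('p \<Rightarrow> real) \<Rightarrow> ('p \<times> real) set" where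
  "grid_points n \<phi> = {(p, k). k \<in> grid n \<phi> p}"

definition valid_grids :: "('p::finite \<Rightarrow> nat) \<Rightarrow> ('p \<Rightarrow> real) \<Rightarrow> bool" where
  "valid_grids n \<phi> \<longleftrightarrow>
     (\<forall>p. 1 \<le> n p \<and> 0 \<le> \<phi> p \<and> \<phi> p < 1 / real (n p)) \<and> Gcd (range n) = 1"

text \<open>A function on the open half-line \<open>{0<..}\<close> is a total function whose values elsewhere are
  irrelevant; \<open>ext0\<close> is its extension by zero.\<close>

definition ext0 :: "(real \<Rightarrow> real) \<Rightarrow> real \<Rightarrow> real" where
  "ext0 f x = (if 0 < x then f x else 0)"

definition norm1 :: "(real \<Rightarrow> real) \<Rightarrow> ennreal" where
  "norm1 f = (\<integral>\<^sup>+ x. ennreal \<bar>ext0 f x\<bar> \<partial>lborel)"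

definition norm1_grid :: "real \<Rightarrow> (real \<Rightarrow> real) \<Rightarrow> ennreal" where
  "norm1_grid a f = (SUP x. \<Sum>\<^sub>\<infinity>k\<in>(UNIV :: int set). ennreal \<bar>ext0 f (x + of_int k / a)\<bar>)"

definition lipschitz_const :: "(real \<Rightarrow> real) \<Rightarrow> real" where
  "lipschitz_const f = Inf {L. L-lipschitz_on UNIV f}"

text \<open>Multiplication with the convention \<open>\<infinity> * 0 = 0 * \<infinity> = \<infinity>\<close>; on \<^typ>\<open>ennreal\<close> these products
  are \<open>0\<close>.\<close>

definition mult_inf :: "ennreal \<Rightarrow> ennreal \<Rightarrow> ennreal" where
  "mult_inf x y = (if x = \<infinity> \<or> y = \<infinity> then \<infinity> else x * y)"

definition is_eigenvalue :: "complex ^ 'n ^ 'n \<Rightarrow> complex \<Rightarrow> bool" where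
  "is_eigenvalue A z \<longleftrightarrow> (\<exists>v. v \<noteq> 0 \<and> A *v v = z *s v)"

definition spectral_radius :: "complex ^ 'n ^ 'n \<Rightarrow> real" where
  "spectral_radius A = Max {cmod z | z. is_eigenvalue A z}"

text \<open>A matrix with an infinite entry gets the value \<open>\<infinity>\<close>, so that \<open>spr H < 1\<close> includes
  finiteness of all entries.\<close>

definition spr :: "('n::finite \<Rightarrow> 'n \<Rightarrow> ennreal) \<Rightarrow> ennreal" where
  "spr H = (if \<exists>i j. H i j = \<infinity> then \<infinity>
            else ennreal (spectral_radius (\<chi> i j. complex_of_real (enn2real (H i j)))))"

section \<open>Parameters\<close>

record ('m, 'p) har_params =
  hN :: "'m + 'p \<Rightarrow> 'm \<Rightarrow> real \<Rightarrow> real"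
  JW :: "'m + 'p \<Rightarrow> 'p \<Rightarrow> real \<Rightarrow> real \<Rightarrow> real"
  hW :: "'m + 'p \<Rightarrow> 'p \<Rightarrow> real \<Rightarrow> real"
  bW :: "'m + 'p \<Rightarrow> 'p \<Rightarrow> real \<Rightarrow> real"
  Phi :: "'m + 'p \<Rightarrow> real \<Rightarrow> real"

definition valid_params :: "('m, 'p) har_params \<Rightarrow> bool" where
  "valid_params \<MM> \<longleftrightarrow>
     (\<forall>\<alpha> m. hN \<MM> \<alpha> m \<in> borel_measurable (restrict_space borel {0<..})) \<and>
     (\<forall>\<alpha> p. (\<lambda>(s, w). JW \<MM> \<alpha> p s w) \<in> borel_measurable (restrict_space borel ({0<..} \<times> UNIV))) \<and>
     (\<forall>\<alpha> p. hW \<MM> \<alpha> p \<in> borel_measurable (restrict_space borel {0<..}) \<and>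
            bW \<MM> \<alpha> p \<in> borel_measurable (restrict_space borel {0<..})) \<and>
     (\<forall>\<alpha> p. \<forall>s>0. 0 \<le> hW \<MM> \<alpha> p s \<and> 0 \<le> bW \<MM> \<alpha> p s) \<and>
     (\<forall>\<alpha> p. \<forall>s>0. \<forall>w. \<bar>JW \<MM> \<alpha> p s w\<bar> \<le> hW \<MM> \<alpha> p s * \<bar>w\<bar> + bW \<MM> \<alpha> p s) \<and>
     (\<forall>\<alpha> p. \<forall>s>0. \<forall>w w'. \<bar>JW \<MM> \<alpha> p s w - JW \<MM> \<alpha> p s w'\<bar> \<le> hW \<MM> \<alpha> p s * \<bar>w - w'\<bar>) \<and>
     (\<forall>\<alpha>. \<exists>L. L-lipschitz_on UNIV (Phi \<MM> \<alpha>)) \<and>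
     (\<forall>m x. 0 \<le> Phi \<MM> (Inl m) x) \<and>
     (\<forall>p. Phi \<MM> (Inr p) 0 = 0)"

definition H_mat :: "('m, 'p) har_params \<Rightarrow> ('p \<Rightarrow> nat) \<Rightarrow> 'm + 'p \<Rightarrow> 'm + 'p \<Rightarrow> ennreal" where
  "H_mat \<MM> n \<alpha> \<beta> = mult_inf (ennreal (lipschitz_const (Phi \<MM> \<alpha>)))
     (case \<beta> of Inl m \<Rightarrow> norm1 (hN \<MM> \<alpha> m) | Inr p \<Rightarrow> norm1_grid (real (n p)) (hW \<MM> \<alpha> p))"

section \<open>Random point configurations and Poisson random measures\<close>

text \<open>A simple point measure is represented by the set of its atoms; its value on \<open>B\<close> is
  \<open>ecount (S \<inter> B)\<close>.  The \<open>\<sigma>\<close>-algebra on configurations is generated by these evaluations.\<close>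

definition ecount :: "'a set \<Rightarrow> ennreal" where
  "ecount S = emeasure (count_space UNIV) S"

definition config_space :: "'a::topological_space set measure" where
  "config_space =
     sigma UNIV {{S. ecount (S \<inter> B) \<in> A} | A B. A \<in> sets borel \<and> B \<in> sets borel}"

text \<open>The intensity is Lebesgue measure on \<open>UNIV \<times> {0..}\<close>.  The Poisson law is written out, because
  \<^const>\<open>poisson_pmf\<close> is unspecified for rate \<open>0\<close>.  Configurations are locally finite for every
  \<open>\<omega>\<close>.\<close>

definition poisson_random_measure ::
    "'w measure \<Rightarrow> ('w \<Rightarrow> (real \<times> real) set) \<Rightarrow> bool" where
  "poisson_random_measure P \<pi> \<longleftrightarrow>
     \<pi> \<in> measurable P config_space \<and>
     (\<forall>\<omega>\<in>space P. \<pi> \<omega> \<subseteq> UNIV \<times> {0..} \<and> (\<forall>B. bounded B \<longrightarrow> finite (\<pi> \<omega> \<inter> B))) \<and>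
     (\<forall>B\<in>sets borel. B \<subseteq> UNIV \<times> {0..} \<longrightarrow> emeasure lborel B < \<infinity> \<longrightarrow>
        (\<forall>j::nat. measure P {\<omega>\<in>space P. ecount (\<pi> \<omega> \<inter> B) = of_nat j} =
           measure lborel B ^ j / fact j * exp (- measure lborel B))) \<and>
     (\<forall>B :: nat \<Rightarrow> (real \<times> real) set. range B \<subseteq> sets borel \<longrightarrow> disjoint_family B \<longrightarrow>
        (\<forall>i. B i \<subseteq> UNIV \<times> {0..}) \<longrightarrow>
        prob_space.indep_vars P (\<lambda>_. borel) (\<lambda>i \<omega>. ecount (\<pi> \<omega> \<inter> B i)) UNIV)"

section \<open>The driving noise\<close>

definition driving_noise ::
    "'w measure \<Rightarrow> ('p \<Rightarrow> nat) \<Rightarrow> ('p \<Rightarrow> real) \<Rightarrow>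
     ('m \<Rightarrow> 'w \<Rightarrow> (real \<times> real) set) \<Rightarrow> ('p \<Rightarrow> real \<Rightarrow> 'w \<Rightarrow> real) \<Rightarrow> bool" where
  "driving_noise P n \<phi> \<pi> \<xi> \<longleftrightarrow>
     (\<forall>m. poisson_random_measure P (\<pi> m)) \<and>
     prob_space.indep_vars P (\<lambda>_. config_space) \<pi> UNIV \<and>
     (\<forall>\<omega>\<in>space P. \<forall>m m'. \<forall>z\<in>\<pi> m \<omega>. \<forall>z'\<in>\<pi> m' \<omega>. fst z = fst z' \<longrightarrow> m = m' \<and> z = z') \<and>
     prob_space.indep_vars P (\<lambda>_. borel) (\<lambda>(p, k). \<xi> p k) (grid_points n \<phi>) \<and>
     prob_space.indep_set P
       (sets (vimage_algebra (space P) (\<lambda>\<omega> m. \<pi> m \<omega>) (Pi\<^sub>M UNIV (\<lambda>_. config_space))))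
       (sets (vimage_algebra (space P) (\<lambda>\<omega>. \<lambda>(p, k)\<in>grid_points n \<phi>. \<xi> p k \<omega>)
          (Pi\<^sub>M (grid_points n \<phi>) (\<lambda>_. borel)))) \<and>
     (\<forall>(p, k)\<in>grid_points n \<phi>. \<forall>j::int. distr P borel (\<xi> p k) = distr P borel (\<xi> p (k + of_int j)))"

definition noise_filtration ::
    "'w measure \<Rightarrow> ('p \<Rightarrow> nat) \<Rightarrow> ('p \<Rightarrow> real) \<Rightarrow>
     ('m \<Rightarrow> 'w \<Rightarrow> (real \<times> real) set) \<Rightarrow> ('p \<Rightarrow> real \<Rightarrow> 'w \<Rightarrow> real) \<Rightarrow> real \<Rightarrow> 'w measure" where
  "noise_filtration P n \<phi> \<pi> \<xi> t = sigma (space P)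
     ({(\<lambda>\<omega>. \<pi> m \<omega> \<inter> {..t} \<times> {0..}) -` A \<inter> space P | m A. A \<in> sets config_space} \<union>
      {\<xi> p k -` A \<inter> space P | p k A. k \<in> grid n \<phi> p \<and> k \<le> t \<and> A \<in> sets borel})"

definition predictable_algebra :: "'w set \<Rightarrow> (real \<Rightarrow> 'w measure) \<Rightarrow> ('w \<times> real) measure" where
  "predictable_algebra \<Omega> F =
     sigma (\<Omega> \<times> UNIV) {A \<times> {s<..t} | A s t. s < t \<and> A \<in> sets (F s)}"

section \<open>HAR processes started at minus infinity\<close>

text \<open>Pathwise quantities: here \<open>N m\<close> is a set of points and \<open>W p k\<close> a number.  The integrals
  against the counting measures of \<open>N m\<close> and of the grids are sums, for which absolute convergence
  coincides with \<^const>\<open>summable_on\<close>; a sum that does not converge is \<open>0\<close> by convention, so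
  \<open>drive_converges\<close> is required separately.\<close>

definition drive_converges ::
    "('m, 'p) har_params \<Rightarrow> ('p \<Rightarrow> nat) \<Rightarrow> ('p \<Rightarrow> real) \<Rightarrow>
     ('m \<Rightarrow> real set) \<Rightarrow> ('p \<Rightarrow> real \<Rightarrow> real) \<Rightarrow> 'm + 'p \<Rightarrow> real \<Rightarrow> bool" where
  "drive_converges \<MM> n \<phi> N W \<alpha> t \<longleftrightarrow>
     (\<forall>m. (\<lambda>s. hN \<MM> \<alpha> m (t - s)) summable_on (N m \<inter> {..<t})) \<and>
     (\<forall>p. (\<lambda>k. JW \<MM> \<alpha> p (t - k) (W p k)) summable_on (grid n \<phi> p \<inter> {..<t}))"

definition drive ::
    "('m::finite, 'p::finite) har_params \<Rightarrow> ('p \<Rightarrow> nat) \<Rightarrow> ('p \<Rightarrow> real) \<Rightarrow>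
     ('m \<Rightarrow> real set) \<Rightarrow> ('p \<Rightarrow> real \<Rightarrow> real) \<Rightarrow> 'm + 'p \<Rightarrow> real \<Rightarrow> real" where
  "drive \<MM> n \<phi> N W \<alpha> t =
     (\<Sum>m\<in>UNIV. \<Sum>\<^sub>\<infinity>s\<in>N m \<inter> {..<t}. hN \<MM> \<alpha> m (t - s)) +
     (\<Sum>p\<in>UNIV. \<Sum>\<^sub>\<infinity>k\<in>grid n \<phi> p \<inter> {..<t}. JW \<MM> \<alpha> p (t - k) (W p k))"

text \<open>\<open>\<Lambda>\<close> is one version of the predictable intensity.  Point processes are locally finite almost
  surely rather than surely, because the filtration is not completed: an adapted process cannot in
  general be modified on the null set where points accumulate.\<close>

definition har_process ::
    "'w measure \<Rightarrow> ('p::finite \<Rightarrow> nat) \<Rightarrow> ('p \<Rightarrow> real) \<Rightarrow>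
     ('m::finite \<Rightarrow> 'w \<Rightarrow> (real \<times> real) set) \<Rightarrow> ('p \<Rightarrow> real \<Rightarrow> 'w \<Rightarrow> real) \<Rightarrow>
     ('m, 'p) har_params \<Rightarrow>
     ('m \<Rightarrow> real \<Rightarrow> 'w \<Rightarrow> real) \<Rightarrow> ('m \<Rightarrow> 'w \<Rightarrow> real set) \<Rightarrow> ('p \<Rightarrow> real \<Rightarrow> 'w \<Rightarrow> real) \<Rightarrow> bool" where
  "har_process P n \<phi> \<pi> \<xi> \<MM> \<Lambda> N W \<longleftrightarrow>
     (let F = noise_filtration P n \<phi> \<pi> \<xi> in
     (\<forall>m t. (\<lambda>\<omega>. N m \<omega> \<inter> {..t}) \<in> measurable (F t) config_space) \<and>
     (\<forall>p. \<forall>k\<in>grid n \<phi> p. W p k \<in> borel_measurable (F k)) \<and>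
     (\<forall>m. (\<lambda>(\<omega>, t). \<Lambda> m t \<omega>) \<in> borel_measurable (predictable_algebra (space P) F)) \<and>
     (\<forall>\<omega>\<in>space P. disjoint_family (\<lambda>m. N m \<omega>)) \<and>
     (AE \<omega> in P. \<forall>m B. bounded B \<longrightarrow> finite (N m \<omega> \<inter> B)) \<and>
     (\<forall>m. AE (\<omega>, t) in P \<Otimes>\<^sub>M lborel.
        drive_converges \<MM> n \<phi> (\<lambda>m. N m \<omega>) (\<lambda>p k. W p k \<omega>) (Inl m) t \<and>
        \<Lambda> m t \<omega> = Phi \<MM> (Inl m) (drive \<MM> n \<phi> (\<lambda>m. N m \<omega>) (\<lambda>p k. W p k \<omega>) (Inl m) t)) \<and>
     (AE \<omega> in P. \<forall>m C. ecount (N m \<omega> \<inter> C) =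
        (\<integral>\<^sup>+ (s, x). indicator (C \<times> {0..}) (s, x) * (if x \<le> \<Lambda> m s \<omega> then 1 else 0)
           \<partial>count_space (\<pi> m \<omega>))) \<and>
     (AE \<omega> in P. \<forall>p. \<forall>k\<in>grid n \<phi> p.
        drive_converges \<MM> n \<phi> (\<lambda>m. N m \<omega>) (\<lambda>p k. W p k \<omega>) (Inr p) k \<and>
        W p k \<omega> = \<xi> p k \<omega> +
          Phi \<MM> (Inr p) (drive \<MM> n \<phi> (\<lambda>m. N m \<omega>) (\<lambda>p k. W p k \<omega>) (Inr p) k)))"

definition bounded_moments ::
    "'w measure \<Rightarrow> ('p \<Rightarrow> nat) \<Rightarrow> ('p \<Rightarrow> real) \<Rightarrow>
     ('m \<Rightarrow> real \<Rightarrow> 'w \<Rightarrow> real) \<Rightarrow> ('p \<Rightarrow> real \<Rightarrow> 'w \<Rightarrow> real) \<Rightarrow> bool" where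
  "bounded_moments P n \<phi> \<Lambda> W \<longleftrightarrow>
     (SUP m. SUP t. \<integral>\<^sup>+ \<omega>. ennreal \<bar>\<Lambda> m t \<omega>\<bar> \<partial>P) < \<infinity> \<and>
     (SUP p. SUP k\<in>grid n \<phi> p. \<integral>\<^sup>+ \<omega>. ennreal \<bar>W p k \<omega>\<bar> \<partial>P) < \<infinity>"

definition modification ::
    "'w measure \<Rightarrow> ('p \<Rightarrow> nat) \<Rightarrow> ('p \<Rightarrow> real) \<Rightarrow>
     ('m \<Rightarrow> 'w \<Rightarrow> real set) \<Rightarrow> ('p \<Rightarrow> real \<Rightarrow> 'w \<Rightarrow> real) \<Rightarrow>
     ('m \<Rightarrow> 'w \<Rightarrow> real set) \<Rightarrow> ('p \<Rightarrow> real \<Rightarrow> 'w \<Rightarrow> real) \<Rightarrow> bool" where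
  "modification P n \<phi> N W N' W' \<longleftrightarrow>
     (AE \<omega> in P. \<forall>m. N m \<omega> = N' m \<omega>) \<and>
     (AE \<omega> in P. \<forall>(p, k)\<in>grid_points n \<phi>. W p k \<omega> = W' p k \<omega>)"

definition path_law ::
    "'w measure \<Rightarrow> ('p \<Rightarrow> nat) \<Rightarrow> ('p \<Rightarrow> real) \<Rightarrow>
     ('m \<Rightarrow> real \<Rightarrow> 'w \<Rightarrow> real) \<Rightarrow> ('m \<Rightarrow> 'w \<Rightarrow> real set) \<Rightarrow> ('p \<Rightarrow> real \<Rightarrow> 'w \<Rightarrow> real) \<Rightarrow>
     (('m \<times> real \<Rightarrow> real) \<times> ('m \<Rightarrow> real set) \<times> ('p \<times> real \<Rightarrow> real)) measure" where
  "path_law P n \<phi> \<Lambda> N W =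
     distr P (Pi\<^sub>M UNIV (\<lambda>_. borel) \<Otimes>\<^sub>M Pi\<^sub>M UNIV (\<lambda>_. config_space) \<Otimes>\<^sub>M
              Pi\<^sub>M (grid_points n \<phi>) (\<lambda>_. borel))
       (\<lambda>\<omega>. (\<lambda>(m, t). \<Lambda> m t \<omega>, \<lambda>m. N m \<omega>, \<lambda>(p, k)\<in>grid_points n \<phi>. W p k \<omega>))"

text \<open>The intensity is a class modulo null sets for the product of \<open>P\<close> and Lebesgue measure, whereas
  the law of the family of all \<open>\<Lambda> m t\<close> depends on the version.  Stationarity is therefore
  the equality of laws for some predictable version.  The process seen from time 1 has the points
  \<open>s - 1\<close> for \<open>s \<in> N m\<close>.\<close>

definition one_stationary ::
    "'w measure \<Rightarrow> ('p \<Rightarrow> nat) \<Rightarrow> ('p \<Rightarrow> real) \<Rightarrow>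
     ('m \<Rightarrow> 'w \<Rightarrow> (real \<times> real) set) \<Rightarrow> ('p \<Rightarrow> real \<Rightarrow> 'w \<Rightarrow> real) \<Rightarrow>
     ('m \<Rightarrow> real \<Rightarrow> 'w \<Rightarrow> real) \<Rightarrow> ('m \<Rightarrow> 'w \<Rightarrow> real set) \<Rightarrow> ('p \<Rightarrow> real \<Rightarrow> 'w \<Rightarrow> real) \<Rightarrow> bool" where
  "one_stationary P n \<phi> \<pi> \<xi> \<Lambda> N W \<longleftrightarrow>
     (\<exists>\<Lambda>'.
        (\<forall>m. (\<lambda>(\<omega>, t). \<Lambda>' m t \<omega>) \<in>
           borel_measurable (predictable_algebra (space P) (noise_filtration P n \<phi> \<pi> \<xi>))) \<and>
        (\<forall>m. AE (\<omega>, t) in P \<Otimes>\<^sub>M lborel. \<Lambda>' m t \<omega> = \<Lambda> m t \<omega>) \<and>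
        path_law P n \<phi> \<Lambda>' N W =
        path_law P n \<phi> (\<lambda>m t. \<Lambda>' m (t + 1)) (\<lambda>m \<omega>. (\<lambda>s. s - 1) ` N m \<omega>) (\<lambda>p k. W p (k + 1)))"

end

(* Since the spectral radius of H is less than 1, some positive vector v satisfies H v <= theta v
   with theta < 1: the solution x(t) of (I - t H) x(t) = 1 stays positive for t in [0,1], because the
   set of good t is open and closed.  By the compensation formula for predictable thinnings of a
   Poisson random measure, the expected distance of two drives is at most a sum of kernel norms times
   expected distances of the intensities and of the drifts, so a Picard step is a contraction by theta
   in the v-weighted supremum of the first moments.  The iterates, started from 0, converge to a
   solution, and the contraction makes it unique.  Each iterate is the same functional of the noise
   at all integer times, and the law of the noise is invariant under unit shifts, so the limit is
   1-stationary. *)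
theory Submission
  imports Defs "HOL-Library.Nat_Bijection"
begin

subsection \<open>Nonnegative matrices of spectral radius less than one\<close>

text \<open>The weights come from the resolvent because no irreducibility is assumed: a Perron
  eigenvector may vanish somewhere, and row sums of H may exceed 1. An intensity is fixed only up to
  null sets of the product of P and Lebesgue measure, while the points are read at random times.
  Hence everything is measured by first moments at fixed times: two thinnings of one Poisson measure
  differ at the atoms between the two graphs, and the mean number of these is at most the integrated
  mean distance of the intensities. The filtration is not completed and the null sets of divergence
  depend on t, so no path is repaired on a null set; total functions with default values
  (\<open>infsum\<close>, \<open>lim\<close>) keep the iterates and their limit predictable on all
  paths, and convergence is recovered almost surely afterwards. For stationarity the scheme is a
  deterministic functional of a configuration and a drift path. Its measurability is proved without
  any probability, in a locale that is interpreted both on the given space and on the space of noise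
  paths.\<close>

lemma eigenvalue_det_zero_iff:
  fixes A :: "complex ^ 'n::finite ^ 'n"
  shows "is_eigenvalue A z \<longleftrightarrow> det (mat z - A) = 0"
proof -
  have eq: "(mat z - A) *v v = z *s v - A *v v" for v :: "complex ^ 'n"
    by (simp add: matrix_vector_mult_diff_rdistrib vec_eq_iff matrix_vector_mult_def mat_def
        left_diff_distrib sum_subtractf if_distrib[of "\<lambda>x. x * _"] cong: if_cong)
  have "is_eigenvalue A z \<longleftrightarrow> (\<exists>v. v \<noteq> 0 \<and> (mat z - A) *v v = 0)"
    unfolding is_eigenvalue_def eq by (metis eq_iff_diff_eq_0)
  also have "\<dots> \<longleftrightarrow> \<not> invertible (mat z - A)"
    unfolding invertible_left_inverse matrix_left_invertible_ker by blast
  also have "\<dots> \<longleftrightarrow> det (mat z - A) = 0"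
    by (simp add: invertible_det_nz)
  finally show ?thesis .
qed

text \<open>At a coordinate where an eigenvector has maximal modulus, the eigenvalue is at most a
  row sum of moduli. The crude sum over all entries suffices to exhibit a number that is not an
  eigenvalue.\<close>

lemma eigenvalue_bound:
  fixes A :: "complex ^ 'n::finite ^ 'n"
  assumes "is_eigenvalue A z"
  shows "cmod z \<le> (\<Sum>i\<in>UNIV. \<Sum>j\<in>UNIV. cmod (A $ i $ j))"
proof -
  obtain v where v: "v \<noteq> 0" "A *v v = z *s v"
    using assms by (auto simp: is_eigenvalue_def)
  have "\<exists>i. \<forall>j. cmod (v $ j) \<le> cmod (v $ i)"
  proof -
    have "Max (range (\<lambda>i. cmod (v $ i))) \<in> range (\<lambda>i. cmod (v $ i))"
      by (intro Max_in) auto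
    then obtain i where "Max (range (\<lambda>i. cmod (v $ i))) = cmod (v $ i)"
      by (rule imageE)
    then show ?thesis
      by (metis Max_ge finite_class.finite_UNIV finite_imageI rangeI)
  qed
  then obtain i where i: "cmod (v $ j) \<le> cmod (v $ i)" for j
    by blast
  have pos: "cmod (v $ i) > 0"
  proof (rule ccontr)
    assume "\<not> cmod (v $ i) > 0"
    then have "v $ j = 0" for j
      using i[of j] by (metis norm_le_zero_iff order.trans not_less)
    then show False
      using v(1) by (simp add: vec_eq_iff)
  qed
  have "cmod z * cmod (v $ i) = cmod ((A *v v) $ i)"
    by (simp add: v(2) norm_mult)
  also have "\<dots> \<le> (\<Sum>j\<in>UNIV. cmod (A $ i $ j) * cmod (v $ j))"
    unfolding matrix_vector_mult_def by (simp add: norm_mult[symmetric] norm_sum)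
  also have "\<dots> \<le> (\<Sum>j\<in>UNIV. cmod (A $ i $ j)) * cmod (v $ i)"
    unfolding sum_distrib_right by (intro sum_mono mult_left_mono i) auto
  finally have "cmod z \<le> (\<Sum>j\<in>UNIV. cmod (A $ i $ j))"
    using pos by simp
  also have "\<dots> \<le> (\<Sum>i\<in>UNIV. \<Sum>j\<in>UNIV. cmod (A $ i $ j))"
    by (rule member_le_sum[of i UNIV "\<lambda>i. \<Sum>j\<in>UNIV. cmod (A $ i $ j)"]) (auto intro: sum_nonneg)
  finally show ?thesis .
qed

text \<open>\<open>spectral_radius\<close> is a \<open>Max\<close>, which bounds each eigenvalue
  only if there are finitely many. They are the roots of the characteristic polynomial, here the
  determinant of a matrix \<open>M\<close> of polynomials; it is not zero, since otherwise every
  number would be an eigenvalue, against \<open>eigenvalue_bound\<close>.\<close>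

lemma finite_eigenvalues:
  fixes A :: "complex ^ 'n::finite ^ 'n"
  shows "finite {z. is_eigenvalue A z}"
proof -
  define M :: "complex poly ^ 'n ^ 'n"
    where "M = (\<chi> i j. (if i = j then [:0, 1:] else 0) - [:A $ i $ j:])"
  have ev: "poly (det M) z = det (mat z - A)" for z
    unfolding det_def by (auto simp: poly_sum poly_prod M_def mat_def intro!: sum.cong prod.cong)
  have "det M \<noteq> 0"
  proof
    assume "det M = 0"
    then have *: "is_eigenvalue A z" for z
      unfolding eigenvalue_det_zero_iff ev[symmetric] by simp
    define K where "K = (\<Sum>i\<in>UNIV. \<Sum>j\<in>UNIV. cmod (A $ i $ j))"
    have "K \<ge> 0"
      unfolding K_def by (intro sum_nonneg) auto
    then show False
      using eigenvalue_bound[OF *, of "of_real (K + 1)"] by (simp add: K_def del: of_real_add)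
  qed
  then show ?thesis
    unfolding eigenvalue_det_zero_iff ev[symmetric] by (rule poly_roots_finite)
qed

text \<open>The witness at t = 1 satisfies H x = x - 1 with all entries of x at least 1. Subtracting
  1 from an entry is a loss of a definite proportion because the entries are also bounded above,
  which gives the factor \<theta>.\<close>

lemma strictly_subinvariant_vector:
  fixes H :: "real ^ 'n::finite ^ 'n"
  assumes nonneg: "\<And>i j. H $ i $ j \<ge> 0"
    and spr: "spectral_radius (\<chi> i j. complex_of_real (H $ i $ j)) < 1"
  obtains v \<theta> where "\<And>i. v $ i > 0" "0 \<le> \<theta>" "\<theta> < 1" "\<And>i. (H *v v) $ i \<le> \<theta> * v $ i"
proof -
  define A where "A = (\<chi> i j. complex_of_real (H $ i $ j))"
  have ev: "cmod z < 1" if "is_eigenvalue A z" for z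
  proof -
    have "{cmod z | z. is_eigenvalue A z} = cmod ` {z. is_eigenvalue A z}"
      by auto
    then have "cmod z \<le> spectral_radius A"
      unfolding spectral_radius_def using finite_eigenvalues[of A] that by (intro Max_ge) auto
    then show ?thesis
      using spr by (simp add: A_def)
  qed
  define B where "B t = mat 1 - t *\<^sub>R H" for t
  have Bv: "(B t *v x) $ i = x $ i - t * (H *v x) $ i" for t x i
    unfolding B_def by (simp add: matrix_vector_mult_diff_rdistrib scaleR_matrix_vector_assoc[symmetric])
  \<comment> \<open>A kernel vector of 1 - t H would be an eigenvector of H for 1 / t, which is at
    least 1 for these t.\<close>
  have det: "det (B t) \<noteq> 0" if t: "t \<in> {0..1}" for t
  proof
    assume "det (B t) = 0"
    then have "\<not> invertible (B t)"
      by (simp add: invertible_det_nz)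
    then obtain x where x: "x \<noteq> 0" "B t *v x = 0"
      unfolding invertible_left_inverse matrix_left_invertible_ker by blast
    have eq: "x $ i = t * (H *v x) $ i" for i
      using Bv[of t x i] x(2) by simp
    have "t \<noteq> 0"
      using x(1) eq by (auto simp: vec_eq_iff)
    define y where "y = (\<chi> i. complex_of_real (x $ i))"
    have "(A *v y) $ i = complex_of_real ((H *v x) $ i)" for i
      by (simp add: A_def y_def matrix_vector_mult_def)
    then have "A *v y = complex_of_real (1 / t) *s y"
      using eq \<open>t \<noteq> 0\<close> by (simp add: vec_eq_iff y_def field_simps)
    moreover have "y \<noteq> 0"
      using x(1) by (auto simp: y_def vec_eq_iff)
    ultimately have "cmod (complex_of_real (1 / t)) < 1"
      by (intro ev) (auto simp: is_eigenvalue_def)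
    then show False
      using t \<open>t \<noteq> 0\<close> by (simp add: norm_divide field_simps)
  qed
  \<comment> \<open>Cramer's rule for the right-hand side with all entries 1: the explicit quotient
    of determinants shows that the solution is continuous in t.\<close>
  define x where "x t = (\<chi> k. det (\<chi> i j. if j = k then 1 else B t $ i $ j) / det (B t))" for t
  have x: "x t $ i = 1 + t * (H *v x t) $ i" if t: "t \<in> {0..1}" for t i
  proof -
    have "B t *v x t = 1"
      using cramer[OF det[OF t], of "x t" "1"] by (simp add: x_def cong: if_cong)
    then show ?thesis
      using Bv[of t "x t" i] by simp
  qed
  have cont_det: "continuous_on {0..1} (\<lambda>t. det (M t))"
    if "\<And>i j. continuous_on {0..1} (\<lambda>t. M t $ i $ j)" for M :: "real \<Rightarrow> real ^ 'n ^ 'n"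
    unfolding det_def
    by (intro continuous_on_sum continuous_on_mult continuous_on_const continuous_on_prod that)
  have cont_B: "continuous_on {0..1} (\<lambda>t. B t $ i $ j)" for i j
    unfolding B_def by (auto intro!: continuous_intros)
  have cont: "continuous_on {0..1} x"
    unfolding x_def
  proof (intro continuous_on_vec_lambda continuous_on_divide cont_det cont_B ballI det)
    show "continuous_on {0..1} (\<lambda>t. (\<chi> i j. if j = k then 1 else B t $ i $ j) $ i $ j)" for k i j
      using cont_B by (cases "j = k") auto
  qed
  \<comment> \<open>A nonnegative solution is automatically at least 1. So the closed condition
    \<ge> 0 and the open condition > 0 define the same set \<open>T\<close> of parameters, which
    makes \<open>T\<close> clopen in the interval.\<close>
  have ge1: "x t $ i \<ge> 1" if t: "t \<in> {0..1}" and nn: "\<And>i. x t $ i \<ge> 0" for t i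
  proof -
    have "(H *v x t) $ i \<ge> 0"
      unfolding matrix_vector_mult_def using nn nonneg by (auto intro!: sum_nonneg mult_nonneg_nonneg)
    then show ?thesis
      using x[OF t, of i] t by simp
  qed
  define T where "T = {t \<in> {0..1}. \<forall>i. x t $ i \<ge> 0}"
  have T': "T = {t \<in> {0..1}. \<forall>i. x t $ i > 0}"
    using ge1 unfolding T_def by (auto simp: less_imp_le intro: less_le_trans[OF zero_less_one])
  have cl: "closed {v :: real^'n. \<forall>i. v $ i \<ge> 0}"
    by (intro closed_Collect_all closed_Collect_le continuous_intros)
  have "open (\<Inter>i. {v :: real^'n. v $ i > 0})"
    by (intro open_INT ballI open_Collect_less continuous_intros) auto
  then have op: "open {v :: real^'n. \<forall>i. v $ i > 0}"
    by (simp add: Collect_all_eq)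
  have "closedin (top_of_set {0..1}) T"
    using continuous_closedin_preimage[OF cont cl] by (simp add: T_def vimage_def Int_def)
  moreover have "openin (top_of_set {0..1}) T"
    using continuous_openin_preimage_gen[OF cont op] by (simp add: T' vimage_def Int_def)
  moreover have "0 \<in> T"
    using x[of 0] by (simp add: T_def)
  ultimately have "T = {0..1}"
    using connected_clopen[of "{0..1::real}"] by auto
  then have "1 \<in> T"
    by simp
  then have v: "x 1 $ i \<ge> 1" for i
    by (intro ge1) (auto simp: T_def)
  \<comment> \<open>With \<open>V\<close> the largest entry of x, each x i / V is at most 1, so x i
    - 1 \<le> (1 - 1 / V) * x i.\<close>
  define V where "V = Max (range (\<lambda>i. x 1 $ i))"
  have V: "x 1 $ i \<le> V" for i
    unfolding V_def by (intro Max_ge) auto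
  then have "V \<ge> 1"
    using v order.trans by blast
  show ?thesis
  proof (rule that[of "x 1" "1 - 1 / V"])
    show "0 < x 1 $ i" for i
      using v[of i] by simp
    show "(H *v x 1) $ i \<le> (1 - 1 / V) * x 1 $ i" for i
    proof -
      have "(H *v x 1) $ i = x 1 $ i - 1"
        using x[of 1 i] by simp
      moreover have "x 1 $ i / V \<le> 1"
        using V[of i] \<open>V \<ge> 1\<close> by simp
      ultimately show ?thesis
        by (simp add: algebra_simps)
    qed
  qed (use \<open>V \<ge> 1\<close> in auto)
qed

lemma spr_less_1_subinvariant:
  fixes H :: "'n::finite \<Rightarrow> 'n \<Rightarrow> ennreal"
  assumes "spr H < 1"
  obtains v \<theta> where "\<And>i. v i > 0" "0 \<le> \<theta>" "\<theta> < 1" "\<And>i j. H i j < \<infinity>"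
    "\<And>i. (\<Sum>j\<in>UNIV. H i j * ennreal (v j)) \<le> ennreal (\<theta> * v i)"
proof -
  define R where "R = (\<chi> i j. enn2real (H i j))"
  have fin: "H i j \<noteq> \<infinity>" for i j
    using assms by (auto simp: spr_def split: if_splits)
  have "ennreal (spectral_radius (\<chi> i j. complex_of_real (R $ i $ j))) < 1"
    using assms fin by (simp add: spr_def R_def)
  then have "spectral_radius (\<chi> i j. complex_of_real (R $ i $ j)) < 1"
    by (metis ennreal_1 ennreal_less_iff ennreal_neg linorder_not_less zero_less_one not_less_iff_gr_or_eq less_le_trans zero_le_one)
  then obtain v \<theta> where v: "\<And>i. v $ i > 0" "0 \<le> \<theta>" "\<theta> < 1" "\<And>i. (R *v v) $ i \<le> \<theta> * v $ i"
    by (rule strictly_subinvariant_vector[rotated]) (auto simp: R_def)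
  have "(\<Sum>j\<in>UNIV. H i j * ennreal (v $ j)) = ennreal ((R *v v) $ i)" for i
    unfolding matrix_vector_mult_def using fin v(1)
    by (simp add: R_def sum_ennreal[symmetric] less_imp_le ennreal_mult less_top)
  then show ?thesis
    using v fin by (intro that[of "\<lambda>i. v $ i" \<theta>]) (auto simp: less_top ennreal_leI)
qed

subsection \<open>Sums over point configurations\<close>

text \<open>For real terms, unconditional summability is absolute. In this form convergence of a
  drive is finiteness of nonnegative integrals, a condition whose measurability can be
  proved.\<close>

lemma summable_on_iff_nn_integral:
  fixes f :: "'a \<Rightarrow> real"
  shows "f summable_on A \<longleftrightarrow> (\<integral>\<^sup>+ x. ennreal \<bar>f x\<bar> \<partial>count_space A) < \<infinity>"
proof -
  have "f summable_on A \<longleftrightarrow> integrable (count_space A) f"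
    by (metis summable_on_iff_abs_summable_on_real abs_summable_equivalent Infinite_Set_Sum.abs_summable_on_def)
  then show ?thesis
    by (simp add: integrable_iff_bounded)
qed

lemma infsum_eq_integral:
  fixes f :: "'a \<Rightarrow> real"
  shows "infsum f A = (\<integral>x. f x \<partial>count_space A)"
proof (cases "f summable_on A")
  case True
  then have "Infinite_Set_Sum.abs_summable_on f A"
    by (metis summable_on_iff_abs_summable_on_real abs_summable_equivalent)
  then show ?thesis
    using infsetsum_infsum[of f A] by (simp add: infsetsum_def)
next
  case False
  then have "\<not> integrable (count_space A) f"
    by (simp add: summable_on_iff_nn_integral integrable_iff_bounded)
  with False show ?thesis
    by (simp add: infsum_not_exists not_integrable_integral_eq)
qed

text \<open>Written with three nonnegative integrals, a sum depending on a parameter becomes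
  measurable as soon as these are; the case distinction reproduces the default value 0 of a
  divergent sum.\<close>

lemma infsum_eq_enn2real:
  fixes f :: "'a \<Rightarrow> real"
  shows "infsum f A = (if (\<integral>\<^sup>+ x. ennreal \<bar>f x\<bar> \<partial>count_space A) < \<infinity>
     then enn2real (\<integral>\<^sup>+ x. ennreal (f x) \<partial>count_space A)
        - enn2real (\<integral>\<^sup>+ x. ennreal (- f x) \<partial>count_space A) else 0)"
proof (cases "(\<integral>\<^sup>+ x. ennreal \<bar>f x\<bar> \<partial>count_space A) < \<infinity>")
  case True
  then have "integrable (count_space A) f"
    by (simp add: integrable_iff_bounded)
  with True show ?thesis
    by (simp add: infsum_eq_integral real_lebesgue_integral_def)
next
  case False
  then show ?thesis
    by (metis summable_on_iff_nn_integral infsum_not_exists)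
qed

text \<open>Summability is not assumed, since a divergent sum has value 0.\<close>

lemma abs_infsum_le:
  fixes f :: "'a \<Rightarrow> real"
  shows "ennreal \<bar>infsum f A\<bar> \<le> (\<integral>\<^sup>+ x. ennreal \<bar>f x\<bar> \<partial>count_space A)"
proof (cases "f summable_on A")
  case True
  then have "integrable (count_space A) f"
    by (simp add: summable_on_iff_nn_integral integrable_iff_bounded)
  from integral_norm_bound_ennreal[OF this] show ?thesis
    by (simp add: infsum_eq_integral)
next
  case False
  then show ?thesis
    by (simp add: infsum_not_exists)
qed

lemma abs_infsum_diff_le:
  fixes f g :: "'a \<Rightarrow> real"
  assumes "f summable_on A" "g summable_on A"
  shows "ennreal \<bar>infsum f A - infsum g A\<bar> \<le> (\<integral>\<^sup>+ x. ennreal \<bar>f x - g x\<bar> \<partial>count_space A)"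
proof -
  have "integrable (count_space A) f" "integrable (count_space A) g"
    using assms by (simp_all add: summable_on_iff_nn_integral integrable_iff_bounded)
  then have "infsum f A - infsum g A = infsum (\<lambda>x. f x - g x) A"
    by (simp add: infsum_eq_integral)
  then show ?thesis
    using abs_infsum_le[of "\<lambda>x. f x - g x" A] by simp
qed

text \<open>\<open>norm1_grid\<close> is stated with \<open>infsum\<close>, whereas the estimates
  use integrals over \<open>count_space\<close>. Along an enumeration of the integers the partial
  sums are finite sums, each below \<open>infsum\<close>.\<close>

lemma nn_integral_count_space_le_infsum:
  fixes f :: "int \<Rightarrow> ennreal"
  shows "(\<integral>\<^sup>+ x. f x \<partial>count_space UNIV) \<le> infsum f UNIV"
proof -
  define e where "e = from_nat_into (UNIV :: int set)"
  have e: "bij_betw e UNIV UNIV"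
    unfolding e_def by (rule bij_betw_from_nat_into) auto
  have "(\<integral>\<^sup>+ x. f x \<partial>count_space UNIV) = (\<Sum>i. f (e i))"
    using nn_integral_bij_count_space[OF e, of f] by (simp add: nn_integral_count_space_nat)
  also have "\<dots> \<le> infsum f UNIV"
  proof (rule suminf_le_const)
    fix N
    have "(\<Sum>i<N. f (e i)) = sum f (e ` {..<N})"
      using bij_betw_imp_inj_on[OF e] by (subst sum.reindex) (auto intro: inj_on_subset)
    also have "\<dots> \<le> infsum f UNIV"
      unfolding nonneg_infsum_complete[of UNIV f, OF zero_le] by (rule SUP_upper) auto
    finally show "(\<Sum>i<N. f (e i)) \<le> infsum f UNIV" .
  qed auto
  finally show ?thesis .
qed

section \<open>Counting functions and measurability over random configurations\<close>

lemma ecount_Int: "ecount (S \<inter> B) = (\<integral>\<^sup>+ z. indicator B z \<partial>count_space S)"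
proof -
  have "(\<integral>\<^sup>+ z. indicator B z \<partial>count_space S) = (\<integral>\<^sup>+ z. indicator (S \<inter> B) z \<partial>count_space S)"
    by (rule nn_integral_cong) (auto simp: indicator_def)
  also have "\<dots> = emeasure (count_space S) (S \<inter> B)"
    by simp
  also have "\<dots> = ecount (S \<inter> B)"
    unfolding ecount_def by (cases "finite (S \<inter> B)") (simp_all add: emeasure_count_space)
  finally show ?thesis ..
qed

lemma ecount_finite: "finite S \<Longrightarrow> ecount S = of_nat (card S)"
  by (simp add: ecount_def emeasure_count_space ennreal_of_nat_eq_real_of_nat)

lemma space_config_space [simp]: "space config_space = UNIV"
  by (simp add: config_space_def space_measure_of_conv)

lemma sets_config_space:
  "sets config_space = sigma_sets UNIV {{S. ecount (S \<inter> B) \<in> A} | A B. A \<in> sets borel \<and> B \<in> sets borel}"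
  unfolding config_space_def by (rule sets_measure_of) auto

lemma measurable_ecount:
  assumes "B \<in> sets borel"
  shows "(\<lambda>S. ecount (S \<inter> B)) \<in> borel_measurable config_space"
proof (rule measurableI)
  fix A :: "ennreal set"
  assume "A \<in> sets borel"
  then have "{S. ecount (S \<inter> B) \<in> A} \<in> sets config_space"
    unfolding sets_config_space using assms by blast
  then show "(\<lambda>S. ecount (S \<inter> B)) -` A \<inter> space config_space \<in> sets config_space"
    by (simp add: vimage_def)
qed simp

lemma measurable_config_spaceI:
  fixes f :: "'w \<Rightarrow> 'a::topological_space set"
  assumes "\<And>B. B \<in> sets borel \<Longrightarrow> (\<lambda>\<omega>. ecount (f \<omega> \<inter> B)) \<in> borel_measurable M"
  shows "f \<in> measurable M config_space"
  unfolding config_space_def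
proof (rule measurable_measure_of)
  fix X :: "'a set set"
  assume "X \<in> {{S. ecount (S \<inter> B) \<in> A} | A B. A \<in> sets borel \<and> B \<in> sets borel}"
  then obtain A B where X: "X = {S. ecount (S \<inter> B) \<in> A}" "A \<in> sets borel" "B \<in> sets borel"
    by auto
  have "f -` X \<inter> space M = (\<lambda>\<omega>. ecount (f \<omega> \<inter> B)) -` A \<inter> space M"
    by (auto simp: X)
  then show "f -` X \<inter> space M \<in> sets M"
    using assms[OF X(3)] X(2) by (simp add: measurable_sets)
qed auto

lemma measurable_ecount_compose:
  assumes "f \<in> measurable M config_space" "B \<in> sets borel"
  shows "(\<lambda>\<omega>. ecount (f \<omega> \<inter> B)) \<in> borel_measurable M"
  using measurable_compose[OF assms(1) measurable_ecount[OF assms(2)]] .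

lemma measurable_config_Int:
  assumes "f \<in> measurable M config_space" "D \<in> sets borel"
  shows "(\<lambda>\<omega>. f \<omega> \<inter> D) \<in> measurable M config_space"
proof (rule measurable_config_spaceI)
  fix B :: "'b set"
  assume "B \<in> sets borel"
  then show "(\<lambda>\<omega>. ecount (f \<omega> \<inter> D \<inter> B)) \<in> borel_measurable M"
    unfolding Int_assoc using assms by (intro measurable_ecount_compose) auto
qed

text \<open>A Dynkin argument on measurable rectangles, where the integral is an indicator times a
  count. The complement step subtracts, so the counts must be finite: \<open>box\<close> works
  inside a ball of radius K, and K tends to infinity only when a general measurable set is
  treated.\<close>

lemma borel_measurable_count_nn_integral:
  fixes f :: "'w \<Rightarrow> 'a::{second_countable_topology, real_normed_vector} set"
  assumes f: "f \<in> measurable M config_space"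
    and fin: "\<And>\<omega> B. \<omega> \<in> space M \<Longrightarrow> bounded B \<Longrightarrow> finite (f \<omega> \<inter> B)"
    and H: "H \<in> borel_measurable (M \<Otimes>\<^sub>M borel)"
  shows "(\<lambda>\<omega>. \<integral>\<^sup>+ z. H (\<omega>, z) \<partial>count_space (f \<omega>)) \<in> borel_measurable M"
proof -
  have box: "(\<lambda>\<omega>. \<integral>\<^sup>+ z. indicator E (\<omega>, z) * indicator (cball 0 (real K)) z \<partial>count_space (f \<omega>)) \<in> borel_measurable M"
    (is "?I E \<in> _") if E: "E \<in> sets (M \<Otimes>\<^sub>M (borel :: 'a measure))" for E K
  proof -
    let ?G = "{a \<times> b | a b. a \<in> sets M \<and> b \<in> sets (borel :: 'a measure)}"
    have sets_eq: "sets (M \<Otimes>\<^sub>M (borel :: 'a measure)) = sigma_sets (space M \<times> UNIV) ?G"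
      using sets_pair_measure[of M "borel :: 'a measure"] by simp
    have "?G \<subseteq> Pow (space M \<times> UNIV)"
      by (auto dest: sets.sets_into_space)
    from Int_stable_pair_measure_generator[of M "borel :: 'a measure"] this E[unfolded sets_eq]
    show ?thesis
    proof (induction rule: sigma_sets_induct_disjoint)
      case (basic E)
      then obtain a b where ab: "E = a \<times> b" "a \<in> sets M" "b \<in> sets borel"
        by auto
      have "?I E = (\<lambda>\<omega>. indicator a \<omega> * ecount (f \<omega> \<inter> (b \<inter> cball 0 (real K))))"
        unfolding ab ecount_Int
        by (subst nn_integral_cmult[symmetric]) (auto simp: fun_eq_iff indicator_times indicator_inter_arith mult_ac)
      then show ?case
        using ab f by (auto intro!: borel_measurable_times_ennreal borel_measurable_indicator measurable_ecount_compose)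
    next
      case empty
      then show ?case by simp
    next
      case (compl E)
      have "?I (space M \<times> UNIV - E) \<omega> = ecount (f \<omega> \<inter> cball 0 (real K)) - ?I E \<omega>"
        if \<omega>: "\<omega> \<in> space M" for \<omega>
      proof -
        have "ecount (f \<omega> \<inter> cball 0 (real K)) < \<infinity>"
          using fin[OF \<omega>, of "cball 0 (real K)"] by (simp add: ecount_finite of_nat_less_top)
        then have "?I E \<omega> < \<infinity>"
          unfolding ecount_Int
          by (rule le_less_trans[rotated]) (auto intro!: nn_integral_mono simp: indicator_def)
        then have "(\<integral>\<^sup>+ z. indicator (cball 0 (real K)) z - indicator E (\<omega>, z) * indicator (cball 0 (real K)) z \<partial>count_space (f \<omega>))
           = ecount (f \<omega> \<inter> cball 0 (real K)) - ?I E \<omega>"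
          unfolding ecount_Int
          by (intro nn_integral_diff) (auto simp: indicator_def)
        moreover have "?I (space M \<times> UNIV - E) \<omega> = (\<integral>\<^sup>+ z. indicator (cball 0 (real K)) z - indicator E (\<omega>, z) * indicator (cball 0 (real K)) z \<partial>count_space (f \<omega>))"
          using \<omega> by (intro nn_integral_cong) (auto simp: indicator_def)
        ultimately show ?thesis by simp
      qed
      then show ?case
        by (rule measurable_cong[THEN iffD2])
           (auto intro!: borel_measurable_minus_ennreal measurable_ecount_compose compl(2) f)
    next
      case (union E)
      have "?I (\<Union>i. E i) = (\<lambda>\<omega>. \<Sum>i. ?I (E i) \<omega>)"
        using union(1)
        by (subst nn_integral_suminf[symmetric])
           (auto simp: fun_eq_iff suminf_indicator[symmetric] ennreal_suminf_multc disjoint_family_on_def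
              intro!: nn_integral_cong)
      then show ?case
        using union by (auto intro!: borel_measurable_suminf)
    qed
  qed
  from H show ?thesis
  proof (induction rule: borel_measurable_induct)
    case (cong g h)
    then have "(\<integral>\<^sup>+ z. g (\<omega>, z) \<partial>count_space (f \<omega>)) = (\<integral>\<^sup>+ z. h (\<omega>, z) \<partial>count_space (f \<omega>))" if "\<omega> \<in> space M" for \<omega>
      using that by (intro nn_integral_cong) (auto simp: space_pair_measure)
    then show ?case
      by (rule measurable_cong[THEN iffD2, OF _ cong(4)])
  next
    case (set E)
    have "(\<integral>\<^sup>+ z. indicator E (\<omega>, z) \<partial>count_space (f \<omega>)) =
      (SUP K. \<integral>\<^sup>+ z. indicator E (\<omega>, z) * indicator (cball 0 (real K)) z \<partial>count_space (f \<omega>))" for \<omega>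
    proof -
      have "(\<integral>\<^sup>+ z. indicator E (\<omega>, z) \<partial>count_space (f \<omega>)) =
        (\<integral>\<^sup>+ z. (SUP K. indicator E (\<omega>, z) * indicator (cball 0 (real K)) z) \<partial>count_space (f \<omega>))"
      proof (rule nn_integral_cong)
        fix z :: 'a
        obtain K :: nat where "norm z \<le> real K"
          using real_arch_simple by blast
        then have "indicator E (\<omega>, z) \<le> (SUP K. indicator E (\<omega>, z) * indicator (cball 0 (real K)) z :: ennreal)"
          by (intro SUP_upper2[of K]) (auto simp: indicator_def)
        moreover have "(SUP K. indicator E (\<omega>, z) * indicator (cball 0 (real K)) z :: ennreal) \<le> indicator E (\<omega>, z)"
          by (rule SUP_least) (simp add: indicator_def)
        ultimately show "indicator E (\<omega>, z) = (SUP K. indicator E (\<omega>, z) * indicator (cball 0 (real K)) z :: ennreal)"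
          by (rule antisym)
      qed
      also have "\<dots> = (SUP K. \<integral>\<^sup>+ z. indicator E (\<omega>, z) * indicator (cball 0 (real K)) z \<partial>count_space (f \<omega>))"
        by (rule nn_integral_monotone_convergence_SUP)
           (auto simp: incseq_def le_fun_def indicator_def)
      finally show ?thesis .
    qed
    then show ?case
      using box[OF set] by (simp add: borel_measurable_SUP)
  next
    case (mult u c)
    then show ?case
      by (simp add: nn_integral_cmult borel_measurable_times_ennreal)
  next
    case (add u v)
    then show ?case
      by (simp add: nn_integral_add borel_measurable_add)
  next
    case (seq U)
    have "(\<integral>\<^sup>+ z. (SUP i. U i) (\<omega>, z) \<partial>count_space (f \<omega>)) = (SUP i. \<integral>\<^sup>+ z. U i (\<omega>, z) \<partial>count_space (f \<omega>))" for \<omega>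
      unfolding SUP_apply using seq.hyps
      by (intro nn_integral_monotone_convergence_SUP) (auto simp: incseq_def le_fun_def)
    then show ?case
      using seq.IH by (simp add: borel_measurable_SUP)
  qed
qed

lemma borel_measurable_count_infsum:
  fixes f :: "'w \<Rightarrow> 'a::{second_countable_topology, real_normed_vector} set"
    and H :: "'w \<times> 'a \<Rightarrow> real"
  assumes f: "f \<in> measurable M config_space"
    and fin: "\<And>\<omega> B. \<omega> \<in> space M \<Longrightarrow> bounded B \<Longrightarrow> finite (f \<omega> \<inter> B)"
    and [measurable]: "H \<in> borel_measurable (M \<Otimes>\<^sub>M borel)"
  shows "(\<lambda>\<omega>. infsum (\<lambda>z. H (\<omega>, z)) (f \<omega>)) \<in> borel_measurable M"
proof -
  have [measurable]: "(\<lambda>\<omega>. \<integral>\<^sup>+ z. ennreal \<bar>H (\<omega>, z)\<bar> \<partial>count_space (f \<omega>)) \<in> borel_measurable M"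
    using borel_measurable_count_nn_integral[OF f fin, of "\<lambda>z. ennreal \<bar>H z\<bar>"] by simp
  have [measurable]: "(\<lambda>\<omega>. \<integral>\<^sup>+ z. ennreal (H (\<omega>, z)) \<partial>count_space (f \<omega>)) \<in> borel_measurable M"
    using borel_measurable_count_nn_integral[OF f fin, of "\<lambda>z. ennreal (H z)"] by simp
  have [measurable]: "(\<lambda>\<omega>. \<integral>\<^sup>+ z. ennreal (- H (\<omega>, z)) \<partial>count_space (f \<omega>)) \<in> borel_measurable M"
    using borel_measurable_count_nn_integral[OF f fin, of "\<lambda>z. ennreal (- H z)"] by simp
  show ?thesis
    unfolding infsum_eq_enn2real by measurable
qed

section \<open>Thinning of a planar configuration\<close>

text \<open>The thinning of \<open>C\<close> by the intensity \<open>l\<close>: times of the atoms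
  on or below its graph. The constraint that heights be nonnegative is left to the
  configuration.\<close>

definition pts :: "(real \<times> real) set \<Rightarrow> (real \<Rightarrow> real) \<Rightarrow> real set" where
  "pts C l = {s. \<exists>x. (s, x) \<in> C \<and> x \<le> l s}"

lemma pts_Int_bij_betw:
  assumes "inj_on fst C"
  shows "bij_betw fst {z \<in> C. snd z \<le> l (fst z) \<and> fst z \<in> D} (pts C l \<inter> D)"
  unfolding bij_betw_def
  using assms by (force simp: pts_def inj_on_def)

text \<open>Atoms have distinct times, so the projection to the time axis loses none. Sums over
  different thinnings thereby become sums over the same configuration with different indicators and
  can be compared term by term.\<close>

lemma nn_integral_count_pts:
  assumes "inj_on fst C"
  shows "(\<integral>\<^sup>+ s. g s \<partial>count_space (pts C l \<inter> D)) =
    (\<integral>\<^sup>+ z. (if snd z \<le> l (fst z) \<and> fst z \<in> D then g (fst z) else 0) \<partial>count_space C)"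
proof -
  have "(\<integral>\<^sup>+ s. g s \<partial>count_space (pts C l \<inter> D)) =
    (\<integral>\<^sup>+ z. g (fst z) \<partial>count_space {z \<in> C. snd z \<le> l (fst z) \<and> fst z \<in> D})"
    using nn_integral_bij_count_space[OF pts_Int_bij_betw[OF assms]] by simp
  also have "\<dots> = (\<integral>\<^sup>+ z. g (fst z) * indicator {z \<in> C. snd z \<le> l (fst z) \<and> fst z \<in> D} z \<partial>count_space UNIV)"
    by (rule nn_integral_count_space_indicator) auto
  also have "\<dots> = (\<integral>\<^sup>+ z. (if snd z \<le> l (fst z) \<and> fst z \<in> D then g (fst z) else 0) * indicator C z \<partial>count_space UNIV)"
    by (rule nn_integral_cong) (auto simp: indicator_def)
  also have "\<dots> = (\<integral>\<^sup>+ z. (if snd z \<le> l (fst z) \<and> fst z \<in> D then g (fst z) else 0) \<partial>count_space C)"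
    by (rule nn_integral_count_space_indicator[symmetric]) auto
  finally show ?thesis .
qed

lemma summable_on_pts_iff:
  fixes g :: "real \<Rightarrow> real"
  assumes "inj_on fst C"
  shows "g summable_on (pts C l \<inter> D) \<longleftrightarrow>
    (\<lambda>z. if snd z \<le> l (fst z) \<and> fst z \<in> D then g (fst z) else 0) summable_on C"
  unfolding summable_on_iff_nn_integral nn_integral_count_pts[OF assms]
  by (simp add: if_distrib[of abs] if_distrib[of ennreal] cong: if_cong)

lemma infsum_pts:
  fixes g :: "real \<Rightarrow> real"
  assumes "inj_on fst C"
  shows "infsum g (pts C l \<inter> D) =
    infsum (\<lambda>z. if snd z \<le> l (fst z) \<and> fst z \<in> D then g (fst z) else 0) C"
  unfolding infsum_eq_enn2real nn_integral_count_pts[OF assms]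
  by (simp add: if_distrib[of abs] if_distrib[of uminus] if_distrib[of ennreal] cong: if_cong)

text \<open>Configurations use the Borel sets of the plane rather than a product \<sigma>-algebra;
  the projections get rules for that formulation.\<close>

lemma borel_measurable_fst_borel [measurable (raw)]:
  fixes f :: "'w \<Rightarrow> 'a::second_countable_topology \<times> 'b::second_countable_topology"
  shows "f \<in> borel_measurable M \<Longrightarrow> (\<lambda>x. fst (f x)) \<in> borel_measurable M"
  unfolding borel_prod[symmetric] by (rule measurable_fst')

lemma borel_measurable_snd_borel [measurable (raw)]:
  fixes f :: "'w \<Rightarrow> 'a::second_countable_topology \<times> 'b::second_countable_topology"
  shows "f \<in> borel_measurable M \<Longrightarrow> (\<lambda>x. snd (f x)) \<in> borel_measurable M"
  unfolding borel_prod[symmetric] by (rule measurable_snd')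

lemma measurable_pts:
  assumes f: "f \<in> measurable M config_space"
    and fin: "\<And>\<omega> B. \<omega> \<in> space M \<Longrightarrow> bounded B \<Longrightarrow> finite (f \<omega> \<inter> B)"
    and inj: "\<And>\<omega>. \<omega> \<in> space M \<Longrightarrow> inj_on fst (f \<omega>)"
    and [measurable]: "(\<lambda>(\<omega>, s). l s \<omega>) \<in> borel_measurable (M \<Otimes>\<^sub>M borel)"
  shows "(\<lambda>\<omega>. pts (f \<omega>) (\<lambda>s. l s \<omega>)) \<in> measurable M config_space"
proof (rule measurable_config_spaceI)
  fix B :: "real set"
  assume [measurable]: "B \<in> sets borel"
  have "ecount (pts (f \<omega>) (\<lambda>s. l s \<omega>) \<inter> B) =
      (\<integral>\<^sup>+ z. (if snd z \<le> l (fst z) \<omega> then indicator B (fst z) else 0) \<partial>count_space (f \<omega>))"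
    if "\<omega> \<in> space M" for \<omega>
  proof -
    have "ecount (pts (f \<omega>) (\<lambda>s. l s \<omega>) \<inter> B) = (\<integral>\<^sup>+ s. 1 \<partial>count_space (pts (f \<omega>) (\<lambda>s. l s \<omega>) \<inter> B))"
      using ecount_Int[of "pts (f \<omega>) (\<lambda>s. l s \<omega>) \<inter> B" UNIV] by simp
    then show ?thesis
      unfolding nn_integral_count_pts[OF inj[OF that]]
      by (auto simp: indicator_def intro!: nn_integral_cong)
  qed
  moreover have "(\<lambda>\<omega>. \<integral>\<^sup>+ z. (\<lambda>(\<omega>, z). if snd z \<le> l (fst z) \<omega> then indicator B (fst z) else 0 :: ennreal) (\<omega>, z) \<partial>count_space (f \<omega>))
     \<in> borel_measurable M"
    by (intro borel_measurable_count_nn_integral[OF f fin])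
       (simp_all add: split_beta')
  ultimately show "(\<lambda>\<omega>. ecount (pts (f \<omega>) (\<lambda>s. l s \<omega>) \<inter> B)) \<in> borel_measurable M"
    by (subst measurable_cong) auto
qed

subsection \<open>Poisson random measures: uniqueness in law and independence\<close>

lemma ecount_image: "inj_on f S \<Longrightarrow> ecount (f ` S) = ecount S"
  by (simp add: ecount_def emeasure_count_space card_image finite_image_iff)

text \<open>Independence of Poisson counts is given for disjoint sets, and their law for sets of
  finite measure. A finite family of Borel sets is therefore cut into the atoms of the algebra it
  generates, and these into shells by the integer part of the norm. The number \<open>g z\<close>
  encodes which of the sets contain z together with the shell of z; numbers that encode nothing
  yield empty pieces.\<close>

lemma bounded_partition:
  fixes B :: "nat \<Rightarrow> 'a::{second_countable_topology, real_normed_vector} set"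
  assumes B: "\<And>i. i < N \<Longrightarrow> B i \<in> sets borel"
  shows "\<exists>D :: nat \<Rightarrow> 'a set. (\<forall>k. D k \<in> sets borel) \<and> disjoint_family D \<and> (\<forall>k. bounded (D k)) \<and>
    (\<forall>k. D k \<subseteq> (\<Union>i<N. B i)) \<and> (\<forall>i<N. B i = (\<Union>k\<in>{k. D k \<noteq> {} \<and> D k \<subseteq> B i}. D k))"
proof -
  define I where "I z = {i. i < N \<and> z \<in> B i}" for z
  define g where "g z = prod_encode (set_encode (I z), nat \<lfloor>norm z\<rfloor>)" for z :: 'a
  define D where "D k = {z \<in> (\<Union>i<N. B i). g z = k}" for k
  have fin: "finite (I z)" for z
    unfolding I_def by auto
  have g: "g z = k \<longleftrightarrow> I z = set_decode (fst (prod_decode k)) \<and> nat \<lfloor>norm z\<rfloor> = snd (prod_decode k)" for z k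
  proof -
    have "g z = k \<longleftrightarrow> (set_encode (I z), nat \<lfloor>norm z\<rfloor>) = prod_decode k"
      unfolding g_def by (metis prod_decode_inverse prod_encode_inverse)
    also have "set_encode (I z) = a \<longleftrightarrow> I z = set_decode a" for a
      by (metis fin set_decode_inverse set_encode_inverse)
    then have "(set_encode (I z), nat \<lfloor>norm z\<rfloor>) = prod_decode k \<longleftrightarrow>
        I z = set_decode (fst (prod_decode k)) \<and> nat \<lfloor>norm z\<rfloor> = snd (prod_decode k)"
      by (cases "prod_decode k") auto
    finally show ?thesis .
  qed
  show ?thesis
  proof (intro exI[of _ D] conjI allI impI)
    show "D k \<in> sets borel" for k
    proof -
      have [measurable]: "B i \<in> sets borel" if "i \<in> {..<N}" for i
        using B that by auto
      have "D k = {z \<in> space borel. (\<exists>i\<in>{..<N}. z \<in> B i) \<and> (\<forall>i\<in>{..<N}. z \<in> B i \<longleftrightarrow> i \<in> set_decode (fst (prod_decode k)))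
          \<and> (\<forall>i\<in>set_decode (fst (prod_decode k)). i < N) \<and> nat \<lfloor>norm z\<rfloor> = snd (prod_decode k)}"
        unfolding D_def g I_def by auto
      also have "\<dots> \<in> sets borel"
        by measurable
      finally show ?thesis .
    qed
    show "disjoint_family D"
      by (auto simp: disjoint_family_on_def D_def)
    show "bounded (D k)" for k
    proof (rule bounded_subset[OF bounded_cball])
      show "D k \<subseteq> cball 0 (real (snd (prod_decode k)) + 1)"
      proof
        fix z
        assume "z \<in> D k"
        then have "nat \<lfloor>norm z\<rfloor> = snd (prod_decode k)"
          by (auto simp: D_def g)
        moreover have "norm z \<le> real (nat \<lfloor>norm z\<rfloor>) + 1"
          using real_of_int_floor_add_one_ge[of "norm z"] by simp
        ultimately show "z \<in> cball 0 (real (snd (prod_decode k)) + 1)"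
          by simp
      qed
    qed
    show "D k \<subseteq> (\<Union>i<N. B i)" for k
      by (auto simp: D_def)
    show "B i = (\<Union>k\<in>{k. D k \<noteq> {} \<and> D k \<subseteq> B i}. D k)" if "i < N" for i
    proof
      show "B i \<subseteq> (\<Union>k\<in>{k. D k \<noteq> {} \<and> D k \<subseteq> B i}. D k)"
      proof
        fix z
        assume z: "z \<in> B i"
        have zD: "z \<in> D (g z)"
          using z that by (auto simp: D_def)
        moreover have "D (g z) \<subseteq> B i"
        proof
          fix y
          assume "y \<in> D (g z)"
          then have "I y = I z"
            using g[of y "g z"] g[of z "g z"] by (auto simp: D_def)
          then show "y \<in> B i"
            using z that unfolding I_def by blast
        qed
        ultimately show "z \<in> (\<Union>k\<in>{k. D k \<noteq> {} \<and> D k \<subseteq> B i}. D k)"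
          by blast
      qed
    qed auto
  qed
qed

text \<open>The series runs over all indices, with 0 outside \<open>K\<close>, so that a count
  becomes a function of the whole sequence of counts on the pieces.\<close>

lemma ecount_partition:
  fixes D :: "nat \<Rightarrow> 'a set"
  assumes "disjoint_family D" "B = (\<Union>k\<in>K. D k)"
  shows "ecount (S \<inter> B) = (\<Sum>k. if k \<in> K then ecount (S \<inter> D k) else 0)"
proof -
  define E where "E k = (if k \<in> K then S \<inter> D k else {})" for k
  have "S \<inter> B = (\<Union>k. E k)"
    by (auto simp: assms(2) E_def)
  moreover have "disjoint_family E"
    using assms(1) by (auto simp: disjoint_family_on_def E_def)
  ultimately have "ecount (S \<inter> B) = (\<Sum>k. ecount (E k))"
    unfolding ecount_def by (simp add: suminf_emeasure)
  then show ?thesis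
    by (auto simp: E_def ecount_def if_distrib cong: if_cong)
qed

lemma poisson_random_measureD:
  assumes "poisson_random_measure P \<pi>"
  shows "\<pi> \<in> measurable P config_space"
    and "\<omega> \<in> space P \<Longrightarrow> \<pi> \<omega> \<subseteq> UNIV \<times> {0..}"
    and "\<omega> \<in> space P \<Longrightarrow> bounded B \<Longrightarrow> finite (\<pi> \<omega> \<inter> B)"
    and "\<And>B j. B \<in> sets borel \<Longrightarrow> B \<subseteq> UNIV \<times> {0..} \<Longrightarrow> emeasure lborel B < \<infinity> \<Longrightarrow>
      measure P {\<omega>\<in>space P. ecount (\<pi> \<omega> \<inter> B) = of_nat j} = measure lborel B ^ j / fact j * exp (- measure lborel B)"
    and "\<And>B :: nat \<Rightarrow> (real \<times> real) set. (\<And>i. B i \<in> sets borel) \<Longrightarrow> disjoint_family B \<Longrightarrow> (\<And>i. B i \<subseteq> UNIV \<times> {0..}) \<Longrightarrow>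
      prob_space.indep_vars P (\<lambda>_. borel) (\<lambda>i \<omega>. ecount (\<pi> \<omega> \<inter> B i)) UNIV"
proof -
  note D = assms[unfolded poisson_random_measure_def]
  note 2 = D[THEN conjunct2, THEN conjunct1] and 3 = D[THEN conjunct2, THEN conjunct2]
  show "\<pi> \<in> measurable P config_space"
    by (rule D[THEN conjunct1])
  show "\<omega> \<in> space P \<Longrightarrow> \<pi> \<omega> \<subseteq> UNIV \<times> {0..}" "\<omega> \<in> space P \<Longrightarrow> bounded B \<Longrightarrow> finite (\<pi> \<omega> \<inter> B)"
    using 2 by blast+
  show "measure P {\<omega>\<in>space P. ecount (\<pi> \<omega> \<inter> B) = of_nat j} = measure lborel B ^ j / fact j * exp (- measure lborel B)"
    if "B \<in> sets borel" "B \<subseteq> UNIV \<times> {0..}" "emeasure lborel B < \<infinity>" for B j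
    using 3[THEN conjunct1, rule_format, OF that] .
  show "prob_space.indep_vars P (\<lambda>_. borel) (\<lambda>i \<omega>. ecount (\<pi> \<omega> \<inter> B i)) UNIV"
    if "\<And>i. B i \<in> sets borel" "disjoint_family B" "\<And>i. B i \<subseteq> UNIV \<times> {0..}" for B :: "nat \<Rightarrow> (real \<times> real) set"
    by (rule 3[THEN conjunct2, rule_format]) (use that in auto)
qed

text \<open>The generating evaluations are closed under intersection only after passing to finitely
  many conditions at once. This is the \<pi>-system on which laws of configurations are compared; N
  = 0 gives the whole space.\<close>

definition config_cylinders :: "'a::topological_space set set set" where
  "config_cylinders = {{S. \<forall>i<N. ecount (S \<inter> B i) \<in> A i} | (N :: nat) B A.
     (\<forall>i<N. B i \<in> sets borel \<and> A i \<in> sets borel)}"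

lemma config_cylindersI:
  assumes "\<And>i. i < N \<Longrightarrow> B i \<in> sets borel" "\<And>i. i < N \<Longrightarrow> A i \<in> sets borel"
  shows "{S. \<forall>i<N::nat. ecount (S \<inter> B i) \<in> A i} \<in> config_cylinders"
  unfolding config_cylinders_def using assms by (intro CollectI exI conjI) auto

lemma Int_stable_config_cylinders: "Int_stable (config_cylinders :: 'a::topological_space set set set)"
proof (rule Int_stableI)
  fix X Y :: "'a set set"
  assume "X \<in> config_cylinders" "Y \<in> config_cylinders"
  then obtain N N' :: nat and B A B' A' where X: "X = {S. \<forall>i<N. ecount (S \<inter> B i) \<in> A i}" "\<forall>i<N. B i \<in> sets borel \<and> A i \<in> sets borel"
    and Y: "Y = {S. \<forall>i<N'. ecount (S \<inter> B' i) \<in> A' i}" "\<forall>i<N'. B' i \<in> sets borel \<and> A' i \<in> sets borel"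
    unfolding config_cylinders_def by blast
  define B'' where "B'' i = (if i < N then B i else B' (i - N))" for i
  define A'' where "A'' i = (if i < N then A i else A' (i - N))" for i
  have split: "(\<forall>i<N + N'. Q i) \<longleftrightarrow> (\<forall>i<N. Q i) \<and> (\<forall>i<N'. Q (N + i))" for Q
    by (metis add_diff_inverse_nat add_less_cancel_left nat_less_le trans_less_add1)
  have "X \<inter> Y = {S. \<forall>i<N + N'. ecount (S \<inter> B'' i) \<in> A'' i}"
    unfolding X Y split by (auto simp: B''_def A''_def)
  moreover have "\<forall>i<N + N'. B'' i \<in> sets borel \<and> A'' i \<in> sets borel"
    unfolding split using X(2) Y(2) by (auto simp: B''_def A''_def)
  ultimately show "X \<inter> Y \<in> config_cylinders"
    by (auto intro!: config_cylindersI)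
qed

lemma sigma_config_cylinders: "sets config_space = sigma_sets UNIV config_cylinders"
proof
  show "sets config_space \<subseteq> sigma_sets UNIV (config_cylinders :: 'a set set set)"
    unfolding sets_config_space
  proof (rule sigma_sets_mono, safe)
    fix A and B :: "'a set"
    assume AB: "A \<in> sets (borel :: ennreal measure)" "B \<in> sets borel"
    then have "{S. \<forall>i<1::nat. ecount (S \<inter> B) \<in> A} \<in> config_cylinders"
      by (intro config_cylindersI)
    then have "{S. ecount (S \<inter> B) \<in> A} \<in> config_cylinders"
      by simp
    then show "{S. ecount (S \<inter> B) \<in> A} \<in> sigma_sets UNIV config_cylinders"
      by (rule sigma_sets.Basic)
  qed
  show "sigma_sets UNIV config_cylinders \<subseteq> sets (config_space :: 'a set measure)"
  proof (rule sets.sigma_sets_subset[of _ config_space, simplified], safe)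
    fix X :: "'a set set"
    assume "X \<in> config_cylinders"
    then obtain N :: nat and B A where X: "X = {S. \<forall>i<N. ecount (S \<inter> B i) \<in> A i}" "\<forall>i<N. B i \<in> sets borel \<and> A i \<in> sets borel"
      unfolding config_cylinders_def by blast
    have "{S \<in> space config_space. \<forall>i\<in>{..<N}. ecount (S \<inter> B i) \<in> A i} \<in> sets config_space"
    proof (rule sets.sets_Collect_finite_All)
      fix i
      assume "i \<in> {..<N}"
      then have "(\<lambda>S. ecount (S \<inter> B i)) -` A i \<inter> space config_space \<in> sets config_space"
        using X(2) by (intro measurable_sets[OF measurable_ecount]) auto
      then show "{S \<in> space config_space. ecount (S \<inter> B i) \<in> A i} \<in> sets config_space"
        by (simp add: vimage_def)
    qed simp
    then show "X \<in> sets config_space"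
      by (simp add: X(1) Ball_def)
  qed
qed

lemma config_measure_eqI:
  fixes \<mu> \<nu> :: "'a::topological_space set measure"
  assumes "sets \<mu> = sets config_space" "sets \<nu> = sets config_space" "emeasure \<mu> UNIV \<noteq> \<infinity>"
    and eq: "\<And>(N::nat) B A. (\<And>i. i < N \<Longrightarrow> B i \<in> sets borel) \<Longrightarrow> (\<And>i. i < N \<Longrightarrow> A i \<in> sets borel) \<Longrightarrow>
      emeasure \<mu> {S. \<forall>i<N. ecount (S \<inter> B i) \<in> A i} = emeasure \<nu> {S. \<forall>i<N. ecount (S \<inter> B i) \<in> A i}"
  shows "\<mu> = \<nu>"
proof (rule measure_eqI_generator_eq[OF Int_stable_config_cylinders])
  show "emeasure \<mu> X = emeasure \<nu> X" if "X \<in> config_cylinders" for X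
    using that unfolding config_cylinders_def by (auto intro!: eq)
  have "{S. \<forall>i<0::nat. ecount (S \<inter> {}) \<in> {}} \<in> (config_cylinders :: 'a set set set)"
    by (rule config_cylindersI) auto
  then show "range (\<lambda>_::nat. UNIV) \<subseteq> (config_cylinders :: 'a set set set)"
    by auto
qed (simp_all only: assms sigma_config_cylinders[symmetric] Pow_UNIV subset_UNIV UN_constant if_False UNIV_not_empty simp_thms)

text \<open>A bounded set contains finitely many atoms on every path, so its count is a natural
  number and its law is determined by the prescribed point masses.\<close>

lemma poisson_count_distr_eq:
  assumes "prob_space P" "poisson_random_measure P \<pi>" "prob_space P'" "poisson_random_measure P' \<pi>'"
    and B: "B \<in> sets borel" "B \<subseteq> UNIV \<times> {0..}" "bounded B"
  shows "distr P borel (\<lambda>\<omega>. ecount (\<pi> \<omega> \<inter> B)) = distr P' borel (\<lambda>\<omega>. ecount (\<pi>' \<omega> \<inter> B))"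
proof -
  have *: "emeasure (distr P borel (\<lambda>\<omega>. ecount (\<pi> \<omega> \<inter> B))) A =
    (\<Sum>j. if of_nat j \<in> A then ennreal (measure lborel B ^ j / fact j * exp (- measure lborel B)) else 0)"
    if "prob_space P" "poisson_random_measure P \<pi>" "A \<in> sets borel"
    for P :: "'c measure" and \<pi> A
  proof -
    interpret prob_space P by fact
    note \<pi> = poisson_random_measureD[OF that(2)]
    have [measurable]: "(\<lambda>\<omega>. ecount (\<pi> \<omega> \<inter> B)) \<in> borel_measurable P"
      by (rule measurable_ecount_compose[OF \<pi>(1) B(1)])
    define E where "E j = (if of_nat j \<in> A then {\<omega> \<in> space P. ecount (\<pi> \<omega> \<inter> B) = of_nat j} else {})" for j :: nat
    have "{\<omega> \<in> space P. ecount (\<pi> \<omega> \<inter> B) = of_nat j} \<in> sets P" for j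
      by measurable
    then have [measurable]: "E j \<in> sets P" for j
      by (simp add: E_def)
    have "emeasure (distr P borel (\<lambda>\<omega>. ecount (\<pi> \<omega> \<inter> B))) A = emeasure P ((\<lambda>\<omega>. ecount (\<pi> \<omega> \<inter> B)) -` A \<inter> space P)"
      using that by (intro emeasure_distr) auto
    also have "(\<lambda>\<omega>. ecount (\<pi> \<omega> \<inter> B)) -` A \<inter> space P = (\<Union>j. E j)"
      using \<pi>(3)[OF _ B(3)] by (auto simp: E_def ecount_finite split: if_splits)
    also have "emeasure P \<dots> = (\<Sum>j. emeasure P (E j))"
      by (rule suminf_emeasure[symmetric]) (auto simp: disjoint_family_on_def E_def split: if_splits)
    also have "\<dots> = (\<Sum>j. if of_nat j \<in> A then ennreal (measure lborel B ^ j / fact j * exp (- measure lborel B)) else 0)"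
      using \<pi>(4)[OF B(1,2) emeasure_bounded_finite[OF B(3)]]
      by (intro suminf_cong) (auto simp: E_def emeasure_eq_measure)
    finally show ?thesis .
  qed
  show ?thesis
    by (rule measure_eqI) (use *[OF assms(1,2)] *[OF assms(3,4)] in auto)
qed

lemma poisson_expectation:
  assumes "prob_space P" "poisson_random_measure P \<pi>"
    and B: "B \<in> sets borel" "B \<subseteq> UNIV \<times> {0..}" "bounded B"
  shows "(\<integral>\<^sup>+ \<omega>. ecount (\<pi> \<omega> \<inter> B) \<partial>P) = emeasure lborel B"
proof -
  interpret prob_space P by fact
  note \<pi> = poisson_random_measureD[OF assms(2)]
  define m where "m = measure lborel B"
  have [measurable]: "(\<lambda>\<omega>. ecount (\<pi> \<omega> \<inter> B)) \<in> borel_measurable P"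
    by (rule measurable_ecount_compose[OF \<pi>(1) B(1)])
  have "ecount (\<pi> \<omega> \<inter> B) = (\<Sum>j. of_nat j * indicator {\<omega> \<in> space P. ecount (\<pi> \<omega> \<inter> B) = of_nat j} \<omega>)"
    if "\<omega> \<in> space P" for \<omega>
  proof -
    have card: "ecount (\<pi> \<omega> \<inter> B) = of_nat (card (\<pi> \<omega> \<inter> B))"
      by (rule ecount_finite[OF \<pi>(3)[OF that B(3)]])
    then have ind: "indicator {\<omega> \<in> space P. ecount (\<pi> \<omega> \<inter> B) = of_nat j} \<omega> =
        (if j = card (\<pi> \<omega> \<inter> B) then 1 else 0 :: ennreal)" for j
      using that by (auto simp: indicator_def)
    have "(\<Sum>j. of_nat j * (if j = card (\<pi> \<omega> \<inter> B) then 1 else 0)) =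
      (\<Sum>j\<in>{card (\<pi> \<omega> \<inter> B)}. of_nat j * (if j = card (\<pi> \<omega> \<inter> B) then 1 else 0 :: ennreal))"
      by (rule suminf_finite) simp_all
    then show ?thesis
      unfolding ind unfolding card by simp
  qed
  then have "(\<integral>\<^sup>+ \<omega>. ecount (\<pi> \<omega> \<inter> B) \<partial>P) =
    (\<integral>\<^sup>+ \<omega>. (\<Sum>j. of_nat j * indicator {\<omega> \<in> space P. ecount (\<pi> \<omega> \<inter> B) = of_nat j} \<omega>) \<partial>P)"
    by (rule nn_integral_cong)
  also have "\<dots> = (\<Sum>j. of_nat j * emeasure P {\<omega> \<in> space P. ecount (\<pi> \<omega> \<inter> B) = of_nat j})"
    by (subst nn_integral_suminf) (auto simp: nn_integral_cmult)
  also have "\<dots> = (\<Sum>j. ennreal (real j * (m ^ j / fact j * exp (- m))))"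
    using \<pi>(4)[OF B(1,2) emeasure_bounded_finite[OF B(3)]]
    by (intro suminf_cong)
       (simp add: emeasure_eq_measure m_def ennreal_of_nat_eq_real_of_nat flip: ennreal_mult')
  also have "\<dots> = ennreal m"
  proof (rule suminf_ennreal_eq)
    have "(\<lambda>j. m ^ j / fact j) sums exp m"
      using exp_converges[of m] by (simp add: field_simps)
    then have "(\<lambda>j. m * exp (- m) * (m ^ j / fact j)) sums (m * exp (- m) * exp m)"
      by (rule sums_mult)
    \<comment> \<open>The factor j cancels against the factorial after an index shift, which leaves
      m times the exponential series; the term j = 0 vanishes.\<close>
    then have "(\<lambda>j. real (Suc j) * (m ^ Suc j / fact (Suc j) * exp (- m))) sums m"
      by (simp add: field_simps exp_minus del: of_nat_Suc)
    then show "(\<lambda>j. real j * (m ^ j / fact j * exp (- m))) sums m"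
      by (subst (asm) sums_Suc_iff) simp
  qed (auto simp: m_def)
  finally show ?thesis
    using emeasure_bounded_finite[OF B(3)] by (simp add: m_def emeasure_eq_ennreal_measure)
qed

lemma borel_measurable_partial_sum:
  assumes "K \<subseteq> J"
  shows "(\<lambda>c. \<Sum>k. if k \<in> K then c k else 0) \<in> borel_measurable (Pi\<^sub>M (J :: nat set) (\<lambda>_. borel :: ennreal measure))"
proof (rule borel_measurable_suminf_order)
  fix k
  show "(\<lambda>c. if k \<in> K then c k else 0) \<in> borel_measurable (Pi\<^sub>M J (\<lambda>_. borel :: ennreal measure))"
    using assms measurable_component_singleton[of k J "\<lambda>_. borel :: ennreal measure"]
    by (cases "k \<in> K") (simp_all add: subset_eq)
qed

lemma cylinder_partial_sums_sets:
  assumes "\<And>i. i < (N::nat) \<Longrightarrow> K i \<subseteq> J" "\<And>i. i < N \<Longrightarrow> A i \<in> sets (borel :: ennreal measure)"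
  shows "{c \<in> space (Pi\<^sub>M (J :: nat set) (\<lambda>_. borel :: ennreal measure)).
     \<forall>i<N. (\<Sum>k. if k \<in> K i then c k else 0) \<in> A i} \<in> sets (Pi\<^sub>M J (\<lambda>_. borel))"
proof -
  have "{c \<in> space (Pi\<^sub>M (J :: nat set) (\<lambda>_. borel :: ennreal measure)).
     \<forall>i\<in>{..<N}. (\<Sum>k. if k \<in> K i then c k else 0) \<in> A i} \<in> sets (Pi\<^sub>M J (\<lambda>_. borel))"
  proof (rule sets.sets_Collect_finite_All)
    fix i
    assume "i \<in> {..<N}"
    then have "(\<lambda>c. \<Sum>k. if k \<in> K i then c k else 0) -` A i \<inter> space (Pi\<^sub>M (J :: nat set) (\<lambda>_. borel :: ennreal measure))
       \<in> sets (Pi\<^sub>M J (\<lambda>_. borel))"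
      using assms by (intro measurable_sets[OF borel_measurable_partial_sum]) auto
    then show "{c \<in> space (Pi\<^sub>M (J :: nat set) (\<lambda>_. borel :: ennreal measure)). (\<Sum>k. if k \<in> K i then c k else 0) \<in> A i}
      \<in> sets (Pi\<^sub>M J (\<lambda>_. borel))"
      by (simp add: vimage_def Int_def conj_commute)
  qed simp
  then show ?thesis
    by (simp only: Ball_def lessThan_iff)
qed

text \<open>A cylinder event is an event for the counts on disjoint bounded pieces. These counts are
  independent with laws fixed by the Lebesgue measures of the pieces, so both processes give the
  sequence of counts the same product law.\<close>

lemma poisson_law_unique:
  assumes P: "prob_space P" "poisson_random_measure P \<pi>" and P': "prob_space P'" "poisson_random_measure P' \<pi>'"
  shows "distr P config_space \<pi> = distr P' config_space \<pi>'"
proof (rule config_measure_eqI)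
  interpret P: prob_space P by fact
  have "emeasure (distr P config_space \<pi>) UNIV = emeasure P (\<pi> -` UNIV \<inter> space P)"
    using sets.top[of config_space] by (intro emeasure_distr[OF poisson_random_measureD(1)[OF P(2)]]) simp
  then show "emeasure (distr P config_space \<pi>) UNIV \<noteq> \<infinity>"
    using P.emeasure_finite by simp
  fix N :: nat and B :: "nat \<Rightarrow> (real \<times> real) set" and A :: "nat \<Rightarrow> ennreal set"
  assume AB: "\<And>i. i < N \<Longrightarrow> B i \<in> sets borel" "\<And>i. i < N \<Longrightarrow> A i \<in> sets borel"
  \<comment> \<open>The Poisson axioms speak of subsets of the half-plane only; the atoms all lie
    there, so intersecting with it changes no count.\<close>
  define B' where "B' i = B i \<inter> UNIV \<times> {0..}" for i
  have "UNIV \<times> {0..} \<in> sets (borel :: (real \<times> real) measure)"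
    by (intro borel_closed closed_Times) auto
  then have B': "B' i \<in> sets borel" if "i < N" for i
    using AB(1)[OF that] by (auto simp: B'_def)
  obtain D :: "nat \<Rightarrow> (real \<times> real) set" where "(\<forall>k. D k \<in> sets borel) \<and> disjoint_family D \<and> (\<forall>k. bounded (D k)) \<and>
    (\<forall>k. D k \<subseteq> (\<Union>i<N. B' i)) \<and> (\<forall>i<N. B' i = (\<Union>k\<in>{k. D k \<noteq> {} \<and> D k \<subseteq> B' i}. D k))"
    using bounded_partition[of N B', OF B'] ..
  then have D: "\<And>k. D k \<in> sets borel" "disjoint_family D" "\<And>k. bounded (D k)"
    "\<And>k. D k \<subseteq> (\<Union>i<N. B' i)" "\<And>i. i < N \<Longrightarrow> B' i = (\<Union>k\<in>{k. D k \<noteq> {} \<and> D k \<subseteq> B' i}. D k)"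
    by simp_all
  have D': "D k \<subseteq> UNIV \<times> {0..}" for k
    using D(4)[of k] by (auto simp: B'_def)
  define K where "K i = {k. D k \<noteq> {} \<and> D k \<subseteq> B' i}" for i
  define T where "T = {c \<in> space (Pi\<^sub>M (UNIV :: nat set) (\<lambda>_. borel :: ennreal measure)).
     \<forall>i<N. (\<Sum>k. if k \<in> K i then c k else 0) \<in> A i}"
  have T: "T \<in> sets (Pi\<^sub>M UNIV (\<lambda>_. borel))"
    unfolding T_def using AB by (intro cylinder_partial_sums_sets) auto
  have *: "emeasure (distr P config_space \<pi>) {S. \<forall>i<N. ecount (S \<inter> B i) \<in> A i} =
     emeasure (Pi\<^sub>M UNIV (\<lambda>k. distr P borel (\<lambda>\<omega>. ecount (\<pi> \<omega> \<inter> D k)))) T"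
    if "prob_space P" "poisson_random_measure P \<pi>" for P :: "'c measure" and \<pi>
  proof -
    interpret prob_space P by fact
    note \<pi> = poisson_random_measureD[OF that(2)]
    have m [measurable]: "(\<lambda>\<omega>. ecount (\<pi> \<omega> \<inter> D k)) \<in> borel_measurable P" for k
      by (rule measurable_ecount_compose[OF \<pi>(1) D(1)])
    have S: "{S. \<forall>i<N. ecount (S \<inter> B i) \<in> A i} \<in> sets config_space"
      unfolding sigma_config_cylinders using AB by (intro sigma_sets.Basic config_cylindersI)
    have eq: "ecount (\<pi> \<omega> \<inter> B i) = (\<Sum>k. if k \<in> K i then ecount (\<pi> \<omega> \<inter> D k) else 0)"
      if "\<omega> \<in> space P" "i < N" for \<omega> i
    proof -
      have "\<pi> \<omega> \<inter> B i = \<pi> \<omega> \<inter> B' i"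
        using \<pi>(2)[OF that(1)] by (auto simp: B'_def)
      then show ?thesis
        using ecount_partition[OF D(2) D(5)[OF that(2)], of "\<pi> \<omega>"] by (simp add: K_def)
    qed
    have "emeasure (distr P config_space \<pi>) {S. \<forall>i<N. ecount (S \<inter> B i) \<in> A i} =
      emeasure P (\<pi> -` {S. \<forall>i<N. ecount (S \<inter> B i) \<in> A i} \<inter> space P)"
      by (rule emeasure_distr[OF \<pi>(1) S])
    also have "\<pi> -` {S. \<forall>i<N. ecount (S \<inter> B i) \<in> A i} \<inter> space P =
      (\<lambda>\<omega>. \<lambda>k\<in>UNIV. ecount (\<pi> \<omega> \<inter> D k)) -` T \<inter> space P"
      by (auto simp: T_def space_PiM eq cong: if_cong)
    also have "emeasure P \<dots> = emeasure (distr P (Pi\<^sub>M UNIV (\<lambda>_. borel)) (\<lambda>\<omega>. \<lambda>k\<in>UNIV. ecount (\<pi> \<omega> \<inter> D k))) T"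
      using T by (intro emeasure_distr[symmetric]) auto
    also have "distr P (Pi\<^sub>M UNIV (\<lambda>_. borel)) (\<lambda>\<omega>. \<lambda>k\<in>UNIV. ecount (\<pi> \<omega> \<inter> D k)) =
      Pi\<^sub>M UNIV (\<lambda>k. distr P borel (\<lambda>\<omega>. ecount (\<pi> \<omega> \<inter> D k)))"
      using \<pi>(5)[OF D(1,2) D'] by (subst (asm) indep_vars_iff_distr_eq_PiM') auto
    finally show ?thesis .
  qed
  show "emeasure (distr P config_space \<pi>) {S. \<forall>i<N. ecount (S \<inter> B i) \<in> A i} =
    emeasure (distr P' config_space \<pi>') {S. \<forall>i<N. ecount (S \<inter> B i) \<in> A i}"
    unfolding *[OF P] *[OF P'] using poisson_count_distr_eq[OF P P' D(1) D' D(3)] by simp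
qed auto

text \<open>The axioms give independence of counts, whereas a whole configuration in
  \<open>C\<close> is involved here. With the event \<open>E\<close> on \<open>C'\<close> held
  fixed, the joint probability and the product are two finite measures in the event on
  \<open>C\<close>. They agree on cylinders, where everything reduces to counts on disjoint
  pieces.\<close>

lemma poisson_indep_disjoint:
  assumes P: "prob_space P" "poisson_random_measure P \<pi>"
    and C: "C \<in> sets borel" "C' \<in> sets borel" "C \<inter> C' = {}"
    and A: "A \<in> sets config_space" and A': "A' \<in> sets borel"
  shows "measure P {\<omega> \<in> space P. \<pi> \<omega> \<inter> C \<in> A \<and> ecount (\<pi> \<omega> \<inter> C') \<in> A'} =
    measure P {\<omega> \<in> space P. \<pi> \<omega> \<inter> C \<in> A} * measure P {\<omega> \<in> space P. ecount (\<pi> \<omega> \<inter> C') \<in> A'}"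
proof -
  interpret prob_space P by fact
  note \<pi> = poisson_random_measureD[OF P(2)]
  have mC: "(\<lambda>\<omega>. \<pi> \<omega> \<inter> C) \<in> measurable P config_space"
    by (rule measurable_config_Int[OF \<pi>(1) C(1)])
  define E where "E = {\<omega> \<in> space P. ecount (\<pi> \<omega> \<inter> C') \<in> A'}"
  have E [measurable]: "E \<in> sets P"
    unfolding E_def using measurable_ecount_compose[OF \<pi>(1) C(2)] A' by measurable
  define \<mu> where "\<mu> = distr (density P (indicator E)) config_space (\<lambda>\<omega>. \<pi> \<omega> \<inter> C)"
  define \<nu> where "\<nu> = scale_measure (emeasure P E) (distr P config_space (\<lambda>\<omega>. \<pi> \<omega> \<inter> C))"
  have \<mu>: "emeasure \<mu> X = emeasure P ({\<omega> \<in> space P. \<pi> \<omega> \<inter> C \<in> X} \<inter> E)" if "X \<in> sets config_space" for X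
  proof -
    have [measurable]: "{\<omega> \<in> space P. \<pi> \<omega> \<inter> C \<in> X} \<in> sets P"
      using measurable_sets[OF mC that] by (simp add: vimage_def Int_def conj_commute)
    have "emeasure \<mu> X = emeasure (density P (indicator E)) {\<omega> \<in> space P. \<pi> \<omega> \<inter> C \<in> X}"
      unfolding \<mu>_def using mC that by (subst emeasure_distr) (auto intro!: arg_cong2[where f=emeasure])
    also have "\<dots> = emeasure P ({\<omega> \<in> space P. \<pi> \<omega> \<inter> C \<in> X} \<inter> E)"
      by (subst emeasure_density) (auto simp: nn_integral_indicator[symmetric] indicator_inter_arith mult.commute
          simp del: nn_integral_indicator intro!: nn_integral_cong)
    finally show ?thesis .
  qed
  have \<nu>: "emeasure \<nu> X = emeasure P E * emeasure P {\<omega> \<in> space P. \<pi> \<omega> \<inter> C \<in> X}" if "X \<in> sets config_space" for X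
    unfolding \<nu>_def using mC that
    by (simp add: emeasure_distr vimage_def Int_def conj_commute)
  have "\<mu> = \<nu>"
  proof (rule config_measure_eqI)
    have "UNIV \<in> sets (config_space :: (real \<times> real) set measure)"
      by (metis sets.top space_config_space)
    then show "emeasure \<mu> UNIV \<noteq> \<infinity>"
      using \<mu>[of UNIV] emeasure_finite by simp
    fix N :: nat and B :: "nat \<Rightarrow> (real \<times> real) set" and A :: "nat \<Rightarrow> ennreal set"
    assume AB: "\<And>i. i < N \<Longrightarrow> B i \<in> sets borel" "\<And>i. i < N \<Longrightarrow> A i \<in> sets borel"
    have S: "{S. \<forall>i<N. ecount (S \<inter> B i) \<in> A i} \<in> sets config_space"
      unfolding sigma_config_cylinders using AB by (intro sigma_sets.Basic config_cylindersI)
    have H: "UNIV \<times> {0..} \<in> sets (borel :: (real \<times> real) measure)"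
      by (intro borel_closed closed_Times) auto
    \<comment> \<open>Index \<open>N\<close> is reserved for \<open>C'\<close>, so that one
      partition serves both regions.\<close>
    define B' where "B' i = (if i < N then B i \<inter> C else C') \<inter> UNIV \<times> {0..}" for i
    have B': "B' i \<in> sets borel" if "i < Suc N" for i
      using AB(1)[of i] C H by (auto simp: B'_def)
    obtain D :: "nat \<Rightarrow> (real \<times> real) set" where "(\<forall>k. D k \<in> sets borel) \<and> disjoint_family D \<and> (\<forall>k. bounded (D k)) \<and>
      (\<forall>k. D k \<subseteq> (\<Union>i<Suc N. B' i)) \<and> (\<forall>i<Suc N. B' i = (\<Union>k\<in>{k. D k \<noteq> {} \<and> D k \<subseteq> B' i}. D k))"
      using bounded_partition[of "Suc N" B', OF B'] ..
    then have D: "\<And>k. D k \<in> sets borel" "disjoint_family D" "\<And>k. bounded (D k)"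
      "\<And>k. D k \<subseteq> (\<Union>i<Suc N. B' i)" "\<And>i. i < Suc N \<Longrightarrow> B' i = (\<Union>k\<in>{k. D k \<noteq> {} \<and> D k \<subseteq> B' i}. D k)"
      by simp_all
    have D': "D k \<subseteq> UNIV \<times> {0..}" for k
      using D(4)[of k] by (auto simp: B'_def)
    define K where "K i = {k. D k \<noteq> {} \<and> D k \<subseteq> B' i}" for i
    \<comment> \<open>Excluding empty pieces matters here: an empty piece would lie in both regions,
      whereas a nonempty one cannot.\<close>
    have K: "K i \<subseteq> - K N" if "i < N" for i
      using that C(3) by (auto simp: K_def B'_def)
    define X where "X = (\<lambda>\<omega> k. ecount (\<pi> \<omega> \<inter> D k))"
    have cnt: "ecount (\<pi> \<omega> \<inter> B' i) = (\<Sum>k. if k \<in> K i then X \<omega> k else 0)" if "i < Suc N" for \<omega> i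
      using ecount_partition[OF D(2) D(5)[OF that], of "\<pi> \<omega>"] by (simp add: K_def X_def cong: if_cong)
    have cnt1: "ecount (\<pi> \<omega> \<inter> C \<inter> B i) = (\<Sum>k. if k \<in> K i then X \<omega> k else 0)" if "\<omega> \<in> space P" "i < N" for \<omega> i
    proof -
      have "\<pi> \<omega> \<inter> C \<inter> B i = \<pi> \<omega> \<inter> B' i"
        using \<pi>(2)[OF that(1)] that(2) by (auto simp: B'_def)
      then show ?thesis
        using cnt that by simp
    qed
    have cnt2: "ecount (\<pi> \<omega> \<inter> C') = (\<Sum>k. if k \<in> K N then X \<omega> k else 0)" if "\<omega> \<in> space P" for \<omega>
    proof -
      have "\<pi> \<omega> \<inter> C' = \<pi> \<omega> \<inter> B' N"
        using \<pi>(2)[OF that(1)] by (auto simp: B'_def)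
      then show ?thesis
        using cnt by simp
    qed
    have restr: "(\<Sum>k. if k \<in> K i then restrict (X \<omega>) J k else 0) = (\<Sum>k. if k \<in> K i then X \<omega> k else 0)"
      if "K i \<subseteq> J" for i J \<omega>
      using that by (intro suminf_cong) auto
    have "indep_vars (\<lambda>_. borel) (\<lambda>k \<omega>. X \<omega> k) UNIV"
      unfolding X_def by (rule \<pi>(5)[OF D(1,2) D'])
    then have ind: "indep_var (Pi\<^sub>M (- K N) (\<lambda>_. borel)) (\<lambda>\<omega>. restrict (X \<omega>) (- K N))
        (Pi\<^sub>M (K N) (\<lambda>_. borel)) (\<lambda>\<omega>. restrict (X \<omega>) (K N))"
      by (rule indep_var_restrict) auto
    define T where "T = {c \<in> space (Pi\<^sub>M (- K N) (\<lambda>_. borel :: ennreal measure)).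
       \<forall>i<N. (\<Sum>k. if k \<in> K i then c k else 0) \<in> A i}"
    define T' where "T' = {c \<in> space (Pi\<^sub>M (K N) (\<lambda>_. borel :: ennreal measure)).
       \<forall>i<1::nat. (\<Sum>k. if k \<in> K N then c k else 0) \<in> A'}"
    have T: "T \<in> sets (Pi\<^sub>M (- K N) (\<lambda>_. borel))"
      unfolding T_def using AB K by (intro cylinder_partial_sums_sets) auto
    have T': "T' \<in> sets (Pi\<^sub>M (K N) (\<lambda>_. borel))"
      unfolding T'_def using A' by (intro cylinder_partial_sums_sets) auto
    have e1: "{\<omega> \<in> space P. \<pi> \<omega> \<inter> C \<in> {S. \<forall>i<N. ecount (S \<inter> B i) \<in> A i}} = (\<lambda>\<omega>. restrict (X \<omega>) (- K N)) -` T \<inter> space P"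
      using K by (auto simp: T_def space_PiM cnt1 restr)
    have e2: "E = (\<lambda>\<omega>. restrict (X \<omega>) (K N)) -` T' \<inter> space P"
      by (auto simp: E_def T'_def space_PiM cnt2 restr)
    have "prob ({\<omega> \<in> space P. \<pi> \<omega> \<inter> C \<in> {S. \<forall>i<N. ecount (S \<inter> B i) \<in> A i}} \<inter> E) =
      prob {\<omega> \<in> space P. \<pi> \<omega> \<inter> C \<in> {S. \<forall>i<N. ecount (S \<inter> B i) \<in> A i}} * prob E"
      using indep_varD[OF ind T T'] unfolding e1 e2
      by (auto simp: vimage_def Int_def conj_ac intro!: arg_cong[where f=prob])
    then show "emeasure \<mu> {S. \<forall>i<N. ecount (S \<inter> B i) \<in> A i} = emeasure \<nu> {S. \<forall>i<N. ecount (S \<inter> B i) \<in> A i}"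
      unfolding \<mu>[OF S] \<nu>[OF S] emeasure_eq_measure by (simp add: ennreal_mult mult.commute)
  qed (auto simp: \<mu>_def \<nu>_def)
  then have "emeasure \<mu> A = emeasure \<nu> A"
    by simp
  then have "prob ({\<omega> \<in> space P. \<pi> \<omega> \<inter> C \<in> A} \<inter> E) = prob {\<omega> \<in> space P. \<pi> \<omega> \<inter> C \<in> A} * prob E"
    unfolding \<mu>[OF A] \<nu>[OF A] emeasure_eq_measure
    by (simp add: ennreal_mult[symmetric] mult.commute)
  moreover have "{\<omega> \<in> space P. \<pi> \<omega> \<inter> C \<in> A} \<inter> E = {\<omega> \<in> space P. \<pi> \<omega> \<inter> C \<in> A \<and> ecount (\<pi> \<omega> \<inter> C') \<in> A'}"
    by (auto simp: E_def)
  ultimately show ?thesis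
    by (simp add: E_def)
qed

section \<open>Translations of configurations\<close>

lemma ecount_translate:
  fixes c :: "'a::real_normed_vector"
  shows "ecount ((\<lambda>z. z - c) ` S \<inter> B) = ecount (S \<inter> (\<lambda>z. z - c) -` B)"
proof -
  have "(\<lambda>z. z - c) ` S \<inter> B = (\<lambda>z. z - c) ` (S \<inter> (\<lambda>z. z - c) -` B)"
    by auto
  then show ?thesis
    by (simp add: ecount_image inj_on_def)
qed

lemma borel_translate_vimage:
  fixes c :: "'a::{second_countable_topology, real_normed_vector}"
  assumes "B \<in> sets borel"
  shows "(\<lambda>z. z - c) -` B \<in> sets borel"
  using measurable_sets[of "\<lambda>z. z - c" borel borel B] assms by simp

lemma measurable_translate_config:
  fixes c :: "'a::{second_countable_topology, real_normed_vector}"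
  assumes "f \<in> measurable M config_space"
  shows "(\<lambda>\<omega>. (\<lambda>z. z - c) ` f \<omega>) \<in> measurable M config_space"
  by (rule measurable_config_spaceI)
     (use assms in \<open>auto simp: ecount_translate intro!: measurable_ecount_compose borel_translate_vimage\<close>)

text \<open>A translation along the time axis preserves Lebesgue measure, boundedness and the
  half-plane, so each axiom for a set is the same axiom for its translate.\<close>

lemma poisson_random_measure_translate:
  assumes \<pi>: "poisson_random_measure P \<pi>"
  shows "poisson_random_measure P (\<lambda>\<omega>. (\<lambda>z. z - (a, 0)) ` \<pi> \<omega>)"
proof -
  note D = poisson_random_measureD[OF \<pi>]
  let ?V = "\<lambda>B. (\<lambda>z. z - (a, 0)) -` B :: (real \<times> real) set"
  have sub: "?V B \<subseteq> UNIV \<times> {0..}" if "B \<subseteq> UNIV \<times> {0..}" for B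
    using that by (auto simp: subset_eq)
  have em: "emeasure lborel (?V B) = emeasure lborel B" if "B \<in> sets borel" for B
  proof -
    have "emeasure lborel B = emeasure (distr lborel borel ((+) (- (a, 0)))) B"
      by (simp add: lborel_distr_plus)
    also have "\<dots> = emeasure lborel (?V B)"
      using that by (subst emeasure_distr) (auto intro!: arg_cong2[where f=emeasure] simp: vimage_def)
    finally show ?thesis ..
  qed
  have me: "measure lborel (?V B) = measure lborel B" if "B \<in> sets borel" for B
    using em[OF that] by (simp add: measure_def)
  have fin: "finite ((\<lambda>z. z - (a, 0)) ` \<pi> \<omega> \<inter> B)" if "\<omega> \<in> space P" "bounded B" for \<omega> B
  proof -
    have "?V B = (\<lambda>z. z + (a, 0)) ` B"
      by (force simp: image_iff)
    then have "bounded (?V B)"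
      using bounded_translation[OF that(2), of "(a, 0)"] by (simp add: add.commute)
    moreover have "(\<lambda>z. z - (a, 0)) ` \<pi> \<omega> \<inter> B = (\<lambda>z. z - (a, 0)) ` (\<pi> \<omega> \<inter> ?V B)"
      by auto
    ultimately show ?thesis
      using D(3)[OF that(1)] by simp
  qed
  show ?thesis
    unfolding poisson_random_measure_def ecount_translate
  proof (intro conjI ballI allI impI)
    show "(\<lambda>\<omega>. (\<lambda>z. z - (a, 0)) ` \<pi> \<omega>) \<in> measurable P config_space"
      by (rule measurable_translate_config[OF D(1)])
    show "(\<lambda>z. z - (a, 0)) ` \<pi> \<omega> \<subseteq> UNIV \<times> {0..}" if "\<omega> \<in> space P" for \<omega>
      using D(2)[OF that] by (auto simp: subset_eq)
    show "finite ((\<lambda>z. z - (a, 0)) ` \<pi> \<omega> \<inter> B)" if "\<omega> \<in> space P" "bounded B" for \<omega> B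
      by (rule fin[OF that])
    show "measure P {\<omega> \<in> space P. ecount (\<pi> \<omega> \<inter> ?V B) = of_nat j} =
        measure lborel B ^ j / fact j * exp (- measure lborel B)"
      if "B \<in> sets borel" "B \<subseteq> UNIV \<times> {0..}" "emeasure lborel B < \<infinity>" for B j
      using D(4)[OF borel_translate_vimage[OF that(1)] sub[OF that(2)]] em[OF that(1)] me[OF that(1)] that(3)
      by simp
    show "prob_space.indep_vars P (\<lambda>_. borel) (\<lambda>i \<omega>. ecount (\<pi> \<omega> \<inter> ?V (B i))) UNIV"
      if "range B \<subseteq> sets borel" "disjoint_family B" "\<forall>i. B i \<subseteq> UNIV \<times> {0..}" for B :: "nat \<Rightarrow> (real \<times> real) set"
    proof (rule D(5))
      show "?V (B i) \<in> sets borel" for i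
        using that(1) by (auto intro!: borel_translate_vimage)
      show "?V (B i) \<subseteq> UNIV \<times> {0..}" for i
        using that(3) by (intro sub) blast
      show "disjoint_family (\<lambda>i. ?V (B i))"
        using that(2) unfolding disjoint_family_on_def by blast
    qed
  qed
qed

subsection \<open>Filtration, predictable sets and the drive\<close>

lemma measurable_coarser:
  "f \<in> measurable M N \<Longrightarrow> sets M \<subseteq> sets M' \<Longrightarrow> space M = space M' \<Longrightarrow> f \<in> measurable M' N"
  by (auto simp: measurable_def)

lemma borel_measurable_countable_nn_integral:
  fixes f :: "'a \<Rightarrow> 'w \<Rightarrow> ennreal"
  assumes "countable A" "\<And>k. k \<in> A \<Longrightarrow> f k \<in> borel_measurable M"
  shows "(\<lambda>\<omega>. \<integral>\<^sup>+ k. f k \<omega> \<partial>count_space A) \<in> borel_measurable M"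
proof -
  interpret sigma_finite_measure "count_space A"
    by (rule sigma_finite_measure_count_space_countable[OF assms(1)])
  have "(\<lambda>z. f (fst z) (snd z)) \<in> borel_measurable (count_space A \<Otimes>\<^sub>M M)"
    by (rule measurable_pair_measure_countable1) (simp_all add: assms)
  from measurable_compose[OF measurable_pair_swap' this] show ?thesis
    by (intro borel_measurable_nn_integral) (simp add: case_prod_beta')
qed

lemma borel_measurable_countable_infsum:
  fixes f :: "'a \<Rightarrow> 'w \<Rightarrow> real"
  assumes "countable A" and [measurable]: "\<And>k. k \<in> A \<Longrightarrow> f k \<in> borel_measurable M"
  shows "(\<lambda>\<omega>. infsum (\<lambda>k. f k \<omega>) A) \<in> borel_measurable M"
proof -
  have [measurable]: "(\<lambda>\<omega>. \<integral>\<^sup>+ k. ennreal \<bar>f k \<omega>\<bar> \<partial>count_space A) \<in> borel_measurable M"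
    "(\<lambda>\<omega>. \<integral>\<^sup>+ k. ennreal (f k \<omega>) \<partial>count_space A) \<in> borel_measurable M"
    "(\<lambda>\<omega>. \<integral>\<^sup>+ k. ennreal (- f k \<omega>) \<partial>count_space A) \<in> borel_measurable M"
    by (intro borel_measurable_countable_nn_integral[OF assms(1)]; measurable)+
  show ?thesis
    unfolding infsum_eq_enn2real by measurable
qed

lemma infsum_Int_indicator:
  fixes f :: "'a \<Rightarrow> real"
  shows "infsum f (A \<inter> D) = infsum (\<lambda>k. if k \<in> D then f k else 0) A"
  by (rule infsum_cong_neutral) auto

lemma countable_grid: "countable (grid n \<phi> p)"
proof -
  have "grid n \<phi> p = range (\<lambda>j :: int. of_int j / real (n p) + \<phi> p)"
    by (auto simp: grid_def)
  then show ?thesis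
    by simp
qed

lemma grid_add_int: 
  assumes "valid_grids n \<phi>"
  shows "k + of_int i \<in> grid n \<phi> p \<longleftrightarrow> k \<in> grid n \<phi> p"
proof -
  have "1 \<le> n p"
    using assms by (simp add: valid_grids_def)
  then have n: "real (n p) \<noteq> 0"
    by simp
  have *: "k + of_int i \<in> grid n \<phi> p" if "k \<in> grid n \<phi> p" for k i
  proof -
    from that obtain j :: int where "k = of_int j / real (n p) + \<phi> p"
      by (auto simp: grid_def)
    then have "k + of_int i = of_int (j + i * int (n p)) / real (n p) + \<phi> p"
      using n by (simp add: field_simps)
    then show ?thesis
      unfolding grid_def by blast
  qed
  show ?thesis
    using *[of k i] *[of "k + of_int i" "- i"] by auto
qed

text \<open>A count is the supremum of the counts of finite subsets, also when it is infinite. A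
  finite set of atoms before t lies before some earlier time, which is the form of left continuity
  needed for predictability.\<close>

lemma ecount_ge_finite_subset:
  assumes "y < ecount X"
  obtains Y where "finite Y" "Y \<subseteq> X" "y < ecount Y"
proof (cases "finite X")
  case True
  then show ?thesis
    using assms that by blast
next
  case False
  have "y < \<infinity>"
    using assms by (rule less_le_trans) simp
  then obtain k :: nat where k: "y < of_nat k"
    by (metis ennreal_Ex_less_of_nat infinity_ennreal_def)
  obtain Y where "Y \<subseteq> X" "finite Y" "card Y = k"
    using infinite_arbitrarily_large[OF False] by blast
  then show ?thesis
    using that[of Y] k by (simp add: ecount_finite)
qed

lemma ecount_mono: "X \<subseteq> Y \<Longrightarrow> ecount X \<le> ecount Y"
  unfolding ecount_def by (intro emeasure_mono) auto

text \<open>Only measurability and path properties of the noise are recorded, and \<open>P\<close>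
  is any measure. This allows a second interpretation on a space of noise paths, where the results
  say that the solution is a measurable functional of the noise.\<close>

locale driven_paths =
  fixes P :: "'w measure"
    and n :: "'p::finite \<Rightarrow> nat"
    and \<phi> :: "'p \<Rightarrow> real"
    and \<pi> :: "'m::finite \<Rightarrow> 'w \<Rightarrow> (real \<times> real) set"
    and \<xi> :: "'p \<Rightarrow> real \<Rightarrow> 'w \<Rightarrow> real"
    and \<MM> :: "('m, 'p) har_params"
  assumes grids: "valid_grids n \<phi>"
    and params: "valid_params \<MM>"
    and \<pi>_measurable: "\<And>m. \<pi> m \<in> measurable P config_space"
    and \<pi>_half: "\<And>m \<omega>. \<omega> \<in> space P \<Longrightarrow> \<pi> m \<omega> \<subseteq> UNIV \<times> {0..}"
    and \<pi>_finite: "\<And>m \<omega> B. \<omega> \<in> space P \<Longrightarrow> bounded B \<Longrightarrow> finite (\<pi> m \<omega> \<inter> B)"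
    and \<pi>_distinct: "\<And>m m' \<omega> z z'. \<omega> \<in> space P \<Longrightarrow> z \<in> \<pi> m \<omega> \<Longrightarrow> z' \<in> \<pi> m' \<omega> \<Longrightarrow> fst z = fst z' \<Longrightarrow> m = m' \<and> z = z'"
    and \<xi>_measurable: "\<And>p k. k \<in> grid n \<phi> p \<Longrightarrow> \<xi> p k \<in> borel_measurable P"
begin

abbreviation "F \<equiv> noise_filtration P n \<phi> \<pi> \<xi>"

abbreviation "Pred \<equiv> predictable_algebra (space P) F"

definition past :: "real \<Rightarrow> (real \<times> real) set" where
  "past t = {..t} \<times> {0..}"

lemma past_borel: "past t \<in> sets borel"
  unfolding past_def by (intro borel_closed closed_Times) auto

section \<open>The filtration and the predictable \<sigma>-algebra\<close>

lemma space_F [simp]: "space (F t) = space P"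
  by (simp add: noise_filtration_def space_measure_of_conv)

lemma sets_F: "sets (F t) = sigma_sets (space P)
     ({(\<lambda>\<omega>. \<pi> m \<omega> \<inter> past t) -` A \<inter> space P | m A. A \<in> sets config_space} \<union>
      {\<xi> p k -` A \<inter> space P | p k A. k \<in> grid n \<phi> p \<and> k \<le> t \<and> A \<in> sets borel})"
  unfolding noise_filtration_def past_def by (rule sets_measure_of) auto

lemma measurable_F_\<pi>: "(\<lambda>\<omega>. \<pi> m \<omega> \<inter> past t) \<in> measurable (F t) config_space"
proof (rule measurableI)
  fix A :: "(real \<times> real) set set"
  assume "A \<in> sets config_space"
  then show "(\<lambda>\<omega>. \<pi> m \<omega> \<inter> past t) -` A \<inter> space (F t) \<in> sets (F t)"
    unfolding sets_F space_F by (intro sigma_sets.Basic) blast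
qed simp

lemma measurable_F_\<xi>:
  assumes "k \<in> grid n \<phi> p" "k \<le> t"
  shows "\<xi> p k \<in> borel_measurable (F t)"
proof (rule measurableI)
  fix A :: "real set"
  assume "A \<in> sets borel"
  then show "\<xi> p k -` A \<inter> space (F t) \<in> sets (F t)"
    unfolding sets_F space_F using assms by (intro sigma_sets.Basic) blast
qed simp

lemma sets_F_subsetI:
  assumes "space N = space P" "\<And>m. (\<lambda>\<omega>. \<pi> m \<omega> \<inter> past t) \<in> measurable N config_space"
    and "\<And>p k. k \<in> grid n \<phi> p \<Longrightarrow> k \<le> t \<Longrightarrow> \<xi> p k \<in> borel_measurable N"
  shows "sets (F t) \<subseteq> sets N"
proof -
  have "sigma_sets (space N)
     ({(\<lambda>\<omega>. \<pi> m \<omega> \<inter> past t) -` A \<inter> space P | m A. A \<in> sets config_space} \<union>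
      {\<xi> p k -` A \<inter> space P | p k A. k \<in> grid n \<phi> p \<and> k \<le> t \<and> A \<in> sets borel}) \<subseteq> sets N"
  proof (rule sets.sigma_sets_subset, safe)
    show "(\<lambda>\<omega>. \<pi> m \<omega> \<inter> past t) -` A \<inter> space P \<in> sets N" if "A \<in> sets config_space" for m A
      using measurable_sets[OF assms(2) that] by (simp add: assms(1))
    show "\<xi> p k -` A \<inter> space P \<in> sets N" if "A \<in> sets borel" "k \<in> grid n \<phi> p" "k \<le> t" for p k A
      using measurable_sets[OF assms(3)[OF that(2,3)] that(1)] by (simp add: assms(1))
  qed
  then show ?thesis
    unfolding sets_F by (simp add: assms(1))
qed

lemma F_le_P: "sets (F t) \<subseteq> sets P"
  by (intro sets_F_subsetI measurable_config_Int \<pi>_measurable past_borel \<xi>_measurable) auto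

lemma F_mono: "s \<le> t \<Longrightarrow> sets (F s) \<subseteq> sets (F t)"
proof (intro sets_F_subsetI)
  fix m
  assume "s \<le> t"
  then have "\<pi> m \<omega> \<inter> past s = \<pi> m \<omega> \<inter> past t \<inter> past s" for \<omega>
    by (auto simp: past_def)
  then show "(\<lambda>\<omega>. \<pi> m \<omega> \<inter> past s) \<in> measurable (F t) config_space"
    using measurable_config_Int[OF measurable_F_\<pi> past_borel] by simp
qed (auto intro: measurable_F_\<xi>)

lemma measurable_F_P: "f \<in> measurable (F s) N \<Longrightarrow> f \<in> measurable P N"
  by (erule measurable_coarser) (simp_all add: F_le_P)

lemma space_Pred [simp]: "space Pred = space P \<times> UNIV"
  by (simp add: predictable_algebra_def space_measure_of_conv)

lemma sets_Pred: "sets Pred = sigma_sets (space P \<times> UNIV) {A \<times> {s<..t} | A s t. s < t \<and> A \<in> sets (F s)}"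
  unfolding predictable_algebra_def
  by (rule sets_measure_of) (use sets.sets_into_space in fastforce)

lemma Pred_rect:
  assumes "A \<in> sets (F s)"
  shows "A \<times> {s<..t} \<in> sets Pred"
proof (cases "s < t")
  case True
  then show ?thesis
    unfolding sets_Pred using assms by (intro sigma_sets.Basic) blast
next
  case False
  then show ?thesis
    by simp
qed

lemma Pred_ray:
  assumes "A \<in> sets (F s)"
  shows "A \<times> {s<..} \<in> sets Pred"
proof -
  have "A \<times> {s<..} = (\<Union>i::nat. A \<times> {s<..s + real i})"
    by (auto, metis add.commute diff_le_eq real_arch_simple)
  then show ?thesis
    using Pred_rect[OF assms] by auto
qed

lemma Pred_le: "sets Pred \<subseteq> sets (P \<Otimes>\<^sub>M borel)"
proof -
  have "sigma_sets (space (P \<Otimes>\<^sub>M borel)) {A \<times> {s<..t} | A s t :: real. s < t \<and> A \<in> sets (F s)} \<subseteq> sets (P \<Otimes>\<^sub>M borel)"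
    by (rule sets.sigma_sets_subset) (use F_le_P in \<open>auto intro!: pair_measureI\<close>)
  then show ?thesis
    unfolding sets_Pred by (simp add: space_pair_measure)
qed

lemma measurable_Pred_P: "f \<in> measurable Pred N \<Longrightarrow> f \<in> measurable (P \<Otimes>\<^sub>M borel) N"
  by (erule measurable_coarser) (auto simp: Pred_le space_pair_measure)

lemma measurable_Pred_snd [measurable]: "snd \<in> borel_measurable Pred"
  unfolding borel_measurable_iff_greater
proof
  fix a :: real
  have "{z \<in> space Pred. a < snd z} = space P \<times> {a<..}"
    by auto
  also have "\<dots> \<in> sets Pred"
    using Pred_ray[of "space P" a] sets.top[of "F a"] by simp
  finally show "{z \<in> space Pred. a < snd z} \<in> sets Pred" .
qed

text \<open>What is known at time s may be used strictly afterwards. The strict inequality matches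
  the left-open time intervals of the predictable rectangles.\<close>

lemma measurable_Pred_after:
  fixes X :: "'w \<Rightarrow> 'b::{second_countable_topology, zero}"
  assumes X: "X \<in> borel_measurable (F s)"
  shows "(\<lambda>z. if s < snd z then X (fst z) else 0) \<in> borel_measurable Pred"
proof (rule measurableI)
  fix A :: "'b set"
  assume A: "A \<in> sets borel"
  have "X -` A \<inter> space P \<in> sets (F s)"
    using measurable_sets[OF X A] by simp
  from Pred_ray[OF this] have 1: "(X -` A \<inter> space P) \<times> {s<..} \<in> sets Pred" .
  have 2: "{z \<in> space Pred. \<not> s < snd z} \<in> sets Pred"
    by measurable
  have "(\<lambda>z. if s < snd z then X (fst z) else 0) -` A \<inter> space Pred =
    (X -` A \<inter> space P) \<times> {s<..} \<union> (if 0 \<in> A then {z \<in> space Pred. \<not> s < snd z} else {})"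
    by (auto split: if_splits)
  then show "(\<lambda>z. if s < snd z then X (fst z) else 0) -` A \<inter> space Pred \<in> sets Pred"
    using 1 2 by auto
qed simp

definition strict_past :: "real \<Rightarrow> (real \<times> real) set" where
  "strict_past t = {..<t} \<times> {0..}"

text \<open>The configuration strictly before t is left continuous: its count on a Borel set is the
  supremum, over rational q < t, of counts known at time q, and each of these is predictable by
  \<open>measurable_Pred_after\<close>.\<close>

lemma measurable_Pred_config: "(\<lambda>z. \<pi> m (fst z) \<inter> strict_past (snd z)) \<in> measurable Pred config_space"
proof (rule measurable_config_spaceI)
  fix B :: "(real \<times> real) set"
  assume B: "B \<in> sets borel"
  have "ecount (\<pi> m (fst z) \<inter> strict_past (snd z) \<inter> B) =
     (SUP q\<in>\<rat>. if q < snd z then ecount (\<pi> m (fst z) \<inter> past q \<inter> B) else 0)" (is "?l = ?r") for z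
  proof (rule antisym)
    show "?l \<le> ?r"
    proof (rule dense_le)
      fix y
      assume "y < ?l"
      then obtain Y where Y: "finite Y" "Y \<subseteq> \<pi> m (fst z) \<inter> strict_past (snd z) \<inter> B" "y < ecount Y"
        by (rule ecount_ge_finite_subset)
      \<comment> \<open>The point \<open>snd z - 1\<close> keeps the maximum well defined and below
        \<open>snd z\<close> also when \<open>Y\<close> is empty.\<close>
      define s where "s = Max (insert (snd z - 1) (fst ` Y))"
      have "s \<in> insert (snd z - 1) (fst ` Y)"
        unfolding s_def using Y(1) by (intro Max_in) auto
      then have "s < snd z"
        using Y(2) by (auto simp: strict_past_def)
      then obtain q where q: "q \<in> \<rat>" "s < q" "q < snd z"
        using Rats_dense_in_real by blast
      have "Y \<subseteq> \<pi> m (fst z) \<inter> past q \<inter> B"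
      proof
        fix u
        assume u: "u \<in> Y"
        have "fst u \<le> s"
          unfolding s_def using Y(1) u by (intro Max_ge) auto
        then have "fst u \<le> q"
          using q(2) by simp
        then show "u \<in> \<pi> m (fst z) \<inter> past q \<inter> B"
          using Y(2) u by (auto simp: strict_past_def past_def)
      qed
      then have "ecount Y \<le> ecount (\<pi> m (fst z) \<inter> past q \<inter> B)"
        by (rule ecount_mono)
      also have "\<dots> \<le> ?r"
        using q by (intro SUP_upper2[of q]) auto
      finally show "y \<le> ?r"
        using Y(3) by simp
    qed
    show "?r \<le> ?l"
    proof (rule SUP_least)
      fix q
      show "(if q < snd z then ecount (\<pi> m (fst z) \<inter> past q \<inter> B) else 0) \<le> ?l"
        by (auto intro!: ecount_mono simp: past_def strict_past_def)
    qed
  qed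
  moreover have "(\<lambda>z. SUP q\<in>\<rat>. if q < snd z then ecount (\<pi> m (fst z) \<inter> past q \<inter> B) else 0) \<in> borel_measurable Pred"
    by (intro borel_measurable_SUP countable_rat measurable_Pred_after measurable_ecount_compose[OF measurable_F_\<pi> B])
  ultimately show "(\<lambda>z. ecount (\<pi> m (fst z) \<inter> strict_past (snd z) \<inter> B)) \<in> borel_measurable Pred"
    by simp
qed

text \<open>A predictable set read at an earlier time r < t is measurable jointly in (\<omega>, t)
  and r, with only predictable information in (\<omega>, t). On a rectangle A \<times> (s, u] the
  condition t > r > s puts (\<omega>, t) into the predictable set A \<times> (s,
  \<infinity>).\<close>

lemma Pred_past_sets:
  assumes "E \<in> sets Pred"
  shows "{w \<in> space (Pred \<Otimes>\<^sub>M borel). snd w < snd (fst w) \<and> (fst (fst w), snd w) \<in> E} \<in> sets (Pred \<Otimes>\<^sub>M borel)"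
    (is "?S E \<in> _")
proof -
  have lt: "{w \<in> space (Pred \<Otimes>\<^sub>M borel). snd w < snd (fst w)} \<in> sets (Pred \<Otimes>\<^sub>M borel)"
    by measurable
  from assms have "E \<in> sigma_sets (space P \<times> UNIV) {A \<times> {s<..t} | A s t. s < t \<and> A \<in> sets (F s)}"
    by (simp add: sets_Pred)
  then show ?thesis
  proof induction
    case (Basic E)
    then obtain A s t where E: "E = A \<times> {s<..t}" "A \<in> sets (F s)"
      by blast
    have "?S E = (A \<times> {s<..}) \<times> {s<..t} \<inter> {w \<in> space (Pred \<Otimes>\<^sub>M borel). snd w < snd (fst w)}"
      using sets.sets_into_space[OF E(2)] by (auto simp: E(1) space_pair_measure)
    then show ?case
      using lt Pred_ray[OF E(2)] by auto
  next
    case Empty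
    then show ?case by simp
  next
    case (Compl E)
    have "?S (space P \<times> UNIV - E) = {w \<in> space (Pred \<Otimes>\<^sub>M borel). snd w < snd (fst w)} - ?S E"
      by (auto simp: space_pair_measure)
    then show ?case
      using lt Compl by auto
  next
    case (Union E)
    have "?S (\<Union>i. E i) = (\<Union>i. ?S (E i))"
      by auto
    then show ?case
      using Union by auto
  qed
qed

lemma measurable_Pred_past:
  fixes f :: "'w \<times> real \<Rightarrow> 'b::{second_countable_topology, zero}"
  assumes f: "f \<in> borel_measurable Pred"
  shows "(\<lambda>w. if snd w < snd (fst w) then f (fst (fst w), snd w) else 0) \<in> borel_measurable (Pred \<Otimes>\<^sub>M borel)"
proof (rule measurableI)
  fix A :: "'b set"
  assume A: "A \<in> sets borel"
  have 1: "{w \<in> space (Pred \<Otimes>\<^sub>M borel). snd w < snd (fst w) \<and> (fst (fst w), snd w) \<in> f -` A \<inter> space Pred} \<in> sets (Pred \<Otimes>\<^sub>M borel)"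
    by (rule Pred_past_sets[OF measurable_sets[OF f A]])
  have 2: "{w \<in> space (Pred \<Otimes>\<^sub>M borel). \<not> snd w < snd (fst w)} \<in> sets (Pred \<Otimes>\<^sub>M borel)"
    by measurable
  have "(\<lambda>w. if snd w < snd (fst w) then f (fst (fst w), snd w) else 0) -` A \<inter> space (Pred \<Otimes>\<^sub>M borel) =
    {w \<in> space (Pred \<Otimes>\<^sub>M borel). snd w < snd (fst w) \<and> (fst (fst w), snd w) \<in> f -` A \<inter> space Pred} \<union>
    (if 0 \<in> A then {w \<in> space (Pred \<Otimes>\<^sub>M borel). \<not> snd w < snd (fst w)} else {})"
    by (auto simp: space_pair_measure split: if_splits)
  then show "(\<lambda>w. if snd w < snd (fst w) then f (fst (fst w), snd w) else 0) -` A \<inter> space (Pred \<Otimes>\<^sub>M borel) \<in> sets (Pred \<Otimes>\<^sub>M borel)"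
    using 1 2 by auto
qed simp

text \<open>Predictable sets are progressive: a rectangle that starts at s \<le> t has its base in
  \<open>F t\<close>, and one that starts later does not meet the times up to t.\<close>

lemma F_past_sets:
  assumes "E \<in> sets Pred"
  shows "{w \<in> space (F t \<Otimes>\<^sub>M borel). snd w \<le> t \<and> w \<in> E} \<in> sets (F t \<Otimes>\<^sub>M borel)" (is "?S E \<in> _")
proof -
  have le: "{w \<in> space (F t \<Otimes>\<^sub>M borel). snd w \<le> t} \<in> sets (F t \<Otimes>\<^sub>M borel)"
    by measurable
  from assms have "E \<in> sigma_sets (space P \<times> UNIV) {A \<times> {s<..t} | A s t. s < t \<and> A \<in> sets (F s)}"
    by (simp add: sets_Pred)
  then show ?thesis
  proof induction
    case (Basic E)
    then obtain A s u where E: "E = A \<times> {s<..u}" "A \<in> sets (F s)"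
      by blast
    show ?case
    proof (cases "s \<le> t")
      case True
      then have "A \<in> sets (F t)"
        using E(2) F_mono by blast
      moreover have "?S E = A \<times> ({s<..u} \<inter> {..t})"
        using sets.sets_into_space[OF E(2)] by (auto simp: E(1) space_pair_measure)
      ultimately show ?thesis
        by auto
    next
      case False
      then have eq: "?S E = {}"
        by (auto simp: E(1))
      show ?thesis
        unfolding eq by simp
    qed
  next
    case Empty
    then show ?case by simp
  next
    case (Compl E)
    have "?S (space P \<times> UNIV - E) = {w \<in> space (F t \<Otimes>\<^sub>M borel). snd w \<le> t} - ?S E"
      by (auto simp: space_pair_measure)
    then show ?case
      using le Compl by auto
  next
    case (Union E)
    have "?S (\<Union>i. E i) = (\<Union>i. ?S (E i))"
      by auto
    then show ?case
      using Union by auto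
  qed
qed

lemma measurable_F_past:
  fixes f :: "'w \<times> real \<Rightarrow> 'b::{second_countable_topology, zero}"
  assumes f: "f \<in> borel_measurable Pred"
  shows "(\<lambda>w. if snd w \<le> t then f w else 0) \<in> borel_measurable (F t \<Otimes>\<^sub>M borel)"
proof (rule measurableI)
  fix A :: "'b set"
  assume A: "A \<in> sets borel"
  have 1: "{w \<in> space (F t \<Otimes>\<^sub>M borel). snd w \<le> t \<and> w \<in> f -` A \<inter> space Pred} \<in> sets (F t \<Otimes>\<^sub>M borel)"
    by (rule F_past_sets[OF measurable_sets[OF f A]])
  have 2: "{w \<in> space (F t \<Otimes>\<^sub>M borel). \<not> snd w \<le> t} \<in> sets (F t \<Otimes>\<^sub>M borel)"
    by measurable
  have "(\<lambda>w. if snd w \<le> t then f w else 0) -` A \<inter> space (F t \<Otimes>\<^sub>M borel) =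
    {w \<in> space (F t \<Otimes>\<^sub>M borel). snd w \<le> t \<and> w \<in> f -` A \<inter> space Pred} \<union>
    (if 0 \<in> A then {w \<in> space (F t \<Otimes>\<^sub>M borel). \<not> snd w \<le> t} else {})"
    by (auto simp: space_pair_measure split: if_splits)
  then show "(\<lambda>w. if snd w \<le> t then f w else 0) -` A \<inter> space (F t \<Otimes>\<^sub>M borel) \<in> sets (F t \<Otimes>\<^sub>M borel)"
    using 1 2 by auto
qed simp

lemma measurable_F_section:
  fixes f :: "'w \<times> real \<Rightarrow> 'b::{second_countable_topology, zero}"
  assumes "f \<in> borel_measurable Pred"
  shows "(\<lambda>\<omega>. f (\<omega>, t)) \<in> borel_measurable (F t)"
proof -
  have "(\<lambda>\<omega>. (\<omega>, t)) \<in> measurable (F t) (F t \<Otimes>\<^sub>M borel)"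
    by measurable
  from measurable_compose[OF this measurable_F_past[OF assms, of t]] show ?thesis
    by simp
qed

lemma \<pi>_inj: "\<omega> \<in> space P \<Longrightarrow> inj_on fst (\<pi> m \<omega> \<inter> D)"
  unfolding inj_on_def using \<pi>_distinct by blast

lemma pts_past: "\<omega> \<in> space P \<Longrightarrow> pts (\<pi> m \<omega>) l \<inter> {..<t} = pts (\<pi> m \<omega> \<inter> strict_past t) l"
  using \<pi>_half[of \<omega> m] by (auto simp: pts_def strict_past_def)

section \<open>Predictability of the drive\<close>

lemma hN_ext0 [measurable]: "ext0 (hN \<MM> \<alpha> m) \<in> borel_measurable borel"
  and hW_ext0 [measurable]: "ext0 (hW \<MM> \<alpha> p) \<in> borel_measurable borel"
  and bW_ext0 [measurable]: "ext0 (bW \<MM> \<alpha> p) \<in> borel_measurable borel"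
proof -
  have *: "ext0 f \<in> borel_measurable borel" if "f \<in> borel_measurable (restrict_space borel {0<..})" for f
    using that by (subst (asm) measurable_restrict_space_iff[where c = 0]) (auto simp: ext0_def[abs_def])
  show "ext0 (hN \<MM> \<alpha> m) \<in> borel_measurable borel" "ext0 (hW \<MM> \<alpha> p) \<in> borel_measurable borel"
    "ext0 (bW \<MM> \<alpha> p) \<in> borel_measurable borel"
    using params by (auto simp: valid_params_def intro!: *)
qed

lemma JW_ext0 [measurable]:
  "(\<lambda>z. if 0 < fst z then JW \<MM> \<alpha> p (fst z) (snd z) else 0) \<in> borel_measurable borel"
proof -
  have "open ({0<..} \<times> (UNIV :: real set) :: (real \<times> real) set)"
    by (intro open_Times) auto
  then have "{0<..} \<times> UNIV \<in> sets (borel :: (real \<times> real) measure)"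
    by simp
  moreover have "(\<lambda>(s, w). JW \<MM> \<alpha> p s w) \<in> borel_measurable (restrict_space borel ({0<..} \<times> UNIV))"
    using params by (auto simp: valid_params_def)
  ultimately have "(\<lambda>z. if z \<in> {0<..} \<times> UNIV then (\<lambda>(s, w). JW \<MM> \<alpha> p s w) z else 0) \<in> borel_measurable borel"
    by (subst (asm) measurable_restrict_space_iff[where c = 0]) auto
  moreover have "(\<lambda>z. if z \<in> {0<..} \<times> UNIV then (\<lambda>(s, w). JW \<MM> \<alpha> p s w) z else 0) =
      (\<lambda>z. if 0 < fst z then JW \<MM> \<alpha> p (fst z) (snd z) else 0)"
    by (auto simp: fun_eq_iff)
  ultimately show ?thesis
    by simp
qed

text \<open>The points before t are a thinning of the atoms before t, and the intensity is read only
  at the times of these atoms. Both ingredients are predictable in (\<omega>, t), so the general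
  result on sums over random configurations applies with \<open>Pred\<close> as base.\<close>

lemma measurable_point_sum:
  fixes lam :: "real \<Rightarrow> 'w \<Rightarrow> real"
  assumes lam: "(\<lambda>(\<omega>, t). lam t \<omega>) \<in> borel_measurable Pred"
  shows "(\<lambda>z. infsum (\<lambda>s. hN \<MM> \<alpha> m (snd z - s)) (pts (\<pi> m (fst z)) (\<lambda>s. lam s (fst z)) \<inter> {..<snd z})) \<in> borel_measurable Pred"
    and "(\<lambda>z. \<integral>\<^sup>+ s. ennreal \<bar>hN \<MM> \<alpha> m (snd z - s)\<bar> \<partial>count_space (pts (\<pi> m (fst z)) (\<lambda>s. lam s (fst z)) \<inter> {..<snd z})) \<in> borel_measurable Pred"
proof -
  let ?C = "\<lambda>z. \<pi> m (fst z) \<inter> strict_past (snd z)"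
  \<comment> \<open>On atoms before \<open>snd z\<close> this is the summand. Elsewhere the
    intensity is replaced by 0 and the kernel by its extension by zero, so that \<open>H\<close> is
    jointly measurable on the whole space.\<close>
  define H where "H = (\<lambda>(z, y). if snd y \<le> (if fst y < snd z then (\<lambda>(\<omega>, t). lam t \<omega>) (fst z, fst y) else 0)
    then ext0 (hN \<MM> \<alpha> m) (snd z - fst y) else 0)"
  have fin: "finite (?C z \<inter> B)" if "z \<in> space Pred" "bounded B" for z B
    using that by (intro finite_subset[OF _ \<pi>_finite[of "fst z" B m]]) auto
  have "(\<lambda>w. (fst w, fst (snd w))) \<in> measurable (Pred \<Otimes>\<^sub>M (borel :: (real \<times> real) measure)) (Pred \<Otimes>\<^sub>M borel)"
    by measurable
  from measurable_compose[OF this measurable_Pred_past[OF lam]]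
  have [measurable]: "(\<lambda>w. if fst (snd w) < snd (fst w) then (\<lambda>(\<omega>, t). lam t \<omega>) (fst (fst w), fst (snd w)) else 0)
    \<in> borel_measurable (Pred \<Otimes>\<^sub>M (borel :: (real \<times> real) measure))"
    unfolding fst_conv snd_conv .
  have H [measurable]: "H \<in> borel_measurable (Pred \<Otimes>\<^sub>M borel)"
  proof -
    have "H = (\<lambda>w. if snd (snd w) \<le> (if fst (snd w) < snd (fst w) then (\<lambda>(\<omega>, t). lam t \<omega>) (fst (fst w), fst (snd w)) else 0)
      then ext0 (hN \<MM> \<alpha> m) (snd (fst w) - fst (snd w)) else 0)"
      by (auto simp: H_def fun_eq_iff)
    also have "\<dots> \<in> borel_measurable (Pred \<Otimes>\<^sub>M borel)"
      by measurable
    finally show ?thesis .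
  qed
  have eq: "(if snd y \<le> lam (fst y) (fst z) \<and> fst y \<in> UNIV then hN \<MM> \<alpha> m (snd z - fst y) else 0) = H (z, y)"
    if "y \<in> ?C z" for z y
    using that by (auto simp: H_def ext0_def strict_past_def)
  have "infsum (\<lambda>s. hN \<MM> \<alpha> m (snd z - s)) (pts (\<pi> m (fst z)) (\<lambda>s. lam s (fst z)) \<inter> {..<snd z}) =
    infsum (\<lambda>y. H (z, y)) (?C z)" if "z \<in> space Pred" for z
  proof -
    have \<omega>: "fst z \<in> space P"
      using that by auto
    have eq': "infsum (\<lambda>y. if snd y \<le> lam (fst y) (fst z) \<and> fst y \<in> UNIV then hN \<MM> \<alpha> m (snd z - fst y) else 0) (?C z) =
        infsum (\<lambda>y. H (z, y)) (?C z)"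
      by (rule infsum_cong) (rule eq)
    show ?thesis
      unfolding pts_past[OF \<omega>]
      using infsum_pts[OF \<pi>_inj[OF \<omega>, of m "strict_past (snd z)"], where g = "\<lambda>s. hN \<MM> \<alpha> m (snd z - s)"
          and l = "\<lambda>s. lam s (fst z)" and D = UNIV]
        eq'
      by simp
  qed
  then show "(\<lambda>z. infsum (\<lambda>s. hN \<MM> \<alpha> m (snd z - s)) (pts (\<pi> m (fst z)) (\<lambda>s. lam s (fst z)) \<inter> {..<snd z})) \<in> borel_measurable Pred"
    using borel_measurable_count_infsum[OF measurable_Pred_config fin H]
    by (rule measurable_cong[THEN iffD2])
  have "(\<integral>\<^sup>+ s. ennreal \<bar>hN \<MM> \<alpha> m (snd z - s)\<bar> \<partial>count_space (pts (\<pi> m (fst z)) (\<lambda>s. lam s (fst z)) \<inter> {..<snd z})) =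
    (\<integral>\<^sup>+ y. ennreal \<bar>H (z, y)\<bar> \<partial>count_space (?C z))" if "z \<in> space Pred" for z
  proof -
    have \<omega>: "fst z \<in> space P"
      using that by auto
    have "(\<integral>\<^sup>+ y. (if snd y \<le> lam (fst y) (fst z) \<and> fst y \<in> UNIV then ennreal \<bar>hN \<MM> \<alpha> m (snd z - fst y)\<bar> else 0) \<partial>count_space (?C z)) =
      (\<integral>\<^sup>+ y. ennreal \<bar>H (z, y)\<bar> \<partial>count_space (?C z))"
    proof (rule nn_integral_cong)
      fix y
      assume "y \<in> space (count_space (?C z))"
      then have y: "y \<in> ?C z"
        by simp
      show "(if snd y \<le> lam (fst y) (fst z) \<and> fst y \<in> UNIV then ennreal \<bar>hN \<MM> \<alpha> m (snd z - fst y)\<bar> else 0) = ennreal \<bar>H (z, y)\<bar>"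
        unfolding eq[OF y, symmetric] by simp
    qed
    then show ?thesis
      unfolding pts_past[OF \<omega>]
      using nn_integral_count_pts[OF \<pi>_inj[OF \<omega>, of m "strict_past (snd z)"], where g = "\<lambda>s. ennreal \<bar>hN \<MM> \<alpha> m (snd z - s)\<bar>"
          and l = "\<lambda>s. lam s (fst z)" and D = UNIV]
      by simp
  qed
  then show "(\<lambda>z. \<integral>\<^sup>+ s. ennreal \<bar>hN \<MM> \<alpha> m (snd z - s)\<bar> \<partial>count_space (pts (\<pi> m (fst z)) (\<lambda>s. lam s (fst z)) \<inter> {..<snd z})) \<in> borel_measurable Pred"
    using borel_measurable_count_nn_integral[OF measurable_Pred_config fin, of "\<lambda>w. ennreal \<bar>H w\<bar>"]
    by (subst measurable_cong) auto
qed

lemma measurable_grid_sum: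
  fixes W :: "real \<Rightarrow> 'w \<Rightarrow> real"
  assumes W: "\<And>k. k \<in> grid n \<phi> p \<Longrightarrow> W k \<in> borel_measurable (F k)"
  shows "(\<lambda>z. infsum (\<lambda>k. JW \<MM> \<alpha> p (snd z - k) (W k (fst z))) (grid n \<phi> p \<inter> {..<snd z})) \<in> borel_measurable Pred"
    and "(\<lambda>z. \<integral>\<^sup>+ k. ennreal \<bar>JW \<MM> \<alpha> p (snd z - k) (W k (fst z))\<bar> \<partial>count_space (grid n \<phi> p \<inter> {..<snd z})) \<in> borel_measurable Pred"
proof -
  \<comment> \<open>The drift at k is replaced by 0 until time k has passed, which makes it
    predictable. The guarded pair is written out so that the composition with \<open>JW_ext0\<close>
    is literal.\<close>
  define H where "H k z = (if 0 < fst (snd z - k, if k < snd z then W k (fst z) else 0)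
     then JW \<MM> \<alpha> p (fst (snd z - k, if k < snd z then W k (fst z) else 0)) (snd (snd z - k, if k < snd z then W k (fst z) else 0)) else 0)" for k z
  have H_eq: "H k z = (if k \<in> {..<snd z} then JW \<MM> \<alpha> p (snd z - k) (W k (fst z)) else 0)" for k z
    by (auto simp: H_def)
  have H [measurable]: "H k \<in> borel_measurable Pred" if "k \<in> grid n \<phi> p" for k
  proof -
    note [measurable] = measurable_Pred_after[OF W[OF that]]
    have "(\<lambda>z. (snd z - k, if k < snd z then W k (fst z) else 0)) \<in> borel_measurable Pred"
      by measurable
    from measurable_compose[OF this JW_ext0] show ?thesis
      unfolding H_def[abs_def] .
  qed
  show "(\<lambda>z. infsum (\<lambda>k. JW \<MM> \<alpha> p (snd z - k) (W k (fst z))) (grid n \<phi> p \<inter> {..<snd z})) \<in> borel_measurable Pred"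
    unfolding infsum_Int_indicator H_eq[symmetric]
    by (rule borel_measurable_countable_infsum[OF countable_grid H])
  have "(\<integral>\<^sup>+ k. ennreal \<bar>JW \<MM> \<alpha> p (snd z - k) (W k (fst z))\<bar> \<partial>count_space (grid n \<phi> p \<inter> {..<snd z})) =
    (\<integral>\<^sup>+ k. ennreal \<bar>H k z\<bar> \<partial>count_space (grid n \<phi> p))" for z
    by (auto simp: nn_integral_count_space_indicator H_eq intro!: nn_integral_cong split: split_indicator)
  then show "(\<lambda>z. \<integral>\<^sup>+ k. ennreal \<bar>JW \<MM> \<alpha> p (snd z - k) (W k (fst z))\<bar> \<partial>count_space (grid n \<phi> p \<inter> {..<snd z})) \<in> borel_measurable Pred"
    using borel_measurable_countable_nn_integral[OF countable_grid, of n \<phi> p "\<lambda>k z. ennreal \<bar>H k z\<bar>" Pred] H by simp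
qed

text \<open>The state of the iteration consists of an intensity and the drifts only; the points are
  recovered from the intensity by thinning.\<close>

definition admissible :: "('m \<Rightarrow> real \<Rightarrow> 'w \<Rightarrow> real) \<Rightarrow> ('p \<Rightarrow> real \<Rightarrow> 'w \<Rightarrow> real) \<Rightarrow> bool" where
  "admissible lam W \<longleftrightarrow> (\<forall>m. (\<lambda>(\<omega>, t). lam m t \<omega>) \<in> borel_measurable Pred) \<and>
     (\<forall>p. \<forall>k\<in>grid n \<phi> p. W p k \<in> borel_measurable (F k))"

definition thin_drive :: "('m \<Rightarrow> real \<Rightarrow> 'w \<Rightarrow> real) \<Rightarrow> ('p \<Rightarrow> real \<Rightarrow> 'w \<Rightarrow> real) \<Rightarrow> 'm + 'p \<Rightarrow> real \<Rightarrow> 'w \<Rightarrow> real" where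
  "thin_drive lam W \<alpha> t \<omega> = drive \<MM> n \<phi> (\<lambda>m. pts (\<pi> m \<omega>) (\<lambda>s. lam m s \<omega>)) (\<lambda>p k. W p k \<omega>) \<alpha> t"

definition thin_converges :: "('m \<Rightarrow> real \<Rightarrow> 'w \<Rightarrow> real) \<Rightarrow> ('p \<Rightarrow> real \<Rightarrow> 'w \<Rightarrow> real) \<Rightarrow> 'm + 'p \<Rightarrow> real \<Rightarrow> 'w \<Rightarrow> bool" where
  "thin_converges lam W \<alpha> t \<omega> \<longleftrightarrow> drive_converges \<MM> n \<phi> (\<lambda>m. pts (\<pi> m \<omega>) (\<lambda>s. lam m s \<omega>)) (\<lambda>p k. W p k \<omega>) \<alpha> t"

lemma measurable_thin_drive:
  assumes "admissible lam W"
  shows "(\<lambda>(\<omega>, t). thin_drive lam W \<alpha> t \<omega>) \<in> borel_measurable Pred"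
  unfolding thin_drive_def drive_def case_prod_beta'
  using assms unfolding admissible_def
  by (intro borel_measurable_add borel_measurable_sum measurable_point_sum(1) measurable_grid_sum(1)) auto

lemma thin_converges_sets:
  assumes "admissible lam W"
  shows "{z \<in> space Pred. thin_converges lam W \<alpha> (snd z) (fst z)} \<in> sets Pred"
proof -
  have [measurable]: "(\<lambda>z. \<integral>\<^sup>+ s. ennreal \<bar>hN \<MM> \<alpha> m (snd z - s)\<bar> \<partial>count_space (pts (\<pi> m (fst z)) (\<lambda>s. lam m s (fst z)) \<inter> {..<snd z})) \<in> borel_measurable Pred" for m
    using assms unfolding admissible_def by (intro measurable_point_sum(2)) auto
  have [measurable]: "(\<lambda>z. \<integral>\<^sup>+ k. ennreal \<bar>JW \<MM> \<alpha> p (snd z - k) (W p k (fst z))\<bar> \<partial>count_space (grid n \<phi> p \<inter> {..<snd z})) \<in> borel_measurable Pred" for p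
    using assms unfolding admissible_def by (intro measurable_grid_sum(2)) auto
  show ?thesis
    unfolding thin_converges_def drive_converges_def summable_on_iff_nn_integral by measurable
qed

text \<open>Up to time t the thinning sees only atoms in the past of t, and a predictable intensity
  is progressive; this is the adaptedness of the point process.\<close>

lemma measurable_thin_points_past:
  assumes "(\<lambda>(\<omega>, t). lam t \<omega>) \<in> borel_measurable Pred"
  shows "(\<lambda>\<omega>. pts (\<pi> m \<omega>) (\<lambda>s. lam s \<omega>) \<inter> {..t}) \<in> measurable (F t) config_space"
proof -
  have "pts (\<pi> m \<omega>) (\<lambda>s. lam s \<omega>) \<inter> {..t} = pts (\<pi> m \<omega> \<inter> past t) (\<lambda>s. if s \<le> t then lam s \<omega> else 0)"
    if "\<omega> \<in> space P" for \<omega>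
    using \<pi>_half[OF that, of m] by (auto simp: pts_def past_def)
  moreover have "(\<lambda>\<omega>. pts (\<pi> m \<omega> \<inter> past t) (\<lambda>s. if s \<le> t then lam s \<omega> else 0)) \<in> measurable (F t) config_space"
  proof (rule measurable_pts[OF measurable_F_\<pi>])
    show "finite (\<pi> m \<omega> \<inter> past t \<inter> B)" if "\<omega> \<in> space (F t)" "bounded B" for \<omega> B
      using that by (intro finite_subset[OF _ \<pi>_finite[of \<omega> B m]]) auto
    show "inj_on fst (\<pi> m \<omega> \<inter> past t)" if "\<omega> \<in> space (F t)" for \<omega>
      using that by (intro \<pi>_inj) simp
    show "(\<lambda>(\<omega>, s). if s \<le> t then lam s \<omega> else 0) \<in> borel_measurable (F t \<Otimes>\<^sub>M borel)"
      unfolding case_prod_beta' using measurable_F_past[OF assms[unfolded case_prod_beta'], of t] .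
  qed
  ultimately show ?thesis
    by (subst measurable_cong) auto
qed

lemma measurable_thin_points:
  assumes "(\<lambda>(\<omega>, t). lam t \<omega>) \<in> borel_measurable Pred"
  shows "(\<lambda>\<omega>. pts (\<pi> m \<omega>) (\<lambda>s. lam s \<omega>)) \<in> measurable P config_space"
proof (rule measurable_pts[OF \<pi>_measurable \<pi>_finite])
  show "inj_on fst (\<pi> m \<omega>)" if "\<omega> \<in> space P" for \<omega>
    using \<pi>_inj[OF that, of m UNIV] by simp
  show "(\<lambda>(\<omega>, s). lam s \<omega>) \<in> borel_measurable (P \<Otimes>\<^sub>M borel)"
    by (rule measurable_Pred_P[OF assms])
qed

end

subsection \<open>Independence of the increments and the compensation formula\<close>

text \<open>Writes a finite count through the events on which it equals j, because independence is
  available for events.\<close>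

lemma ecount_eq_suminf:
  assumes "finite X"
  shows "ecount X = (\<Sum>j. of_nat j * (if ecount X = of_nat j then 1 else 0))"
proof -
  have "(\<Sum>j. of_nat j * (if ecount X = of_nat j then 1 else 0 :: ennreal)) =
      (\<Sum>j\<in>{card X}. of_nat j * (if ecount X = of_nat j then 1 else 0))"
    using assms by (intro suminf_finite) (auto simp: ecount_finite)
  then show ?thesis
    using assms by (simp add: ecount_finite)
qed

text \<open>The compensation formula compares two of these measures, one with \<open>N\<close> the counting measure of
  the atoms and one with \<open>N\<close> the intensity, on the predictable rectangles.\<close>

definition kernel_measure ::
    "'w measure \<Rightarrow> 'c measure \<Rightarrow> ('w \<Rightarrow> 'z \<Rightarrow> 'c) \<Rightarrow> ('w \<Rightarrow> 'z measure) \<Rightarrow> 'c measure" where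
  "kernel_measure P S g N = measure_of (space S) (sets S) (\<lambda>E. \<integral>\<^sup>+ \<omega>. \<integral>\<^sup>+ z. indicator E (g \<omega> z) \<partial>N \<omega> \<partial>P)"

lemma sets_kernel_measure [simp]: "sets (kernel_measure P S g N) = sets S"
  by (simp add: kernel_measure_def sets.sigma_sets_eq sets.space_closed)

lemma space_kernel_measure [simp]: "space (kernel_measure P S g N) = space S"
  by (simp add: kernel_measure_def space_measure_of_conv)

lemma emeasure_kernel_measure:
  assumes out: "\<And>E. E \<in> sets S \<Longrightarrow> (\<lambda>\<omega>. \<integral>\<^sup>+ z. indicator E (g \<omega> z) \<partial>N \<omega>) \<in> borel_measurable P"
    and inn: "\<And>\<omega> E. \<omega> \<in> space P \<Longrightarrow> E \<in> sets S \<Longrightarrow> (\<lambda>z. indicator E (g \<omega> z) :: ennreal) \<in> borel_measurable (N \<omega>)"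
    and E: "E \<in> sets S"
  shows "emeasure (kernel_measure P S g N) E = (\<integral>\<^sup>+ \<omega>. \<integral>\<^sup>+ z. indicator E (g \<omega> z) \<partial>N \<omega> \<partial>P)"
proof (rule emeasure_measure_of[OF kernel_measure_def sets.space_closed])
  show "positive (sets (kernel_measure P S g N)) (\<lambda>E. \<integral>\<^sup>+ \<omega>. \<integral>\<^sup>+ z. indicator E (g \<omega> z) \<partial>N \<omega> \<partial>P)"
    by (simp add: positive_def)
  show "countably_additive (sets (kernel_measure P S g N)) (\<lambda>E. \<integral>\<^sup>+ \<omega>. \<integral>\<^sup>+ z. indicator E (g \<omega> z) \<partial>N \<omega> \<partial>P)"
  proof (rule countably_additiveI)
    fix A :: "nat \<Rightarrow> _ set"
    assume A: "range A \<subseteq> sets (kernel_measure P S g N)" "disjoint_family A"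
    then have A': "A i \<in> sets S" for i
      by auto
    have "(\<Sum>i. \<integral>\<^sup>+ \<omega>. \<integral>\<^sup>+ z. indicator (A i) (g \<omega> z) \<partial>N \<omega> \<partial>P) =
      (\<integral>\<^sup>+ \<omega>. (\<Sum>i. \<integral>\<^sup>+ z. indicator (A i) (g \<omega> z) \<partial>N \<omega>) \<partial>P)"
      using out[OF A'] by (simp add: nn_integral_suminf)
    also have "\<dots> = (\<integral>\<^sup>+ \<omega>. \<integral>\<^sup>+ z. (\<Sum>i. indicator (A i) (g \<omega> z)) \<partial>N \<omega> \<partial>P)"
      using inn[OF _ A'] by (intro nn_integral_cong nn_integral_suminf[symmetric])
    also have "\<dots> = (\<integral>\<^sup>+ \<omega>. \<integral>\<^sup>+ z. indicator (\<Union>i. A i) (g \<omega> z) \<partial>N \<omega> \<partial>P)"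
      using suminf_indicator[OF A(2)] by simp
    finally show "(\<Sum>i. \<integral>\<^sup>+ \<omega>. \<integral>\<^sup>+ z. indicator (A i) (g \<omega> z) \<partial>N \<omega> \<partial>P) =
      (\<integral>\<^sup>+ \<omega>. \<integral>\<^sup>+ z. indicator (\<Union>i. A i) (g \<omega> z) \<partial>N \<omega> \<partial>P)" .
  qed
qed (use E in simp)

lemma nn_integral_kernel_measure:
  assumes out: "\<And>h :: 'c \<Rightarrow> ennreal. h \<in> borel_measurable S \<Longrightarrow> (\<lambda>\<omega>. \<integral>\<^sup>+ z. h (g \<omega> z) \<partial>N \<omega>) \<in> borel_measurable P"
    and inn: "\<And>\<omega>. \<omega> \<in> space P \<Longrightarrow> g \<omega> \<in> measurable (N \<omega>) S"
    and f: "f \<in> borel_measurable S"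
  shows "(\<integral>\<^sup>+ y. f y \<partial>kernel_measure P S g N) = (\<integral>\<^sup>+ \<omega>. \<integral>\<^sup>+ z. f (g \<omega> z) \<partial>N \<omega> \<partial>P)"
  using f
proof (induction rule: borel_measurable_induct)
  case (cong f h)
  have "(\<integral>\<^sup>+ y. f y \<partial>kernel_measure P S g N) = (\<integral>\<^sup>+ y. h y \<partial>kernel_measure P S g N)"
    using cong(3) by (intro nn_integral_cong) simp
  moreover have "(\<integral>\<^sup>+ \<omega>. \<integral>\<^sup>+ z. f (g \<omega> z) \<partial>N \<omega> \<partial>P) = (\<integral>\<^sup>+ \<omega>. \<integral>\<^sup>+ z. h (g \<omega> z) \<partial>N \<omega> \<partial>P)"
    using cong(3) measurable_space[OF inn] by (intro nn_integral_cong) auto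
  ultimately show ?case
    using cong(4) by simp
next
  case (set A)
  then have "(\<integral>\<^sup>+ y. indicator A y \<partial>kernel_measure P S g N) = emeasure (kernel_measure P S g N) A"
    by (intro nn_integral_indicator) simp
  also have "\<dots> = (\<integral>\<^sup>+ \<omega>. \<integral>\<^sup>+ z. indicator A (g \<omega> z) \<partial>N \<omega> \<partial>P)"
  proof (rule emeasure_kernel_measure[OF out _ set])
    show "(\<lambda>z. indicator E (g \<omega> z) :: ennreal) \<in> borel_measurable (N \<omega>)" if "\<omega> \<in> space P" "E \<in> sets S" for \<omega> E
      using measurable_compose[OF inn[OF that(1)] borel_measurable_indicator[OF that(2)]] .
  qed simp
  finally show ?case .
next
  case (mult u c)
  then have "u \<in> borel_measurable (kernel_measure P S g N)"
    by (simp cong: measurable_cong_sets)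
  then show ?case
    using mult out[of u] measurable_compose[OF inn, of _ u borel] by (simp add: nn_integral_cmult cong: nn_integral_cong)
next
  case (add u v)
  then have "u \<in> borel_measurable (kernel_measure P S g N)" "v \<in> borel_measurable (kernel_measure P S g N)"
    by (simp_all cong: measurable_cong_sets)
  then show ?case
    using add out[of u] out[of v] measurable_compose[OF inn, of _ u borel] measurable_compose[OF inn, of _ v borel]
    by (simp add: nn_integral_add cong: nn_integral_cong)
next
  case (seq U)
  have U: "U i \<in> borel_measurable (kernel_measure P S g N)" for i
    using seq.hyps by (simp cong: measurable_cong_sets)
  have "(\<integral>\<^sup>+ y. (SUP i. U i) y \<partial>kernel_measure P S g N) = (SUP i. \<integral>\<^sup>+ y. U i y \<partial>kernel_measure P S g N)"
    unfolding SUP_apply using seq.hyps U by (intro nn_integral_monotone_convergence_SUP) auto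
  also have "\<dots> = (SUP i. \<integral>\<^sup>+ \<omega>. \<integral>\<^sup>+ z. U i (g \<omega> z) \<partial>N \<omega> \<partial>P)"
    using seq.IH by simp
  also have "\<dots> = (\<integral>\<^sup>+ \<omega>. (SUP i. \<integral>\<^sup>+ z. U i (g \<omega> z) \<partial>N \<omega>) \<partial>P)"
    using seq.hyps out by (intro nn_integral_monotone_convergence_SUP[symmetric])
      (auto simp: incseq_def le_fun_def intro!: nn_integral_mono)
  also have "\<dots> = (\<integral>\<^sup>+ \<omega>. \<integral>\<^sup>+ z. (SUP i. U i) (g \<omega> z) \<partial>N \<omega> \<partial>P)"
    unfolding SUP_apply using seq.hyps measurable_compose[OF inn, of _ "U _" borel]
    by (intro nn_integral_cong nn_integral_monotone_convergence_SUP[symmetric])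
      (auto simp: incseq_def le_fun_def)
  finally show ?case
    using seq.hyps by simp
qed

locale har_noise = driven_paths P n \<phi> \<pi> \<xi> \<MM> + prob_space P
  for P :: "'w measure"
    and n :: "'p::finite \<Rightarrow> nat"
    and \<phi> :: "'p \<Rightarrow> real"
    and \<pi> :: "'m::finite \<Rightarrow> 'w \<Rightarrow> (real \<times> real) set"
    and \<xi> :: "'p \<Rightarrow> real \<Rightarrow> 'w \<Rightarrow> real"
    and \<MM> :: "('m, 'p) har_params" +
  assumes noise: "driving_noise P n \<phi> \<pi> \<xi>"
begin

section \<open>Independence of the past from later atoms\<close>

lemma poisson: "poisson_random_measure P (\<pi> m)"
  and indep_\<pi>: "indep_vars (\<lambda>_. config_space) \<pi> UNIV"
  and indep_\<pi>_\<xi>: "indep_set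
       (sets (vimage_algebra (space P) (\<lambda>\<omega> m. \<pi> m \<omega>) (Pi\<^sub>M UNIV (\<lambda>_. config_space))))
       (sets (vimage_algebra (space P) (\<lambda>\<omega>. \<lambda>(p, k)\<in>grid_points n \<phi>. \<xi> p k \<omega>)
          (Pi\<^sub>M (grid_points n \<phi>) (\<lambda>_. borel))))"
  using noise unfolding driving_noise_def by auto

lemma prob_\<pi>_prod:
  assumes "\<And>m. Z m \<in> sets config_space"
  shows "prob {\<omega> \<in> space P. \<forall>m. \<pi> m \<omega> \<in> Z m} = (\<Prod>m\<in>UNIV. prob {\<omega> \<in> space P. \<pi> m \<omega> \<in> Z m})"
proof -
  have "{\<omega> \<in> space P. \<forall>m. \<pi> m \<omega> \<in> Z m} = (\<Inter>m\<in>UNIV. \<pi> m -` Z m \<inter> space P)"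
    by auto
  moreover have "{\<omega> \<in> space P. \<pi> m \<omega> \<in> Z m} = \<pi> m -` Z m \<inter> space P" for m
    by auto
  ultimately show ?thesis
    using indep_varsD_finite[OF indep_\<pi>, of Z] assms by simp
qed

text \<open>The past of s is enlarged to contain all drifts and the entire configurations of the
  other labels; only for label m is the configuration cut at s. The larger \<sigma>-algebra has a
  simple \<pi>-system of generators, on which the product formula combines three facts: the
  independence of disjoint regions for label m, that of the labels, and that of configurations and
  drifts.\<close>

lemma past_indep:
  assumes X: "X \<in> sets (F s)" and C: "C \<in> sets borel" "C \<inter> past s = {}" and A': "A' \<in> sets borel"
  shows "prob (X \<inter> {\<omega> \<in> space P. ecount (\<pi> m \<omega> \<inter> C) \<in> A'}) = prob X * prob {\<omega> \<in> space P. ecount (\<pi> m \<omega> \<inter> C) \<in> A'}"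
proof -
  define E where "E = {\<omega> \<in> space P. ecount (\<pi> m \<omega> \<inter> C) \<in> A'}"
  define Pi where "Pi = vimage_algebra (space P) (\<lambda>\<omega> m. \<pi> m \<omega>) (Pi\<^sub>M UNIV (\<lambda>_. config_space))"
  define Xi where "Xi = vimage_algebra (space P) (\<lambda>\<omega>. \<lambda>(p, k)\<in>grid_points n \<phi>. \<xi> p k \<omega>) (Pi\<^sub>M (grid_points n \<phi>) (\<lambda>_. borel))"
  have space_Pi [simp]: "space Pi = space P" and space_Xi [simp]: "space Xi = space P"
    by (simp_all add: Pi_def Xi_def)
  have ind: "prob (a \<inter> b) = prob a * prob b" if "a \<in> sets Pi" "b \<in> sets Xi" for a b
    using indep_setD[OF indep_\<pi>_\<xi>] that by (simp add: Pi_def Xi_def)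
  have Pi_ev: "sets Pi \<subseteq> events" and Xi_ev: "sets Xi \<subseteq> events"
    using indep_setD_ev1[OF indep_\<pi>_\<xi>] indep_setD_ev2[OF indep_\<pi>_\<xi>] by (simp_all add: Pi_def Xi_def)
  have Pi_\<pi>: "\<pi> m' \<in> measurable Pi config_space" for m'
  proof -
    have "(\<lambda>\<omega> m. \<pi> m \<omega>) \<in> measurable Pi (Pi\<^sub>M UNIV (\<lambda>_. config_space))"
      unfolding Pi_def by (rule measurable_vimage_algebra1) (auto simp: space_PiM)
    from measurable_compose[OF this measurable_component_singleton[of m']] show ?thesis
      by simp
  qed
  have Xi_\<xi>: "\<xi> p k \<in> borel_measurable Xi" if "k \<in> grid n \<phi> p" for p k
  proof -
    have pk: "(p, k) \<in> grid_points n \<phi>"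
      using that by (simp add: grid_points_def)
    have "(\<lambda>\<omega>. \<lambda>(p, k)\<in>grid_points n \<phi>. \<xi> p k \<omega>) \<in> measurable Xi (Pi\<^sub>M (grid_points n \<phi>) (\<lambda>_. borel))"
      unfolding Xi_def by (rule measurable_vimage_algebra1) (auto simp: space_PiM)
    from measurable_compose[OF this measurable_component_singleton[OF pk]] show ?thesis
      using pk by simp
  qed
  \<comment> \<open>The only label whose configuration is cut at s is m; for the others the past is
    a function of the whole configuration.\<close>
  define g where "g m' \<omega> = (if m' = m then \<pi> m \<omega> \<inter> past s else \<pi> m' \<omega>)" for m' \<omega>
  have g_Pi: "g m' \<in> measurable Pi config_space" for m'
    unfolding g_def using Pi_\<pi> measurable_config_Int[OF Pi_\<pi> past_borel] by (cases "m' = m") auto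
  define X1 where "X1 B = {\<omega> \<in> space P. \<forall>m'. g m' \<omega> \<in> B m'}" for B :: "'m \<Rightarrow> (real \<times> real) set set"
  have X1_Pi: "X1 B \<in> sets Pi" if "\<And>m'. B m' \<in> sets config_space" for B
  proof -
    have "{\<omega> \<in> space Pi. \<forall>m'\<in>UNIV. g m' \<omega> \<in> B m'} \<in> sets Pi"
    proof (rule sets.sets_Collect_finite_All)
      show "{\<omega> \<in> space Pi. g m' \<omega> \<in> B m'} \<in> sets Pi" for m'
        using measurable_sets[OF g_Pi that] by (simp add: vimage_def Int_def conj_commute)
    qed simp
    then show ?thesis
      by (simp add: X1_def)
  qed
  have E_Pi: "E \<in> sets Pi"
    using measurable_sets[OF measurable_ecount_compose[OF Pi_\<pi> C(1)] A'] by (simp add: E_def vimage_def Int_def conj_commute)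
  define G where "G = {X1 B \<inter> A3 | B A3. (\<forall>m'. B m' \<in> sets config_space) \<and> A3 \<in> sets Xi}"
  have U: "(UNIV :: (real \<times> real) set set) \<in> sets config_space"
    using sets.top[of "config_space :: (real \<times> real) set measure"] by simp
  have GI: "X1 B \<inter> A3 \<in> G" if "\<And>m'. B m' \<in> sets config_space" "A3 \<in> sets Xi" for B A3
    unfolding G_def using that by blast
  have G_ev: "G \<subseteq> events"
  proof
    fix Y
    assume "Y \<in> G"
    then obtain B A3 where "Y = X1 B \<inter> A3" "\<forall>m'. B m' \<in> sets config_space" "A3 \<in> sets Xi"
      unfolding G_def by blast
    then show "Y \<in> events"
      using X1_Pi[of B] Pi_ev Xi_ev by auto
  qed
  have stable: "Int_stable G"
  proof (rule Int_stableI)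
    fix Y Y'
    assume "Y \<in> G" "Y' \<in> G"
    then obtain B A3 B' A3' where Y: "Y = X1 B \<inter> A3" "\<And>m'. B m' \<in> sets config_space" "A3 \<in> sets Xi"
      and Y': "Y' = X1 B' \<inter> A3'" "\<And>m'. B' m' \<in> sets config_space" "A3' \<in> sets Xi"
      unfolding G_def by blast
    have "Y \<inter> Y' = X1 (\<lambda>m'. B m' \<inter> B' m') \<inter> (A3 \<inter> A3')"
      unfolding Y(1) Y'(1) X1_def by auto
    then show "Y \<inter> Y' \<in> G"
      using Y Y' by (auto intro!: GI)
  qed
  have "sets (F s) \<subseteq> sets (sigma (space P) G)"
  proof (rule sets_F_subsetI)
    have G_Pow: "G \<subseteq> Pow (space P)"
      using G_ev sets.sets_into_space by blast
    have sets_G: "sets (sigma (space P) G) = sigma_sets (space P) G"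
      by (rule sets_measure_of[OF G_Pow])
    show space_G: "space (sigma (space P) G) = space P"
      by (rule space_measure_of[OF G_Pow])
    have g_G: "g m' \<in> measurable (sigma (space P) G) config_space" for m'
    proof (rule measurableI)
      fix B :: "(real \<times> real) set set"
      assume B: "B \<in> sets config_space"
      have "g m' -` B \<inter> space (sigma (space P) G) = X1 ((\<lambda>_. UNIV)(m' := B)) \<inter> space P"
        by (auto simp: X1_def space_G)
      also have "\<dots> \<in> G"
        using B U sets.top[of Xi] by (intro GI) auto
      finally show "g m' -` B \<inter> space (sigma (space P) G) \<in> sets (sigma (space P) G)"
        unfolding sets_G by (rule sigma_sets.Basic)
    qed simp
    show "(\<lambda>\<omega>. \<pi> m' \<omega> \<inter> past s) \<in> measurable (sigma (space P) G) config_space" for m'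
    proof (cases "m' = m")
      case True
      then show ?thesis
        using g_G[of m] by (simp add: g_def[abs_def])
    next
      case False
      then show ?thesis
        using measurable_config_Int[OF g_G[of m'] past_borel, of s] by (simp add: g_def[abs_def])
    qed
    show "\<xi> p k \<in> borel_measurable (sigma (space P) G)" if "k \<in> grid n \<phi> p" for p k
    proof (rule measurableI)
      fix A :: "real set"
      assume A: "A \<in> sets borel"
      have "\<xi> p k -` A \<inter> space Xi \<in> sets Xi"
        by (rule measurable_sets[OF Xi_\<xi>[OF that] A])
      then have "X1 (\<lambda>_. UNIV) \<inter> (\<xi> p k -` A \<inter> space P) \<in> G"
        using U by (intro GI) auto
      moreover have "X1 (\<lambda>_. UNIV) \<inter> (\<xi> p k -` A \<inter> space P) = \<xi> p k -` A \<inter> space (sigma (space P) G)"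
        by (auto simp: X1_def space_G)
      ultimately show "\<xi> p k -` A \<inter> space (sigma (space P) G) \<in> sets (sigma (space P) G)"
        unfolding sets_G by (metis sigma_sets.Basic)
    qed simp
  qed
  moreover have "sets (sigma (space P) G) = sigma_sets (space P) G"
    using G_ev sets.sets_into_space by (intro sets_measure_of) blast
  ultimately have XG: "X \<in> sigma_sets (space P) G"
    using X by auto
  \<comment> \<open>\<open>Bm\<close> and \<open>Cm\<close> express the past part and the later
    count of label m as events for its whole configuration, so that independence of the labels
    factors out the same product \<open>R\<close> with and without \<open>E\<close>.\<close>
  have base: "prob (Y \<inter> E) = prob Y * prob E" if "Y \<in> G" for Y
  proof -
    obtain B A3 where Y: "Y = X1 B \<inter> A3" and B: "\<And>m'. B m' \<in> sets config_space" and A3: "A3 \<in> sets Xi"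
      using \<open>Y \<in> G\<close> unfolding G_def by blast
    define Bm where "Bm = {S. S \<inter> past s \<in> B m}"
    have Bm: "Bm \<in> sets config_space"
      using measurable_sets[OF measurable_config_Int[OF measurable_ident_sets[OF refl] past_borel[of s]] B[of m]]
      by (simp add: Bm_def vimage_def)
    define Cm where "Cm = {S. ecount (S \<inter> C) \<in> A'}"
    have Cm: "Cm \<in> sets config_space"
      using measurable_sets[OF measurable_ecount[OF C(1)] A'] by (simp add: Cm_def vimage_def)
    define R where "R = (\<Prod>m'\<in>UNIV - {m}. prob {\<omega> \<in> space P. \<pi> m' \<omega> \<in> B m'})"
    have prodm: "prob {\<omega> \<in> space P. \<forall>m'. \<pi> m' \<omega> \<in> (B(m := D)) m'} = prob {\<omega> \<in> space P. \<pi> m \<omega> \<in> D} * R"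
      if "D \<in> sets config_space" for D
    proof -
      have "prob {\<omega> \<in> space P. \<forall>m'. \<pi> m' \<omega> \<in> (B(m := D)) m'} = (\<Prod>m'\<in>UNIV. prob {\<omega> \<in> space P. \<pi> m' \<omega> \<in> (B(m := D)) m'})"
        using that B by (intro prob_\<pi>_prod) auto
      also have "\<dots> = prob {\<omega> \<in> space P. \<pi> m \<omega> \<in> D} * (\<Prod>m'\<in>UNIV - {m}. prob {\<omega> \<in> space P. \<pi> m' \<omega> \<in> (B(m := D)) m'})"
        by (subst prod.remove[of _ m]) auto
      also have "(\<Prod>m'\<in>UNIV - {m}. prob {\<omega> \<in> space P. \<pi> m' \<omega> \<in> (B(m := D)) m'}) = R"
        unfolding R_def by (intro prod.cong) auto
      finally show ?thesis .
    qed
    have X1_eq: "X1 B = {\<omega> \<in> space P. \<forall>m'. \<pi> m' \<omega> \<in> (B(m := Bm)) m'}"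
      by (auto simp: X1_def g_def Bm_def split: if_splits)
    have X1E_eq: "X1 B \<inter> E = {\<omega> \<in> space P. \<forall>m'. \<pi> m' \<omega> \<in> (B(m := Bm \<inter> Cm)) m'}"
      unfolding X1_eq by (auto simp: E_def Cm_def split: if_splits)
    have E_eq: "E = {\<omega> \<in> space P. \<pi> m \<omega> \<in> Cm}"
      by (auto simp: E_def Cm_def)
    have pp: "prob {\<omega> \<in> space P. \<pi> m \<omega> \<in> Bm \<inter> Cm} = prob {\<omega> \<in> space P. \<pi> m \<omega> \<in> Bm} * prob {\<omega> \<in> space P. \<pi> m \<omega> \<in> Cm}"
      using poisson_indep_disjoint[OF prob_space_axioms poisson past_borel C(1) _ B A', of s m m] C(2)
      by (simp add: Bm_def Cm_def Int_commute conj_commute)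
    have "prob (X1 B \<inter> E) = prob {\<omega> \<in> space P. \<pi> m \<omega> \<in> Bm \<inter> Cm} * R"
      unfolding X1E_eq by (rule prodm[OF sets.Int[OF Bm Cm]])
    moreover have "prob (X1 B) = prob {\<omega> \<in> space P. \<pi> m \<omega> \<in> Bm} * R"
      unfolding X1_eq by (rule prodm[OF Bm])
    ultimately have "prob (X1 B \<inter> E) = prob (X1 B) * prob E"
      unfolding pp E_eq[symmetric] by simp
    moreover have "prob (X1 B \<inter> A3) = prob (X1 B) * prob A3"
      by (rule ind[OF X1_Pi[OF B] A3])
    moreover have "prob ((X1 B \<inter> E) \<inter> A3) = prob (X1 B \<inter> E) * prob A3"
      by (rule ind[OF sets.Int[OF X1_Pi[OF B] E_Pi] A3])
    moreover have "Y \<inter> E = (X1 B \<inter> E) \<inter> A3"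
      by (auto simp: Y)
    ultimately show ?thesis
      by (simp add: Y)
  qed
  have "indep_set (sigma_sets (space P) G) (sigma_sets (space P) {E})"
    using G_ev E_Pi Pi_ev base stable
    by (intro indep_set_sigma_sets indep_setI) (auto simp: Int_stable_def)
  from indep_setD[OF this XG, of E] show ?thesis
    by (simp add: E_def)
qed

text \<open>The compensation formula on one rectangle: the count is expanded over its values,
  \<open>past_indep\<close> splits each term, and the resummed mean is the Lebesgue measure.\<close>

lemma rect_expectation:
  assumes A: "A \<in> sets (F s)" and C: "C \<in> sets borel" "C \<inter> past s = {}" "bounded C" "C \<subseteq> UNIV \<times> {0..}"
  shows "(\<integral>\<^sup>+ \<omega>. indicator A \<omega> * ecount (\<pi> m \<omega> \<inter> C) \<partial>P) = emeasure P A * emeasure lborel C"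
proof -
  have [measurable]: "A \<in> events"
    using A F_le_P by blast
  have [measurable]: "(\<lambda>\<omega>. ecount (\<pi> m \<omega> \<inter> C)) \<in> borel_measurable P"
    by (rule measurable_ecount_compose[OF \<pi>_measurable C(1)])
  have ex: "ecount (\<pi> m \<omega> \<inter> C) = (\<Sum>j. of_nat j * indicator {\<omega> \<in> space P. ecount (\<pi> m \<omega> \<inter> C) = of_nat j} \<omega>)"
    if "\<omega> \<in> space P" for \<omega>
    using ecount_eq_suminf[OF \<pi>_finite[OF that C(3), of m]] that by (simp add: indicator_def of_bool_def)
  have "(\<integral>\<^sup>+ \<omega>. indicator A \<omega> * ecount (\<pi> m \<omega> \<inter> C) \<partial>P) =
    (\<integral>\<^sup>+ \<omega>. (\<Sum>j. of_nat j * indicator (A \<inter> {\<omega> \<in> space P. ecount (\<pi> m \<omega> \<inter> C) = of_nat j}) \<omega>) \<partial>P)"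
  proof (rule nn_integral_cong)
    fix \<omega>
    assume "\<omega> \<in> space P"
    then have "indicator A \<omega> * ecount (\<pi> m \<omega> \<inter> C) =
        indicator A \<omega> * (\<Sum>j. of_nat j * indicator {\<omega> \<in> space P. ecount (\<pi> m \<omega> \<inter> C) = of_nat j} \<omega>)"
      by (rule arg_cong[OF ex])
    also have "\<dots> = (\<Sum>j. indicator A \<omega> * (of_nat j * indicator {\<omega> \<in> space P. ecount (\<pi> m \<omega> \<inter> C) = of_nat j} \<omega>))"
      by (rule ennreal_suminf_cmult[symmetric])
    also have "\<dots> = (\<Sum>j. of_nat j * indicator (A \<inter> {\<omega> \<in> space P. ecount (\<pi> m \<omega> \<inter> C) = of_nat j}) \<omega>)"
      by (intro suminf_cong) (simp add: indicator_def)
    finally show "indicator A \<omega> * ecount (\<pi> m \<omega> \<inter> C) =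
      (\<Sum>j. of_nat j * indicator (A \<inter> {\<omega> \<in> space P. ecount (\<pi> m \<omega> \<inter> C) = of_nat j}) \<omega>)" .
  qed
  also have "\<dots> = (\<Sum>j. of_nat j * emeasure P (A \<inter> {\<omega> \<in> space P. ecount (\<pi> m \<omega> \<inter> C) = of_nat j}))"
    by (subst nn_integral_suminf) (auto simp: nn_integral_cmult)
  also have "\<dots> = (\<Sum>j. emeasure P A * (of_nat j * emeasure P {\<omega> \<in> space P. ecount (\<pi> m \<omega> \<inter> C) = of_nat j}))"
    using past_indep[OF A C(1,2), of "{of_nat _}" m]
    by (intro suminf_cong) (simp add: emeasure_eq_measure ennreal_mult mult_ac)
  also have "\<dots> = emeasure P A * (\<Sum>j. of_nat j * emeasure P {\<omega> \<in> space P. ecount (\<pi> m \<omega> \<inter> C) = of_nat j})"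
    by (rule ennreal_suminf_cmult)
  also have "(\<Sum>j. of_nat j * emeasure P {\<omega> \<in> space P. ecount (\<pi> m \<omega> \<inter> C) = of_nat j}) =
    (\<integral>\<^sup>+ \<omega>. (\<Sum>j. of_nat j * indicator {\<omega> \<in> space P. ecount (\<pi> m \<omega> \<inter> C) = of_nat j} \<omega>) \<partial>P)"
    by (subst nn_integral_suminf) (auto simp: nn_integral_cmult)
  also have "\<dots> = (\<integral>\<^sup>+ \<omega>. ecount (\<pi> m \<omega> \<inter> C) \<partial>P)"
    by (rule nn_integral_cong) (rule ex[symmetric])
  also have "\<dots> = emeasure lborel C"
    by (rule poisson_expectation[OF prob_space_axioms poisson C(1,4,3)])
  finally show ?thesis .
qed

text \<open>The boxes generate the product and, up to empty intersections, are stable under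
  intersection; the two sides of the compensation formula are compared on them.\<close>

lemma sets_Pred_pair:
  "sets (Pred \<Otimes>\<^sub>M (borel :: real measure)) = sigma_sets ((space P \<times> UNIV) \<times> UNIV)
     {(A \<times> {s<..t}) \<times> {a<..b} | A s t a b. s < t \<and> A \<in> sets (F s)}"
proof -
  let ?Ea = "{A \<times> {s<..t} | A s t. s < t \<and> A \<in> sets (F s)}"
  let ?Eb = "range (\<lambda>(a, b). {a <.. b :: real})"
  let ?G = "{(A \<times> {s<..t}) \<times> {a<..b} | A s t a b. s < t \<and> A \<in> sets (F s)}"
  have EaP: "?Ea \<subseteq> Pow (space Pred)"
    using sets.sets_into_space by fastforce
  have "sets (Pred \<Otimes>\<^sub>M (borel :: real measure)) = sets (sigma (space Pred \<times> space borel) {a \<times> b | a b. a \<in> ?Ea \<and> b \<in> ?Eb})"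
  proof (rule sets_pair_eq)
    show "?Ea \<subseteq> Pow (space Pred)" by fact
    show "sets Pred = sigma_sets (space Pred) ?Ea"
      by (simp add: sets_Pred)
    show "(\<lambda>i :: nat. space P \<times> {- real i - 1<..real i + 1}) ` UNIV \<subseteq> ?Ea"
      using sets.top[of "F _"] by (fastforce simp: space_F)
    show "\<Union> ((\<lambda>i :: nat. space P \<times> {- real i - 1<..real i + 1}) ` UNIV) = space Pred"
    proof -
      have "\<exists>i::nat. - real i - 1 < x \<and> x \<le> real i + 1" for x :: real
        by (rule exI[of _ "nat \<lceil>\<bar>x\<bar>\<rceil>"]) linarith
      then show ?thesis
        by auto
    qed
    show "?Eb \<subseteq> Pow (space borel)"
      by simp
    show "sets (borel :: real measure) = sigma_sets (space borel) ?Eb"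
      by (subst borel_sigma_sets_Ioc) (simp add: sets_measure_of)
    show "(\<lambda>i :: nat. {- real i - 1<..real i + 1}) ` UNIV \<subseteq> ?Eb"
      by auto
    show "\<Union> ((\<lambda>i :: nat. {- real i - 1<..real i + 1}) ` UNIV) = space (borel :: real measure)"
    proof -
      have "\<exists>i::nat. - real i - 1 < x \<and> x \<le> real i + 1" for x :: real
        by (rule exI[of _ "nat \<lceil>\<bar>x\<bar>\<rceil>"]) linarith
      then show ?thesis
        by auto
    qed
  qed auto
  also have "{a \<times> b | a b. a \<in> ?Ea \<and> b \<in> ?Eb} = ?G"
    by (auto; blast)
  also have "sets (sigma (space Pred \<times> space borel) ?G) = sigma_sets ((space P \<times> UNIV) \<times> UNIV) ?G"
  proof -
    have "?G \<subseteq> Pow ((space P \<times> UNIV) \<times> UNIV)"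
      using EaP by auto
    then have "sets (sigma ((space P \<times> UNIV) \<times> UNIV) ?G) = sigma_sets ((space P \<times> UNIV) \<times> UNIV) ?G"
      by (rule sets_measure_of)
    then show ?thesis
      by (simp only: space_Pred space_borel)
  qed
  finally show ?thesis .
qed

section \<open>The compensation formula for predictable integrands\<close>

definition upper_half :: "(real \<times> real) set" where
  "upper_half = UNIV \<times> {0..}"

lemma upper_half_borel [measurable]: "upper_half \<in> sets borel"
  unfolding upper_half_def by (intro borel_closed closed_Times) auto

lemma measurable_to_Pred: "(\<lambda>w. (fst w, fst (snd w))) \<in> measurable (P \<Otimes>\<^sub>M (borel :: (real \<times> real) measure)) Pred"
proof (rule measurableI)
  fix A
  assume "A \<in> sets Pred"
  then have "A \<in> sets (P \<Otimes>\<^sub>M borel)"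
    using Pred_le by blast
  moreover have "(\<lambda>w. (fst w, fst (snd w))) \<in> measurable (P \<Otimes>\<^sub>M (borel :: (real \<times> real) measure)) (P \<Otimes>\<^sub>M borel)"
    by measurable
  ultimately show "(\<lambda>w. (fst w, fst (snd w))) -` A \<inter> space (P \<Otimes>\<^sub>M (borel :: (real \<times> real) measure)) \<in> sets (P \<Otimes>\<^sub>M (borel :: (real \<times> real) measure))"
    by (rule measurable_sets[rotated])
qed (auto simp: space_pair_measure)

lemma measurable_to_Pred_pair:
  "(\<lambda>w. ((fst w, fst (snd w)), snd (snd w))) \<in> measurable (P \<Otimes>\<^sub>M (borel :: (real \<times> real) measure)) (Pred \<Otimes>\<^sub>M borel)"
  by (intro measurable_Pair measurable_to_Pred) measurable

text \<open>Both sides are integrals of f against measures on the product of the predictable and the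
  Borel \<sigma>-algebra. The measures agree on boxes by \<open>rect_expectation\<close>, and boxes
  of finite mass exhaust the space, so they agree everywhere;
  \<open>nn_integral_kernel_measure\<close> then returns to the iterated integrals.\<close>

theorem compensation:
  fixes f :: "('w \<times> real) \<times> real \<Rightarrow> ennreal"
  assumes f: "f \<in> borel_measurable (Pred \<Otimes>\<^sub>M borel)"
  shows "(\<integral>\<^sup>+ \<omega>. \<integral>\<^sup>+ z. f ((\<omega>, fst z), snd z) \<partial>count_space (\<pi> m \<omega>) \<partial>P) =
    (\<integral>\<^sup>+ \<omega>. \<integral>\<^sup>+ z. f ((\<omega>, fst z), snd z) \<partial>restrict_space lborel upper_half \<partial>P)"
proof -
  let ?g = "\<lambda>\<omega> z. ((\<omega>, fst z), snd z) :: ('w \<times> real) \<times> real"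
  let ?S = "Pred \<Otimes>\<^sub>M (borel :: real measure)"
  let ?M1 = "kernel_measure P ?S ?g (\<lambda>\<omega>. count_space (\<pi> m \<omega>))"
  let ?M2 = "kernel_measure P ?S ?g (\<lambda>_. restrict_space lborel upper_half)"
  have out1: "(\<lambda>\<omega>. \<integral>\<^sup>+ z. h (?g \<omega> z) \<partial>count_space (\<pi> m \<omega>)) \<in> borel_measurable P"
    if "h \<in> borel_measurable ?S" for h :: "_ \<Rightarrow> ennreal"
    using borel_measurable_count_nn_integral[OF \<pi>_measurable \<pi>_finite measurable_compose[OF measurable_to_Pred_pair that], of m]
    by simp
  have inn1: "?g \<omega> \<in> measurable (count_space (\<pi> m \<omega>)) ?S" if "\<omega> \<in> space P" for \<omega>
    using that by (auto simp: space_pair_measure)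
  have gm: "?g \<omega> \<in> measurable lborel ?S" if "\<omega> \<in> space P" for \<omega>
  proof -
    have "(\<lambda>z. (\<omega>, z)) \<in> measurable lborel (P \<Otimes>\<^sub>M (borel :: (real \<times> real) measure))"
      using that by measurable
    from measurable_compose[OF this measurable_to_Pred_pair] show ?thesis
      by simp
  qed
  have int2: "(\<integral>\<^sup>+ z. h (?g \<omega> z) \<partial>restrict_space lborel upper_half) = (\<integral>\<^sup>+ z. h (?g \<omega> z) * indicator upper_half z \<partial>lborel)"
    for h :: "_ \<Rightarrow> ennreal" and \<omega>
    by (subst nn_integral_restrict_space) auto
  have out2: "(\<lambda>\<omega>. \<integral>\<^sup>+ z. h (?g \<omega> z) \<partial>restrict_space lborel upper_half) \<in> borel_measurable P"
    if "h \<in> borel_measurable ?S" for h :: "_ \<Rightarrow> ennreal"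
  proof -
    have "(\<lambda>w. h ((fst w, fst (snd w)), snd (snd w))) \<in> borel_measurable (P \<Otimes>\<^sub>M (borel :: (real \<times> real) measure))"
      using measurable_compose[OF measurable_to_Pred_pair that] .
    then have [measurable]: "(\<lambda>w. h ((fst w, fst (snd w)), snd (snd w))) \<in> borel_measurable (P \<Otimes>\<^sub>M (lborel :: (real \<times> real) measure))"
      by (simp cong: measurable_cong_sets)
    have "(\<lambda>\<omega>. \<integral>\<^sup>+ z. h (?g \<omega> z) * indicator upper_half z \<partial>lborel) \<in> borel_measurable P"
      by (intro lborel.borel_measurable_nn_integral) (simp add: case_prod_beta')
    then show ?thesis
      by (simp add: int2)
  qed
  have inn2: "?g \<omega> \<in> measurable (restrict_space lborel upper_half) ?S" if "\<omega> \<in> space P" for \<omega>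
    using gm[OF that] by (rule measurable_restrict_space1)
  have box: "emeasure ?M1 Y = emeasure P A * emeasure lborel (({s<..t} \<times> {a<..b}) \<inter> upper_half)"
     "emeasure ?M2 Y = emeasure P A * emeasure lborel (({s<..t} \<times> {a<..b}) \<inter> upper_half)"
    if Y: "Y = (A \<times> {s<..t}) \<times> {a<..b}" "A \<in> sets (F s)" for Y A s t and a b :: real
  proof -
    define C where "C = ({s<..t} \<times> {a<..b}) \<inter> upper_half"
    have C1: "({s<..t} \<times> {a<..b}) \<in> sets (borel :: (real \<times> real) measure)"
      unfolding borel_prod[symmetric] by (intro pair_measureI) auto
    then have C: "C \<in> sets borel"
      by (simp add: C_def)
    have A: "A \<in> sets P"
      using Y(2) F_le_P by blast
    have YS: "Y \<in> sets ?S"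
      unfolding Y(1) by (intro pair_measureI Pred_rect Y(2)) auto
    have "bounded ({s<..t} \<times> {a<..b})"
      by (intro bounded_Times) (auto intro: bounded_subset[OF bounded_closed_interval])
    then have bC: "bounded C"
      unfolding C_def by (rule bounded_subset) auto
    have "emeasure ?M1 Y = (\<integral>\<^sup>+ \<omega>. \<integral>\<^sup>+ z. indicator Y (?g \<omega> z) \<partial>count_space (\<pi> m \<omega>) \<partial>P)"
      by (rule emeasure_kernel_measure[OF out1 _ YS]) auto
    also have "\<dots> = (\<integral>\<^sup>+ \<omega>. indicator A \<omega> * ecount (\<pi> m \<omega> \<inter> C) \<partial>P)"
    proof (rule nn_integral_cong)
      fix \<omega>
      assume \<omega>: "\<omega> \<in> space P"
      have "(\<integral>\<^sup>+ z. indicator Y (?g \<omega> z) \<partial>count_space (\<pi> m \<omega>)) = (\<integral>\<^sup>+ z. indicator A \<omega> * indicator C z \<partial>count_space (\<pi> m \<omega>))"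
        using \<pi>_half[OF \<omega>, of m]
        by (intro nn_integral_cong) (auto simp: Y(1) C_def upper_half_def indicator_def)
      then show "(\<integral>\<^sup>+ z. indicator Y (?g \<omega> z) \<partial>count_space (\<pi> m \<omega>)) = indicator A \<omega> * ecount (\<pi> m \<omega> \<inter> C)"
        by (simp add: nn_integral_cmult ecount_Int)
    qed
    \<comment> \<open>The time interval is open at s, so \<open>C\<close> does not meet the past of
      s, where the event A is known.\<close>
    also have "\<dots> = emeasure P A * emeasure lborel C"
      by (rule rect_expectation[OF Y(2) C _ bC]) (auto simp: C_def past_def upper_half_def)
    finally show "emeasure ?M1 Y = emeasure P A * emeasure lborel (({s<..t} \<times> {a<..b}) \<inter> upper_half)"
      by (simp add: C_def)
    have "emeasure ?M2 Y = (\<integral>\<^sup>+ \<omega>. \<integral>\<^sup>+ z. indicator Y (?g \<omega> z) \<partial>restrict_space lborel upper_half \<partial>P)"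
      by (rule emeasure_kernel_measure[OF out2 _ YS]) (auto intro: measurable_compose[OF inn2])
    also have "\<dots> = (\<integral>\<^sup>+ \<omega>. indicator A \<omega> * emeasure lborel C \<partial>P)"
    proof (rule nn_integral_cong)
      fix \<omega>
      have "(\<integral>\<^sup>+ z. indicator Y (?g \<omega> z) * indicator upper_half z \<partial>lborel) = (\<integral>\<^sup>+ z. indicator A \<omega> * indicator C z \<partial>lborel)"
        by (intro nn_integral_cong) (auto simp: Y(1) C_def indicator_def)
      then show "(\<integral>\<^sup>+ z. indicator Y (?g \<omega> z) \<partial>restrict_space lborel upper_half) = indicator A \<omega> * emeasure lborel C"
        using C by (simp add: int2 nn_integral_cmult)
    qed
    also have "\<dots> = emeasure P A * emeasure lborel C"
      using A by (simp add: nn_integral_multc)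
    finally show "emeasure ?M2 Y = emeasure P A * emeasure lborel (({s<..t} \<times> {a<..b}) \<inter> upper_half)"
      by (simp add: C_def)
  qed
  let ?G = "{(A \<times> {s<..t}) \<times> {a<..b} | A s t (a::real) b. s < t \<and> A \<in> sets (F s)}"
  have eq: "?M1 = ?M2"
  proof (rule measure_eqI_generator_eq)
    show "Int_stable ?G"
    proof (rule Int_stableI)
      fix Y Y'
      assume "Y \<in> ?G" "Y' \<in> ?G"
      then obtain A s t a b A' s' t' a' b' where Y: "Y = (A \<times> {s<..t}) \<times> {a<..b}" "A \<in> sets (F s)"
        and Y': "Y' = (A' \<times> {s'<..t'}) \<times> {a'<..b'}" "A' \<in> sets (F s')"
        by blast
      have "A \<inter> A' \<in> sets (F (max s s'))"
        using Y(2) Y'(2) F_mono[of s "max s s'"] F_mono[of s' "max s s'"] by auto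
      moreover have eq: "Y \<inter> Y' = ((A \<inter> A') \<times> {max s s'<..min t t'}) \<times> {max a a'<..min b b'}"
        by (auto simp: Y(1) Y'(1))
      ultimately show "Y \<inter> Y' \<in> ?G"
      proof (cases "max s s' < min t t'")
        \<comment> \<open>Generators have a nonempty time interval, so an empty intersection is
          represented by a box whose base is empty.\<close>
        case False
        then have "Y \<inter> Y' = ({} \<times> {0<..1}) \<times> {0<..1}"
          unfolding eq by auto
        moreover have "({} :: 'w set) \<in> sets (F 0)" "(0::real) < 1"
          by auto
        ultimately show ?thesis
          by blast
      qed blast
    qed
    show "?G \<subseteq> Pow ((space P \<times> UNIV) \<times> UNIV)"
      using sets.sets_into_space by fastforce
    show "emeasure ?M1 Y = emeasure ?M2 Y" if "Y \<in> ?G" for Y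
      using that box by auto
    show "sets ?M1 = sigma_sets ((space P \<times> UNIV) \<times> UNIV) ?G" "sets ?M2 = sigma_sets ((space P \<times> UNIV) \<times> UNIV) ?G"
      by (simp_all only: sets_kernel_measure sets_Pred_pair)
    let ?A = "\<lambda>i::nat. (space P \<times> {- real i - 1<..real i + 1}) \<times> {- real i - 1<..real i + 1}"
    have sp: "space P \<in> sets (F s)" for s
      using sets.top[of "F s"] by simp
    show "range ?A \<subseteq> ?G"
    proof
      fix Y
      assume "Y \<in> range ?A"
      then obtain i :: nat where "Y = ?A i"
        by auto
      moreover have "- real i - 1 < real i + 1"
        by simp
      ultimately show "Y \<in> ?G"
        using sp by blast
    qed
    have "\<exists>i::nat. (- real i - 1 < x \<and> x \<le> real i + 1) \<and> (- real i - 1 < y \<and> y \<le> real i + 1)" for x y :: real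
      by (rule exI[of _ "nat \<lceil>max \<bar>x\<bar> \<bar>y\<bar>\<rceil>"]) linarith
    then show "(\<Union>i. ?A i) = (space P \<times> UNIV) \<times> UNIV"
      by auto
    show "emeasure ?M1 (?A i) \<noteq> \<infinity>" for i
    proof -
      have "bounded ({- real i - 1<..real i + 1} \<times> {- real i - 1<..real i + 1})"
        by (intro bounded_Times) (auto intro: bounded_subset[OF bounded_closed_interval])
      then have "bounded (({- real i - 1<..real i + 1} \<times> {- real i - 1<..real i + 1}) \<inter> upper_half)"
        by (rule bounded_subset) auto
      from emeasure_bounded_finite[OF this] show ?thesis
        unfolding box(1)[OF refl sp] by (simp add: emeasure_space_1 less_top)
    qed
  qed
  show ?thesis
    using nn_integral_kernel_measure[OF out1 inn1 f] nn_integral_kernel_measure[OF out2 inn2 f] eq by simp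
qed

text \<open>The integrand only needs a bound, at each time s, for its integral over the heights.
  After an exchange of integrals the deterministic kernel \<open>g\<close> stands against the mean
  of \<open>D\<close> at a fixed time, which is where moment bounds enter.\<close>

lemma thinning_bound:
  fixes f :: "('w \<times> real) \<times> real \<Rightarrow> ennreal"
  assumes f: "f \<in> borel_measurable (Pred \<Otimes>\<^sub>M borel)"
    and D: "D \<in> borel_measurable Pred" and g [measurable]: "g \<in> borel_measurable borel"
    and bd: "\<And>\<omega> s. \<omega> \<in> space P \<Longrightarrow> (\<integral>\<^sup>+ x. f ((\<omega>, s), x) * indicator {0..} x \<partial>lborel) \<le> g s * D (\<omega>, s)"
  shows "(\<integral>\<^sup>+ \<omega>. \<integral>\<^sup>+ z. f ((\<omega>, fst z), snd z) \<partial>count_space (\<pi> m \<omega>) \<partial>P) \<le> (\<integral>\<^sup>+ s. g s * (\<integral>\<^sup>+ \<omega>. D (\<omega>, s) \<partial>P) \<partial>lborel)"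
proof -
  interpret L: pair_sigma_finite P "lborel :: real measure" ..
  have [measurable]: "D \<in> borel_measurable (P \<Otimes>\<^sub>M borel)"
    by (rule measurable_Pred_P[OF D])
  have "(\<integral>\<^sup>+ \<omega>. \<integral>\<^sup>+ z. f ((\<omega>, fst z), snd z) \<partial>count_space (\<pi> m \<omega>) \<partial>P) =
    (\<integral>\<^sup>+ \<omega>. \<integral>\<^sup>+ z. f ((\<omega>, fst z), snd z) * indicator upper_half z \<partial>lborel \<partial>P)"
    unfolding compensation[OF f] by (intro nn_integral_cong) (simp add: nn_integral_restrict_space)
  also have "\<dots> \<le> (\<integral>\<^sup>+ \<omega>. \<integral>\<^sup>+ s. g s * D (\<omega>, s) \<partial>lborel \<partial>P)"
  proof (rule nn_integral_mono)
    fix \<omega>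
    assume \<omega>: "\<omega> \<in> space P"
    have "(\<lambda>z. (\<omega>, z)) \<in> measurable borel (P \<Otimes>\<^sub>M (borel :: (real \<times> real) measure))"
      using \<omega> by measurable
    from measurable_compose[OF measurable_compose[OF this measurable_to_Pred_pair] f]
    have [measurable]: "(\<lambda>z. f ((\<omega>, fst z), snd z)) \<in> borel_measurable borel"
      by simp
    have m: "(\<lambda>z. f ((\<omega>, fst z), snd z) * indicator upper_half z) \<in> borel_measurable (lborel \<Otimes>\<^sub>M lborel)"
      unfolding lborel_prod by measurable
    have "(\<integral>\<^sup>+ z. f ((\<omega>, fst z), snd z) * indicator upper_half z \<partial>lborel) =
      (\<integral>\<^sup>+ s. \<integral>\<^sup>+ x. f ((\<omega>, s), x) * indicator upper_half (s, x) \<partial>lborel \<partial>lborel)"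
      using lborel.nn_integral_fst[OF m] unfolding lborel_prod by simp
    also have "\<dots> = (\<integral>\<^sup>+ s. \<integral>\<^sup>+ x. f ((\<omega>, s), x) * indicator {0..} x \<partial>lborel \<partial>lborel)"
      by (intro nn_integral_cong) (auto simp: upper_half_def indicator_def)
    also have "\<dots> \<le> (\<integral>\<^sup>+ s. g s * D (\<omega>, s) \<partial>lborel)"
      by (intro nn_integral_mono bd \<omega>)
    finally show "(\<integral>\<^sup>+ z. f ((\<omega>, fst z), snd z) * indicator upper_half z \<partial>lborel) \<le> (\<integral>\<^sup>+ s. g s * D (\<omega>, s) \<partial>lborel)" .
  qed
  also have "\<dots> = (\<integral>\<^sup>+ s. \<integral>\<^sup>+ \<omega>. g s * D (\<omega>, s) \<partial>P \<partial>lborel)"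
    by (rule L.Fubini'[symmetric]) measurable
  also have "\<dots> = (\<integral>\<^sup>+ s. g s * (\<integral>\<^sup>+ \<omega>. D (\<omega>, s) \<partial>P) \<partial>lborel)"
    by (intro nn_integral_cong nn_integral_cmult) measurable
  finally show ?thesis .
qed

end

subsection \<open>Moment estimates for the drive\<close>

lemma nn_integral_reflect:
  fixes f :: "real \<Rightarrow> ennreal"
  assumes [measurable]: "f \<in> borel_measurable borel"
  shows "(\<integral>\<^sup>+ s. f (t - s) \<partial>lborel) = (\<integral>\<^sup>+ s. f s \<partial>lborel)"
  using nn_integral_real_affine[of f "-1" t] by simp

lemma ennreal_abs_sums:
  fixes f :: "'a \<Rightarrow> real" and g :: "'b \<Rightarrow> real"
  shows "ennreal ((\<Sum>i\<in>A. \<bar>f i\<bar>) + (\<Sum>j\<in>B. \<bar>g j\<bar>)) = (\<Sum>i\<in>A. ennreal \<bar>f i\<bar>) + (\<Sum>j\<in>B. ennreal \<bar>g j\<bar>)"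
  by (simp add: ennreal_plus sum_nonneg)

lemma ennreal_abs_diff_sums_le:
  fixes f f' :: "'a \<Rightarrow> real" and g g' :: "'b \<Rightarrow> real"
  assumes "\<And>i. ennreal \<bar>f i - f' i\<bar> \<le> A i" "\<And>j. ennreal \<bar>g j - g' j\<bar> \<le> B j"
  shows "ennreal \<bar>((\<Sum>i\<in>I. f i) + (\<Sum>j\<in>J. g j)) - ((\<Sum>i\<in>I. f' i) + (\<Sum>j\<in>J. g' j))\<bar>
    \<le> (\<Sum>i\<in>I. A i) + (\<Sum>j\<in>J. B j)"
proof -
  have "\<bar>((\<Sum>i\<in>I. f i) + (\<Sum>j\<in>J. g j)) - ((\<Sum>i\<in>I. f' i) + (\<Sum>j\<in>J. g' j))\<bar> =
    \<bar>(\<Sum>i\<in>I. f i - f' i) + (\<Sum>j\<in>J. g j - g' j)\<bar>"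
    by (simp add: sum_subtractf)
  also have "\<dots> \<le> (\<Sum>i\<in>I. \<bar>f i - f' i\<bar>) + (\<Sum>j\<in>J. \<bar>g j - g' j\<bar>)"
    by (rule order.trans[OF abs_triangle_ineq]) (intro add_mono sum_abs)
  finally have "ennreal \<bar>((\<Sum>i\<in>I. f i) + (\<Sum>j\<in>J. g j)) - ((\<Sum>i\<in>I. f' i) + (\<Sum>j\<in>J. g' j))\<bar> \<le>
    ennreal ((\<Sum>i\<in>I. \<bar>f i - f' i\<bar>) + (\<Sum>j\<in>J. \<bar>g j - g' j\<bar>))"
    by (rule ennreal_leI)
  also have "\<dots> = (\<Sum>i\<in>I. ennreal \<bar>f i - f' i\<bar>) + (\<Sum>j\<in>J. ennreal \<bar>g j - g' j\<bar>)"
    by (rule ennreal_abs_sums)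
  also have "\<dots> \<le> (\<Sum>i\<in>I. A i) + (\<Sum>j\<in>J. B j)"
    by (intro add_mono sum_mono assms)
  finally show ?thesis .
qed

text \<open>The infimum of the Lipschitz constants is itself one: every difference quotient is a
  lower bound of the set of constants.\<close>

lemma lipschitz_constD:
  assumes "\<exists>L. L-lipschitz_on UNIV f"
  shows "\<bar>f x - f y\<bar> \<le> lipschitz_const f * \<bar>x - y\<bar>" "0 \<le> lipschitz_const f"
proof -
  have ne: "{L. L-lipschitz_on UNIV f} \<noteq> {}"
    using assms by auto
  show "0 \<le> lipschitz_const f"
    unfolding lipschitz_const_def using ne by (intro cInf_greatest) (auto simp: lipschitz_on_def)
  show "\<bar>f x - f y\<bar> \<le> lipschitz_const f * \<bar>x - y\<bar>"
  proof (cases "x = y")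
    case False
    have "\<bar>f x - f y\<bar> / \<bar>x - y\<bar> \<le> lipschitz_const f"
      unfolding lipschitz_const_def
    proof (rule cInf_greatest[OF ne])
      fix L
      assume "L \<in> {L. L-lipschitz_on UNIV f}"
      then have "\<bar>f x - f y\<bar> \<le> L * \<bar>x - y\<bar>"
        using lipschitz_onD[of L UNIV f x y] by (simp add: dist_real_def)
      then show "\<bar>f x - f y\<bar> / \<bar>x - y\<bar> \<le> L"
        using False by (simp add: divide_simps)
    qed
    then show ?thesis
      using False by (simp add: divide_simps)
  qed simp
qed

lemma nn_integral_grid_le_norm1_grid:
  assumes "valid_grids n \<phi>"
  shows "(\<integral>\<^sup>+ k. ennreal \<bar>ext0 f (t - k)\<bar> \<partial>count_space (grid n \<phi> p)) \<le> norm1_grid (real (n p)) f"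
proof -
  have "1 \<le> n p"
    using assms by (simp add: valid_grids_def)
  then have np: "real (n p) > 0"
    by simp
  \<comment> \<open>The grid is enumerated downwards, so that t - e j is a translate t - \<phi> p +
    j / n p, as in the supremum defining \<open>norm1_grid\<close>.\<close>
  define e where "e j = \<phi> p - of_int j / real (n p)" for j :: int
  have e: "bij_betw e UNIV (grid n \<phi> p)"
    unfolding bij_betw_def
  proof
    show "inj e"
      using np by (auto simp: inj_on_def e_def)
    show "range e = grid n \<phi> p"
    proof
      show "range e \<subseteq> grid n \<phi> p"
      proof
        fix x
        assume "x \<in> range e"
        then obtain j where "x = e j"
          by auto
        then have "x = of_int (- j) / real (n p) + \<phi> p"
          by (simp add: e_def)
        then show "x \<in> grid n \<phi> p"
          unfolding grid_def by blast
      qed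
      show "grid n \<phi> p \<subseteq> range e"
      proof
        fix x
        assume "x \<in> grid n \<phi> p"
        then obtain j :: int where "x = of_int j / real (n p) + \<phi> p"
          unfolding grid_def by blast
        then have "x = e (- j)"
          by (simp add: e_def)
        then show "x \<in> range e"
          by blast
      qed
    qed
  qed
  have "(\<integral>\<^sup>+ k. ennreal \<bar>ext0 f (t - k)\<bar> \<partial>count_space (grid n \<phi> p)) =
    (\<integral>\<^sup>+ j. ennreal \<bar>ext0 f (t - e j)\<bar> \<partial>count_space UNIV)"
    by (rule nn_integral_bij_count_space[OF e, symmetric])
  also have "\<dots> \<le> (\<Sum>\<^sub>\<infinity>j\<in>UNIV. ennreal \<bar>ext0 f (t - e j)\<bar>)"
    by (rule nn_integral_count_space_le_infsum)
  also have "\<dots> = (\<Sum>\<^sub>\<infinity>j\<in>UNIV. ennreal \<bar>ext0 f ((t - \<phi> p) + of_int j / real (n p))\<bar>)"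
    by (simp add: e_def algebra_simps)
  also have "\<dots> \<le> norm1_grid (real (n p)) f"
    unfolding norm1_grid_def by (rule SUP_upper) simp
  finally show ?thesis .
qed

context har_noise
begin

text \<open>The entries of the matrix without the Lipschitz factors, since the drive is estimated
  before \<open>Phi\<close> is applied.\<close>

definition knorm :: "'m + 'p \<Rightarrow> 'm + 'p \<Rightarrow> ennreal" where
  "knorm \<alpha> \<beta> = (case \<beta> of Inl m \<Rightarrow> norm1 (hN \<MM> \<alpha> m) | Inr p \<Rightarrow> norm1_grid (real (n p)) (hW \<MM> \<alpha> p))"

lemma sum_knorm: "(\<Sum>\<beta>\<in>UNIV. knorm \<alpha> \<beta> * a \<beta>) =
    (\<Sum>m\<in>UNIV. norm1 (hN \<MM> \<alpha> m) * a (Inl m)) + (\<Sum>p\<in>UNIV. norm1_grid (real (n p)) (hW \<MM> \<alpha> p) * a (Inr p))"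
  using sum.Plus[of "UNIV :: 'm set" "UNIV :: 'p set" "\<lambda>\<beta>. knorm \<alpha> \<beta> * a \<beta>"] by (simp add: knorm_def)

text \<open>A bound for almost every s is enough under the time integral, which fits intensities
  that are determined only up to null sets.\<close>

lemma kernel_integral_le:
  fixes E :: "real \<Rightarrow> ennreal"
  assumes "AE s in lborel. E s \<le> c"
  shows "(\<integral>\<^sup>+ s. ennreal \<bar>ext0 (hN \<MM> \<alpha> m) (t - s)\<bar> * E s \<partial>lborel) \<le> norm1 (hN \<MM> \<alpha> m) * c"
proof -
  have "(\<integral>\<^sup>+ s. ennreal \<bar>ext0 (hN \<MM> \<alpha> m) (t - s)\<bar> * E s \<partial>lborel) \<le>
    (\<integral>\<^sup>+ s. ennreal \<bar>ext0 (hN \<MM> \<alpha> m) (t - s)\<bar> * c \<partial>lborel)"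
    using assms by (intro nn_integral_mono_AE) (auto elim!: eventually_mono intro: mult_left_mono)
  also have "\<dots> = (\<integral>\<^sup>+ s. ennreal \<bar>ext0 (hN \<MM> \<alpha> m) (t - s)\<bar> \<partial>lborel) * c"
    by (rule nn_integral_multc) measurable
  also have "(\<integral>\<^sup>+ s. ennreal \<bar>ext0 (hN \<MM> \<alpha> m) (t - s)\<bar> \<partial>lborel) = norm1 (hN \<MM> \<alpha> m)"
    unfolding norm1_def by (rule nn_integral_reflect) measurable
  finally show ?thesis .
qed

lemma measurable_lam_P [measurable (raw)]:
  fixes lam :: "real \<Rightarrow> 'w \<Rightarrow> real"
  assumes "(\<lambda>(\<omega>, t). lam t \<omega>) \<in> borel_measurable Pred"
  shows "lam t \<in> borel_measurable P"
  using measurable_F_P[OF measurable_F_section[OF assms[unfolded case_prod_beta'], where t = t]] by simp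

lemma measurable_pair_swap_Pred:
  assumes "(\<lambda>(\<omega>, t). lam t \<omega>) \<in> borel_measurable Pred"
  shows "(\<lambda>w. lam (snd (fst w)) (fst (fst w))) \<in> borel_measurable (Pred \<Otimes>\<^sub>M (borel :: real measure))"
  using measurable_compose[OF measurable_fst assms, of "borel :: real measure"] by (simp add: case_prod_beta')

text \<open>At time s an atom is kept by exactly one of the two thinnings only if its height lies
  between the two intensities, in an interval of length equal to their distance. This is what makes
  thinning a Lipschitz operation in mean.\<close>

lemma point_diff_expectation:
  fixes lam lam' :: "real \<Rightarrow> 'w \<Rightarrow> real"
  assumes lam: "(\<lambda>(\<omega>, t). lam t \<omega>) \<in> borel_measurable Pred" and lam': "(\<lambda>(\<omega>, t). lam' t \<omega>) \<in> borel_measurable Pred"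
    and [measurable]: "g \<in> borel_measurable borel"
  shows "(\<integral>\<^sup>+ \<omega>. \<integral>\<^sup>+ z. (if (snd z \<le> lam (fst z) \<omega>) \<noteq> (snd z \<le> lam' (fst z) \<omega>) then g (fst z) else 0) \<partial>count_space (\<pi> m \<omega>) \<partial>P)
    \<le> (\<integral>\<^sup>+ s. g s * (\<integral>\<^sup>+ \<omega>. ennreal \<bar>lam s \<omega> - lam' s \<omega>\<bar> \<partial>P) \<partial>lborel)"
proof -
  note [measurable] = measurable_pair_swap_Pred[OF lam] measurable_pair_swap_Pred[OF lam']
    lam[unfolded case_prod_beta'] lam'[unfolded case_prod_beta']
  define f where "f w = (if (snd w \<le> lam (snd (fst w)) (fst (fst w))) \<noteq> (snd w \<le> lam' (snd (fst w)) (fst (fst w))) then g (snd (fst w)) else 0)"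
    for w :: "('w \<times> real) \<times> real"
  have [measurable]: "(\<lambda>w :: ('w \<times> real) \<times> real. snd (fst w)) \<in> borel_measurable (Pred \<Otimes>\<^sub>M borel)"
    using measurable_compose[OF measurable_fst measurable_Pred_snd] .
  have "(\<integral>\<^sup>+ \<omega>. \<integral>\<^sup>+ z. f ((\<omega>, fst z), snd z) \<partial>count_space (\<pi> m \<omega>) \<partial>P) \<le>
    (\<integral>\<^sup>+ s. g s * (\<integral>\<^sup>+ \<omega>. (\<lambda>z. ennreal \<bar>lam (snd z) (fst z) - lam' (snd z) (fst z)\<bar>) (\<omega>, s) \<partial>P) \<partial>lborel)"
  proof (rule thinning_bound)
    show "f \<in> borel_measurable (Pred \<Otimes>\<^sub>M borel)"
      unfolding f_def[abs_def] by measurable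
    show "(\<integral>\<^sup>+ x. f ((\<omega>, s), x) * indicator {0..} x \<partial>lborel) \<le> g s * (\<lambda>z. ennreal \<bar>lam (snd z) (fst z) - lam' (snd z) (fst z)\<bar>) (\<omega>, s)" for \<omega> s
    proof -
      have "(\<integral>\<^sup>+ x. f ((\<omega>, s), x) * indicator {0..} x \<partial>lborel) \<le>
        (\<integral>\<^sup>+ x. g s * indicator {min (lam s \<omega>) (lam' s \<omega>)..max (lam s \<omega>) (lam' s \<omega>)} x \<partial>lborel)"
        by (rule nn_integral_mono) (auto simp: f_def indicator_def split: if_splits)
      also have "\<dots> = g s * ennreal \<bar>lam s \<omega> - lam' s \<omega>\<bar>"
        by (simp add: nn_integral_cmult max_def min_def abs_if)
      finally show ?thesis
        by simp
    qed
  qed measurable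
  then show ?thesis
    unfolding f_def fst_conv snd_conv .
qed

text \<open>The kept atoms at time s have heights in an interval of length at most the absolute
  value of the intensity; a negative intensity keeps none.\<close>

lemma point_expectation:
  fixes lam :: "real \<Rightarrow> 'w \<Rightarrow> real"
  assumes lam: "(\<lambda>(\<omega>, t). lam t \<omega>) \<in> borel_measurable Pred"
    and [measurable]: "g \<in> borel_measurable borel"
  shows "(\<integral>\<^sup>+ \<omega>. \<integral>\<^sup>+ z. (if snd z \<le> lam (fst z) \<omega> then g (fst z) else 0) \<partial>count_space (\<pi> m \<omega>) \<partial>P)
    \<le> (\<integral>\<^sup>+ s. g s * (\<integral>\<^sup>+ \<omega>. ennreal \<bar>lam s \<omega>\<bar> \<partial>P) \<partial>lborel)"
proof -
  note [measurable] = measurable_pair_swap_Pred[OF lam] lam[unfolded case_prod_beta']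
  define f where "f w = (if snd w \<le> lam (snd (fst w)) (fst (fst w)) then g (snd (fst w)) else 0)"
    for w :: "('w \<times> real) \<times> real"
  have [measurable]: "(\<lambda>w :: ('w \<times> real) \<times> real. snd (fst w)) \<in> borel_measurable (Pred \<Otimes>\<^sub>M borel)"
    using measurable_compose[OF measurable_fst measurable_Pred_snd] .
  have "(\<integral>\<^sup>+ \<omega>. \<integral>\<^sup>+ z. f ((\<omega>, fst z), snd z) \<partial>count_space (\<pi> m \<omega>) \<partial>P) \<le>
    (\<integral>\<^sup>+ s. g s * (\<integral>\<^sup>+ \<omega>. (\<lambda>z. ennreal \<bar>lam (snd z) (fst z)\<bar>) (\<omega>, s) \<partial>P) \<partial>lborel)"
  proof (rule thinning_bound)
    show "f \<in> borel_measurable (Pred \<Otimes>\<^sub>M borel)"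
      unfolding f_def[abs_def] by measurable
    show "(\<integral>\<^sup>+ x. f ((\<omega>, s), x) * indicator {0..} x \<partial>lborel) \<le> g s * (\<lambda>z. ennreal \<bar>lam (snd z) (fst z)\<bar>) (\<omega>, s)" for \<omega> s
    proof -
      have "(\<integral>\<^sup>+ x. f ((\<omega>, s), x) * indicator {0..} x \<partial>lborel) \<le> (\<integral>\<^sup>+ x. g s * indicator {0..\<bar>lam s \<omega>\<bar>} x \<partial>lborel)"
        by (rule nn_integral_mono) (auto simp: f_def indicator_def split: if_splits)
      also have "\<dots> = g s * ennreal \<bar>lam s \<omega>\<bar>"
        by (simp add: nn_integral_cmult)
      finally show ?thesis
        by simp
    qed
  qed measurable
  then show ?thesis
    unfolding f_def fst_conv snd_conv .
qed

lemma JW_bounds: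
  assumes "s > 0"
  shows "\<bar>JW \<MM> \<alpha> p s w\<bar> \<le> hW \<MM> \<alpha> p s * \<bar>w\<bar> + bW \<MM> \<alpha> p s"
    and "\<bar>JW \<MM> \<alpha> p s w - JW \<MM> \<alpha> p s w'\<bar> \<le> hW \<MM> \<alpha> p s * \<bar>w - w'\<bar>"
    and "0 \<le> hW \<MM> \<alpha> p s" "0 \<le> bW \<MM> \<alpha> p s"
  using params assms by (auto simp: valid_params_def)

text \<open>The sums of absolute values are defined whether or not the drive converges, and
  convergence is their finiteness.\<close>

definition abs_points :: "(real \<Rightarrow> 'w \<Rightarrow> real) \<Rightarrow> 'm + 'p \<Rightarrow> 'm \<Rightarrow> real \<Rightarrow> 'w \<Rightarrow> ennreal" where
  "abs_points lam \<alpha> m t \<omega> = (\<integral>\<^sup>+ s. ennreal \<bar>hN \<MM> \<alpha> m (t - s)\<bar> \<partial>count_space (pts (\<pi> m \<omega>) (\<lambda>s. lam s \<omega>) \<inter> {..<t}))"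

definition abs_grid :: "(real \<Rightarrow> 'w \<Rightarrow> real) \<Rightarrow> 'm + 'p \<Rightarrow> 'p \<Rightarrow> real \<Rightarrow> 'w \<Rightarrow> ennreal" where
  "abs_grid W \<alpha> p t \<omega> = (\<integral>\<^sup>+ k. ennreal \<bar>JW \<MM> \<alpha> p (t - k) (W k \<omega>)\<bar> \<partial>count_space (grid n \<phi> p \<inter> {..<t}))"

lemma thin_converges_iff:
  "thin_converges lam W \<alpha> t \<omega> \<longleftrightarrow> (\<forall>m. abs_points (lam m) \<alpha> m t \<omega> < \<infinity>) \<and> (\<forall>p. abs_grid (W p) \<alpha> p t \<omega> < \<infinity>)"
  unfolding thin_converges_def drive_converges_def summable_on_iff_nn_integral abs_points_def abs_grid_def ..

lemma abs_thin_drive_le: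
  "ennreal \<bar>thin_drive lam W \<alpha> t \<omega>\<bar> \<le> (\<Sum>m\<in>UNIV. abs_points (lam m) \<alpha> m t \<omega>) + (\<Sum>p\<in>UNIV. abs_grid (W p) \<alpha> p t \<omega>)"
proof -
  let ?a = "\<lambda>m. infsum (\<lambda>s. hN \<MM> \<alpha> m (t - s)) (pts (\<pi> m \<omega>) (\<lambda>s. lam m s \<omega>) \<inter> {..<t})"
  let ?b = "\<lambda>p. infsum (\<lambda>k. JW \<MM> \<alpha> p (t - k) (W p k \<omega>)) (grid n \<phi> p \<inter> {..<t})"
  have "\<bar>thin_drive lam W \<alpha> t \<omega>\<bar> \<le> (\<Sum>m\<in>UNIV. \<bar>?a m\<bar>) + (\<Sum>p\<in>UNIV. \<bar>?b p\<bar>)"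
    unfolding thin_drive_def drive_def
    by (rule order.trans[OF abs_triangle_ineq]) (intro add_mono sum_abs)
  then have "ennreal \<bar>thin_drive lam W \<alpha> t \<omega>\<bar> \<le> ennreal ((\<Sum>m\<in>UNIV. \<bar>?a m\<bar>) + (\<Sum>p\<in>UNIV. \<bar>?b p\<bar>))"
    by (rule ennreal_leI)
  also have "\<dots> = (\<Sum>m\<in>UNIV. ennreal \<bar>?a m\<bar>) + (\<Sum>p\<in>UNIV. ennreal \<bar>?b p\<bar>)"
    by (rule ennreal_abs_sums)
  also have "\<dots> \<le> (\<Sum>m\<in>UNIV. abs_points (lam m) \<alpha> m t \<omega>) + (\<Sum>p\<in>UNIV. abs_grid (W p) \<alpha> p t \<omega>)"
    unfolding abs_points_def abs_grid_def by (intro add_mono sum_mono abs_infsum_le)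
  finally show ?thesis .
qed

lemma measurable_abs_points [measurable (raw)]:
  assumes "(\<lambda>(\<omega>, t). lam t \<omega>) \<in> borel_measurable Pred"
  shows "abs_points lam \<alpha> m t \<in> borel_measurable P"
  using measurable_F_P[OF measurable_F_section[OF measurable_point_sum(2)[OF assms, where \<alpha> = \<alpha> and m = m], where t = t]]
  by (simp add: abs_points_def[abs_def])

lemma measurable_abs_grid [measurable (raw)]:
  assumes "\<And>k. k \<in> grid n \<phi> p \<Longrightarrow> W k \<in> borel_measurable (F k)"
  shows "abs_grid W \<alpha> p t \<in> borel_measurable P"
  using measurable_F_P[OF measurable_F_section[OF measurable_grid_sum(2)[OF assms, where \<alpha> = \<alpha>], where t = t]]
  by (simp add: abs_grid_def[abs_def])

lemma abs_points_expectation: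
  assumes lam: "(\<lambda>(\<omega>, t). lam t \<omega>) \<in> borel_measurable Pred"
    and c: "AE s in lborel. (\<integral>\<^sup>+ \<omega>. ennreal \<bar>lam s \<omega>\<bar> \<partial>P) \<le> c"
  shows "(\<integral>\<^sup>+ \<omega>. abs_points lam \<alpha> m t \<omega> \<partial>P) \<le> norm1 (hN \<MM> \<alpha> m) * c"
proof -
  have "(\<integral>\<^sup>+ \<omega>. abs_points lam \<alpha> m t \<omega> \<partial>P) =
    (\<integral>\<^sup>+ \<omega>. \<integral>\<^sup>+ z. (if snd z \<le> lam (fst z) \<omega> then ennreal \<bar>ext0 (hN \<MM> \<alpha> m) (t - fst z)\<bar> else 0) \<partial>count_space (\<pi> m \<omega>) \<partial>P)"
  proof (rule nn_integral_cong)
    fix \<omega>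
    assume "\<omega> \<in> space P"
    then have inj: "inj_on fst (\<pi> m \<omega>)"
      using \<pi>_inj[of \<omega> m UNIV] by simp
    show "abs_points lam \<alpha> m t \<omega> = (\<integral>\<^sup>+ z. (if snd z \<le> lam (fst z) \<omega> then ennreal \<bar>ext0 (hN \<MM> \<alpha> m) (t - fst z)\<bar> else 0) \<partial>count_space (\<pi> m \<omega>))"
      unfolding abs_points_def nn_integral_count_pts[OF inj]
      by (intro nn_integral_cong) (auto simp: ext0_def)
  qed
  also have "\<dots> \<le> (\<integral>\<^sup>+ s. ennreal \<bar>ext0 (hN \<MM> \<alpha> m) (t - s)\<bar> * (\<integral>\<^sup>+ \<omega>. ennreal \<bar>lam s \<omega>\<bar> \<partial>P) \<partial>lborel)"
    by (rule point_expectation[OF lam]) measurable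
  also have "\<dots> \<le> norm1 (hN \<MM> \<alpha> m) * c"
    by (rule kernel_integral_le[OF c])
  finally show ?thesis .
qed

lemma grid_kernel_expectation:
  assumes X: "\<And>k. k \<in> grid n \<phi> p \<Longrightarrow> X k \<in> borel_measurable P"
    and c: "\<And>k. k \<in> grid n \<phi> p \<Longrightarrow> (\<integral>\<^sup>+ \<omega>. X k \<omega> \<partial>P) \<le> c"
  shows "(\<integral>\<^sup>+ \<omega>. \<integral>\<^sup>+ k. ennreal \<bar>ext0 f (t - k)\<bar> * X k \<omega> \<partial>count_space (grid n \<phi> p) \<partial>P) \<le> norm1_grid (real (n p)) f * c"
proof -
  have "(\<integral>\<^sup>+ \<omega>. \<integral>\<^sup>+ k. ennreal \<bar>ext0 f (t - k)\<bar> * X k \<omega> \<partial>count_space (grid n \<phi> p) \<partial>P) =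
    (\<integral>\<^sup>+ k. \<integral>\<^sup>+ \<omega>. ennreal \<bar>ext0 f (t - k)\<bar> * X k \<omega> \<partial>P \<partial>count_space (grid n \<phi> p))"
    using X by (intro nn_integral_count_space_nn_integral countable_grid) auto
  also have "\<dots> = (\<integral>\<^sup>+ k. ennreal \<bar>ext0 f (t - k)\<bar> * (\<integral>\<^sup>+ \<omega>. X k \<omega> \<partial>P) \<partial>count_space (grid n \<phi> p))"
    using X by (intro nn_integral_cong nn_integral_cmult) auto
  also have "\<dots> \<le> (\<integral>\<^sup>+ k. ennreal \<bar>ext0 f (t - k)\<bar> * c \<partial>count_space (grid n \<phi> p))"
    using c by (intro nn_integral_mono mult_left_mono) auto
  also have "\<dots> = (\<integral>\<^sup>+ k. ennreal \<bar>ext0 f (t - k)\<bar> \<partial>count_space (grid n \<phi> p)) * c"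
    by (rule nn_integral_multc) simp
  also have "\<dots> \<le> norm1_grid (real (n p)) f * c"
    by (intro mult_right_mono nn_integral_grid_le_norm1_grid grids) simp
  finally show ?thesis .
qed

lemma nn_integral_count_grid_le:
  assumes "\<And>k. k \<in> grid n \<phi> p \<Longrightarrow> k < t \<Longrightarrow> f k \<le> g k"
  shows "(\<integral>\<^sup>+ k. f k \<partial>count_space (grid n \<phi> p \<inter> {..<t})) \<le> (\<integral>\<^sup>+ k. g k \<partial>count_space (grid n \<phi> p))"
  using assms by (auto simp: nn_integral_count_space_indicator intro!: nn_integral_mono split: split_indicator)

lemma abs_grid_expectation:
  assumes W: "\<And>k. k \<in> grid n \<phi> p \<Longrightarrow> W k \<in> borel_measurable (F k)"
    and c: "\<And>k. k \<in> grid n \<phi> p \<Longrightarrow> (\<integral>\<^sup>+ \<omega>. ennreal \<bar>W k \<omega>\<bar> \<partial>P) \<le> c"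
  shows "(\<integral>\<^sup>+ \<omega>. abs_grid W \<alpha> p t \<omega> \<partial>P) \<le> norm1_grid (real (n p)) (hW \<MM> \<alpha> p) * c + norm1_grid (real (n p)) (bW \<MM> \<alpha> p)"
proof -
  have WP: "W k \<in> borel_measurable P" if "k \<in> grid n \<phi> p" for k
    by (rule measurable_F_P[OF W[OF that]])
  let ?h = "\<lambda>k. ennreal \<bar>ext0 (hW \<MM> \<alpha> p) (t - k)\<bar>" and ?b = "\<lambda>k. ennreal \<bar>ext0 (bW \<MM> \<alpha> p) (t - k)\<bar>"
  have "abs_grid W \<alpha> p t \<omega> \<le> (\<integral>\<^sup>+ k. ?h k * ennreal \<bar>W k \<omega>\<bar> \<partial>count_space (grid n \<phi> p)) + (\<integral>\<^sup>+ k. ?b k \<partial>count_space (grid n \<phi> p))" for \<omega>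
  proof -
    have "abs_grid W \<alpha> p t \<omega> \<le> (\<integral>\<^sup>+ k. ?h k * ennreal \<bar>W k \<omega>\<bar> + ?b k \<partial>count_space (grid n \<phi> p))"
      unfolding abs_grid_def
    proof (rule nn_integral_count_grid_le)
      fix k
      assume "k < t"
      then have "\<bar>JW \<MM> \<alpha> p (t - k) (W k \<omega>)\<bar> \<le> \<bar>ext0 (hW \<MM> \<alpha> p) (t - k)\<bar> * \<bar>W k \<omega>\<bar> + \<bar>ext0 (bW \<MM> \<alpha> p) (t - k)\<bar>"
        using JW_bounds(1)[of "t - k" \<alpha> p "W k \<omega>"] JW_bounds(3,4)[of "t - k" \<alpha> p] by (simp add: ext0_def)
      then show "ennreal \<bar>JW \<MM> \<alpha> p (t - k) (W k \<omega>)\<bar> \<le> ?h k * ennreal \<bar>W k \<omega>\<bar> + ?b k"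
        by (simp add: ennreal_leI flip: ennreal_mult ennreal_plus)
    qed
    then show ?thesis
      by (simp add: nn_integral_add)
  qed
  then have "(\<integral>\<^sup>+ \<omega>. abs_grid W \<alpha> p t \<omega> \<partial>P) \<le>
    (\<integral>\<^sup>+ \<omega>. (\<integral>\<^sup>+ k. ?h k * ennreal \<bar>W k \<omega>\<bar> \<partial>count_space (grid n \<phi> p)) + (\<integral>\<^sup>+ k. ?b k \<partial>count_space (grid n \<phi> p)) \<partial>P)"
    by (intro nn_integral_mono)
  also have "\<dots> = (\<integral>\<^sup>+ \<omega>. (\<integral>\<^sup>+ k. ?h k * ennreal \<bar>W k \<omega>\<bar> \<partial>count_space (grid n \<phi> p)) \<partial>P) + (\<integral>\<^sup>+ k. ?b k \<partial>count_space (grid n \<phi> p))"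
    using WP by (subst nn_integral_add)
      (auto simp: emeasure_space_1 intro!: borel_measurable_countable_nn_integral countable_grid)
  also have "\<dots> \<le> norm1_grid (real (n p)) (hW \<MM> \<alpha> p) * c + norm1_grid (real (n p)) (bW \<MM> \<alpha> p)"
    using WP c by (intro add_mono grid_kernel_expectation nn_integral_grid_le_norm1_grid grids) auto
  finally show ?thesis .
qed

text \<open>The linear growth estimate: together with finite norms it shows that the drive converges
  almost surely at each fixed time and that moments remain bounded under a Picard step.\<close>

lemma drive_total_expectation:
  assumes adm: "admissible lam W"
    and c: "AE s in lborel. \<forall>m. (\<integral>\<^sup>+ \<omega>. ennreal \<bar>lam m s \<omega>\<bar> \<partial>P) \<le> a (Inl m)"
      "\<And>p k. k \<in> grid n \<phi> p \<Longrightarrow> (\<integral>\<^sup>+ \<omega>. ennreal \<bar>W p k \<omega>\<bar> \<partial>P) \<le> a (Inr p)"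
  shows "(\<integral>\<^sup>+ \<omega>. (\<Sum>m\<in>UNIV. abs_points (lam m) \<alpha> m t \<omega>) + (\<Sum>p\<in>UNIV. abs_grid (W p) \<alpha> p t \<omega>) \<partial>P) \<le>
    (\<Sum>\<beta>\<in>UNIV. knorm \<alpha> \<beta> * a \<beta>) + (\<Sum>p\<in>UNIV. norm1_grid (real (n p)) (bW \<MM> \<alpha> p))"
proof -
  have lam: "(\<lambda>(\<omega>, t). lam m t \<omega>) \<in> borel_measurable Pred" for m
    using adm by (simp add: admissible_def)
  have W: "k \<in> grid n \<phi> p \<Longrightarrow> W p k \<in> borel_measurable (F k)" for p k
    using adm by (simp add: admissible_def)
  note [measurable] = measurable_abs_points[OF lam] measurable_abs_grid[OF W]
  have "AE s in lborel. (\<integral>\<^sup>+ \<omega>. ennreal \<bar>lam m s \<omega>\<bar> \<partial>P) \<le> a (Inl m)" for m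
    using c(1) by (rule eventually_mono) auto
  then have 1: "(\<Sum>m\<in>UNIV. \<integral>\<^sup>+ \<omega>. abs_points (lam m) \<alpha> m t \<omega> \<partial>P) \<le> (\<Sum>m\<in>UNIV. norm1 (hN \<MM> \<alpha> m) * a (Inl m))"
    by (intro sum_mono abs_points_expectation lam)
  have 2: "(\<Sum>p\<in>UNIV. \<integral>\<^sup>+ \<omega>. abs_grid (W p) \<alpha> p t \<omega> \<partial>P) \<le>
    (\<Sum>p\<in>UNIV. norm1_grid (real (n p)) (hW \<MM> \<alpha> p) * a (Inr p) + norm1_grid (real (n p)) (bW \<MM> \<alpha> p))"
    by (intro sum_mono abs_grid_expectation W c(2))
  have "(\<integral>\<^sup>+ \<omega>. (\<Sum>m\<in>UNIV. abs_points (lam m) \<alpha> m t \<omega>) + (\<Sum>p\<in>UNIV. abs_grid (W p) \<alpha> p t \<omega>) \<partial>P) =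
    (\<Sum>m\<in>UNIV. \<integral>\<^sup>+ \<omega>. abs_points (lam m) \<alpha> m t \<omega> \<partial>P) + (\<Sum>p\<in>UNIV. \<integral>\<^sup>+ \<omega>. abs_grid (W p) \<alpha> p t \<omega> \<partial>P)"
    by (simp add: nn_integral_add nn_integral_sum)
  also have "\<dots> \<le> (\<Sum>m\<in>UNIV. norm1 (hN \<MM> \<alpha> m) * a (Inl m)) +
    (\<Sum>p\<in>UNIV. norm1_grid (real (n p)) (hW \<MM> \<alpha> p) * a (Inr p) + norm1_grid (real (n p)) (bW \<MM> \<alpha> p))"
    by (rule add_mono[OF 1 2])
  also have "\<dots> = (\<Sum>\<beta>\<in>UNIV. knorm \<alpha> \<beta> * a \<beta>) + (\<Sum>p\<in>UNIV. norm1_grid (real (n p)) (bW \<MM> \<alpha> p))"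
    by (simp add: sum_knorm sum.distrib add.assoc)
  finally show ?thesis .
qed

text \<open>Both drives must converge: a divergent sum counts as 0, and the difference of the two
  values would then not be controlled by the termwise differences.\<close>

lemma abs_thin_drive_diff_le:
  assumes \<omega>: "\<omega> \<in> space P" and conv: "thin_converges lam W \<alpha> t \<omega>" "thin_converges lam' W' \<alpha> t \<omega>"
  shows "ennreal \<bar>thin_drive lam W \<alpha> t \<omega> - thin_drive lam' W' \<alpha> t \<omega>\<bar> \<le>
    (\<Sum>m\<in>UNIV. \<integral>\<^sup>+ z. (if (snd z \<le> lam m (fst z) \<omega>) \<noteq> (snd z \<le> lam' m (fst z) \<omega>)
       then ennreal \<bar>ext0 (hN \<MM> \<alpha> m) (t - fst z)\<bar> else 0) \<partial>count_space (\<pi> m \<omega>)) +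
    (\<Sum>p\<in>UNIV. \<integral>\<^sup>+ k. ennreal \<bar>ext0 (hW \<MM> \<alpha> p) (t - k)\<bar> * ennreal \<bar>W p k \<omega> - W' p k \<omega>\<bar> \<partial>count_space (grid n \<phi> p))"
    (is "_ \<le> (\<Sum>m\<in>UNIV. ?A m) + (\<Sum>p\<in>UNIV. ?B p)")
proof -
  let ?a = "\<lambda>lam m. infsum (\<lambda>s. hN \<MM> \<alpha> m (t - s)) (pts (\<pi> m \<omega>) (\<lambda>s. lam m s \<omega>) \<inter> {..<t})"
  let ?b = "\<lambda>W p. infsum (\<lambda>k. JW \<MM> \<alpha> p (t - k) (W p k \<omega>)) (grid n \<phi> p \<inter> {..<t})"
  have inj: "inj_on fst (\<pi> m \<omega>)" for m
    using \<pi>_inj[OF \<omega>, of m UNIV] by simp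
  have sN: "(\<lambda>s. hN \<MM> \<alpha> m (t - s)) summable_on (pts (\<pi> m \<omega>) (\<lambda>s. lam m s \<omega>) \<inter> {..<t})"
    "(\<lambda>s. hN \<MM> \<alpha> m (t - s)) summable_on (pts (\<pi> m \<omega>) (\<lambda>s. lam' m s \<omega>) \<inter> {..<t})" for m
    using conv by (auto simp: thin_converges_def drive_converges_def)
  have sW: "(\<lambda>k. JW \<MM> \<alpha> p (t - k) (W p k \<omega>)) summable_on (grid n \<phi> p \<inter> {..<t})"
    "(\<lambda>k. JW \<MM> \<alpha> p (t - k) (W' p k \<omega>)) summable_on (grid n \<phi> p \<inter> {..<t})" for p
    using conv by (auto simp: thin_converges_def drive_converges_def)
  have A: "ennreal \<bar>?a lam m - ?a lam' m\<bar> \<le> ?A m" for m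
  proof -
    have "ennreal \<bar>?a lam m - ?a lam' m\<bar> \<le>
      (\<integral>\<^sup>+ z. ennreal \<bar>(if snd z \<le> lam m (fst z) \<omega> \<and> fst z \<in> {..<t} then hN \<MM> \<alpha> m (t - fst z) else 0) -
         (if snd z \<le> lam' m (fst z) \<omega> \<and> fst z \<in> {..<t} then hN \<MM> \<alpha> m (t - fst z) else 0)\<bar> \<partial>count_space (\<pi> m \<omega>))"
      unfolding infsum_pts[OF inj]
      using sN[of m] unfolding summable_on_pts_iff[OF inj] by (rule abs_infsum_diff_le)
    also have "\<dots> \<le> ?A m"
      by (intro nn_integral_mono) (auto simp: ext0_def)
    finally show ?thesis .
  qed
  have B: "ennreal \<bar>?b W p - ?b W' p\<bar> \<le> ?B p" for p
  proof -
    have "ennreal \<bar>?b W p - ?b W' p\<bar> \<le>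
      (\<integral>\<^sup>+ k. ennreal \<bar>JW \<MM> \<alpha> p (t - k) (W p k \<omega>) - JW \<MM> \<alpha> p (t - k) (W' p k \<omega>)\<bar> \<partial>count_space (grid n \<phi> p \<inter> {..<t}))"
      by (rule abs_infsum_diff_le[OF sW])
    also have "\<dots> \<le> ?B p"
    proof (rule nn_integral_count_grid_le)
      fix k
      assume "k < t"
      then have "\<bar>JW \<MM> \<alpha> p (t - k) (W p k \<omega>) - JW \<MM> \<alpha> p (t - k) (W' p k \<omega>)\<bar> \<le> \<bar>ext0 (hW \<MM> \<alpha> p) (t - k)\<bar> * \<bar>W p k \<omega> - W' p k \<omega>\<bar>"
        using JW_bounds(2)[of "t - k" \<alpha> p "W p k \<omega>" "W' p k \<omega>"] JW_bounds(3)[of "t - k" \<alpha> p] by (simp add: ext0_def)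
      then show "ennreal \<bar>JW \<MM> \<alpha> p (t - k) (W p k \<omega>) - JW \<MM> \<alpha> p (t - k) (W' p k \<omega>)\<bar> \<le>
        ennreal \<bar>ext0 (hW \<MM> \<alpha> p) (t - k)\<bar> * ennreal \<bar>W p k \<omega> - W' p k \<omega>\<bar>"
        by (simp add: ennreal_leI flip: ennreal_mult)
    qed
    finally show ?thesis .
  qed
  show ?thesis
    unfolding thin_drive_def drive_def by (rule ennreal_abs_diff_sums_le) (rule A, rule B)
qed

lemma thin_drive_contraction:
  assumes adm: "admissible lam W" "admissible lam' W'"
    and conv: "AE \<omega> in P. thin_converges lam W \<alpha> t \<omega>" "AE \<omega> in P. thin_converges lam' W' \<alpha> t \<omega>"
    and a: "AE s in lborel. \<forall>m. (\<integral>\<^sup>+ \<omega>. ennreal \<bar>lam m s \<omega> - lam' m s \<omega>\<bar> \<partial>P) \<le> a (Inl m)"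
      "\<And>p k. k \<in> grid n \<phi> p \<Longrightarrow> (\<integral>\<^sup>+ \<omega>. ennreal \<bar>W p k \<omega> - W' p k \<omega>\<bar> \<partial>P) \<le> a (Inr p)"
  shows "(\<integral>\<^sup>+ \<omega>. ennreal \<bar>thin_drive lam W \<alpha> t \<omega> - thin_drive lam' W' \<alpha> t \<omega>\<bar> \<partial>P) \<le> (\<Sum>\<beta>\<in>UNIV. knorm \<alpha> \<beta> * a \<beta>)"
proof -
  have lam: "(\<lambda>(\<omega>, t). lam m t \<omega>) \<in> borel_measurable Pred" and lam': "(\<lambda>(\<omega>, t). lam' m t \<omega>) \<in> borel_measurable Pred" for m
    using adm by (simp_all add: admissible_def)
  have W: "W p k \<in> borel_measurable P" "W' p k \<in> borel_measurable P" if "k \<in> grid n \<phi> p" for p k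
  proof -
    have "W p k \<in> borel_measurable (F k)" "W' p k \<in> borel_measurable (F k)"
      using adm that by (simp_all add: admissible_def)
    then show "W p k \<in> borel_measurable P" "W' p k \<in> borel_measurable P"
      by (blast intro: measurable_F_P)+
  qed
  let ?A = "\<lambda>m \<omega>. \<integral>\<^sup>+ z. (if (snd z \<le> lam m (fst z) \<omega>) \<noteq> (snd z \<le> lam' m (fst z) \<omega>)
       then ennreal \<bar>ext0 (hN \<MM> \<alpha> m) (t - fst z)\<bar> else 0) \<partial>count_space (\<pi> m \<omega>)"
  let ?B = "\<lambda>p \<omega>. \<integral>\<^sup>+ k. ennreal \<bar>ext0 (hW \<MM> \<alpha> p) (t - k)\<bar> * ennreal \<bar>W p k \<omega> - W' p k \<omega>\<bar> \<partial>count_space (grid n \<phi> p)"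
  have mA [measurable]: "?A m \<in> borel_measurable P" for m
  proof -
    have [measurable]: "(\<lambda>w. lam m (fst (snd w)) (fst w)) \<in> borel_measurable (P \<Otimes>\<^sub>M (borel :: (real \<times> real) measure))"
      "(\<lambda>w. lam' m (fst (snd w)) (fst w)) \<in> borel_measurable (P \<Otimes>\<^sub>M (borel :: (real \<times> real) measure))"
      using measurable_compose[OF measurable_to_Pred lam[of m]] measurable_compose[OF measurable_to_Pred lam'[of m]]
      by simp_all
    have "(\<lambda>w. if (snd (snd w) \<le> lam m (fst (snd w)) (fst w)) \<noteq> (snd (snd w) \<le> lam' m (fst (snd w)) (fst w))
       then ennreal \<bar>ext0 (hN \<MM> \<alpha> m) (t - fst (snd w))\<bar> else 0) \<in> borel_measurable (P \<Otimes>\<^sub>M (borel :: (real \<times> real) measure))"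
      by measurable
    from borel_measurable_count_nn_integral[OF \<pi>_measurable \<pi>_finite this, of m] show ?thesis
      unfolding fst_conv snd_conv .
  qed
  have mB [measurable]: "?B p \<in> borel_measurable P" for p
    using W by (intro borel_measurable_countable_nn_integral countable_grid) auto
  have EA: "(\<integral>\<^sup>+ \<omega>. ?A m \<omega> \<partial>P) \<le> norm1 (hN \<MM> \<alpha> m) * a (Inl m)" for m
  proof -
    have "(\<integral>\<^sup>+ \<omega>. ?A m \<omega> \<partial>P) \<le> (\<integral>\<^sup>+ s. ennreal \<bar>ext0 (hN \<MM> \<alpha> m) (t - s)\<bar> * (\<integral>\<^sup>+ \<omega>. ennreal \<bar>lam m s \<omega> - lam' m s \<omega>\<bar> \<partial>P) \<partial>lborel)"
      by (rule point_diff_expectation[OF lam lam']) measurable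
    also have "\<dots> \<le> norm1 (hN \<MM> \<alpha> m) * a (Inl m)"
      using a(1) by (intro kernel_integral_le) (auto elim!: eventually_mono)
    finally show ?thesis .
  qed
  have EB: "(\<integral>\<^sup>+ \<omega>. ?B p \<omega> \<partial>P) \<le> norm1_grid (real (n p)) (hW \<MM> \<alpha> p) * a (Inr p)" for p
    using W a(2) by (intro grid_kernel_expectation) auto
  have "(\<integral>\<^sup>+ \<omega>. ennreal \<bar>thin_drive lam W \<alpha> t \<omega> - thin_drive lam' W' \<alpha> t \<omega>\<bar> \<partial>P) \<le>
    (\<integral>\<^sup>+ \<omega>. (\<Sum>m\<in>UNIV. ?A m \<omega>) + (\<Sum>p\<in>UNIV. ?B p \<omega>) \<partial>P)"
  proof (rule nn_integral_mono_AE)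
    show "AE \<omega> in P. ennreal \<bar>thin_drive lam W \<alpha> t \<omega> - thin_drive lam' W' \<alpha> t \<omega>\<bar> \<le>
      (\<Sum>m\<in>UNIV. ?A m \<omega>) + (\<Sum>p\<in>UNIV. ?B p \<omega>)"
      using AE_space[of P] conv by eventually_elim (rule abs_thin_drive_diff_le)
  qed
  also have "\<dots> = (\<Sum>m\<in>UNIV. \<integral>\<^sup>+ \<omega>. ?A m \<omega> \<partial>P) + (\<Sum>p\<in>UNIV. \<integral>\<^sup>+ \<omega>. ?B p \<omega> \<partial>P)"
    using mA mB by (simp add: nn_integral_add nn_integral_sum)
  also have "\<dots> \<le> (\<Sum>\<beta>\<in>UNIV. knorm \<alpha> \<beta> * a \<beta>)"
    unfolding sum_knorm by (intro add_mono sum_mono EA EB)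
  finally show ?thesis .
qed

end

subsection \<open>Picard iteration\<close>

text \<open>The tail \<open>S j\<close> of the absolute increments has mean at most r \<theta>^j /
  (1 - \<theta>) by the geometric series. Finiteness of \<open>S 0\<close> gives almost sure
  convergence, and \<open>S j\<close> dominates the distance of \<open>X j\<close> to the
  limit.\<close>

lemma geometric_increments_limit:
  fixes X :: "nat \<Rightarrow> 'w \<Rightarrow> real"
  assumes [measurable]: "\<And>j. X j \<in> borel_measurable M"
    and inc: "\<And>j. (\<integral>\<^sup>+ \<omega>. ennreal \<bar>X (Suc j) \<omega> - X j \<omega>\<bar> \<partial>M) \<le> ennreal (r * \<theta> ^ j)"
    and \<theta>: "0 \<le> \<theta>" "\<theta> < 1" and r: "0 \<le> r"
  shows "AE \<omega> in M. (\<lambda>j. X j \<omega>) \<longlonglongrightarrow> lim (\<lambda>j. X j \<omega>)"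
    and "(\<integral>\<^sup>+ \<omega>. ennreal \<bar>lim (\<lambda>j. X j \<omega>) - X j \<omega>\<bar> \<partial>M) \<le> ennreal (r * \<theta> ^ j / (1 - \<theta>))"
proof -
  define S where "S j \<omega> = (\<Sum>i. ennreal \<bar>X (Suc (i + j)) \<omega> - X (i + j) \<omega>\<bar>)" for j \<omega>
  have [measurable]: "S j \<in> borel_measurable M" for j
    unfolding S_def by measurable
  have ES: "(\<integral>\<^sup>+ \<omega>. S j \<omega> \<partial>M) \<le> ennreal (r * \<theta> ^ j / (1 - \<theta>))" for j
  proof -
    have "(\<integral>\<^sup>+ \<omega>. S j \<omega> \<partial>M) = (\<Sum>i. \<integral>\<^sup>+ \<omega>. ennreal \<bar>X (Suc (i + j)) \<omega> - X (i + j) \<omega>\<bar> \<partial>M)"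
      unfolding S_def by (rule nn_integral_suminf) measurable
    also have "\<dots> \<le> (\<Sum>i. ennreal (r * \<theta> ^ j * \<theta> ^ i))"
    proof (rule suminf_le)
      show "(\<integral>\<^sup>+ \<omega>. ennreal \<bar>X (Suc (i + j)) \<omega> - X (i + j) \<omega>\<bar> \<partial>M) \<le> ennreal (r * \<theta> ^ j * \<theta> ^ i)" for i
        using inc[of "i + j"] by (simp add: power_add mult_ac)
    qed auto
    also have "\<dots> = ennreal (r * \<theta> ^ j * (1 / (1 - \<theta>)))"
      using \<theta> r by (intro suminf_ennreal_eq sums_mult geometric_sums) auto
    finally show ?thesis
      by simp
  qed
  have "AE \<omega> in M. S 0 \<omega> \<noteq> \<infinity>"
    by (rule nn_integral_PInf_AE) (use ES[of 0] in \<open>auto simp: top_unique\<close>)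
  then show conv: "AE \<omega> in M. (\<lambda>j. X j \<omega>) \<longlonglongrightarrow> lim (\<lambda>j. X j \<omega>)"
  proof eventually_elim
    case (elim \<omega>)
    then have "(\<Sum>i. ennreal \<bar>X (Suc i) \<omega> - X i \<omega>\<bar>) \<noteq> \<infinity>"
      by (simp add: S_def)
    then have "summable (\<lambda>i. \<bar>X (Suc i) \<omega> - X i \<omega>\<bar>)"
      by (intro summable_suminf_not_top) auto
    then have "summable (\<lambda>i. X (Suc i) \<omega> - X i \<omega>)"
      by (rule summable_rabs_cancel)
    then have "(\<lambda>N. \<Sum>i<N. X (Suc i) \<omega> - X i \<omega>) \<longlonglongrightarrow> (\<Sum>i. X (Suc i) \<omega> - X i \<omega>)"
      by (rule summable_LIMSEQ)
    then have "(\<lambda>N. X N \<omega> - X 0 \<omega>) \<longlonglongrightarrow> (\<Sum>i. X (Suc i) \<omega> - X i \<omega>)"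
      unfolding sum_lessThan_telescope[of "\<lambda>i. X i \<omega>"] .
    from tendsto_add[OF this tendsto_const[of "X 0 \<omega>"]]
    have "(\<lambda>N. X N \<omega>) \<longlonglongrightarrow> (\<Sum>i. X (Suc i) \<omega> - X i \<omega>) + X 0 \<omega>"
      by simp
    then have "convergent (\<lambda>j. X j \<omega>)"
      by (auto simp: convergent_def)
    then show ?case
      by (simp add: convergent_LIMSEQ_iff)
  qed
  have "AE \<omega> in M. ennreal \<bar>lim (\<lambda>j. X j \<omega>) - X j \<omega>\<bar> \<le> S j \<omega>"
    using conv
  proof eventually_elim
    case (elim \<omega>)
    then have "(\<lambda>N. X (N + j) \<omega>) \<longlonglongrightarrow> lim (\<lambda>j. X j \<omega>)"
      by (rule LIMSEQ_ignore_initial_segment)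
    then have "(\<lambda>N. ennreal \<bar>X (N + j) \<omega> - X j \<omega>\<bar>) \<longlonglongrightarrow> ennreal \<bar>lim (\<lambda>j. X j \<omega>) - X j \<omega>\<bar>"
      by (intro tendsto_intros)
    moreover have "ennreal \<bar>X (N + j) \<omega> - X j \<omega>\<bar> \<le> S j \<omega>" for N
    proof -
      have "X (N + j) \<omega> - X j \<omega> = (\<Sum>i<N. X (Suc (i + j)) \<omega> - X (i + j) \<omega>)"
        using sum_lessThan_telescope[of "\<lambda>i. X (i + j) \<omega>" N] by simp
      also have "\<bar>\<dots>\<bar> \<le> (\<Sum>i<N. \<bar>X (Suc (i + j)) \<omega> - X (i + j) \<omega>\<bar>)"
        by (rule sum_abs)
      finally have "ennreal \<bar>X (N + j) \<omega> - X j \<omega>\<bar> \<le> ennreal (\<Sum>i<N. \<bar>X (Suc (i + j)) \<omega> - X (i + j) \<omega>\<bar>)"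
        by (rule ennreal_leI)
      also have "\<dots> = (\<Sum>i<N. ennreal \<bar>X (Suc (i + j)) \<omega> - X (i + j) \<omega>\<bar>)"
        by (rule sum_ennreal[symmetric]) simp
      also have "\<dots> \<le> S j \<omega>"
        unfolding S_def by (rule sum_le_suminf) auto
      finally show ?thesis .
    qed
    then have "\<exists>N0. \<forall>N\<ge>N0. ennreal \<bar>X (N + j) \<omega> - X j \<omega>\<bar> \<le> S j \<omega>"
      by blast
    ultimately show ?case
      by (rule LIMSEQ_le_const2)
  qed
  then have "(\<integral>\<^sup>+ \<omega>. ennreal \<bar>lim (\<lambda>j. X j \<omega>) - X j \<omega>\<bar> \<partial>M) \<le> (\<integral>\<^sup>+ \<omega>. S j \<omega> \<partial>M)"
    by (rule nn_integral_mono_AE)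
  also note ES
  finally show "(\<integral>\<^sup>+ \<omega>. ennreal \<bar>lim (\<lambda>j. X j \<omega>) - X j \<omega>\<bar> \<partial>M) \<le> ennreal (r * \<theta> ^ j / (1 - \<theta>))" .
qed

lemma zero_if_le_geometric:
  fixes e :: ennreal
  assumes "\<And>j. e \<le> ennreal (r * \<theta> ^ j)" "0 \<le> \<theta>" "\<theta> < 1"
  shows "e = 0"
proof -
  have "(\<lambda>j. ennreal (r * \<theta> ^ j)) \<longlonglongrightarrow> ennreal (r * 0)"
    using assms(2,3) by (intro tendsto_ennrealI tendsto_mult tendsto_const LIMSEQ_power_zero) auto
  then have "e \<le> ennreal (r * 0)"
    by (rule LIMSEQ_le_const) (use assms(1) in auto)
  then show ?thesis
    by simp
qed

lemma nn_integral_abs_triangle: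
  fixes X Y Z :: "'w \<Rightarrow> real"
  assumes [measurable]: "X \<in> borel_measurable M" "Y \<in> borel_measurable M" "Z \<in> borel_measurable M"
  shows "(\<integral>\<^sup>+ \<omega>. ennreal \<bar>X \<omega> - Z \<omega>\<bar> \<partial>M) \<le> (\<integral>\<^sup>+ \<omega>. ennreal \<bar>X \<omega> - Y \<omega>\<bar> \<partial>M) + (\<integral>\<^sup>+ \<omega>. ennreal \<bar>Y \<omega> - Z \<omega>\<bar> \<partial>M)"
proof -
  have "(\<integral>\<^sup>+ \<omega>. ennreal \<bar>X \<omega> - Z \<omega>\<bar> \<partial>M) \<le> (\<integral>\<^sup>+ \<omega>. ennreal \<bar>X \<omega> - Y \<omega>\<bar> + ennreal \<bar>Y \<omega> - Z \<omega>\<bar> \<partial>M)"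
    by (intro nn_integral_mono) (auto simp flip: ennreal_plus intro!: ennreal_leI)
  also have "\<dots> = (\<integral>\<^sup>+ \<omega>. ennreal \<bar>X \<omega> - Y \<omega>\<bar> \<partial>M) + (\<integral>\<^sup>+ \<omega>. ennreal \<bar>Y \<omega> - Z \<omega>\<bar> \<partial>M)"
    by (rule nn_integral_add) measurable
  finally show ?thesis .
qed

lemma AE_pair_fst:
  assumes "sigma_finite_measure L" "AE \<omega> in P. Q \<omega>"
  shows "AE z in P \<Otimes>\<^sub>M L. Q (fst z)"
proof -
  interpret sigma_finite_measure L by fact
  obtain N where N: "{\<omega> \<in> space P. \<not> Q \<omega>} \<subseteq> N" "emeasure P N = 0" "N \<in> sets P"
    using assms(2) by (rule AE_E)
  have "emeasure (P \<Otimes>\<^sub>M L) (N \<times> space L) = emeasure P N * emeasure L (space L)"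
    by (rule emeasure_pair_measure_Times) (use N in auto)
  then have "N \<times> space L \<in> null_sets (P \<Otimes>\<^sub>M L)"
    using N by (intro null_setsI) auto
  then show ?thesis
    by (rule AE_I') (use N(1) in \<open>auto simp: space_pair_measure\<close>)
qed

text \<open>Equations for intensities hold almost everywhere on the product, whereas the moment
  estimates are made at a fixed time; this passes to almost every time.\<close>

lemma AE_pair_swapD:
  assumes "sigma_finite_measure P" "sigma_finite_measure L" "AE z in P \<Otimes>\<^sub>M L. Q (fst z) (snd z)"
  shows "AE t in L. AE \<omega> in P. Q \<omega> t"
proof -
  interpret PL: pair_sigma_finite P L
    using assms by (simp add: pair_sigma_finite_def)
  interpret LP: pair_sigma_finite L P
    using assms by (simp add: pair_sigma_finite_def)
  have "AE z in distr (L \<Otimes>\<^sub>M P) (P \<Otimes>\<^sub>M L) (\<lambda>(x, y). (y, x)). Q (fst z) (snd z)"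
    by (subst PL.distr_pair_swap[symmetric]) (rule assms(3))
  then have "AE z in L \<Otimes>\<^sub>M P. Q (fst (case z of (x, y) \<Rightarrow> (y, x))) (snd (case z of (x, y) \<Rightarrow> (y, x)))"
    by (rule AE_distrD[rotated]) (rule measurable_pair_swap')
  from LP.AE_pair[OF this] show ?thesis
    by simp
qed

section \<open>The Picard scheme as a functional of the noise path\<close>

text \<open>The step acts on a single configuration \<open>c\<close> and drift path
  \<open>x\<close>; no \<omega> and no measure occur. The shift identity for the iterates is then an
  identity between paths.\<close>

definition picard_step ::
    "('m::finite, 'p::finite) har_params \<Rightarrow> ('p \<Rightarrow> nat) \<Rightarrow> ('p \<Rightarrow> real) \<Rightarrow>
     ('m \<Rightarrow> (real \<times> real) set) \<Rightarrow> ('p \<times> real \<Rightarrow> real) \<Rightarrow>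
     ('m \<Rightarrow> real \<Rightarrow> real) \<times> ('p \<Rightarrow> real \<Rightarrow> real) \<Rightarrow> ('m \<Rightarrow> real \<Rightarrow> real) \<times> ('p \<Rightarrow> real \<Rightarrow> real)" where
  "picard_step \<MM> n \<phi> c x lw =
     (let D = drive \<MM> n \<phi> (\<lambda>m. pts (c m) (fst lw m)) (snd lw) in
      (\<lambda>m t. Phi \<MM> (Inl m) (D (Inl m) t), \<lambda>p k. x (p, k) + Phi \<MM> (Inr p) (D (Inr p) k)))"

definition picard ::
    "('m::finite, 'p::finite) har_params \<Rightarrow> ('p \<Rightarrow> nat) \<Rightarrow> ('p \<Rightarrow> real) \<Rightarrow>
     ('m \<Rightarrow> (real \<times> real) set) \<Rightarrow> ('p \<times> real \<Rightarrow> real) \<Rightarrow> nat \<Rightarrow>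
     ('m \<Rightarrow> real \<Rightarrow> real) \<times> ('p \<Rightarrow> real \<Rightarrow> real)" where
  "picard \<MM> n \<phi> c x j = (picard_step \<MM> n \<phi> c x ^^ j) (\<lambda>m t. 0, \<lambda>p k. 0)"

text \<open>\<open>lim\<close> has the same unspecified value for all divergent sequences, so the
  limit is a total functional: measurability and the shift identity pass to it without an
  exceptional set.\<close>

definition picard_intensity ::
    "('m::finite, 'p::finite) har_params \<Rightarrow> ('p \<Rightarrow> nat) \<Rightarrow> ('p \<Rightarrow> real) \<Rightarrow>
     ('m \<Rightarrow> (real \<times> real) set) \<Rightarrow> ('p \<times> real \<Rightarrow> real) \<Rightarrow> 'm \<Rightarrow> real \<Rightarrow> real" where
  "picard_intensity \<MM> n \<phi> c x m t = lim (\<lambda>j. fst (picard \<MM> n \<phi> c x j) m t)"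

definition picard_drift ::
    "('m::finite, 'p::finite) har_params \<Rightarrow> ('p \<Rightarrow> nat) \<Rightarrow> ('p \<Rightarrow> real) \<Rightarrow>
     ('m \<Rightarrow> (real \<times> real) set) \<Rightarrow> ('p \<times> real \<Rightarrow> real) \<Rightarrow> 'p \<Rightarrow> real \<Rightarrow> real" where
  "picard_drift \<MM> n \<phi> c x p k = lim (\<lambda>j. snd (picard \<MM> n \<phi> c x j) p k)"

context driven_paths
begin

definition drift_path :: "'w \<Rightarrow> 'p \<times> real \<Rightarrow> real" where
  "drift_path \<omega> = (\<lambda>(p, k)\<in>grid_points n \<phi>. \<xi> p k \<omega>)"

definition lamI :: "nat \<Rightarrow> 'm \<Rightarrow> real \<Rightarrow> 'w \<Rightarrow> real" where
  "lamI j m t \<omega> = fst (picard \<MM> n \<phi> (\<lambda>m. \<pi> m \<omega>) (drift_path \<omega>) j) m t"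

definition WI :: "nat \<Rightarrow> 'p \<Rightarrow> real \<Rightarrow> 'w \<Rightarrow> real" where
  "WI j p k \<omega> = snd (picard \<MM> n \<phi> (\<lambda>m. \<pi> m \<omega>) (drift_path \<omega>) j) p k"

definition lamL :: "'m \<Rightarrow> real \<Rightarrow> 'w \<Rightarrow> real" where
  "lamL m t \<omega> = picard_intensity \<MM> n \<phi> (\<lambda>m. \<pi> m \<omega>) (drift_path \<omega>) m t"

definition WL :: "'p \<Rightarrow> real \<Rightarrow> 'w \<Rightarrow> real" where
  "WL p k \<omega> = picard_drift \<MM> n \<phi> (\<lambda>m. \<pi> m \<omega>) (drift_path \<omega>) p k"

lemma lamI_0: "lamI 0 m t \<omega> = 0" and WI_0: "WI 0 p k \<omega> = 0"
  by (simp_all add: lamI_def WI_def picard_def)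

lemma lamI_Suc: "lamI (Suc j) m t \<omega> = Phi \<MM> (Inl m) (thin_drive (lamI j) (WI j) (Inl m) t \<omega>)"
  by (simp add: lamI_def WI_def picard_def picard_step_def thin_drive_def Let_def)

lemma WI_Suc: "k \<in> grid n \<phi> p \<Longrightarrow> WI (Suc j) p k \<omega> = \<xi> p k \<omega> + Phi \<MM> (Inr p) (thin_drive (lamI j) (WI j) (Inr p) k \<omega>)"
  by (simp add: lamI_def WI_def picard_def picard_step_def thin_drive_def Let_def drift_path_def grid_points_def)

lemma Phi_borel [measurable]: "Phi \<MM> \<alpha> \<in> borel_measurable borel"
proof -
  have "\<exists>L. L-lipschitz_on UNIV (Phi \<MM> \<alpha>)"
    using params by (simp add: valid_params_def)
  then show ?thesis
    by (auto intro!: borel_measurable_continuous_onI dest: lipschitz_on_continuous_on)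
qed

lemma measurable_Phi_thin_drive:
  assumes "admissible lam W"
  shows "(\<lambda>(\<omega>, t). Phi \<MM> \<alpha> (thin_drive lam W \<alpha> t \<omega>)) \<in> borel_measurable Pred"
    and "(\<lambda>\<omega>. Phi \<MM> \<alpha> (thin_drive lam W \<alpha> t \<omega>)) \<in> borel_measurable (F t)"
proof -
  show 1: "(\<lambda>(\<omega>, t). Phi \<MM> \<alpha> (thin_drive lam W \<alpha> t \<omega>)) \<in> borel_measurable Pred"
    using measurable_compose[OF measurable_thin_drive[OF assms, of \<alpha>] Phi_borel[of \<alpha>]] by (simp add: case_prod_beta')
  show "(\<lambda>\<omega>. Phi \<MM> \<alpha> (thin_drive lam W \<alpha> t \<omega>)) \<in> borel_measurable (F t)"
    using measurable_F_section[OF 1[unfolded case_prod_beta'], where t = t] by simp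
qed

lemma admissible_iter: "admissible (lamI j) (WI j)"
proof (induction j)
  case 0
  then show ?case
    by (simp add: admissible_def lamI_0 WI_0 case_prod_beta')
next
  case (Suc j)
  show ?case
    unfolding admissible_def
  proof (intro conjI allI ballI)
    show "(\<lambda>(\<omega>, t). lamI (Suc j) m t \<omega>) \<in> borel_measurable Pred" for m
      unfolding lamI_Suc by (rule measurable_Phi_thin_drive(1)[OF Suc])
    show "WI (Suc j) p k \<in> borel_measurable (F k)" if k: "k \<in> grid n \<phi> p" for p k
      unfolding WI_Suc[OF k, abs_def]
      by (intro borel_measurable_add measurable_F_\<xi>[OF k] measurable_Phi_thin_drive(2)[OF Suc]) simp
  qed
qed

text \<open>Pointwise limits taken with \<open>lim\<close> stay measurable for the same
  \<sigma>-algebra on all paths, so predictability and adaptedness survive although the filtration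
  is not completed.\<close>

lemma admissible_limit: "admissible lamL WL"
  unfolding admissible_def
proof (intro conjI allI ballI)
  show "(\<lambda>(\<omega>, t). lamL m t \<omega>) \<in> borel_measurable Pred" for m
    unfolding lamL_def picard_intensity_def lamI_def[symmetric] case_prod_beta'
    using admissible_iter unfolding admissible_def case_prod_beta'
    by (intro borel_measurable_lim_metric) auto
  show "WL p k \<in> borel_measurable (F k)" if k: "k \<in> grid n \<phi> p" for p k
    unfolding WL_def[abs_def] picard_drift_def WI_def[symmetric]
    using admissible_iter k unfolding admissible_def
    by (intro borel_measurable_lim_metric) auto
qed

end

text \<open>\<open>v\<close> and \<open>\<theta>\<close> are the weights and the factor obtained
  from the spectral radius. Finiteness of \<open>knorm\<close> is a separate assumption because here
  a Lipschitz constant 0 times \<infinity> is 0, and the weighted inequality would not imply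
  it.\<close>

locale har_contract = har_noise P n \<phi> \<pi> \<xi> \<MM>
  for P :: "'w measure"
    and n :: "'p::finite \<Rightarrow> nat"
    and \<phi> :: "'p \<Rightarrow> real"
    and \<pi> :: "'m::finite \<Rightarrow> 'w \<Rightarrow> (real \<times> real) set"
    and \<xi> :: "'p \<Rightarrow> real \<Rightarrow> 'w \<Rightarrow> real"
    and \<MM> :: "('m, 'p) har_params" +
  fixes v :: "'m + 'p \<Rightarrow> real" and \<theta> :: real
  assumes v_pos: "\<And>\<beta>. v \<beta> > 0" and \<theta>: "0 \<le> \<theta>" "\<theta> < 1"
    and knorm_finite: "\<And>\<alpha> \<beta>. knorm \<alpha> \<beta> < \<infinity>"
    and subinvariant: "\<And>\<alpha>. (\<Sum>\<beta>\<in>UNIV. ennreal (lipschitz_const (Phi \<MM> \<alpha>)) * knorm \<alpha> \<beta> * ennreal (v \<beta>)) \<le> ennreal (\<theta> * v \<alpha>)"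
    and b_finite: "\<And>\<alpha> p. norm1_grid (real (n p)) (bW \<MM> \<alpha> p) < \<infinity>"
    and \<xi>_finite: "(SUP (p, k)\<in>grid_points n \<phi>. \<integral>\<^sup>+ \<omega>. ennreal \<bar>\<xi> p k \<omega>\<bar> \<partial>P) < \<infinity>"
begin

section \<open>Weighted first-moment distance and contraction\<close>

definition mbounded :: "('m \<Rightarrow> real \<Rightarrow> 'w \<Rightarrow> real) \<Rightarrow> ('p \<Rightarrow> real \<Rightarrow> 'w \<Rightarrow> real) \<Rightarrow> bool" where
  "mbounded lam W \<longleftrightarrow> (\<exists>c<\<infinity>. (\<forall>m t. (\<integral>\<^sup>+ \<omega>. ennreal \<bar>lam m t \<omega>\<bar> \<partial>P) \<le> c) \<and>
     (\<forall>p. \<forall>k\<in>grid n \<phi> p. (\<integral>\<^sup>+ \<omega>. ennreal \<bar>W p k \<omega>\<bar> \<partial>P) \<le> c))"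

text \<open>The weighted distance at level \<open>c\<close>, scaled by \<open>v\<close> label by
  label. For intensities it is required at almost every time only, since two versions may differ on
  a null set; drifts are compared at every grid point.\<close>

definition mdist :: "('m \<Rightarrow> real \<Rightarrow> 'w \<Rightarrow> real) \<Rightarrow> ('p \<Rightarrow> real \<Rightarrow> 'w \<Rightarrow> real) \<Rightarrow>
    ('m \<Rightarrow> real \<Rightarrow> 'w \<Rightarrow> real) \<Rightarrow> ('p \<Rightarrow> real \<Rightarrow> 'w \<Rightarrow> real) \<Rightarrow> real \<Rightarrow> bool" where
  "mdist lam W lam' W' c \<longleftrightarrow>
     (AE t in lborel. \<forall>m. (\<integral>\<^sup>+ \<omega>. ennreal \<bar>lam m t \<omega> - lam' m t \<omega>\<bar> \<partial>P) \<le> ennreal (c * v (Inl m))) \<and>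
     (\<forall>p. \<forall>k\<in>grid n \<phi> p. (\<integral>\<^sup>+ \<omega>. ennreal \<bar>W p k \<omega> - W' p k \<omega>\<bar> \<partial>P) \<le> ennreal (c * v (Inr p)))"

lemma Phi_lipschitz: "\<bar>Phi \<MM> \<alpha> x - Phi \<MM> \<alpha> y\<bar> \<le> lipschitz_const (Phi \<MM> \<alpha>) * \<bar>x - y\<bar>"
  and lipschitz_const_nonneg: "0 \<le> lipschitz_const (Phi \<MM> \<alpha>)"
  using params lipschitz_constD[of "Phi \<MM> \<alpha>"] by (simp_all add: valid_params_def)

lemma drive_bound_finite:
  assumes "c < \<infinity>"
  shows "(\<Sum>\<beta>\<in>UNIV. knorm \<alpha> \<beta> * c) + (\<Sum>p\<in>UNIV. norm1_grid (real (n p)) (bW \<MM> \<alpha> p)) < \<infinity>"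
  using assms knorm_finite b_finite by (simp add: ennreal_mult_eq_top_iff less_top[symmetric])

lemma measurable_totals:
  assumes "admissible lam W"
  shows "(\<lambda>\<omega>. (\<Sum>m\<in>UNIV. abs_points (lam m) \<alpha> m t \<omega>) + (\<Sum>p\<in>UNIV. abs_grid (W p) \<alpha> p t \<omega>)) \<in> borel_measurable P"
  using assms unfolding admissible_def
  by (intro borel_measurable_add borel_measurable_sum measurable_abs_points measurable_abs_grid) auto

text \<open>At a fixed time the sum of all absolute contributions has finite mean. The exceptional
  null set depends on t.\<close>

lemma converges_AE:
  assumes adm: "admissible lam W" and bd: "mbounded lam W"
  shows "AE \<omega> in P. thin_converges lam W \<alpha> t \<omega>"
proof -
  obtain c where c: "c < \<infinity>" "\<And>m t. (\<integral>\<^sup>+ \<omega>. ennreal \<bar>lam m t \<omega>\<bar> \<partial>P) \<le> c"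
    "\<And>p k. k \<in> grid n \<phi> p \<Longrightarrow> (\<integral>\<^sup>+ \<omega>. ennreal \<bar>W p k \<omega>\<bar> \<partial>P) \<le> c"
    using bd by (auto simp: mbounded_def)
  let ?T = "\<lambda>\<omega>. (\<Sum>m\<in>UNIV. abs_points (lam m) \<alpha> m t \<omega>) + (\<Sum>p\<in>UNIV. abs_grid (W p) \<alpha> p t \<omega>)"
  have "(\<integral>\<^sup>+ \<omega>. ?T \<omega> \<partial>P) \<le> (\<Sum>\<beta>\<in>UNIV. knorm \<alpha> \<beta> * c) + (\<Sum>p\<in>UNIV. norm1_grid (real (n p)) (bW \<MM> \<alpha> p))"
    using c by (intro drive_total_expectation[OF adm, where a = "\<lambda>_. c"]) auto
  also note drive_bound_finite[OF c(1)]
  finally have "AE \<omega> in P. ?T \<omega> \<noteq> \<infinity>"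
    by (intro nn_integral_PInf_AE measurable_totals[OF adm]) auto
  then show ?thesis
  proof eventually_elim
    case (elim \<omega>)
    then show ?case
      unfolding thin_converges_iff by (auto simp: less_top)
  qed
qed

lemma Phi_drive_bounded:
  assumes adm: "admissible lam W" and bd: "mbounded lam W"
  obtains C where "C < \<infinity>" "\<And>\<alpha> t. (\<integral>\<^sup>+ \<omega>. ennreal \<bar>Phi \<MM> \<alpha> (thin_drive lam W \<alpha> t \<omega>)\<bar> \<partial>P) \<le> C"
proof -
  obtain c where c: "c < \<infinity>" "\<And>m t. (\<integral>\<^sup>+ \<omega>. ennreal \<bar>lam m t \<omega>\<bar> \<partial>P) \<le> c"
    "\<And>p k. k \<in> grid n \<phi> p \<Longrightarrow> (\<integral>\<^sup>+ \<omega>. ennreal \<bar>W p k \<omega>\<bar> \<partial>P) \<le> c"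
    using bd by (auto simp: mbounded_def)
  define B where "B \<alpha> = (\<Sum>\<beta>\<in>UNIV. knorm \<alpha> \<beta> * c) + (\<Sum>p\<in>UNIV. norm1_grid (real (n p)) (bW \<MM> \<alpha> p))" for \<alpha>
  define C where "C \<alpha> = ennreal \<bar>Phi \<MM> \<alpha> 0\<bar> + ennreal (lipschitz_const (Phi \<MM> \<alpha>)) * B \<alpha>" for \<alpha>
  have C: "C \<alpha> < \<infinity>" for \<alpha>
    using drive_bound_finite[OF c(1), of \<alpha>] by (simp add: C_def B_def ennreal_mult_less_top)
  have bound: "(\<integral>\<^sup>+ \<omega>. ennreal \<bar>Phi \<MM> \<alpha> (thin_drive lam W \<alpha> t \<omega>)\<bar> \<partial>P) \<le> C \<alpha>" for \<alpha> t
  proof -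
    let ?T = "\<lambda>\<omega>. (\<Sum>m\<in>UNIV. abs_points (lam m) \<alpha> m t \<omega>) + (\<Sum>p\<in>UNIV. abs_grid (W p) \<alpha> p t \<omega>)"
    note [measurable] = measurable_totals[OF adm, of \<alpha> t]
    have "ennreal \<bar>Phi \<MM> \<alpha> (thin_drive lam W \<alpha> t \<omega>)\<bar> \<le> ennreal \<bar>Phi \<MM> \<alpha> 0\<bar> + ennreal (lipschitz_const (Phi \<MM> \<alpha>)) * ?T \<omega>" for \<omega>
    proof -
      have "\<bar>Phi \<MM> \<alpha> (thin_drive lam W \<alpha> t \<omega>)\<bar> \<le> \<bar>Phi \<MM> \<alpha> 0\<bar> + lipschitz_const (Phi \<MM> \<alpha>) * \<bar>thin_drive lam W \<alpha> t \<omega>\<bar>"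
        using Phi_lipschitz[of \<alpha> "thin_drive lam W \<alpha> t \<omega>" 0] by simp
      then have "ennreal \<bar>Phi \<MM> \<alpha> (thin_drive lam W \<alpha> t \<omega>)\<bar> \<le> ennreal (\<bar>Phi \<MM> \<alpha> 0\<bar> + lipschitz_const (Phi \<MM> \<alpha>) * \<bar>thin_drive lam W \<alpha> t \<omega>\<bar>)"
        by (rule ennreal_leI)
      also have "\<dots> = ennreal \<bar>Phi \<MM> \<alpha> 0\<bar> + ennreal (lipschitz_const (Phi \<MM> \<alpha>)) * ennreal \<bar>thin_drive lam W \<alpha> t \<omega>\<bar>"
        using lipschitz_const_nonneg[of \<alpha>] by (simp add: ennreal_plus ennreal_mult)
      also have "\<dots> \<le> ennreal \<bar>Phi \<MM> \<alpha> 0\<bar> + ennreal (lipschitz_const (Phi \<MM> \<alpha>)) * ?T \<omega>"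
        by (intro add_left_mono mult_left_mono abs_thin_drive_le) simp
      finally show ?thesis .
    qed
    then have "(\<integral>\<^sup>+ \<omega>. ennreal \<bar>Phi \<MM> \<alpha> (thin_drive lam W \<alpha> t \<omega>)\<bar> \<partial>P) \<le>
      (\<integral>\<^sup>+ \<omega>. ennreal \<bar>Phi \<MM> \<alpha> 0\<bar> + ennreal (lipschitz_const (Phi \<MM> \<alpha>)) * ?T \<omega> \<partial>P)"
      by (rule nn_integral_mono)
    also have "\<dots> = (\<integral>\<^sup>+ \<omega>. ennreal \<bar>Phi \<MM> \<alpha> 0\<bar> \<partial>P) + (\<integral>\<^sup>+ \<omega>. ennreal (lipschitz_const (Phi \<MM> \<alpha>)) * ?T \<omega> \<partial>P)"
      by (rule nn_integral_add) measurable
    also have "\<dots> = ennreal \<bar>Phi \<MM> \<alpha> 0\<bar> + ennreal (lipschitz_const (Phi \<MM> \<alpha>)) * (\<integral>\<^sup>+ \<omega>. ?T \<omega> \<partial>P)"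
      by (subst nn_integral_cmult) (simp_all add: emeasure_space_1)
    also have "\<dots> \<le> C \<alpha>"
      unfolding C_def B_def using c
      by (intro add_left_mono mult_left_mono drive_total_expectation[OF adm, where a = "\<lambda>_. c"]) auto
    finally show ?thesis .
  qed
  show ?thesis
  proof (rule that)
    show "(\<Sum>\<alpha>\<in>UNIV. C \<alpha>) < \<infinity>"
      using C by (simp add: less_top[symmetric])
    have "C \<alpha> \<le> (\<Sum>\<alpha>\<in>UNIV. C \<alpha>)" for \<alpha>
      by (rule member_le_sum) auto
    with bound show "(\<integral>\<^sup>+ \<omega>. ennreal \<bar>Phi \<MM> \<alpha> (thin_drive lam W \<alpha> t \<omega>)\<bar> \<partial>P) \<le> (\<Sum>\<alpha>\<in>UNIV. C \<alpha>)" for \<alpha> t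
      by (rule order.trans)
  qed
qed

text \<open>The Lipschitz factor turns \<open>knorm\<close> into the matrix entries, and
  subinvariance of the weights extracts \<theta>. The conclusion holds at every t although the
  distance is assumed at almost every time, because the drive integrates over past
  intensities.\<close>

lemma step_contract:
  assumes adm: "admissible lam W" "admissible lam' W'" and bd: "mbounded lam W" "mbounded lam' W'"
    and dist: "mdist lam W lam' W' c" and c: "0 \<le> c"
  shows "(\<integral>\<^sup>+ \<omega>. ennreal \<bar>Phi \<MM> \<alpha> (thin_drive lam W \<alpha> t \<omega>) - Phi \<MM> \<alpha> (thin_drive lam' W' \<alpha> t \<omega>)\<bar> \<partial>P)
    \<le> ennreal (c * \<theta> * v \<alpha>)"
proof -
  let ?L = "ennreal (lipschitz_const (Phi \<MM> \<alpha>))"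
  have [measurable]: "thin_drive lam W \<alpha> t \<in> borel_measurable P" "thin_drive lam' W' \<alpha> t \<in> borel_measurable P"
    using measurable_F_P[OF measurable_F_section[OF measurable_thin_drive[OF adm(1), unfolded case_prod_beta'], where t = t]]
      measurable_F_P[OF measurable_F_section[OF measurable_thin_drive[OF adm(2), unfolded case_prod_beta'], where t = t]]
    by simp_all
  have "(\<integral>\<^sup>+ \<omega>. ennreal \<bar>Phi \<MM> \<alpha> (thin_drive lam W \<alpha> t \<omega>) - Phi \<MM> \<alpha> (thin_drive lam' W' \<alpha> t \<omega>)\<bar> \<partial>P) \<le>
    (\<integral>\<^sup>+ \<omega>. ?L * ennreal \<bar>thin_drive lam W \<alpha> t \<omega> - thin_drive lam' W' \<alpha> t \<omega>\<bar> \<partial>P)"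
    using Phi_lipschitz lipschitz_const_nonneg
    by (intro nn_integral_mono) (simp add: ennreal_leI flip: ennreal_mult)
  also have "\<dots> = ?L * (\<integral>\<^sup>+ \<omega>. ennreal \<bar>thin_drive lam W \<alpha> t \<omega> - thin_drive lam' W' \<alpha> t \<omega>\<bar> \<partial>P)"
    by (rule nn_integral_cmult) measurable
  also have "\<dots> \<le> ?L * (\<Sum>\<beta>\<in>UNIV. knorm \<alpha> \<beta> * ennreal (c * v \<beta>))"
    using dist unfolding mdist_def
    by (intro mult_left_mono thin_drive_contraction adm converges_AE bd) auto
  also have "\<dots> = ennreal c * (\<Sum>\<beta>\<in>UNIV. ?L * knorm \<alpha> \<beta> * ennreal (v \<beta>))"
    using c v_pos by (simp add: sum_distrib_left ennreal_mult less_imp_le mult_ac)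
  also have "\<dots> \<le> ennreal c * ennreal (\<theta> * v \<alpha>)"
    by (intro mult_left_mono subinvariant) simp
  also have "\<dots> = ennreal (c * \<theta> * v \<alpha>)"
    using c \<theta> v_pos[of \<alpha>] by (simp add: ennreal_mult[symmetric] mult_ac)
  finally show ?thesis .
qed

lemma mdist_of_mbounded:
  assumes "admissible lam W" "admissible lam' W'" "mbounded lam W" "mbounded lam' W'"
  obtains c where "0 \<le> c"
    "\<And>m t. (\<integral>\<^sup>+ \<omega>. ennreal \<bar>lam m t \<omega> - lam' m t \<omega>\<bar> \<partial>P) \<le> ennreal (c * v (Inl m))"
    "\<And>p k. k \<in> grid n \<phi> p \<Longrightarrow> (\<integral>\<^sup>+ \<omega>. ennreal \<bar>W p k \<omega> - W' p k \<omega>\<bar> \<partial>P) \<le> ennreal (c * v (Inr p))"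
proof -
  obtain c1 where c1: "c1 < \<infinity>" "\<And>m t. (\<integral>\<^sup>+ \<omega>. ennreal \<bar>lam m t \<omega>\<bar> \<partial>P) \<le> c1"
    "\<And>p k. k \<in> grid n \<phi> p \<Longrightarrow> (\<integral>\<^sup>+ \<omega>. ennreal \<bar>W p k \<omega>\<bar> \<partial>P) \<le> c1"
    using assms(3) by (auto simp: mbounded_def)
  obtain c2 where c2: "c2 < \<infinity>" "\<And>m t. (\<integral>\<^sup>+ \<omega>. ennreal \<bar>lam' m t \<omega>\<bar> \<partial>P) \<le> c2"
    "\<And>p k. k \<in> grid n \<phi> p \<Longrightarrow> (\<integral>\<^sup>+ \<omega>. ennreal \<bar>W' p k \<omega>\<bar> \<partial>P) \<le> c2"
    using assms(4) by (auto simp: mbounded_def)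
  define r where "r = enn2real (c1 + c2)"
  have r: "c1 + c2 = ennreal r"
    using c1(1) c2(1) by (simp add: r_def)
  have r0: "r \<ge> 0"
    by (simp add: r_def)
  \<comment> \<open>Since 1 / v \<beta> is one of the summands, c * v \<beta> is at least
    \<open>r\<close> for every label.\<close>
  define c where "c = r * (\<Sum>\<beta>\<in>UNIV. 1 / v \<beta>)"
  have c0: "0 \<le> c"
    unfolding c_def using r0 v_pos by (intro mult_nonneg_nonneg sum_nonneg) (auto simp: less_imp_le)
  have cv: "r \<le> c * v \<beta>" for \<beta>
  proof -
    have "1 / v \<beta> \<le> (\<Sum>\<beta>\<in>UNIV. 1 / v \<beta>)"
      using v_pos by (intro member_le_sum) (auto simp: less_imp_le)
    then have "r * (1 / v \<beta>) * v \<beta> \<le> c * v \<beta>"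
      unfolding c_def using r0 v_pos[of \<beta>] by (intro mult_right_mono mult_left_mono) auto
    then show ?thesis
      using v_pos[of \<beta>] by simp
  qed
  have tri: "(\<integral>\<^sup>+ \<omega>. ennreal \<bar>X \<omega> - Y \<omega>\<bar> \<partial>P) \<le> ennreal (c * v \<beta>)"
    if "X \<in> borel_measurable P" "Y \<in> borel_measurable P" "(\<integral>\<^sup>+ \<omega>. ennreal \<bar>X \<omega>\<bar> \<partial>P) \<le> c1" "(\<integral>\<^sup>+ \<omega>. ennreal \<bar>Y \<omega>\<bar> \<partial>P) \<le> c2" for X Y \<beta>
  proof -
    have "(\<integral>\<^sup>+ \<omega>. ennreal \<bar>X \<omega> - Y \<omega>\<bar> \<partial>P) \<le> (\<integral>\<^sup>+ \<omega>. ennreal \<bar>X \<omega>\<bar> \<partial>P) + (\<integral>\<^sup>+ \<omega>. ennreal \<bar>Y \<omega>\<bar> \<partial>P)"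
      using nn_integral_abs_triangle[OF that(1) _ that(2), of "\<lambda>_. 0"] by simp
    also have "\<dots> \<le> c1 + c2"
      by (intro add_mono that)
    also have "\<dots> \<le> ennreal (c * v \<beta>)"
      unfolding r by (rule ennreal_leI[OF cv])
    finally show ?thesis .
  qed
  show ?thesis
  proof (rule that[OF c0])
    show "(\<integral>\<^sup>+ \<omega>. ennreal \<bar>lam m t \<omega> - lam' m t \<omega>\<bar> \<partial>P) \<le> ennreal (c * v (Inl m))" for m t
      using assms(1,2) by (intro tri c1 c2 measurable_lam_P) (auto simp: admissible_def)
    show "(\<integral>\<^sup>+ \<omega>. ennreal \<bar>W p k \<omega> - W' p k \<omega>\<bar> \<partial>P) \<le> ennreal (c * v (Inr p))" if "k \<in> grid n \<phi> p" for p k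
    proof (intro tri c1 c2 that)
      have "W p k \<in> borel_measurable (F k)" "W' p k \<in> borel_measurable (F k)"
        using assms(1,2) that by (auto simp: admissible_def)
      then show "W p k \<in> borel_measurable P" "W' p k \<in> borel_measurable P"
        by (blast intro: measurable_F_P)+
    qed
  qed
qed

text \<open>The equations of the process with the points replaced by the thinning of the intensity.
  Convergence of the drive is left out, as it follows from bounded moments.\<close>

definition solves :: "('m \<Rightarrow> real \<Rightarrow> 'w \<Rightarrow> real) \<Rightarrow> ('p \<Rightarrow> real \<Rightarrow> 'w \<Rightarrow> real) \<Rightarrow> bool" where
  "solves lam W \<longleftrightarrow>
     (\<forall>m. AE z in P \<Otimes>\<^sub>M lborel. lam m (snd z) (fst z) = Phi \<MM> (Inl m) (thin_drive lam W (Inl m) (snd z) (fst z))) \<and>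
     (\<forall>p. \<forall>k\<in>grid n \<phi> p. AE \<omega> in P. W p k \<omega> = \<xi> p k \<omega> + Phi \<MM> (Inr p) (thin_drive lam W (Inr p) k \<omega>))"

text \<open>Bounded moments make the distance finite at some level \<open>c\<close>. Each use of the
  equations improves the level by the factor \<theta>, so the distance is below every c \<theta>^j
  and vanishes; countably many j leave a common null set of times.\<close>

lemma solves_unique:
  assumes adm: "admissible lam W" "admissible lam' W'" and bd: "mbounded lam W" "mbounded lam' W'"
    and sol: "solves lam W" "solves lam' W'"
  shows "AE t in lborel. \<forall>m. (\<integral>\<^sup>+ \<omega>. ennreal \<bar>lam m t \<omega> - lam' m t \<omega>\<bar> \<partial>P) = 0"
    and "\<And>p k. k \<in> grid n \<phi> p \<Longrightarrow> AE \<omega> in P. W p k \<omega> = W' p k \<omega>"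
proof -
  have sP: "sigma_finite_measure P" and sL: "sigma_finite_measure (lborel :: real measure)"
    by unfold_locales
  obtain c where c: "0 \<le> c"
    "\<And>m t. (\<integral>\<^sup>+ \<omega>. ennreal \<bar>lam m t \<omega> - lam' m t \<omega>\<bar> \<partial>P) \<le> ennreal (c * v (Inl m))"
    "\<And>p k. k \<in> grid n \<phi> p \<Longrightarrow> (\<integral>\<^sup>+ \<omega>. ennreal \<bar>W p k \<omega> - W' p k \<omega>\<bar> \<partial>P) \<le> ennreal (c * v (Inr p))"
    using mdist_of_mbounded[OF adm bd] by blast
  have AEl: "AE t in lborel. \<forall>m. AE \<omega> in P. lam m t \<omega> = Phi \<MM> (Inl m) (thin_drive lam W (Inl m) t \<omega>)"
    and AEl': "AE t in lborel. \<forall>m. AE \<omega> in P. lam' m t \<omega> = Phi \<MM> (Inl m) (thin_drive lam' W' (Inl m) t \<omega>)"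
    using sol unfolding solves_def
    by (auto intro!: AE_finite_allI[of UNIV, simplified] AE_pair_swapD[OF sP sL])
  have dist: "mdist lam W lam' W' (c * \<theta> ^ j)" for j
  proof (induction j)
    case 0
    then show ?case
      using c by (simp add: mdist_def)
  next
    case (Suc j)
    have c': "0 \<le> c * \<theta> ^ j"
      using c(1) \<theta> by simp
    note con = step_contract[OF adm bd Suc c']
    show ?case
      unfolding mdist_def
    proof (intro conjI allI ballI)
      show "AE t in lborel. \<forall>m. (\<integral>\<^sup>+ \<omega>. ennreal \<bar>lam m t \<omega> - lam' m t \<omega>\<bar> \<partial>P) \<le> ennreal (c * \<theta> ^ Suc j * v (Inl m))"
        using AEl AEl'
      proof eventually_elim
        case (elim t)
        show ?case
        proof
          fix m
          have "AE \<omega> in P. ennreal \<bar>lam m t \<omega> - lam' m t \<omega>\<bar> =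
            ennreal \<bar>Phi \<MM> (Inl m) (thin_drive lam W (Inl m) t \<omega>) - Phi \<MM> (Inl m) (thin_drive lam' W' (Inl m) t \<omega>)\<bar>"
            using elim(1)[rule_format, of m] elim(2)[rule_format, of m] by eventually_elim simp
          then have "(\<integral>\<^sup>+ \<omega>. ennreal \<bar>lam m t \<omega> - lam' m t \<omega>\<bar> \<partial>P) =
            (\<integral>\<^sup>+ \<omega>. ennreal \<bar>Phi \<MM> (Inl m) (thin_drive lam W (Inl m) t \<omega>) - Phi \<MM> (Inl m) (thin_drive lam' W' (Inl m) t \<omega>)\<bar> \<partial>P)"
            by (rule nn_integral_cong_AE)
          then show "(\<integral>\<^sup>+ \<omega>. ennreal \<bar>lam m t \<omega> - lam' m t \<omega>\<bar> \<partial>P) \<le> ennreal (c * \<theta> ^ Suc j * v (Inl m))"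
            using con[of "Inl m" t] by (simp add: mult_ac)
        qed
      qed
      show "(\<integral>\<^sup>+ \<omega>. ennreal \<bar>W p k \<omega> - W' p k \<omega>\<bar> \<partial>P) \<le> ennreal (c * \<theta> ^ Suc j * v (Inr p))" if k: "k \<in> grid n \<phi> p" for p k
      proof -
        have "AE \<omega> in P. W p k \<omega> = \<xi> p k \<omega> + Phi \<MM> (Inr p) (thin_drive lam W (Inr p) k \<omega>)"
          "AE \<omega> in P. W' p k \<omega> = \<xi> p k \<omega> + Phi \<MM> (Inr p) (thin_drive lam' W' (Inr p) k \<omega>)"
          using sol k by (auto simp: solves_def)
        then have "AE \<omega> in P. ennreal \<bar>W p k \<omega> - W' p k \<omega>\<bar> =
            ennreal \<bar>Phi \<MM> (Inr p) (thin_drive lam W (Inr p) k \<omega>) - Phi \<MM> (Inr p) (thin_drive lam' W' (Inr p) k \<omega>)\<bar>"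
          by eventually_elim simp
        then have "(\<integral>\<^sup>+ \<omega>. ennreal \<bar>W p k \<omega> - W' p k \<omega>\<bar> \<partial>P) =
            (\<integral>\<^sup>+ \<omega>. ennreal \<bar>Phi \<MM> (Inr p) (thin_drive lam W (Inr p) k \<omega>) - Phi \<MM> (Inr p) (thin_drive lam' W' (Inr p) k \<omega>)\<bar> \<partial>P)"
          by (rule nn_integral_cong_AE)
        then show ?thesis
          using con[of "Inr p" k] by (simp add: mult_ac)
      qed
    qed
  qed
  have "AE t in lborel. \<forall>j m. (\<integral>\<^sup>+ \<omega>. ennreal \<bar>lam m t \<omega> - lam' m t \<omega>\<bar> \<partial>P) \<le> ennreal (c * \<theta> ^ j * v (Inl m))"
    using dist unfolding mdist_def AE_all_countable by auto
  then show "AE t in lborel. \<forall>m. (\<integral>\<^sup>+ \<omega>. ennreal \<bar>lam m t \<omega> - lam' m t \<omega>\<bar> \<partial>P) = 0"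
  proof eventually_elim
    case (elim t)
    show ?case
    proof
      fix m
      show "(\<integral>\<^sup>+ \<omega>. ennreal \<bar>lam m t \<omega> - lam' m t \<omega>\<bar> \<partial>P) = 0"
        using elim \<theta> by (intro zero_if_le_geometric[of _ "c * v (Inl m)" \<theta>]) (auto simp: mult_ac)
    qed
  qed
  show "AE \<omega> in P. W p k \<omega> = W' p k \<omega>" if k: "k \<in> grid n \<phi> p" for p k
  proof -
    have "W p k \<in> borel_measurable (F k)" "W' p k \<in> borel_measurable (F k)"
      using adm k by (auto simp: admissible_def)
    then have [measurable]: "W p k \<in> borel_measurable P" "W' p k \<in> borel_measurable P"
      by (blast intro: measurable_F_P)+
    have "(\<integral>\<^sup>+ \<omega>. ennreal \<bar>W p k \<omega> - W' p k \<omega>\<bar> \<partial>P) = 0"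
      using dist k \<theta> by (intro zero_if_le_geometric[of _ "c * v (Inr p)" \<theta>]) (auto simp: mdist_def mult_ac)
    then show ?thesis
      by (subst (asm) nn_integral_0_iff_AE) (auto simp: ennreal_eq_0_iff)
  qed
qed

section \<open>Moments and limit of the iterates\<close>

lemma \<xi>_bound: "k \<in> grid n \<phi> p \<Longrightarrow> (\<integral>\<^sup>+ \<omega>. ennreal \<bar>\<xi> p k \<omega>\<bar> \<partial>P) \<le> (SUP (p, k)\<in>grid_points n \<phi>. \<integral>\<^sup>+ \<omega>. ennreal \<bar>\<xi> p k \<omega>\<bar> \<partial>P)"
  by (rule SUP_upper2[of "(p, k)"]) (auto simp: grid_points_def)

lemma mbounded_iter: "mbounded (lamI j) (WI j)"
proof (induction j)
  case 0
  show ?case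
    unfolding mbounded_def by (intro exI[of _ 0]) (simp add: lamI_0 WI_0)
next
  case (Suc j)
  obtain C where C: "C < \<infinity>" "\<And>\<alpha> t. (\<integral>\<^sup>+ \<omega>. ennreal \<bar>Phi \<MM> \<alpha> (thin_drive (lamI j) (WI j) \<alpha> t \<omega>)\<bar> \<partial>P) \<le> C"
    using Phi_drive_bounded[OF admissible_iter Suc] by blast
  let ?S = "SUP (p, k)\<in>grid_points n \<phi>. \<integral>\<^sup>+ \<omega>. ennreal \<bar>\<xi> p k \<omega>\<bar> \<partial>P"
  show ?case
    unfolding mbounded_def
  proof (intro exI[of _ "?S + C"] conjI allI ballI)
    show "?S + C < \<infinity>"
      using C(1) \<xi>_finite by simp
    show "(\<integral>\<^sup>+ \<omega>. ennreal \<bar>lamI (Suc j) m t \<omega>\<bar> \<partial>P) \<le> ?S + C" for m t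
      unfolding lamI_Suc using C(2) by (intro order.trans[OF C(2)]) simp
    show "(\<integral>\<^sup>+ \<omega>. ennreal \<bar>WI (Suc j) p k \<omega>\<bar> \<partial>P) \<le> ?S + C" if k: "k \<in> grid n \<phi> p" for p k
    proof -
      note [measurable] = \<xi>_measurable[OF k]
        measurable_F_P[OF measurable_Phi_thin_drive(2)[OF admissible_iter, of "Inr p" j k]]
      have "(\<integral>\<^sup>+ \<omega>. ennreal \<bar>WI (Suc j) p k \<omega>\<bar> \<partial>P) \<le>
        (\<integral>\<^sup>+ \<omega>. ennreal \<bar>\<xi> p k \<omega>\<bar> + ennreal \<bar>Phi \<MM> (Inr p) (thin_drive (lamI j) (WI j) (Inr p) k \<omega>)\<bar> \<partial>P)"
        unfolding WI_Suc[OF k] by (intro nn_integral_mono) (auto simp flip: ennreal_plus intro!: ennreal_leI)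
      also have "\<dots> = (\<integral>\<^sup>+ \<omega>. ennreal \<bar>\<xi> p k \<omega>\<bar> \<partial>P) + (\<integral>\<^sup>+ \<omega>. ennreal \<bar>Phi \<MM> (Inr p) (thin_drive (lamI j) (WI j) (Inr p) k \<omega>)\<bar> \<partial>P)"
        by (rule nn_integral_add) measurable
      also have "\<dots> \<le> ?S + C"
        by (intro add_mono \<xi>_bound k C(2))
      finally show ?thesis .
    qed
  qed
qed

text \<open>The first two iterates are at a finite weighted distance, and each further step
  contracts it. The bounds hold at every time, so the limit is controlled at every time as
  well.\<close>

lemma iter_increments:
  obtains c where "0 \<le> c"
    "\<And>j m t. (\<integral>\<^sup>+ \<omega>. ennreal \<bar>lamI (Suc j) m t \<omega> - lamI j m t \<omega>\<bar> \<partial>P) \<le> ennreal (c * v (Inl m) * \<theta> ^ j)"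
    "\<And>j p k. k \<in> grid n \<phi> p \<Longrightarrow> (\<integral>\<^sup>+ \<omega>. ennreal \<bar>WI (Suc j) p k \<omega> - WI j p k \<omega>\<bar> \<partial>P) \<le> ennreal (c * v (Inr p) * \<theta> ^ j)"
proof -
  obtain c where c: "0 \<le> c"
    "\<And>m t. (\<integral>\<^sup>+ \<omega>. ennreal \<bar>lamI (Suc 0) m t \<omega> - lamI 0 m t \<omega>\<bar> \<partial>P) \<le> ennreal (c * v (Inl m))"
    "\<And>p k. k \<in> grid n \<phi> p \<Longrightarrow> (\<integral>\<^sup>+ \<omega>. ennreal \<bar>WI (Suc 0) p k \<omega> - WI 0 p k \<omega>\<bar> \<partial>P) \<le> ennreal (c * v (Inr p))"
    using mdist_of_mbounded[OF admissible_iter admissible_iter mbounded_iter mbounded_iter, of "Suc 0" 0] by blast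
  have "(\<forall>m t. (\<integral>\<^sup>+ \<omega>. ennreal \<bar>lamI (Suc j) m t \<omega> - lamI j m t \<omega>\<bar> \<partial>P) \<le> ennreal (c * \<theta> ^ j * v (Inl m))) \<and>
    (\<forall>p. \<forall>k\<in>grid n \<phi> p. (\<integral>\<^sup>+ \<omega>. ennreal \<bar>WI (Suc j) p k \<omega> - WI j p k \<omega>\<bar> \<partial>P) \<le> ennreal (c * \<theta> ^ j * v (Inr p)))" for j
  proof (induction j)
    case 0
    then show ?case
      using c by simp
  next
    case (Suc j)
    then have d: "mdist (lamI (Suc j)) (WI (Suc j)) (lamI j) (WI j) (c * \<theta> ^ j)"
      by (simp add: mdist_def)
    have "0 \<le> c * \<theta> ^ j"
      using c(1) \<theta> by simp
    note con = step_contract[OF admissible_iter admissible_iter mbounded_iter mbounded_iter d this]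
    show ?case
    proof (intro conjI allI ballI)
      show "(\<integral>\<^sup>+ \<omega>. ennreal \<bar>lamI (Suc (Suc j)) m t \<omega> - lamI (Suc j) m t \<omega>\<bar> \<partial>P) \<le> ennreal (c * \<theta> ^ Suc j * v (Inl m))" for m t
        using con[of "Inl m" t] unfolding lamI_Suc[of "Suc j"] lamI_Suc[of j] by (simp add: mult_ac)
      show "(\<integral>\<^sup>+ \<omega>. ennreal \<bar>WI (Suc (Suc j)) p k \<omega> - WI (Suc j) p k \<omega>\<bar> \<partial>P) \<le> ennreal (c * \<theta> ^ Suc j * v (Inr p))"
        if k: "k \<in> grid n \<phi> p" for p k
        using con[of "Inr p" k] unfolding WI_Suc[OF k, of "Suc j"] WI_Suc[OF k, of j] by (simp add: mult_ac)
    qed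
  qed
  then show ?thesis
    using that[OF c(1)] by (simp add: mult_ac)
qed

lemma limit_distance:
  obtains c where "0 \<le> c"
    "\<And>j m t. (\<integral>\<^sup>+ \<omega>. ennreal \<bar>lamL m t \<omega> - lamI j m t \<omega>\<bar> \<partial>P) \<le> ennreal (c * \<theta> ^ j * v (Inl m))"
    "\<And>j p k. k \<in> grid n \<phi> p \<Longrightarrow> (\<integral>\<^sup>+ \<omega>. ennreal \<bar>WL p k \<omega> - WI j p k \<omega>\<bar> \<partial>P) \<le> ennreal (c * \<theta> ^ j * v (Inr p))"
proof -
  obtain c where c: "0 \<le> c"
    "\<And>j m t. (\<integral>\<^sup>+ \<omega>. ennreal \<bar>lamI (Suc j) m t \<omega> - lamI j m t \<omega>\<bar> \<partial>P) \<le> ennreal (c * v (Inl m) * \<theta> ^ j)"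
    "\<And>j p k. k \<in> grid n \<phi> p \<Longrightarrow> (\<integral>\<^sup>+ \<omega>. ennreal \<bar>WI (Suc j) p k \<omega> - WI j p k \<omega>\<bar> \<partial>P) \<le> ennreal (c * v (Inr p) * \<theta> ^ j)"
    using iter_increments by blast
  have cv: "0 \<le> c * v \<beta>" for \<beta>
    using c(1) v_pos[of \<beta>] by simp
  show ?thesis
  proof (rule that[of "c / (1 - \<theta>)"])
    show "0 \<le> c / (1 - \<theta>)"
      using c(1) \<theta> by simp
    show "(\<integral>\<^sup>+ \<omega>. ennreal \<bar>lamL m t \<omega> - lamI j m t \<omega>\<bar> \<partial>P) \<le> ennreal (c / (1 - \<theta>) * \<theta> ^ j * v (Inl m))" for j m t
    proof -
      have "lamI j m t \<in> borel_measurable P" for j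
        using admissible_iter[of j] by (intro measurable_lam_P) (simp add: admissible_def)
      from geometric_increments_limit(2)[OF this c(2) \<theta> cv, of j] show ?thesis
        by (simp add: lamL_def picard_intensity_def lamI_def mult_ac)
    qed
    show "(\<integral>\<^sup>+ \<omega>. ennreal \<bar>WL p k \<omega> - WI j p k \<omega>\<bar> \<partial>P) \<le> ennreal (c / (1 - \<theta>) * \<theta> ^ j * v (Inr p))"
      if k: "k \<in> grid n \<phi> p" for j p k
    proof -
      have "WI j p k \<in> borel_measurable P" for j
        using admissible_iter[of j] k by (intro measurable_F_P[of _ k]) (simp add: admissible_def)
      from geometric_increments_limit(2)[OF this c(3)[OF k] \<theta> cv, of j] show ?thesis
        by (simp add: WL_def picard_drift_def WI_def mult_ac)
    qed
  qed
qed

lemma mbounded_limit: "mbounded lamL WL"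
proof -
  obtain c where c: "0 \<le> c"
    "\<And>j m t. (\<integral>\<^sup>+ \<omega>. ennreal \<bar>lamL m t \<omega> - lamI j m t \<omega>\<bar> \<partial>P) \<le> ennreal (c * \<theta> ^ j * v (Inl m))"
    "\<And>j p k. k \<in> grid n \<phi> p \<Longrightarrow> (\<integral>\<^sup>+ \<omega>. ennreal \<bar>WL p k \<omega> - WI j p k \<omega>\<bar> \<partial>P) \<le> ennreal (c * \<theta> ^ j * v (Inr p))"
    using limit_distance by blast
  have "ennreal (c * v \<beta>) \<le> (\<Sum>\<beta>\<in>UNIV. ennreal (c * v \<beta>))" for \<beta>
    by (rule member_le_sum) auto
  note le = order.trans[OF _ this]
  show ?thesis
    unfolding mbounded_def
  proof (intro exI[of _ "\<Sum>\<beta>\<in>UNIV. ennreal (c * v \<beta>)"] conjI allI ballI)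
    show "(\<Sum>\<beta>\<in>UNIV. ennreal (c * v \<beta>)) < \<infinity>"
      by (simp add: less_top[symmetric])
    show "(\<integral>\<^sup>+ \<omega>. ennreal \<bar>lamL m t \<omega>\<bar> \<partial>P) \<le> (\<Sum>\<beta>\<in>UNIV. ennreal (c * v \<beta>))" for m t
      using c(2)[of m t 0] by (intro le[of _ "Inl m"]) (simp add: lamI_0)
    show "(\<integral>\<^sup>+ \<omega>. ennreal \<bar>WL p k \<omega>\<bar> \<partial>P) \<le> (\<Sum>\<beta>\<in>UNIV. ennreal (c * v \<beta>))" if "k \<in> grid n \<phi> p" for p k
      using c(3)[OF that, of 0] by (intro le[of _ "Inr p"]) (simp add: WI_0)
  qed
qed

text \<open>The limit and its image under a Picard step are both within a geometric distance of
  iterate j + 1: the limit by construction, its image by the contraction applied to the limit and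
  iterate j. Hence they agree almost surely at each fixed time.\<close>

lemma limit_fixed_point:
  shows "AE \<omega> in P. lamL m t \<omega> = Phi \<MM> (Inl m) (thin_drive lamL WL (Inl m) t \<omega>)"
    and "k \<in> grid n \<phi> p \<Longrightarrow> AE \<omega> in P. WL p k \<omega> = \<xi> p k \<omega> + Phi \<MM> (Inr p) (thin_drive lamL WL (Inr p) k \<omega>)"
proof -
  obtain c where c: "0 \<le> c"
    "\<And>j m t. (\<integral>\<^sup>+ \<omega>. ennreal \<bar>lamL m t \<omega> - lamI j m t \<omega>\<bar> \<partial>P) \<le> ennreal (c * \<theta> ^ j * v (Inl m))"
    "\<And>j p k. k \<in> grid n \<phi> p \<Longrightarrow> (\<integral>\<^sup>+ \<omega>. ennreal \<bar>WL p k \<omega> - WI j p k \<omega>\<bar> \<partial>P) \<le> ennreal (c * \<theta> ^ j * v (Inr p))"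
    using limit_distance by blast
  have c': "0 \<le> c * \<theta> ^ j" for j
    using c(1) \<theta> by simp
  have d: "mdist lamL WL (lamI j) (WI j) (c * \<theta> ^ j)" for j
    using c by (simp add: mdist_def)
  note con = step_contract[OF admissible_limit admissible_iter mbounded_limit mbounded_iter d c']
  have eq0: "AE \<omega> in P. X \<omega> = Z \<omega>"
    if [measurable]: "X \<in> borel_measurable P" "Z \<in> borel_measurable P" "\<And>j. Y j \<in> borel_measurable P"
      and XY: "\<And>j. (\<integral>\<^sup>+ \<omega>. ennreal \<bar>X \<omega> - Y j \<omega>\<bar> \<partial>P) \<le> ennreal (c * \<theta> ^ Suc j * v \<beta>)"
      and ZY: "\<And>j. (\<integral>\<^sup>+ \<omega>. ennreal \<bar>Z \<omega> - Y j \<omega>\<bar> \<partial>P) \<le> ennreal (c * \<theta> ^ j * \<theta> * v \<beta>)"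
    for X Z :: "'w \<Rightarrow> real" and Y \<beta>
  proof -
    have "(\<integral>\<^sup>+ \<omega>. ennreal \<bar>X \<omega> - Z \<omega>\<bar> \<partial>P) = 0"
    proof (rule zero_if_le_geometric[OF _ \<theta>])
      fix j
      have "(\<integral>\<^sup>+ \<omega>. ennreal \<bar>X \<omega> - Z \<omega>\<bar> \<partial>P) \<le> (\<integral>\<^sup>+ \<omega>. ennreal \<bar>X \<omega> - Y j \<omega>\<bar> \<partial>P) + (\<integral>\<^sup>+ \<omega>. ennreal \<bar>Y j \<omega> - Z \<omega>\<bar> \<partial>P)"
        by (rule nn_integral_abs_triangle) measurable
      also have "\<dots> \<le> ennreal (c * \<theta> ^ Suc j * v \<beta>) + ennreal (c * \<theta> ^ j * \<theta> * v \<beta>)"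
        using ZY by (intro add_mono XY) (simp add: abs_minus_commute)
      also have "\<dots> = ennreal (2 * c * \<theta> * v \<beta> * \<theta> ^ j)"
        using c(1) \<theta> v_pos[of \<beta>] by (simp add: ennreal_plus[symmetric] mult_ac less_imp_le del: ennreal_plus)
      finally show "(\<integral>\<^sup>+ \<omega>. ennreal \<bar>X \<omega> - Z \<omega>\<bar> \<partial>P) \<le> ennreal (2 * c * \<theta> * v \<beta> * \<theta> ^ j)" .
    qed
    then show ?thesis
      by (subst (asm) nn_integral_0_iff_AE) (auto simp: ennreal_eq_0_iff)
  qed
  show "AE \<omega> in P. lamL m t \<omega> = Phi \<MM> (Inl m) (thin_drive lamL WL (Inl m) t \<omega>)"
  proof (rule eq0)
    show "lamL m t \<in> borel_measurable P"
      using admissible_limit by (intro measurable_lam_P) (simp add: admissible_def)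
    show "lamI (Suc j) m t \<in> borel_measurable P" for j
      using admissible_iter[of "Suc j"] by (intro measurable_lam_P) (simp add: admissible_def)
    show "(\<lambda>\<omega>. Phi \<MM> (Inl m) (thin_drive lamL WL (Inl m) t \<omega>)) \<in> borel_measurable P"
      by (rule measurable_F_P[OF measurable_Phi_thin_drive(2)[OF admissible_limit]])
    show "(\<integral>\<^sup>+ \<omega>. ennreal \<bar>lamL m t \<omega> - lamI (Suc j) m t \<omega>\<bar> \<partial>P) \<le> ennreal (c * \<theta> ^ Suc j * v (Inl m))" for j
      by (rule c(2))
    show "(\<integral>\<^sup>+ \<omega>. ennreal \<bar>Phi \<MM> (Inl m) (thin_drive lamL WL (Inl m) t \<omega>) - lamI (Suc j) m t \<omega>\<bar> \<partial>P) \<le> ennreal (c * \<theta> ^ j * \<theta> * v (Inl m))" for j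
      unfolding lamI_Suc by (rule con)
  qed
  show "AE \<omega> in P. WL p k \<omega> = \<xi> p k \<omega> + Phi \<MM> (Inr p) (thin_drive lamL WL (Inr p) k \<omega>)" if k: "k \<in> grid n \<phi> p"
  proof (rule eq0)
    show "WL p k \<in> borel_measurable P"
      using admissible_limit k by (intro measurable_F_P[of _ k]) (simp add: admissible_def)
    show "WI (Suc j) p k \<in> borel_measurable P" for j
      using admissible_iter[of "Suc j"] k by (intro measurable_F_P[of _ k]) (simp add: admissible_def)
    show "(\<lambda>\<omega>. \<xi> p k \<omega> + Phi \<MM> (Inr p) (thin_drive lamL WL (Inr p) k \<omega>)) \<in> borel_measurable P"
      by (intro borel_measurable_add \<xi>_measurable[OF k] measurable_F_P[OF measurable_Phi_thin_drive(2)[OF admissible_limit]])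
    show "(\<integral>\<^sup>+ \<omega>. ennreal \<bar>WL p k \<omega> - WI (Suc j) p k \<omega>\<bar> \<partial>P) \<le> ennreal (c * \<theta> ^ Suc j * v (Inr p))" for j
      by (rule c(3)[OF k])
    show "(\<integral>\<^sup>+ \<omega>. ennreal \<bar>\<xi> p k \<omega> + Phi \<MM> (Inr p) (thin_drive lamL WL (Inr p) k \<omega>) - WI (Suc j) p k \<omega>\<bar> \<partial>P) \<le> ennreal (c * \<theta> ^ j * \<theta> * v (Inr p))" for j
      unfolding WI_Suc[OF k] using con[of "Inr p" k j] by simp
  qed
qed

end

subsection \<open>Existence and uniqueness\<close>

lemma ecount_eqI:
  assumes "\<And>C. ecount (A \<inter> C) = ecount (B \<inter> C)"
  shows "A = B"
proof -
  have *: "s \<in> A \<longleftrightarrow> ecount (A \<inter> {s}) \<noteq> 0" for s and A :: "'a set"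
    by (cases "s \<in> A") (simp_all add: ecount_def)
  have "s \<in> A \<longleftrightarrow> s \<in> B" for s
    unfolding *[of s A] *[of s B] assms ..
  then show ?thesis
    by blast
qed

context driven_paths
begin

text \<open>Identifies the thinning integral in \<open>har_process\<close> with the count of
  \<open>pts\<close>; the factor for nonnegative heights is 1 on all atoms.\<close>

lemma count_below_intensity:
  assumes "\<omega> \<in> space P"
  shows "(\<integral>\<^sup>+ (s, x). indicator (C \<times> {0..}) (s, x) * (if x \<le> l s then 1 else 0) \<partial>count_space (\<pi> m \<omega>)) =
    ecount (pts (\<pi> m \<omega>) l \<inter> C)"
proof -
  have inj: "inj_on fst (\<pi> m \<omega>)"
    using \<pi>_inj[OF assms, of m UNIV] by simp
  have "ecount (pts (\<pi> m \<omega>) l \<inter> C) = (\<integral>\<^sup>+ s. 1 \<partial>count_space (pts (\<pi> m \<omega>) l \<inter> C))"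
    using ecount_Int[of "pts (\<pi> m \<omega>) l \<inter> C" UNIV] by simp
  also have "\<dots> = (\<integral>\<^sup>+ z. (if snd z \<le> l (fst z) \<and> fst z \<in> C then 1 else 0) \<partial>count_space (\<pi> m \<omega>))"
    by (rule nn_integral_count_pts[OF inj])
  also have "\<dots> = (\<integral>\<^sup>+ (s, x). indicator (C \<times> {0..}) (s, x) * (if x \<le> l s then 1 else 0) \<partial>count_space (\<pi> m \<omega>))"
    using \<pi>_half[OF assms, of m] by (intro nn_integral_cong) (auto simp: indicator_def split: prod.split)
  finally show ?thesis ..
qed

lemma measurable_adapted_points:
  fixes N :: "'w \<Rightarrow> real set"
  assumes "\<And>t. (\<lambda>\<omega>. N \<omega> \<inter> {..t}) \<in> measurable (F t) config_space"
  shows "N \<in> measurable P config_space"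
proof (rule measurable_config_spaceI)
  fix B :: "real set"
  assume B: "B \<in> sets borel"
  have "ecount (N \<omega> \<inter> B) = (SUP i. ecount (N \<omega> \<inter> {..real i} \<inter> B))" for \<omega>
  proof -
    have "(SUP i. ecount (N \<omega> \<inter> {..real i} \<inter> B)) = ecount (\<Union>i. N \<omega> \<inter> {..real i} \<inter> B)"
      unfolding ecount_def by (rule SUP_emeasure_incseq) (auto simp: incseq_def)
    also have "(\<Union>i. N \<omega> \<inter> {..real i} \<inter> B) = N \<omega> \<inter> B"
      using real_arch_simple by auto
    finally show ?thesis ..
  qed
  moreover have "(\<lambda>\<omega>. SUP i. ecount (N \<omega> \<inter> {..real i} \<inter> B)) \<in> borel_measurable P"
    by (intro borel_measurable_SUP measurable_ecount_compose[OF measurable_F_P[OF assms] B]) auto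
  ultimately show "(\<lambda>\<omega>. ecount (N \<omega> \<inter> B)) \<in> borel_measurable P"
    by simp
qed

end

context har_contract
begin

section \<open>Uniqueness\<close>

text \<open>Reduces a process with bounded moments to its intensity and drifts. Equality of counts
  on all sets forces the points to be the thinning of the intensity almost surely, so
  \<open>N\<close> may be eliminated from the equations.\<close>

lemma har_process_thinning:
  assumes har: "har_process P n \<phi> \<pi> \<xi> \<MM> \<Lambda> N W" and bd: "bounded_moments P n \<phi> \<Lambda> W"
  shows "admissible \<Lambda> W" "mbounded \<Lambda> W" "solves \<Lambda> W"
    "AE \<omega> in P. \<forall>m. N m \<omega> = pts (\<pi> m \<omega>) (\<lambda>s. \<Lambda> m s \<omega>)"
proof -
  note H = har[unfolded har_process_def Let_def]
  show "admissible \<Lambda> W"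
    using H unfolding admissible_def by blast
  show "mbounded \<Lambda> W"
    unfolding mbounded_def
  proof (intro exI conjI allI ballI)
    let ?S1 = "SUP m. SUP t. \<integral>\<^sup>+ \<omega>. ennreal \<bar>\<Lambda> m t \<omega>\<bar> \<partial>P" and ?S2 = "SUP p. SUP k\<in>grid n \<phi> p. \<integral>\<^sup>+ \<omega>. ennreal \<bar>W p k \<omega>\<bar> \<partial>P"
    show "?S1 + ?S2 < \<infinity>"
      using bd by (simp add: bounded_moments_def)
    show "(\<integral>\<^sup>+ \<omega>. ennreal \<bar>\<Lambda> m t \<omega>\<bar> \<partial>P) \<le> ?S1 + ?S2" for m t
    proof -
      have "(\<integral>\<^sup>+ \<omega>. ennreal \<bar>\<Lambda> m t \<omega>\<bar> \<partial>P) \<le> ?S1"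
        by (intro SUP_upper2[of m] SUP_upper2[of t]) auto
      then show ?thesis
        by (rule order.trans) simp
    qed
    show "(\<integral>\<^sup>+ \<omega>. ennreal \<bar>W p k \<omega>\<bar> \<partial>P) \<le> ?S1 + ?S2" if "k \<in> grid n \<phi> p" for p k
    proof -
      have "(\<integral>\<^sup>+ \<omega>. ennreal \<bar>W p k \<omega>\<bar> \<partial>P) \<le> ?S2"
        using that by (intro SUP_upper2[of p] SUP_upper2[of k]) auto
      then show ?thesis
        by (rule order.trans) simp
    qed
  qed
  have "AE \<omega> in P. \<forall>m C. ecount (N m \<omega> \<inter> C) =
        (\<integral>\<^sup>+ (s, x). indicator (C \<times> {0..}) (s, x) * (if x \<le> \<Lambda> m s \<omega> then 1 else 0) \<partial>count_space (\<pi> m \<omega>))"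
    using H by blast
  then show N: "AE \<omega> in P. \<forall>m. N m \<omega> = pts (\<pi> m \<omega>) (\<lambda>s. \<Lambda> m s \<omega>)"
    using AE_space
  proof eventually_elim
    case (elim \<omega>)
    have "ecount (N m \<omega> \<inter> C) = ecount (pts (\<pi> m \<omega>) (\<lambda>s. \<Lambda> m s \<omega>) \<inter> C)" for m C
      using elim(1)[rule_format, of m C] count_below_intensity[OF elim(2), where C = C and l = "\<lambda>s. \<Lambda> m s \<omega>" and m = m] by simp
    then show ?case
      by (intro allI ecount_eqI)
  qed
  show "solves \<Lambda> W"
    unfolding solves_def
  proof (intro conjI allI ballI)
    fix m
    have "AE z in P \<Otimes>\<^sub>M lborel. \<forall>m. N m (fst z) = pts (\<pi> m (fst z)) (\<lambda>s. \<Lambda> m s (fst z))"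
      by (rule AE_pair_fst[OF _ N]) unfold_locales
    moreover have "AE (\<omega>, t) in P \<Otimes>\<^sub>M lborel.
        drive_converges \<MM> n \<phi> (\<lambda>m. N m \<omega>) (\<lambda>p k. W p k \<omega>) (Inl m) t \<and>
        \<Lambda> m t \<omega> = Phi \<MM> (Inl m) (drive \<MM> n \<phi> (\<lambda>m. N m \<omega>) (\<lambda>p k. W p k \<omega>) (Inl m) t)"
      using H by blast
    ultimately show "AE z in P \<Otimes>\<^sub>M lborel. \<Lambda> m (snd z) (fst z) = Phi \<MM> (Inl m) (thin_drive \<Lambda> W (Inl m) (snd z) (fst z))"
      by eventually_elim (simp add: thin_drive_def case_prod_beta)
  next
    fix p k
    assume k: "k \<in> grid n \<phi> p"
    have "AE \<omega> in P. \<forall>p. \<forall>k\<in>grid n \<phi> p.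
        drive_converges \<MM> n \<phi> (\<lambda>m. N m \<omega>) (\<lambda>p k. W p k \<omega>) (Inr p) k \<and>
        W p k \<omega> = \<xi> p k \<omega> + Phi \<MM> (Inr p) (drive \<MM> n \<phi> (\<lambda>m. N m \<omega>) (\<lambda>p k. W p k \<omega>) (Inr p) k)"
      using H by blast
    with N show "AE \<omega> in P. W p k \<omega> = \<xi> p k \<omega> + Phi \<MM> (Inr p) (thin_drive \<Lambda> W (Inr p) k \<omega>)"
    proof eventually_elim
      case (elim \<omega>)
      have "W p k \<omega> = \<xi> p k \<omega> + Phi \<MM> (Inr p) (drive \<MM> n \<phi> (\<lambda>m. N m \<omega>) (\<lambda>p k. W p k \<omega>) (Inr p) k)"
        using elim(2) k by blast
      also have "(\<lambda>m. N m \<omega>) = (\<lambda>m. pts (\<pi> m \<omega>) (\<lambda>s. \<Lambda> m s \<omega>))"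
        using elim(1) by blast
      finally show ?case
        by (simp add: thin_drive_def)
    qed
  qed
qed

text \<open>Intensities that agree at almost every time could still differ at the random times of
  the atoms. With weight 1, \<open>point_diff_expectation\<close> bounds the mean number of atoms
  treated differently by an integral that is 0.\<close>

lemma thin_points_AE_eq:
  assumes adm: "admissible lam W" "admissible lam' W'"
    and eq: "AE t in lborel. \<forall>m. (\<integral>\<^sup>+ \<omega>. ennreal \<bar>lam m t \<omega> - lam' m t \<omega>\<bar> \<partial>P) = 0"
  shows "AE \<omega> in P. \<forall>m. pts (\<pi> m \<omega>) (\<lambda>s. lam m s \<omega>) = pts (\<pi> m \<omega>) (\<lambda>s. lam' m s \<omega>)"
  unfolding AE_all_countable
proof
  fix m
  have lam: "(\<lambda>(\<omega>, t). lam m t \<omega>) \<in> borel_measurable Pred" and lam': "(\<lambda>(\<omega>, t). lam' m t \<omega>) \<in> borel_measurable Pred"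
    using adm by (simp_all add: admissible_def)
  let ?A = "\<lambda>\<omega>. \<integral>\<^sup>+ z. (if (snd z \<le> lam m (fst z) \<omega>) \<noteq> (snd z \<le> lam' m (fst z) \<omega>) then 1 else 0) \<partial>count_space (\<pi> m \<omega>)"
  have mA: "?A \<in> borel_measurable P"
  proof -
    have [measurable]: "(\<lambda>w. lam m (fst (snd w)) (fst w)) \<in> borel_measurable (P \<Otimes>\<^sub>M (borel :: (real \<times> real) measure))"
      "(\<lambda>w. lam' m (fst (snd w)) (fst w)) \<in> borel_measurable (P \<Otimes>\<^sub>M (borel :: (real \<times> real) measure))"
      using measurable_compose[OF measurable_to_Pred lam] measurable_compose[OF measurable_to_Pred lam'] by simp_all
    have "(\<lambda>w. if (snd (snd w) \<le> lam m (fst (snd w)) (fst w)) \<noteq> (snd (snd w) \<le> lam' m (fst (snd w)) (fst w))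
       then 1 else 0 :: ennreal) \<in> borel_measurable (P \<Otimes>\<^sub>M (borel :: (real \<times> real) measure))"
      by measurable
    from borel_measurable_count_nn_integral[OF \<pi>_measurable \<pi>_finite this, of m] show ?thesis
      unfolding fst_conv snd_conv .
  qed
  have "(\<integral>\<^sup>+ \<omega>. ?A \<omega> \<partial>P) \<le> (\<integral>\<^sup>+ s. 1 * (\<integral>\<^sup>+ \<omega>. ennreal \<bar>lam m s \<omega> - lam' m s \<omega>\<bar> \<partial>P) \<partial>lborel)"
    by (rule point_diff_expectation[OF lam lam', where g = "\<lambda>_. 1"]) simp
  also have "\<dots> = (\<integral>\<^sup>+ s. 0 \<partial>(lborel :: real measure))"
    using eq by (intro nn_integral_cong_AE) (auto elim!: eventually_mono)
  finally have "(\<integral>\<^sup>+ \<omega>. ?A \<omega> \<partial>P) = 0"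
    by simp
  then have "AE \<omega> in P. ?A \<omega> = 0"
    using mA by (simp add: nn_integral_0_iff_AE)
  then show "AE \<omega> in P. pts (\<pi> m \<omega>) (\<lambda>s. lam m s \<omega>) = pts (\<pi> m \<omega>) (\<lambda>s. lam' m s \<omega>)"
  proof eventually_elim
    case (elim \<omega>)
    then have "AE z in count_space (\<pi> m \<omega>). (if (snd z \<le> lam m (fst z) \<omega>) \<noteq> (snd z \<le> lam' m (fst z) \<omega>) then 1 else 0 :: ennreal) = 0"
      by (subst (asm) nn_integral_0_iff_AE) auto
    then have "\<forall>z\<in>\<pi> m \<omega>. (snd z \<le> lam m (fst z) \<omega>) = (snd z \<le> lam' m (fst z) \<omega>)"
      unfolding AE_count_space by (auto split: if_splits)
    then have "(s, x) \<in> \<pi> m \<omega> \<and> x \<le> lam m s \<omega> \<longleftrightarrow> (s, x) \<in> \<pi> m \<omega> \<and> x \<le> lam' m s \<omega>" for s x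
      by (metis fst_conv snd_conv)
    then show ?case
      unfolding pts_def by simp
  qed
qed

text \<open>The second conclusion lets the intensity of the limit process serve as a predictable
  version of the intensity of any other such process.\<close>

lemma har_process_unique:
  assumes "har_process P n \<phi> \<pi> \<xi> \<MM> \<Lambda> N W" "bounded_moments P n \<phi> \<Lambda> W"
    and "har_process P n \<phi> \<pi> \<xi> \<MM> \<Lambda>' N' W'" "bounded_moments P n \<phi> \<Lambda>' W'"
  shows "modification P n \<phi> N W N' W'" "AE (\<omega>, t) in P \<Otimes>\<^sub>M lborel. \<Lambda> m t \<omega> = \<Lambda>' m t \<omega>"
proof -
  note h = har_process_thinning[OF assms(1,2)] and h' = har_process_thinning[OF assms(3,4)]
  note u = solves_unique[OF h(1) h'(1) h(2) h'(2) h(3) h'(3)]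
  have N: "AE \<omega> in P. \<forall>m. N m \<omega> = N' m \<omega>"
    using h(4) h'(4) thin_points_AE_eq[OF h(1) h'(1) u(1)] by eventually_elim simp
  have "countable (grid_points n \<phi>)"
  proof -
    have "grid_points n \<phi> = (SIGMA p:UNIV. grid n \<phi> p)"
      by (auto simp: grid_points_def)
    then show ?thesis
      by (auto intro: countable_grid)
  qed
  then have "AE \<omega> in P. \<forall>(p, k)\<in>grid_points n \<phi>. W p k \<omega> = W' p k \<omega>"
    using u(2) by (subst AE_ball_countable) (auto simp: grid_points_def)
  with N show "modification P n \<phi> N W N' W'"
    by (simp add: modification_def)
  interpret L: pair_sigma_finite P "lborel :: real measure" ..
  have lam: "(\<lambda>(\<omega>, t). \<Lambda> m t \<omega>) \<in> borel_measurable Pred" and lam': "(\<lambda>(\<omega>, t). \<Lambda>' m t \<omega>) \<in> borel_measurable Pred"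
    using h(1) h'(1) by (simp_all add: admissible_def)
  note [measurable] = measurable_Pred_P[OF lam, unfolded case_prod_beta'] measurable_Pred_P[OF lam', unfolded case_prod_beta']
  have m [measurable]: "(\<lambda>z. ennreal \<bar>\<Lambda> m (snd z) (fst z) - \<Lambda>' m (snd z) (fst z)\<bar>) \<in> borel_measurable (P \<Otimes>\<^sub>M (lborel :: real measure))"
    by (subst measurable_cong_sets[OF sets_pair_measure_cong[OF refl sets_lborel] refl]) measurable
  have "(\<integral>\<^sup>+ z. ennreal \<bar>\<Lambda> m (snd z) (fst z) - \<Lambda>' m (snd z) (fst z)\<bar> \<partial>(P \<Otimes>\<^sub>M lborel)) =
    (\<integral>\<^sup>+ t. \<integral>\<^sup>+ \<omega>. ennreal \<bar>\<Lambda> m t \<omega> - \<Lambda>' m t \<omega>\<bar> \<partial>P \<partial>lborel)"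
    using L.nn_integral_snd[OF m] by simp
  also have "\<dots> = (\<integral>\<^sup>+ t. 0 \<partial>(lborel :: real measure))"
    using u(1) by (intro nn_integral_cong_AE) (auto elim!: eventually_mono)
  finally have "AE z in P \<Otimes>\<^sub>M lborel. ennreal \<bar>\<Lambda> m (snd z) (fst z) - \<Lambda>' m (snd z) (fst z)\<bar> = 0"
    using m by (simp add: nn_integral_0_iff_AE)
  then show "AE (\<omega>, t) in P \<Otimes>\<^sub>M lborel. \<Lambda> m t \<omega> = \<Lambda>' m t \<omega>"
    by eventually_elim (auto simp: ennreal_eq_0_iff)
qed

section \<open>Existence\<close>

definition NL :: "'m \<Rightarrow> 'w \<Rightarrow> real set" where
  "NL m \<omega> = pts (\<pi> m \<omega>) (\<lambda>s. lamL m s \<omega>)"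

text \<open>The mean number of points in [-i, i] is at most 2 i times the moment bound. Countably
  many such windows suffice for all bounded sets.\<close>

lemma NL_locally_finite: "AE \<omega> in P. \<forall>m B. bounded B \<longrightarrow> finite (NL m \<omega> \<inter> B)"
proof -
  have lam: "(\<lambda>(\<omega>, t). lamL m t \<omega>) \<in> borel_measurable Pred" for m
    using admissible_limit by (simp add: admissible_def)
  obtain c where c: "c < \<infinity>" "\<And>m t. (\<integral>\<^sup>+ \<omega>. ennreal \<bar>lamL m t \<omega>\<bar> \<partial>P) \<le> c"
    using mbounded_limit by (auto simp: mbounded_def)
  have "AE \<omega> in P. \<forall>m. \<forall>i::nat. ecount (NL m \<omega> \<inter> {- real i..real i}) \<noteq> \<infinity>"
    unfolding AE_all_countable
  proof (intro allI)
    fix m and i :: nat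
    let ?g = "indicator {- real i..real i} :: real \<Rightarrow> ennreal"
    have "(\<integral>\<^sup>+ \<omega>. ecount (NL m \<omega> \<inter> {- real i..real i}) \<partial>P) =
      (\<integral>\<^sup>+ \<omega>. \<integral>\<^sup>+ z. (if snd z \<le> lamL m (fst z) \<omega> then ?g (fst z) else 0) \<partial>count_space (\<pi> m \<omega>) \<partial>P)"
    proof (rule nn_integral_cong)
      fix \<omega>
      assume \<omega>: "\<omega> \<in> space P"
      show "ecount (NL m \<omega> \<inter> {- real i..real i}) = (\<integral>\<^sup>+ z. (if snd z \<le> lamL m (fst z) \<omega> then ?g (fst z) else 0) \<partial>count_space (\<pi> m \<omega>))"
        unfolding NL_def count_below_intensity[OF \<omega>, symmetric]
        using \<pi>_half[OF \<omega>, of m] by (intro nn_integral_cong) (auto simp: indicator_def split: prod.split)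
    qed
    also have "\<dots> \<le> (\<integral>\<^sup>+ s. ?g s * (\<integral>\<^sup>+ \<omega>. ennreal \<bar>lamL m s \<omega>\<bar> \<partial>P) \<partial>lborel)"
      by (rule point_expectation[OF lam]) simp
    also have "\<dots> \<le> (\<integral>\<^sup>+ s. ?g s * c \<partial>lborel)"
      by (intro nn_integral_mono mult_left_mono c(2)) simp
    also have "\<dots> = ennreal (2 * real i) * c"
      by (simp add: nn_integral_multc)
    also have "\<dots> < \<infinity>"
      using c(1) by (simp add: ennreal_mult_less_top)
    finally show "AE \<omega> in P. ecount (NL m \<omega> \<inter> {- real i..real i}) \<noteq> \<infinity>"
      unfolding NL_def by (intro nn_integral_PInf_AE measurable_ecount_compose measurable_thin_points lam) auto
  qed
  then show ?thesis
  proof eventually_elim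
    case (elim \<omega>)
    show ?case
    proof (intro allI impI)
      fix m and B :: "real set"
      assume "bounded B"
      then obtain a where a: "\<And>x. x \<in> B \<Longrightarrow> \<bar>x\<bar> \<le> a"
        unfolding bounded_iff by auto
      obtain i :: nat where i: "a \<le> real i"
        using real_arch_simple by blast
      have "finite (NL m \<omega> \<inter> {- real i..real i})"
        using elim[rule_format, of m i] by (auto simp: ecount_def emeasure_count_space split: if_splits)
      moreover have "NL m \<omega> \<inter> B \<subseteq> NL m \<omega> \<inter> {- real i..real i}"
        using a i by force
      ultimately show "finite (NL m \<omega> \<inter> B)"
        by (rule finite_subset[rotated])
    qed
  qed
qed

lemma bounded_moments_limit: "bounded_moments P n \<phi> lamL WL"
proof -
  obtain c where c: "c < \<infinity>" "\<And>m t. (\<integral>\<^sup>+ \<omega>. ennreal \<bar>lamL m t \<omega>\<bar> \<partial>P) \<le> c"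
    "\<And>p k. k \<in> grid n \<phi> p \<Longrightarrow> (\<integral>\<^sup>+ \<omega>. ennreal \<bar>WL p k \<omega>\<bar> \<partial>P) \<le> c"
    using mbounded_limit by (auto simp: mbounded_def)
  have "(SUP m. SUP t. \<integral>\<^sup>+ \<omega>. ennreal \<bar>lamL m t \<omega>\<bar> \<partial>P) \<le> c"
    by (intro SUP_least c(2))
  moreover have "(SUP p. SUP k\<in>grid n \<phi> p. \<integral>\<^sup>+ \<omega>. ennreal \<bar>WL p k \<omega>\<bar> \<partial>P) \<le> c"
    by (intro SUP_least c(3))
  ultimately show ?thesis
    unfolding bounded_moments_def using c(1) by (meson le_less_trans)
qed

lemma har_process_limit: "har_process P n \<phi> \<pi> \<xi> \<MM> lamL NL WL"
  unfolding har_process_def Let_def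
proof (intro conjI allI ballI)
  have lam: "(\<lambda>(\<omega>, t). lamL m t \<omega>) \<in> borel_measurable Pred" for m
    using admissible_limit by (simp add: admissible_def)
  show "(\<lambda>\<omega>. NL m \<omega> \<inter> {..t}) \<in> measurable (F t) config_space" for m t
    unfolding NL_def by (rule measurable_thin_points_past[OF lam])
  show "WL p k \<in> borel_measurable (F k)" if "k \<in> grid n \<phi> p" for p k
    using admissible_limit that by (simp add: admissible_def)
  show "(\<lambda>(\<omega>, t). lamL m t \<omega>) \<in> borel_measurable Pred" for m
    by (rule lam)
  show "disjoint_family (\<lambda>m. NL m \<omega>)" if "\<omega> \<in> space P" for \<omega>
    unfolding disjoint_family_on_def NL_def pts_def using \<pi>_distinct[OF that] by fastforce
  show "AE \<omega> in P. \<forall>m B. bounded B \<longrightarrow> finite (NL m \<omega> \<inter> B)"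
    by (rule NL_locally_finite)
  show "AE \<omega> in P. \<forall>m C. ecount (NL m \<omega> \<inter> C) =
      (\<integral>\<^sup>+ (s, x). indicator (C \<times> {0..}) (s, x) * (if x \<le> lamL m s \<omega> then 1 else 0) \<partial>count_space (\<pi> m \<omega>))"
    using AE_space by eventually_elim (simp add: NL_def count_below_intensity)
  show "AE (\<omega>, t) in P \<Otimes>\<^sub>M lborel.
      drive_converges \<MM> n \<phi> (\<lambda>m. NL m \<omega>) (\<lambda>p k. WL p k \<omega>) (Inl m) t \<and>
      lamL m t \<omega> = Phi \<MM> (Inl m) (drive \<MM> n \<phi> (\<lambda>m. NL m \<omega>) (\<lambda>p k. WL p k \<omega>) (Inl m) t)" for m
  proof -
    \<comment> \<open>Convergence and the equation are known almost surely at each fixed time. To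
      exchange the order of time and chance, the set where both hold must be jointly measurable,
      which predictability provides.\<close>
    let ?Q = "\<lambda>\<omega> t. thin_converges lamL WL (Inl m) t \<omega> \<and> lamL m t \<omega> = Phi \<MM> (Inl m) (thin_drive lamL WL (Inl m) t \<omega>)"
    interpret L: pair_sigma_finite P "lborel :: real measure" ..
    note [measurable] = lam[of m, unfolded case_prod_beta'] measurable_Phi_thin_drive(1)[OF admissible_limit, of "Inl m", unfolded case_prod_beta']
    have "{z \<in> space Pred. thin_converges lamL WL (Inl m) (snd z) (fst z)} \<inter>
        {z \<in> space Pred. lamL m (snd z) (fst z) = Phi \<MM> (Inl m) (thin_drive lamL WL (Inl m) (snd z) (fst z))} \<in> sets Pred"
      by (intro sets.Int thin_converges_sets admissible_limit) measurable
    moreover have "{z \<in> space Pred. thin_converges lamL WL (Inl m) (snd z) (fst z)} \<inter>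
        {z \<in> space Pred. lamL m (snd z) (fst z) = Phi \<MM> (Inl m) (thin_drive lamL WL (Inl m) (snd z) (fst z))} =
        {z \<in> space (P \<Otimes>\<^sub>M (lborel :: real measure)). ?Q (fst z) (snd z)}"
      by (auto simp: space_pair_measure)
    moreover have "sets (P \<Otimes>\<^sub>M (lborel :: real measure)) = sets (P \<Otimes>\<^sub>M borel)"
      by (rule sets_pair_measure_cong) simp_all
    ultimately have m: "{z \<in> space (P \<Otimes>\<^sub>M (lborel :: real measure)). ?Q (fst z) (snd z)} \<in> sets (P \<Otimes>\<^sub>M lborel)"
      using Pred_le by auto
    have "AE \<omega> in P. ?Q \<omega> t" for t
      using converges_AE[OF admissible_limit mbounded_limit] limit_fixed_point(1) by (rule AE_conjI)
    then have "AE t in lborel. AE \<omega> in P. ?Q \<omega> t"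
      by (rule AE_I2)
    then have "AE \<omega> in P. AE t in lborel. ?Q \<omega> t"
      by (subst L.AE_commute[OF m])
    then have "AE z in P \<Otimes>\<^sub>M lborel. ?Q (fst z) (snd z)"
      using L.AE_pair_iff[OF m] by simp
    then show ?thesis
      by (simp add: thin_converges_def thin_drive_def NL_def case_prod_beta')
  qed
  have "AE \<omega> in P. thin_converges lamL WL (Inr p) k \<omega> \<and> WL p k \<omega> = \<xi> p k \<omega> + Phi \<MM> (Inr p) (thin_drive lamL WL (Inr p) k \<omega>)"
    if "k \<in> grid n \<phi> p" for p k
    using converges_AE[OF admissible_limit mbounded_limit] limit_fixed_point(2)[OF that] by (rule AE_conjI)
  then have "AE \<omega> in P. \<forall>p. \<forall>k\<in>grid n \<phi> p.
      thin_converges lamL WL (Inr p) k \<omega> \<and> WL p k \<omega> = \<xi> p k \<omega> + Phi \<MM> (Inr p) (thin_drive lamL WL (Inr p) k \<omega>)"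
    unfolding AE_all_countable AE_ball_countable[OF countable_grid] by blast
  then show "AE \<omega> in P. \<forall>p. \<forall>k\<in>grid n \<phi> p.
      drive_converges \<MM> n \<phi> (\<lambda>m. NL m \<omega>) (\<lambda>p k. WL p k \<omega>) (Inr p) k \<and>
      WL p k \<omega> = \<xi> p k \<omega> + Phi \<MM> (Inr p) (drive \<MM> n \<phi> (\<lambda>m. NL m \<omega>) (\<lambda>p k. WL p k \<omega>) (Inr p) k)"
    by (simp add: thin_converges_def thin_drive_def NL_def)
qed

end

subsection \<open>Stationarity\<close>

definition shift_config :: "('m \<Rightarrow> (real \<times> real) set) \<Rightarrow> 'm \<Rightarrow> (real \<times> real) set" where
  "shift_config c m = (\<lambda>z. z - (1, 0)) ` c m"

definition shift_drift :: "('p \<Rightarrow> nat) \<Rightarrow> ('p \<Rightarrow> real) \<Rightarrow> ('p \<times> real \<Rightarrow> real) \<Rightarrow> 'p \<times> real \<Rightarrow> real" where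
  "shift_drift n \<phi> x = (\<lambda>i\<in>grid_points n \<phi>. x (fst i, snd i + 1))"

lemma pts_shift: "pts ((\<lambda>z. z - (1, 0)) ` C) (\<lambda>s. l (s + 1)) = (\<lambda>s. s - 1) ` pts C l"
proof -
  have *: "(s, x) \<in> (\<lambda>z. z - (1, 0)) ` C \<longleftrightarrow> (s + 1, x) \<in> C" for s x
    by (force simp: image_iff)
  have **: "s \<in> (\<lambda>s. s - 1) ` S \<longleftrightarrow> s + 1 \<in> S" for s :: real and S
    by (force simp: image_iff)
  show ?thesis
    by (auto simp: set_eq_iff ** pts_def *)
qed

lemma grid_shift: "valid_grids n \<phi> \<Longrightarrow> k + 1 \<in> grid n \<phi> p \<longleftrightarrow> k \<in> grid n \<phi> p"
  using grid_add_int[of n \<phi> k 1 p] by simp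

lemma infsum_shift:
  fixes g :: "real \<Rightarrow> real"
  shows "infsum g ((\<lambda>s. s - 1) ` A) = infsum (\<lambda>s. g (s - 1)) A"
  by (subst infsum_reindex) (auto simp: inj_on_def o_def)

text \<open>The frequencies are integers, so a unit shift maps every grid onto itself; the rest is a
  change of summation variable.\<close>

lemma drive_shift:
  assumes "valid_grids n \<phi>"
  shows "drive \<MM> n \<phi> (\<lambda>m. (\<lambda>s. s - 1) ` N m) (\<lambda>p k. W p (k + 1)) \<alpha> t = drive \<MM> n \<phi> N W \<alpha> (t + 1)"
proof -
  have 1: "(\<lambda>s. s - 1) ` A \<inter> {..<t} = (\<lambda>s. s - 1) ` (A \<inter> {..<t + 1})" for A
    by auto
  have 2: "grid n \<phi> p \<inter> {..<t} = (\<lambda>s. s - 1) ` (grid n \<phi> p \<inter> {..<t + 1})" for p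
  proof -
    have "grid n \<phi> p = (\<lambda>s. s - 1) ` grid n \<phi> p"
      using grid_shift[OF assms, of _ p] by (force simp: image_iff)
    then show ?thesis
      using 1[of "grid n \<phi> p"] by simp
  qed
  show ?thesis
    unfolding drive_def 1 by (subst 2) (simp add: infsum_shift algebra_simps)
qed

lemma picard_shift:
  assumes grids: "valid_grids n \<phi>" and x: "x \<in> extensional (grid_points n \<phi>)"
  shows "picard \<MM> n \<phi> (shift_config c) (shift_drift n \<phi> x) j =
    (\<lambda>m t. fst (picard \<MM> n \<phi> c x j) m (t + 1), \<lambda>p k. snd (picard \<MM> n \<phi> c x j) p (k + 1))"
proof (induction j)
  case 0
  then show ?case
    by (simp add: picard_def)
next
  case (Suc j)
  \<comment> \<open>The identity holds off the grid as well: k + 1 is off the grid exactly if k is,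
    and both sides are then \<open>undefined\<close> by extensionality.\<close>
  have x': "shift_drift n \<phi> x (p, k) = x (p, k + 1)" for p k
    using x grid_shift[OF grids, of k p] by (auto simp: shift_drift_def grid_points_def extensional_def)
  have Suc_eq: "picard \<MM> n \<phi> c x (Suc j) = picard_step \<MM> n \<phi> c x (picard \<MM> n \<phi> c x j)" for c x
    by (simp add: picard_def)
  have "drive \<MM> n \<phi> (\<lambda>m. pts (shift_config c m) (\<lambda>t. fst (picard \<MM> n \<phi> c x j) m (t + 1)))
      (\<lambda>p k. snd (picard \<MM> n \<phi> c x j) p (k + 1)) \<alpha> t =
    drive \<MM> n \<phi> (\<lambda>m. pts (c m) (fst (picard \<MM> n \<phi> c x j) m)) (snd (picard \<MM> n \<phi> c x j)) \<alpha> (t + 1)" for \<alpha> t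
    unfolding shift_config_def pts_shift by (rule drive_shift[OF grids])
  then show ?case
    unfolding Suc_eq Suc by (simp add: picard_step_def Let_def x')
qed

section \<open>The canonical space of noise paths\<close>

definition noise_space :: "('p \<Rightarrow> nat) \<Rightarrow> ('p \<Rightarrow> real) \<Rightarrow> (('m \<Rightarrow> (real \<times> real) set) \<times> ('p \<times> real \<Rightarrow> real)) measure" where
  "noise_space n \<phi> = Pi\<^sub>M UNIV (\<lambda>_. config_space) \<Otimes>\<^sub>M Pi\<^sub>M (grid_points n \<phi>) (\<lambda>_. borel)"

definition good_configs :: "('m \<Rightarrow> (real \<times> real) set) set" where
  "good_configs = {c. (\<forall>m. c m \<subseteq> UNIV \<times> {0..} \<and> (\<forall>B. bounded B \<longrightarrow> finite (c m \<inter> B))) \<and>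
     (\<forall>m m'. \<forall>z\<in>c m. \<forall>z'\<in>c m'. fst z = fst z' \<longrightarrow> m = m' \<and> z = z')}"

text \<open>The path properties of the noise must hold at every point of the space, so it is cut
  down to good configurations. \<open>restrict_space\<close> carries the trace \<sigma>-algebra, so
  that measurability of \<open>good_configs\<close> is never asked for.\<close>

definition path_space :: "('p \<Rightarrow> nat) \<Rightarrow> ('p \<Rightarrow> real) \<Rightarrow> (('m \<Rightarrow> (real \<times> real) set) \<times> ('p \<times> real \<Rightarrow> real)) measure" where
  "path_space n \<phi> = restrict_space (noise_space n \<phi>) (good_configs \<times> UNIV)"

lemma space_path_space: "space (path_space n \<phi>) = good_configs \<times> extensional (grid_points n \<phi>)"
  by (auto simp: path_space_def noise_space_def space_restrict_space space_pair_measure space_PiM PiE_UNIV_domain PiE_def)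

lemma good_configs_shift:
  assumes "c \<in> good_configs"
  shows "shift_config c \<in> good_configs"
  unfolding good_configs_def
proof (intro CollectI conjI allI impI ballI)
  show "shift_config c m \<subseteq> UNIV \<times> {0..}" for m
    using assms by (force simp: good_configs_def shift_config_def)
  show "finite (shift_config c m \<inter> B)" if "bounded B" for m B
  proof -
    have "(\<lambda>z. z - (1, 0)) -` B = (\<lambda>z. (1, 0) + z) ` B"
      by (force simp: image_iff)
    then have "bounded ((\<lambda>z. z - (1, 0)) -` B)"
      using bounded_translation[OF that, of "(1, 0)"] by simp
    then have "finite (c m \<inter> (\<lambda>z. z - (1, 0)) -` B)"
      using assms by (auto simp: good_configs_def)
    moreover have "shift_config c m \<inter> B = (\<lambda>z. z - (1, 0)) ` (c m \<inter> (\<lambda>z. z - (1, 0)) -` B)"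
      by (auto simp: shift_config_def)
    ultimately show ?thesis
      by simp
  qed
  fix m m' z z'
  assume z: "z \<in> shift_config c m" "z' \<in> shift_config c m'" "fst z = fst z'"
  obtain y where y: "y \<in> c m" "z = y - (1, 0)"
    using z(1) unfolding shift_config_def by blast
  obtain y' where y': "y' \<in> c m'" "z' = y' - (1, 0)"
    using z(2) unfolding shift_config_def by blast
  have "fst y = fst y'"
    using z(3) y(2) y'(2) by simp
  then have "m = m' \<and> y = y'"
    using assms y(1) y'(1) unfolding good_configs_def by blast
  then show "m = m'" "z = z'"
    using y(2) y'(2) by simp_all
qed

text \<open>The coordinate maps play the roles of the Poisson configurations and of the drifts; the
  measure on the path space enters only through its \<sigma>-algebra.\<close>

lemma driven_paths_path_space:
  assumes "valid_grids n \<phi>" "valid_params \<MM>"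
  shows "driven_paths (path_space n \<phi>) n \<phi> (\<lambda>m w. fst w m) (\<lambda>p k w. snd w (p, k)) (\<MM> :: ('m::finite, 'p::finite) har_params)"
proof
  show "valid_grids n \<phi>" "valid_params \<MM>"
    by fact+
  show "(\<lambda>w. fst w m) \<in> measurable (path_space n \<phi>) config_space" for m :: 'm
    unfolding path_space_def noise_space_def
    by (rule measurable_restrict_space1) measurable
  show "fst w m \<subseteq> UNIV \<times> {0..}" if "w \<in> space (path_space n \<phi>)" for m :: 'm and w
    using that by (auto simp: space_path_space good_configs_def mem_Times_iff)
  show "finite (fst w m \<inter> B)" if "w \<in> space (path_space n \<phi>)" "bounded B" for m :: 'm and w B
    using that by (auto simp: space_path_space good_configs_def mem_Times_iff)
  show "m = m' \<and> z = z'" if "w \<in> space (path_space n \<phi>)" "z \<in> fst w m" "z' \<in> fst w m'" "fst z = fst z'" for m m' :: 'm and w z z'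
  proof -
    have "fst w \<in> good_configs"
      using that(1) by (auto simp: space_path_space)
    then show ?thesis
      using that(2-) unfolding good_configs_def by blast
  qed
  show "(\<lambda>w. snd w (p, k)) \<in> borel_measurable (path_space n \<phi>)" if "k \<in> grid n \<phi> p" for p k
  proof -
    have "(p, k) \<in> grid_points n \<phi>"
      using that by (simp add: grid_points_def)
    then show ?thesis
      unfolding path_space_def noise_space_def by (intro measurable_restrict_space1) measurable
  qed
qed

definition path_solution ::
    "('m::finite, 'p::finite) har_params \<Rightarrow> ('p \<Rightarrow> nat) \<Rightarrow> ('p \<Rightarrow> real) \<Rightarrow>
     ('m \<Rightarrow> (real \<times> real) set) \<times> ('p \<times> real \<Rightarrow> real) \<Rightarrow>
     ('m \<times> real \<Rightarrow> real) \<times> ('m \<Rightarrow> real set) \<times> ('p \<times> real \<Rightarrow> real)" where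
  "path_solution \<MM> n \<phi> w =
     (\<lambda>(m, t). picard_intensity \<MM> n \<phi> (fst w) (snd w) m t,
      \<lambda>m. pts (fst w m) (picard_intensity \<MM> n \<phi> (fst w) (snd w) m),
      \<lambda>(p, k)\<in>grid_points n \<phi>. picard_drift \<MM> n \<phi> (fst w) (snd w) p k)"

lemma measurable_solution_triple:
  assumes "\<And>m t. lam m t \<in> borel_measurable M" "\<And>m. N m \<in> measurable M config_space"
    and "\<And>p k. k \<in> grid n \<phi> p \<Longrightarrow> W p k \<in> borel_measurable M"
  shows "(\<lambda>\<omega>. (\<lambda>(m, t). lam m t \<omega>, \<lambda>m. N m \<omega>, \<lambda>(p, k)\<in>grid_points n \<phi>. W p k \<omega>)) \<in>
    measurable M (Pi\<^sub>M UNIV (\<lambda>_. borel) \<Otimes>\<^sub>M Pi\<^sub>M UNIV (\<lambda>_. config_space) \<Otimes>\<^sub>M Pi\<^sub>M (grid_points n \<phi>) (\<lambda>_. borel))"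
proof (intro measurable_Pair)
  have "(\<lambda>\<omega>. \<lambda>i\<in>UNIV. lam (fst i) (snd i) \<omega>) \<in> measurable M (Pi\<^sub>M UNIV (\<lambda>_. borel))"
    by (rule measurable_restrict) (rule assms(1))
  then show "(\<lambda>\<omega>. \<lambda>(m, t). lam m t \<omega>) \<in> measurable M (Pi\<^sub>M UNIV (\<lambda>_. borel))"
    unfolding restrict_UNIV case_prod_beta' .
  have "(\<lambda>\<omega>. \<lambda>m\<in>UNIV. N m \<omega>) \<in> measurable M (Pi\<^sub>M UNIV (\<lambda>_. config_space))"
    by (rule measurable_restrict) (rule assms(2))
  then show "(\<lambda>\<omega>. \<lambda>m. N m \<omega>) \<in> measurable M (Pi\<^sub>M UNIV (\<lambda>_. config_space))"
    unfolding restrict_UNIV .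
  show "(\<lambda>\<omega>. \<lambda>(p, k)\<in>grid_points n \<phi>. W p k \<omega>) \<in> measurable M (Pi\<^sub>M (grid_points n \<phi>) (\<lambda>_. borel))"
    unfolding case_prod_beta' using assms(3) by (intro measurable_restrict) (auto simp: grid_points_def)
qed

text \<open>Read on the path space, \<open>admissible_limit\<close> says that the limit intensity
  and the limit drifts are measurable functionals of the noise path, and the points follow by
  thinning.\<close>

lemma measurable_path_solution:
  assumes "valid_grids n \<phi>" "valid_params \<MM>"
  shows "path_solution \<MM> n \<phi> \<in> measurable (path_space n \<phi>)
    (Pi\<^sub>M UNIV (\<lambda>_. borel) \<Otimes>\<^sub>M Pi\<^sub>M UNIV (\<lambda>_. config_space) \<Otimes>\<^sub>M Pi\<^sub>M (grid_points n \<phi>) (\<lambda>_. borel))"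
proof -
  interpret Q: driven_paths "path_space n \<phi>" n \<phi> "\<lambda>m w. fst w m" "\<lambda>p k w. snd w (p, k)" \<MM>
    by (rule driven_paths_path_space[OF assms])
  \<comment> \<open>Drift paths in this space are extensional, so restricting them to the grid
    points changes nothing.\<close>
  have drift: "Q.drift_path w = snd w" if "w \<in> space (path_space n \<phi>)" for w
    using that by (auto simp: Q.drift_path_def space_path_space extensional_def fun_eq_iff restrict_def)
  have lam: "(\<lambda>(w, t). Q.lamL m t w) \<in> borel_measurable Q.Pred" for m
    using Q.admissible_limit by (simp add: Q.admissible_def)
  have "(\<lambda>w. (\<lambda>(m, t). Q.lamL m t w, \<lambda>m. pts (fst w m) (\<lambda>s. Q.lamL m s w), \<lambda>(p, k)\<in>grid_points n \<phi>. Q.WL p k w)) \<in>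
    measurable (path_space n \<phi>) (Pi\<^sub>M UNIV (\<lambda>_. borel) \<Otimes>\<^sub>M Pi\<^sub>M UNIV (\<lambda>_. config_space) \<Otimes>\<^sub>M Pi\<^sub>M (grid_points n \<phi>) (\<lambda>_. borel))"
  proof (rule measurable_solution_triple)
    show "Q.lamL m t \<in> borel_measurable (path_space n \<phi>)" for m t
      using Q.measurable_F_P[OF Q.measurable_F_section[OF lam[unfolded case_prod_beta'], where t = t]] by simp
    show "(\<lambda>w. pts (fst w m) (\<lambda>s. Q.lamL m s w)) \<in> measurable (path_space n \<phi>) config_space" for m
      by (rule Q.measurable_thin_points[OF lam])
    show "Q.WL p k \<in> borel_measurable (path_space n \<phi>)" if "k \<in> grid n \<phi> p" for p k
      using Q.admissible_limit that by (intro Q.measurable_F_P[of _ k]) (simp add: Q.admissible_def)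
  qed
  moreover have "(\<lambda>(m, t). Q.lamL m t w, \<lambda>m. pts (fst w m) (\<lambda>s. Q.lamL m s w), \<lambda>(p, k)\<in>grid_points n \<phi>. Q.WL p k w) =
    path_solution \<MM> n \<phi> w" if "w \<in> space (path_space n \<phi>)" for w
    unfolding path_solution_def Q.lamL_def Q.WL_def drift[OF that] by simp
  ultimately show ?thesis
    by (subst measurable_cong) (auto simp del: split_paired_All)
qed

lemma path_solution_shift:
  assumes "valid_grids n \<phi>" "x \<in> extensional (grid_points n \<phi>)"
  shows "path_solution \<MM> n \<phi> (shift_config c, shift_drift n \<phi> x) =
     (\<lambda>(m, t). picard_intensity \<MM> n \<phi> c x m (t + 1),
      \<lambda>m. (\<lambda>s. s - 1) ` pts (c m) (picard_intensity \<MM> n \<phi> c x m),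
      \<lambda>(p, k)\<in>grid_points n \<phi>. picard_drift \<MM> n \<phi> c x p (k + 1))"
proof -
  have "picard_intensity \<MM> n \<phi> (shift_config c) (shift_drift n \<phi> x) m t = picard_intensity \<MM> n \<phi> c x m (t + 1)" for m t
    unfolding picard_intensity_def picard_shift[OF assms] by simp
  moreover have "picard_drift \<MM> n \<phi> (shift_config c) (shift_drift n \<phi> x) p k = picard_drift \<MM> n \<phi> c x p (k + 1)" for p k
    unfolding picard_drift_def picard_shift[OF assms] by simp
  moreover have "pts (shift_config c m) (\<lambda>t. picard_intensity \<MM> n \<phi> c x m (t + 1)) =
    (\<lambda>s. s - 1) ` pts (c m) (picard_intensity \<MM> n \<phi> c x m)" for m
    unfolding shift_config_def by (rule pts_shift)
  moreover have "picard_intensity \<MM> n \<phi> (shift_config c) (shift_drift n \<phi> x) m = (\<lambda>t. picard_intensity \<MM> n \<phi> c x m (t + 1))" for m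
    by (rule ext) (rule calculation(1))
  ultimately show ?thesis
    by (simp add: path_solution_def)
qed

context har_noise
begin

section \<open>Shift invariance of the law of the noise\<close>

lemma noise_configs_good: "\<omega> \<in> space P \<Longrightarrow> (\<lambda>m. \<pi> m \<omega>) \<in> good_configs"
  using \<pi>_half \<pi>_finite \<pi>_distinct unfolding good_configs_def by blast

lemma drift_path_extensional: "drift_path \<omega> \<in> extensional (grid_points n \<phi>)"
  by (simp add: drift_path_def)

lemma measurable_configs: "(\<lambda>\<omega> m. \<pi> m \<omega>) \<in> measurable P (Pi\<^sub>M UNIV (\<lambda>_. config_space))"
  using measurable_restrict[of UNIV \<pi> P "\<lambda>_. config_space"] \<pi>_measurable by (simp add: restrict_UNIV)

lemma measurable_drift_path: "drift_path \<in> measurable P (Pi\<^sub>M (grid_points n \<phi>) (\<lambda>_. borel))"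
  unfolding drift_path_def[abs_def] case_prod_beta'
  using \<xi>_measurable by (intro measurable_restrict) (auto simp: grid_points_def)

lemma measurable_shift_config:
  "shift_config \<in> measurable (Pi\<^sub>M UNIV (\<lambda>_ :: 'm. config_space)) (Pi\<^sub>M UNIV (\<lambda>_. config_space))"
proof -
  have "(\<lambda>c. \<lambda>m\<in>UNIV. (\<lambda>z. z - (1, 0)) ` c m) \<in> measurable (Pi\<^sub>M UNIV (\<lambda>_ :: 'm. config_space)) (Pi\<^sub>M UNIV (\<lambda>_. config_space :: (real \<times> real) set measure))"
    by (intro measurable_restrict measurable_translate_config measurable_component_singleton) auto
  then show ?thesis
    by (simp add: shift_config_def[abs_def] restrict_UNIV)
qed

lemma measurable_shift_drift:
  "shift_drift n \<phi> \<in> measurable (Pi\<^sub>M (grid_points n \<phi>) (\<lambda>_. borel)) (Pi\<^sub>M (grid_points n \<phi>) (\<lambda>_. borel))"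
  unfolding shift_drift_def[abs_def]
  using grid_shift[OF grids] by (intro measurable_restrict measurable_component_singleton) (auto simp: grid_points_def)

text \<open>Configurations and drifts are independent as blocks, so the law of the pair is a
  product. The maps \<open>f\<close> and \<open>g\<close> are general so that the noise and the
  shifted noise are both covered.\<close>

lemma distr_noise_pair:
  assumes f: "f \<in> measurable (Pi\<^sub>M UNIV (\<lambda>_ :: 'm. config_space)) C" and g: "g \<in> measurable (Pi\<^sub>M (grid_points n \<phi>) (\<lambda>_. borel)) X"
  shows "distr P (C \<Otimes>\<^sub>M X) (\<lambda>\<omega>. (f (\<lambda>m. \<pi> m \<omega>), g (drift_path \<omega>))) =
    distr P C (\<lambda>\<omega>. f (\<lambda>m. \<pi> m \<omega>)) \<Otimes>\<^sub>M distr P X (\<lambda>\<omega>. g (drift_path \<omega>))"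
proof (rule pair_measure_eqI[symmetric])
  note F = measurable_compose[OF measurable_configs f] and G = measurable_compose[OF measurable_drift_path g]
  show "sigma_finite_measure (distr P C (\<lambda>\<omega>. f (\<lambda>m. \<pi> m \<omega>)))" "sigma_finite_measure (distr P X (\<lambda>\<omega>. g (drift_path \<omega>)))"
    by (intro prob_space_imp_sigma_finite prob_space_distr F G)+
  fix A B
  assume "A \<in> sets (distr P C (\<lambda>\<omega>. f (\<lambda>m. \<pi> m \<omega>)))" "B \<in> sets (distr P X (\<lambda>\<omega>. g (drift_path \<omega>)))"
  then have A: "A \<in> sets C" and B: "B \<in> sets X"
    by simp_all
  let ?A = "(\<lambda>\<omega>. f (\<lambda>m. \<pi> m \<omega>)) -` A \<inter> space P" and ?B = "(\<lambda>\<omega>. g (drift_path \<omega>)) -` B \<inter> space P"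
  have "?A = (\<lambda>\<omega> m. \<pi> m \<omega>) -` (f -` A \<inter> space (Pi\<^sub>M UNIV (\<lambda>_ :: 'm. config_space))) \<inter> space P"
    using measurable_space[OF measurable_configs] by auto
  then have A': "?A \<in> sets (vimage_algebra (space P) (\<lambda>\<omega> m. \<pi> m \<omega>) (Pi\<^sub>M UNIV (\<lambda>_. config_space)))"
    using in_vimage_algebra[OF measurable_sets[OF f A], of "\<lambda>\<omega> m. \<pi> m \<omega>" "space P"] by simp
  have "?B = drift_path -` (g -` B \<inter> space (Pi\<^sub>M (grid_points n \<phi>) (\<lambda>_. borel))) \<inter> space P"
    using measurable_space[OF measurable_drift_path] by auto
  then have B': "?B \<in> sets (vimage_algebra (space P) drift_path (Pi\<^sub>M (grid_points n \<phi>) (\<lambda>_. borel)))"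
    using in_vimage_algebra[OF measurable_sets[OF g B], of drift_path "space P"] by simp
  have "prob (?A \<inter> ?B) = prob ?A * prob ?B"
    using indep_setD[OF indep_\<pi>_\<xi> A'] B' unfolding drift_path_def[abs_def] by blast
  moreover have "(\<lambda>\<omega>. (f (\<lambda>m. \<pi> m \<omega>), g (drift_path \<omega>))) -` (A \<times> B) \<inter> space P = ?A \<inter> ?B"
    by auto
  ultimately show "emeasure (distr P C (\<lambda>\<omega>. f (\<lambda>m. \<pi> m \<omega>))) A * emeasure (distr P X (\<lambda>\<omega>. g (drift_path \<omega>))) B =
    emeasure (distr P (C \<Otimes>\<^sub>M X) (\<lambda>\<omega>. (f (\<lambda>m. \<pi> m \<omega>), g (drift_path \<omega>)))) (A \<times> B)"
    using A B emeasure_distr[OF F A] emeasure_distr[OF G B] emeasure_distr[OF measurable_Pair[OF F G], of "A \<times> B"]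
    by (simp add: emeasure_eq_measure ennreal_mult)
qed simp

text \<open>Independence of the labels makes both laws product measures; each factor is the law of a
  Poisson random measure, and that law is unique.\<close>

lemma config_law_shift:
  "distr P (Pi\<^sub>M UNIV (\<lambda>_. config_space)) (\<lambda>\<omega>. shift_config (\<lambda>m. \<pi> m \<omega>)) = distr P (Pi\<^sub>M UNIV (\<lambda>_. config_space)) (\<lambda>\<omega> m. \<pi> m \<omega>)"
proof -
  have 1: "distr P (Pi\<^sub>M UNIV (\<lambda>_. config_space)) (\<lambda>\<omega> m. \<pi> m \<omega>) = Pi\<^sub>M UNIV (\<lambda>m. distr P config_space (\<pi> m))"
    using indep_\<pi> by (subst (asm) indep_vars_iff_distr_eq_PiM') (simp_all add: \<pi>_measurable restrict_UNIV)
  have tr: "(\<lambda>S. (\<lambda>z. z - (1, 0)) ` S) \<in> measurable config_space (config_space :: (real \<times> real) set measure)"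
    by (rule measurable_translate_config[OF measurable_ident_sets[OF refl]])
  have "indep_vars (\<lambda>_. config_space) (\<lambda>m \<omega>. (\<lambda>z. z - (1, 0)) ` \<pi> m \<omega>) UNIV"
    by (rule indep_vars_compose2[OF indep_\<pi> tr])
  then have "distr P (Pi\<^sub>M UNIV (\<lambda>_. config_space)) (\<lambda>\<omega> m. (\<lambda>z. z - (1, 0)) ` \<pi> m \<omega>) =
    Pi\<^sub>M UNIV (\<lambda>m. distr P config_space (\<lambda>\<omega>. (\<lambda>z. z - (1, 0)) ` \<pi> m \<omega>))"
    by (subst (asm) indep_vars_iff_distr_eq_PiM') (simp_all add: measurable_translate_config \<pi>_measurable restrict_UNIV)
  also have "\<dots> = Pi\<^sub>M UNIV (\<lambda>m. distr P config_space (\<pi> m))"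
  proof -
    have "distr P config_space (\<lambda>\<omega>. (\<lambda>z. z - (1, 0)) ` \<pi> m \<omega>) = distr P config_space (\<pi> m)" for m
      by (rule poisson_law_unique[OF prob_space_axioms poisson_random_measure_translate[OF poisson] prob_space_axioms poisson])
    then show ?thesis
      by (rule arg_cong[OF ext])
  qed
  finally show ?thesis
    unfolding 1 shift_config_def[abs_def] .
qed

text \<open>The drifts have a product law, and the unit shift reindexes the product along an
  injection of the grid points under which the factors do not change.\<close>

lemma drift_law_shift:
  "distr P (Pi\<^sub>M (grid_points n \<phi>) (\<lambda>_. borel)) (\<lambda>\<omega>. shift_drift n \<phi> (drift_path \<omega>)) = distr P (Pi\<^sub>M (grid_points n \<phi>) (\<lambda>_. borel)) drift_path"
proof -
  let ?I = "grid_points n \<phi>"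
  define D where "D i = distr P borel (\<xi> (fst i) (snd i))" for i
  define f where "f i = (fst i, snd i + 1)" for i :: "'p \<times> real"
  have "\<phi> undefined \<in> grid n \<phi> undefined"
    unfolding grid_def by (auto intro: exI[of _ 0])
  then have ne: "?I \<noteq> {}"
    by (auto simp: grid_points_def)
  have "indep_vars (\<lambda>_. borel) (\<lambda>(p, k). \<xi> p k) ?I"
    using noise by (simp add: driving_noise_def)
  then have 1: "distr P (Pi\<^sub>M ?I (\<lambda>_. borel)) drift_path = Pi\<^sub>M ?I D"
    using ne \<xi>_measurable unfolding drift_path_def[abs_def] D_def[abs_def] case_prod_beta'
    by (subst (asm) indep_vars_iff_distr_eq_PiM') (auto simp: grid_points_def)
  have fI: "f \<in> ?I \<rightarrow> ?I" "inj_on f ?I"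
    using grid_shift[OF grids] by (auto simp: f_def grid_points_def inj_on_def)
  have Df: "D (f i) = D i" if "i \<in> ?I" for i
  proof -
    have "\<forall>(p, k)\<in>?I. \<forall>j::int. distr P borel (\<xi> p k) = distr P borel (\<xi> p (k + of_int j))"
      using noise by (simp add: driving_noise_def)
    from bspec[OF this that] have "distr P borel (\<xi> (fst i) (snd i)) = distr P borel (\<xi> (fst i) (snd i + of_int 1))"
      unfolding case_prod_beta' by (rule spec)
    then show ?thesis
      by (simp add: D_def f_def)
  qed
  have PD: "prob_space (D i)" if "i \<in> ?I" for i
    unfolding D_def using that \<xi>_measurable by (intro prob_space_distr) (auto simp: grid_points_def)
  have PiD: "Pi\<^sub>M ?I (\<lambda>i. D (f i)) = Pi\<^sub>M ?I D"
    by (rule PiM_cong) (auto simp: Df)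
  have setsD: "sets (Pi\<^sub>M ?I D) = sets (Pi\<^sub>M ?I (\<lambda>_. borel))"
    by (rule sets_PiM_cong) (auto simp: D_def)
  have "distr P (Pi\<^sub>M ?I (\<lambda>_. borel)) (\<lambda>\<omega>. shift_drift n \<phi> (drift_path \<omega>)) =
    distr (distr P (Pi\<^sub>M ?I (\<lambda>_. borel)) drift_path) (Pi\<^sub>M ?I (\<lambda>_. borel)) (shift_drift n \<phi>)"
    by (subst distr_distr[OF measurable_shift_drift measurable_drift_path]) (simp add: o_def)
  also have "\<dots> = distr (Pi\<^sub>M ?I D) (Pi\<^sub>M ?I (\<lambda>i. D (f i))) (\<lambda>x. \<lambda>i\<in>?I. x (f i))"
    unfolding 1
  proof (rule distr_cong)
    show "sets (Pi\<^sub>M ?I (\<lambda>_. borel)) = sets (Pi\<^sub>M ?I (\<lambda>i. D (f i)))"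
      unfolding PiD setsD ..
  qed (simp_all add: shift_drift_def f_def)
  also have "\<dots> = Pi\<^sub>M ?I (\<lambda>i. D (f i))"
    by (rule distr_PiM_reindex[OF PD fI(2,1)])
  finally show ?thesis
    unfolding 1 PiD .
qed

definition noise_path :: "'w \<Rightarrow> ('m \<Rightarrow> (real \<times> real) set) \<times> ('p \<times> real \<Rightarrow> real)" where
  "noise_path \<omega> = (\<lambda>m. \<pi> m \<omega>, drift_path \<omega>)"

definition shifted_noise_path :: "'w \<Rightarrow> ('m \<Rightarrow> (real \<times> real) set) \<times> ('p \<times> real \<Rightarrow> real)" where
  "shifted_noise_path \<omega> = (shift_config (\<lambda>m. \<pi> m \<omega>), shift_drift n \<phi> (drift_path \<omega>))"

lemma measurable_noise_path:
  "noise_path \<in> measurable P (path_space n \<phi>)" "shifted_noise_path \<in> measurable P (path_space n \<phi>)"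
proof -
  have "noise_path \<in> measurable P (noise_space n \<phi>)"
    unfolding noise_path_def[abs_def] noise_space_def
    by (intro measurable_Pair measurable_configs measurable_drift_path)
  then show "noise_path \<in> measurable P (path_space n \<phi>)"
    unfolding path_space_def using noise_configs_good
    by (intro measurable_restrict_space2) (auto simp: noise_path_def)
  have "shifted_noise_path \<in> measurable P (noise_space n \<phi>)"
    unfolding shifted_noise_path_def[abs_def] noise_space_def
    by (intro measurable_Pair measurable_compose[OF measurable_configs measurable_shift_config]
        measurable_compose[OF measurable_drift_path measurable_shift_drift])
  then show "shifted_noise_path \<in> measurable P (path_space n \<phi>)"
    unfolding path_space_def using noise_configs_good
    by (intro measurable_restrict_space2) (auto simp: shifted_noise_path_def intro!: good_configs_shift)
qed

text \<open>Equality of the laws is obtained on the full product space and carried over to the path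
  space.\<close>

lemma noise_law_shift: "distr P (path_space n \<phi>) shifted_noise_path = distr P (path_space n \<phi>) noise_path"
proof -
  let ?C = "Pi\<^sub>M UNIV (\<lambda>_ :: 'm. config_space :: (real \<times> real) set measure)" and ?X = "Pi\<^sub>M (grid_points n \<phi>) (\<lambda>_. borel :: real measure)"
  have "distr P (?C \<Otimes>\<^sub>M ?X) shifted_noise_path =
    distr P ?C (\<lambda>\<omega>. shift_config (\<lambda>m. \<pi> m \<omega>)) \<Otimes>\<^sub>M distr P ?X (\<lambda>\<omega>. shift_drift n \<phi> (drift_path \<omega>))"
    unfolding shifted_noise_path_def[abs_def] by (rule distr_noise_pair[OF measurable_shift_config measurable_shift_drift])
  also have "\<dots> = distr P ?C (\<lambda>\<omega> m. \<pi> m \<omega>) \<Otimes>\<^sub>M distr P ?X drift_path"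
    unfolding config_law_shift drift_law_shift ..
  also have "\<dots> = distr P (?C \<Otimes>\<^sub>M ?X) noise_path"
    unfolding noise_path_def[abs_def]
    by (rule distr_noise_pair[OF measurable_ident_sets[OF refl] measurable_ident_sets[OF refl], symmetric])
  finally have eq: "distr P (noise_space n \<phi>) shifted_noise_path = distr P (noise_space n \<phi>) noise_path"
    by (simp add: noise_space_def)
  show ?thesis
  proof (rule measure_eqI)
    fix E
    assume "E \<in> sets (distr P (path_space n \<phi>) shifted_noise_path)"
    then have E: "E \<in> sets (path_space n \<phi>)"
      by simp
    then obtain A where A: "A \<in> sets (noise_space n \<phi>)" "E = good_configs \<times> UNIV \<inter> A"
      by (auto simp: path_space_def sets_restrict_space)
    \<comment> \<open>Both noise paths stay among the good configurations, so a trace event has the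
      same preimage as the event it is cut from.\<close>
    have *: "emeasure (distr P (path_space n \<phi>) g) E = emeasure (distr P (noise_space n \<phi>) g) A"
      if g: "g \<in> measurable P (path_space n \<phi>)" for g
    proof -
      have g': "g \<in> measurable P (noise_space n \<phi>)" "g \<in> space P \<rightarrow> good_configs \<times> UNIV"
        using g unfolding path_space_def measurable_restrict_space2_iff by auto
      have "g -` E \<inter> space P = g -` A \<inter> space P"
        using g'(2) unfolding A(2) by blast
      then show ?thesis
        using emeasure_distr[OF g E] emeasure_distr[OF g'(1) A(1)] by simp
    qed
    show "emeasure (distr P (path_space n \<phi>) shifted_noise_path) E = emeasure (distr P (path_space n \<phi>) noise_path) E"
      unfolding *[OF measurable_noise_path(1)] *[OF measurable_noise_path(2)] eq ..
  qed simp
qed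

end

context har_contract
begin

section \<open>Stationarity of the process\<close>

text \<open>The process and the process seen from time 1 are the same functional
  \<open>path_solution\<close>, applied to the noise and to the shifted noise on every path; their
  laws agree because the laws of the noise do.\<close>

lemma path_law_shift:
  "path_law P n \<phi> lamL NL WL =
   path_law P n \<phi> (\<lambda>m t. lamL m (t + 1)) (\<lambda>m \<omega>. (\<lambda>s. s - 1) ` NL m \<omega>) (\<lambda>p k. WL p (k + 1))"
proof -
  let ?O = "Pi\<^sub>M UNIV (\<lambda>_ :: 'm \<times> real. borel :: real measure) \<Otimes>\<^sub>M Pi\<^sub>M UNIV (\<lambda>_ :: 'm. config_space :: real set measure) \<Otimes>\<^sub>M
      Pi\<^sub>M (grid_points n \<phi>) (\<lambda>_. borel :: real measure)"
  note sol = measurable_path_solution[OF grids params]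
  have 1: "(\<lambda>\<omega>. (\<lambda>(m, t). lamL m t \<omega>, \<lambda>m. NL m \<omega>, \<lambda>(p, k)\<in>grid_points n \<phi>. WL p k \<omega>)) = path_solution \<MM> n \<phi> \<circ> noise_path"
    by (rule ext) (simp add: path_solution_def noise_path_def lamL_def NL_def WL_def)
  have 2: "(\<lambda>\<omega>. (\<lambda>(m, t). lamL m (t + 1) \<omega>, \<lambda>m. (\<lambda>s. s - 1) ` NL m \<omega>, \<lambda>(p, k)\<in>grid_points n \<phi>. WL p (k + 1) \<omega>)) =
      path_solution \<MM> n \<phi> \<circ> shifted_noise_path"
    by (rule ext) (simp add: path_solution_shift[OF grids drift_path_extensional] shifted_noise_path_def lamL_def NL_def WL_def)
  have "path_law P n \<phi> lamL NL WL = distr (distr P (path_space n \<phi>) noise_path) ?O (path_solution \<MM> n \<phi>)"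
    unfolding path_law_def 1 by (rule distr_distr[OF sol measurable_noise_path(1), symmetric])
  also have "\<dots> = distr (distr P (path_space n \<phi>) shifted_noise_path) ?O (path_solution \<MM> n \<phi>)"
    unfolding noise_law_shift ..
  also have "\<dots> = path_law P n \<phi> (\<lambda>m t. lamL m (t + 1)) (\<lambda>m \<omega>. (\<lambda>s. s - 1) ` NL m \<omega>) (\<lambda>p k. WL p (k + 1))"
    unfolding path_law_def 2 by (rule distr_distr[OF sol measurable_noise_path(2)])
  finally show ?thesis .
qed

text \<open>Points and drifts may be changed on a null set, as only countably many random objects
  are involved. The intensity is kept the same: equality almost surely at each t would give no
  common null set for all t.\<close>

lemma path_law_cong_AE:
  assumes "\<And>m t. lam m t \<in> borel_measurable P"
    and "\<And>m. N m \<in> measurable P config_space" "\<And>m. N' m \<in> measurable P config_space"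
    and "\<And>p k. k \<in> grid n \<phi> p \<Longrightarrow> W p k \<in> borel_measurable P" "\<And>p k. k \<in> grid n \<phi> p \<Longrightarrow> W' p k \<in> borel_measurable P"
    and "AE \<omega> in P. \<forall>m. N m \<omega> = N' m \<omega>" "AE \<omega> in P. \<forall>(p, k)\<in>grid_points n \<phi>. W p k \<omega> = W' p k \<omega>"
  shows "path_law P n \<phi> lam N W = path_law P n \<phi> lam N' W'"
  unfolding path_law_def
proof (rule distr_cong_AE[OF refl refl])
  show "AE \<omega> in P. (\<lambda>(m, t). lam m t \<omega>, \<lambda>m. N m \<omega>, \<lambda>(p, k)\<in>grid_points n \<phi>. W p k \<omega>) =
      (\<lambda>(m, t). lam m t \<omega>, \<lambda>m. N' m \<omega>, \<lambda>(p, k)\<in>grid_points n \<phi>. W' p k \<omega>)"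
    using assms(6,7) by eventually_elim (auto simp: fun_eq_iff restrict_def)
qed (intro measurable_solution_triple assms; assumption)+

text \<open>The version of the intensity demanded by \<open>one_stationary\<close> is
  \<open>lamL\<close>, the canonical functional of the noise, which agrees with the given intensity
  almost everywhere. Points and drifts are then exchanged with those of the limit process before and
  after the shift.\<close>

lemma har_process_stationary:
  assumes har: "har_process P n \<phi> \<pi> \<xi> \<MM> \<Lambda> N W" and bd: "bounded_moments P n \<phi> \<Lambda> W"
  shows "one_stationary P n \<phi> \<pi> \<xi> \<Lambda> N W"
proof -
  note har_L = har_process_limit and bd_L = bounded_moments_limit
  have "modification P n \<phi> N W NL WL"
    by (rule har_process_unique(1)[OF har bd har_L bd_L])
  then have NW: "AE \<omega> in P. \<forall>m. N m \<omega> = NL m \<omega>" "AE \<omega> in P. \<forall>(p, k)\<in>grid_points n \<phi>. W p k \<omega> = WL p k \<omega>"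
    by (simp_all add: modification_def)
  have \<Lambda>: "AE (\<omega>, t) in P \<Otimes>\<^sub>M lborel. lamL m t \<omega> = \<Lambda> m t \<omega>" for m
    by (rule har_process_unique(2)[OF har_L bd_L har bd])
  have mN: "N m \<in> measurable P config_space" if "har_process P n \<phi> \<pi> \<xi> \<MM> \<Lambda> N W" for \<Lambda> N W m
    using that unfolding har_process_def Let_def by (intro measurable_adapted_points) blast
  have mW: "W p k \<in> borel_measurable P" if "har_process P n \<phi> \<pi> \<xi> \<MM> \<Lambda> N W" "k \<in> grid n \<phi> p" for \<Lambda> N W p k
    using that unfolding har_process_def Let_def by (intro measurable_F_P[of _ k]) blast
  have lam: "(\<lambda>(\<omega>, t). lamL m t \<omega>) \<in> borel_measurable Pred" for m
    using admissible_limit by (simp add: admissible_def)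
  have mlam: "lamL m t \<in> borel_measurable P" for m t
    by (rule measurable_lam_P[OF lam])
  have shift_grid: "k + 1 \<in> grid n \<phi> p" if "k \<in> grid n \<phi> p" for p k
    using that by (simp add: grid_shift[OF grids])
  have "path_law P n \<phi> lamL N W = path_law P n \<phi> lamL NL WL"
    by (intro path_law_cong_AE mlam mN[OF har] mN[OF har_L] mW[OF har] mW[OF har_L] NW)
  also note path_law_shift
  also have "path_law P n \<phi> (\<lambda>m t. lamL m (t + 1)) (\<lambda>m \<omega>. (\<lambda>s. s - 1) ` NL m \<omega>) (\<lambda>p k. WL p (k + 1)) =
    path_law P n \<phi> (\<lambda>m t. lamL m (t + 1)) (\<lambda>m \<omega>. (\<lambda>s. s - 1) ` N m \<omega>) (\<lambda>p k. W p (k + 1))"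
  proof (rule path_law_cong_AE)
    show "AE \<omega> in P. \<forall>m. (\<lambda>s. s - 1) ` NL m \<omega> = (\<lambda>s. s - 1) ` N m \<omega>"
      using NW(1) by eventually_elim simp
    show "AE \<omega> in P. \<forall>(p, k)\<in>grid_points n \<phi>. WL p (k + 1) \<omega> = W p (k + 1) \<omega>"
      using NW(2) by eventually_elim (auto simp: grid_points_def dest: shift_grid)
  qed (intro mlam measurable_translate_config mN[OF har] mN[OF har_L] mW[OF har] mW[OF har_L] shift_grid; assumption)+
  finally show ?thesis
    unfolding one_stationary_def using lam \<Lambda> by blast
qed

end

theorem theorem3p8:
  fixes P :: "'w measure"
    and n :: "'p::finite \<Rightarrow> nat"
    and \<phi> :: "'p \<Rightarrow> real"
    and \<pi> :: "'m::finite \<Rightarrow> 'w \<Rightarrow> (real \<times> real) set"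
    and \<xi> :: "'p \<Rightarrow> real \<Rightarrow> 'w \<Rightarrow> real"
    and \<MM> :: "('m, 'p) har_params"
  assumes "prob_space P"
    and "valid_grids n \<phi>"
    and "driving_noise P n \<phi> \<pi> \<xi>"
    and "valid_params \<MM>"
    and "spr (H_mat \<MM> n) < 1"
    and "\<And>\<alpha> p. norm1_grid (real (n p)) (bW \<MM> \<alpha> p) < \<infinity>"
    and "(SUP (p, k)\<in>grid_points n \<phi>. \<integral>\<^sup>+ \<omega>. ennreal \<bar>\<xi> p k \<omega>\<bar> \<partial>P) < \<infinity>"
  shows "(\<exists>\<Lambda> N W. har_process P n \<phi> \<pi> \<xi> \<MM> \<Lambda> N W \<and> bounded_moments P n \<phi> \<Lambda> W) \<and>
    (\<forall>\<Lambda> N W \<Lambda>' N' W'.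
       har_process P n \<phi> \<pi> \<xi> \<MM> \<Lambda> N W \<and> bounded_moments P n \<phi> \<Lambda> W \<and>
       har_process P n \<phi> \<pi> \<xi> \<MM> \<Lambda>' N' W' \<and> bounded_moments P n \<phi> \<Lambda>' W' \<longrightarrow>
       modification P n \<phi> N W N' W') \<and>
    (\<forall>\<Lambda> N W. har_process P n \<phi> \<pi> \<xi> \<MM> \<Lambda> N W \<and> bounded_moments P n \<phi> \<Lambda> W \<longrightarrow>
       one_stationary P n \<phi> \<pi> \<xi> \<Lambda> N W)"
proof -
  interpret prob_space P by fact
  note noise = assms(3)[unfolded driving_noise_def]
  have poisson: "poisson_random_measure P (\<pi> m)" for m
    by (rule noise[THEN conjunct1, rule_format])
  note distinct = noise[THEN conjunct2, THEN conjunct2, THEN conjunct1, rule_format]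
    and indep_\<xi> = noise[THEN conjunct2, THEN conjunct2, THEN conjunct2, THEN conjunct1]
  note D = poisson_random_measureD[OF poisson]
  interpret har_noise P n \<phi> \<pi> \<xi> \<MM>
  proof
    show "m = m' \<and> z = z'" if "\<omega> \<in> space P" "z \<in> \<pi> m \<omega>" "z' \<in> \<pi> m' \<omega>" "fst z = fst z'" for m m' \<omega> z z'
      using distinct[OF that] .
    show "\<xi> p k \<in> borel_measurable P" if "k \<in> grid n \<phi> p" for p k
    proof -
      have "(p, k) \<in> grid_points n \<phi>"
        using that by (simp add: grid_points_def)
      then have "random_variable borel ((\<lambda>(p, k). \<xi> p k) (p, k))"
        using indep_\<xi> unfolding indep_vars_def by blast
      then show ?thesis
        by simp
    qed
  qed (use assms D in auto)
  obtain v \<theta> where v: "\<And>i. v i > 0" "0 \<le> \<theta>" "\<theta> < 1" "\<And>i j. H_mat \<MM> n i j < \<infinity>"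
    "\<And>i. (\<Sum>j\<in>UNIV. H_mat \<MM> n i j * ennreal (v j)) \<le> ennreal (\<theta> * v i)"
    using spr_less_1_subinvariant[OF assms(5)] by blast
  have H: "H_mat \<MM> n \<alpha> \<beta> = mult_inf (ennreal (lipschitz_const (Phi \<MM> \<alpha>))) (knorm \<alpha> \<beta>)" for \<alpha> \<beta>
    by (simp add: H_mat_def knorm_def)
  \<comment> \<open>By the convention in \<open>mult_inf\<close> a finite matrix entry forces a
    finite norm even when the Lipschitz constant is 0; the entry is then the ordinary
    product.\<close>
  have fin: "knorm \<alpha> \<beta> < \<infinity>" for \<alpha> \<beta>
    using v(4)[of \<alpha> \<beta>] by (auto simp: H mult_inf_def less_top split: if_splits)
  have H': "H_mat \<MM> n \<alpha> \<beta> = ennreal (lipschitz_const (Phi \<MM> \<alpha>)) * knorm \<alpha> \<beta>" for \<alpha> \<beta>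
    using less_imp_neq[OF fin[of \<alpha> \<beta>]] by (simp add: H mult_inf_def)
  interpret har_contract P n \<phi> \<pi> \<xi> \<MM> v \<theta>
    by unfold_locales (use v(1-3,5) fin assms(6,7) in \<open>auto simp: H'\<close>)
  show ?thesis
    using har_process_limit bounded_moments_limit har_process_unique(1) har_process_stationary by blast
qed

end
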